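(* Let $\mathcal{B}$ be a Banach space, $U\subset\mathcal{B}$ a non-empty open convex set, $r_0>0$, and $(\Omega,\mathcal{F},\mathbb{P})$ a probability space with an invertible, measure-preserving, ergodic $\tau$. For each $r\in(0,r_0]$ let $E_r$ be a real Banach space with a closed convex cone $\mathcal{C}_r$ ($\mathbb{R}_+\mathcal{C}_r=\mathcal{C}_r$, $\mathcal{C}_r\cap(-\mathcal{C}_r)=\{0\}$), $\ell_r\in E_r'$ of norm one and constants $K_r\ge1$, $\rho_r\in(0,1]$, $\vartheta_r\ge1$ such that $\langle\ell_r,\phi\rangle\ge\|\phi\|/K_r$ for $\phi\in\mathcal{C}_r$ and $\mathcal{C}_r(\rho_r)=\{\phi\in\mathcal{C}_r:B(\phi,\rho_r\|\phi\|)\subset\mathcal{C}_r\}\neq\{0\}$; all constants and norms are uniformly bounded on compact subsets of $(0,r_0]$. For $0<s<r\le r_0$ let $j_{s,r}:E_r\to E_s$ be continuous linear injections with $\sup_{s,r}\|j_{s,r}\|<\infty$, $j_{t,s}j_{s,r}=j_{t,r}$ for $t<s<r$, $j_{s,r}(\mathcal{C}_r)\subset\mathcal{C}_s$ and $\ell_r=\ell_s\circ j_{s,r}$. Let $X_r=L^\infty(\Omega;E_r)$ (bounded Bochner measurable sections, sup norm) and let $\mathbf{j}_{s,r}:X_r\to X_s$ act fiberwise by $j_{s,r}$. For each $r\in(0,r_0]$ and $u\in U$ let $(\mathcal{L}_{r,u,\omega})_{\omega\in\Omega}\subset L(E_r)$ satisfy $\mathcal{L}_{r,u,\omega}(\mathcal{C}_r\setminus\{0\})\subset\mathcal{C}_r(\rho_r)\setminus\{0\}$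 and $\frac1{\vartheta_r}\le\|\mathcal{L}_{r,u,\omega}\|\le\vartheta_r$, such that $\mathbf{L}_{r,u}:X_r\to X_r$, $(\mathbf{L}_{r,u}\boldsymbol\phi)_\omega=\mathcal{L}_{r,u,\tau^{-1}\omega}\phi_{\tau^{-1}\omega}$, preserves Bochner measurability, and $j_{s,r}\mathcal{L}_{r,u,\omega}=\mathcal{L}_{s,u,\omega}j_{s,r}$ for all $0<s<r\le r_0$, $u$, $\omega$. Let $\boldsymbol\pi_{r,u}(\boldsymbol\phi)_\omega=\mathcal{L}_{r,u,\tau^{-1}\omega}\phi_{\tau^{-1}\omega}/\langle\ell_r,\mathcal{L}_{r,u,\tau^{-1}\omega}\phi_{\tau^{-1}\omega}\rangle$, and let $\mathbf{f}_r(u)\in X_r$ be its unique fixed point with values in $\{\phi\in\mathcal{C}_r(\rho_r):\langle\ell_r,\phi\rangle=1\}$ (these satisfy $\mathbf{j}_{s,r}\mathbf{f}_r(u)=\mathbf{f}_s(u)$). Let $\boldsymbol\Lambda_u(\mathbf{f})=\langle\ell_r,\mathbf{L}_{r,u}\mathbf{f}_r(u)\rangle\in L^\infty(\Omega,\mathbb{R}_+)$ (independent of $r$). Suppose that for every $0<s<r\le r_0$ and $t\in[0,r-s)$ the map $u\in U\mapsto\mathbf{L}_{s,u}\mathbf{j}_{s,r}\in L(X_r,X_s)$ is $C^t$. Then for every $0<s<r_0$ and $0<t<r_0-s$, the maps \[u\mapsto\mathbf{f}_s(u)\in X_s,\qquad u\mapsto\boldsymbol\Lambda_u(\mathbf{f})\in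 L^\infty(\Omega,\mathbb{R}_+),\qquad u\mapsto\int_\Omega\log\Lambda_u(\mathbf{f})_\omega\,d\mathbb{P}(\omega)\] are all $C^t$. In particular the last expression (the characteristic exponent) is $C^{r_0-\epsilon}$ for every $\epsilon>0$.
   Context: For $t=k+\alpha$ with $k\in\mathbb{N}_0$ and $\alpha\in(0,1]$, a map $g$ from $U$ into a Banach space is $C^t$ if it is $k$ times Fréchet differentiable with bounded derivatives and its $k$-th derivative is $\alpha$-Hölder; $C^0$ means continuous. Bochner measurable means uniform limit of measurable countably-valued maps. *)

theory Defs
  imports "HOL-Analysis.Analysis" "HOL-Probability.Probability" "HOL-Library.Function_Algebras"
begin

instantiation "fun" :: (type, real_vector) real_vector
begin
definition scaleR_fun :: "real \<Rightarrow> ('a \<Rightarrow> 'b) \<Rightarrow> 'a \<Rightarrow> 'b" where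
  "scaleR_fun c f = (\<lambda>x. c *\<^sub>R f x)"
instance
  by standard (auto simp: scaleR_fun_def fun_eq_iff scaleR_add_right scaleR_add_left)
end

definition normed_subspace :: "'v::real_vector set \<Rightarrow> ('v \<Rightarrow> real) \<Rightarrow> bool" where
  "normed_subspace Y n \<longleftrightarrow>
     0 \<in> Y \<and> (\<forall>x\<in>Y. \<forall>y\<in>Y. x + y \<in> Y) \<and> (\<forall>c. \<forall>x\<in>Y. c *\<^sub>R x \<in> Y) \<and>
     (\<forall>x\<in>Y. n x \<ge> 0) \<and> (\<forall>x\<in>Y. n x = 0 \<longleftrightarrow> x = 0) \<and>
     (\<forall>c. \<forall>x\<in>Y. n (c *\<^sub>R x) = \<bar>c\<bar> * n x) \<and>
     (\<forall>x\<in>Y. \<forall>y\<in>Y. n (x + y) \<le> n x + n y)"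

definition banach_subspace :: "'v::real_vector set \<Rightarrow> ('v \<Rightarrow> real) \<Rightarrow> bool" where
  "banach_subspace Y n \<longleftrightarrow> normed_subspace Y n \<and>
     (\<forall>x :: nat \<Rightarrow> 'v. (\<forall>k. x k \<in> Y) \<and>
        (\<forall>e>0. \<exists>N. \<forall>k\<ge>N. \<forall>m\<ge>N. n (x k - x m) < e) \<longrightarrow>
        (\<exists>y\<in>Y. (\<lambda>k. n (x k - y)) \<longlonglongrightarrow> 0))"

definition linear_on :: "'v::real_vector set \<Rightarrow> ('v \<Rightarrow> 'y::real_vector) \<Rightarrow> bool" where
  "linear_on Y T \<longleftrightarrow> (\<forall>x\<in>Y. \<forall>y\<in>Y. \<forall>c a. T (c *\<^sub>R x + a *\<^sub>R y) = c *\<^sub>R T x + a *\<^sub>R T y)"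

definition bounded_linear_on ::
  "'v::real_vector set \<Rightarrow> ('v \<Rightarrow> real) \<Rightarrow> 'y::real_vector set \<Rightarrow> ('y \<Rightarrow> real) \<Rightarrow> ('v \<Rightarrow> 'y) \<Rightarrow> bool" where
  "bounded_linear_on X nX Y nY T \<longleftrightarrow> (\<forall>x\<in>X. T x \<in> Y) \<and> linear_on X T \<and>
     (\<exists>C. \<forall>x\<in>X. nY (T x) \<le> C * nX x)"

definition opnorm :: "'v set \<Rightarrow> ('v \<Rightarrow> real) \<Rightarrow> ('y \<Rightarrow> real) \<Rightarrow> ('v \<Rightarrow> 'y) \<Rightarrow> real" where
  "opnorm X nX nY T = Sup {nY (T x) | x. x \<in> X \<and> nX x \<le> 1}"

text \<open>The space L(X,Y) of bounded linear operators, represented as functions that vanish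
off the carrier X (so that the operator norm is a genuine norm).\<close>

definition Lspace ::
  "'v::real_vector set \<Rightarrow> ('v \<Rightarrow> real) \<Rightarrow> 'y::real_vector set \<Rightarrow> ('y \<Rightarrow> real) \<Rightarrow> ('v \<Rightarrow> 'y) set" where
  "Lspace X nX Y nY = {T. bounded_linear_on X nX Y nY T \<and> (\<forall>x. x \<notin> X \<longrightarrow> T x = 0)}"

definition countably_valued_meas :: "'w measure \<Rightarrow> 'v set \<Rightarrow> ('w \<Rightarrow> 'v) \<Rightarrow> bool" where
  "countably_valued_meas M E g \<longleftrightarrow> (\<forall>\<omega>\<in>space M. g \<omega> \<in> E) \<and> countable (g ` space M) \<and>
     (\<forall>v. {\<omega>\<in>space M. g \<omega> = v} \<in> sets M)"

definition bochner_measurable :: "'w measure \<Rightarrow> 'v::real_vector set \<Rightarrow> ('v \<Rightarrow> real) \<Rightarrow> ('w \<Rightarrow> 'v) \<Rightarrow> bool" where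
  "bochner_measurable M E n \<phi> \<longleftrightarrow> (\<forall>\<omega>\<in>space M. \<phi> \<omega> \<in> E) \<and>
     (\<exists>g :: nat \<Rightarrow> 'w \<Rightarrow> 'v. (\<forall>k. countably_valued_meas M E (g k)) \<and>
        (\<forall>e>0. \<exists>N. \<forall>k\<ge>N. \<forall>\<omega>\<in>space M. n (g k \<omega> - \<phi> \<omega>) < e))"

definition Linf :: "'w measure \<Rightarrow> 'v::real_vector set \<Rightarrow> ('v \<Rightarrow> real) \<Rightarrow> ('w \<Rightarrow> 'v) set" where
  "Linf M E n = {\<phi>. bochner_measurable M E n \<phi> \<and> (\<exists>C. \<forall>\<omega>\<in>space M. n (\<phi> \<omega>) \<le> C) \<and>
                    (\<forall>\<omega>. \<omega> \<notin> space M \<longrightarrow> \<phi> \<omega> = 0)}"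

definition supnorm :: "'w measure \<Rightarrow> ('v \<Rightarrow> real) \<Rightarrow> ('w \<Rightarrow> 'v) \<Rightarrow> real" where
  "supnorm M n \<phi> = Sup ((\<lambda>\<omega>. n (\<phi> \<omega>)) ` space M)"

text \<open>A candidate k-th derivative at a point is a map taking a list of k directions to Y.
It must be k-linear and bounded; its norm is the multilinear operator norm.\<close>

definition multilinear_bdd ::
  "nat \<Rightarrow> 'y::real_vector set \<Rightarrow> ('y \<Rightarrow> real) \<Rightarrow> ('b::real_normed_vector list \<Rightarrow> 'y) \<Rightarrow> bool" where
  "multilinear_bdd k Y nY T \<longleftrightarrow>
     (\<forall>hs. length hs = k \<longrightarrow> T hs \<in> Y) \<and>
     (\<forall>pre post x y c a. length pre + length post + 1 = k \<longrightarrow>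
        T (pre @ (c *\<^sub>R x + a *\<^sub>R y) # post) = c *\<^sub>R T (pre @ x # post) + a *\<^sub>R T (pre @ y # post)) \<and>
     (\<exists>C. \<forall>hs. length hs = k \<longrightarrow> nY (T hs) \<le> C * prod_list (map norm hs))"

definition mnorm :: "nat \<Rightarrow> ('y \<Rightarrow> real) \<Rightarrow> ('b::real_normed_vector list \<Rightarrow> 'y) \<Rightarrow> real" where
  "mnorm k nY T = Sup {nY (T hs) | hs. length hs = k \<and> (\<forall>h\<in>set hs. norm h \<le> 1)}"

text \<open>C^t for t = k + alpha, k a natural number, alpha in (0,1]: k times Frechet differentiable
on U with bounded derivatives (orders 0..k) and alpha-Hoelder k-th derivative.
D i u is the i-th derivative at u (D 0 u [] = g u; D (i+1) u (h # hs) = (D' (D i) u h) hs).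
C^0 means continuous.\<close>

definition C_holder ::
  "'b::banach set \<Rightarrow> 'y::real_vector set \<Rightarrow> ('y \<Rightarrow> real) \<Rightarrow> real \<Rightarrow> ('b \<Rightarrow> 'y) \<Rightarrow> bool" where
  "C_holder U Y nY t g \<longleftrightarrow>
    (if t = 0 then
       (\<forall>u\<in>U. g u \<in> Y) \<and>
       (\<forall>u\<in>U. \<forall>e>0. \<exists>d>0. \<forall>v\<in>U. norm (v - u) < d \<longrightarrow> nY (g v - g u) < e)
     else
       (\<exists>(k::nat) \<alpha>. t = real k + \<alpha> \<and> 0 < \<alpha> \<and> \<alpha> \<le> 1 \<and>
         (\<exists>D :: nat \<Rightarrow> 'b \<Rightarrow> 'b list \<Rightarrow> 'y.
           (\<forall>u\<in>U. D 0 u [] = g u) \<and>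
           (\<forall>i\<le>k. \<forall>u\<in>U. multilinear_bdd i Y nY (D i u)) \<and>
           (\<forall>i<k. \<forall>u\<in>U.
              ((\<lambda>h. mnorm i nY (\<lambda>hs. D i (u + h) hs - D i u hs - D (Suc i) u (h # hs)) / norm h)
                 \<longlongrightarrow> 0) (at 0)) \<and>
           (\<forall>i\<le>k. \<exists>C. \<forall>u\<in>U. mnorm i nY (D i u) \<le> C) \<and>
           (\<exists>C. \<forall>u\<in>U. \<forall>v\<in>U. mnorm k nY (\<lambda>hs. D k u hs - D k v hs) \<le> C * norm (u - v) powr \<alpha>))))"

definition closed_convex_cone :: "'v::real_vector set \<Rightarrow> ('v \<Rightarrow> real) \<Rightarrow> 'v set \<Rightarrow> bool" where
  "closed_convex_cone E n C \<longleftrightarrow> C \<noteq> {} \<and> C \<subseteq> E \<and>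
     (\<forall>c\<ge>0. \<forall>x\<in>C. c *\<^sub>R x \<in> C) \<and>
     (\<forall>x\<in>C. \<forall>y\<in>C. \<forall>a. 0 \<le> a \<and> a \<le> 1 \<longrightarrow> a *\<^sub>R x + (1 - a) *\<^sub>R y \<in> C) \<and>
     (\<forall>x :: nat \<Rightarrow> 'v. \<forall>y\<in>E. (\<forall>k. x k \<in> C) \<and> (\<lambda>k. n (x k - y)) \<longlonglongrightarrow> 0 \<longrightarrow> y \<in> C) \<and>
     C \<inter> uminus ` C = {0}"

definition cone_rho :: "'v::real_vector set \<Rightarrow> ('v \<Rightarrow> real) \<Rightarrow> 'v set \<Rightarrow> real \<Rightarrow> 'v set" where
  "cone_rho E n C \<rho> = {\<phi>\<in>C. \<forall>\<psi>\<in>E. n (\<psi> - \<phi>) < \<rho> * n \<phi> \<longrightarrow> \<psi> \<in> C}"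

definition measure_pres :: "'w measure \<Rightarrow> ('w \<Rightarrow> 'w) \<Rightarrow> bool" where
  "measure_pres M T \<longleftrightarrow> T \<in> M \<rightarrow>\<^sub>M M \<and> (\<forall>A\<in>sets M. emeasure M (T -` A \<inter> space M) = emeasure M A)"

definition invertible_mp :: "'w measure \<Rightarrow> ('w \<Rightarrow> 'w) \<Rightarrow> bool" where
  "invertible_mp M \<tau> \<longleftrightarrow> bij_betw \<tau> (space M) (space M) \<and> measure_pres M \<tau> \<and>
     measure_pres M (inv_into (space M) \<tau>)"

definition ergodic_map :: "'w measure \<Rightarrow> ('w \<Rightarrow> 'w) \<Rightarrow> bool" where
  "ergodic_map M \<tau> \<longleftrightarrow> (\<forall>A\<in>sets M. \<tau> -` A \<inter> space M = A \<longrightarrow> measure M A = 0 \<or> measure M A = 1)"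

definition Lop :: "'w measure \<Rightarrow> ('w \<Rightarrow> 'w) \<Rightarrow> ('w \<Rightarrow> 'v \<Rightarrow> 'v::real_vector) \<Rightarrow> ('w \<Rightarrow> 'v) \<Rightarrow> 'w \<Rightarrow> 'v" where
  "Lop M \<tau> Lw \<phi> = (\<lambda>\<omega>. if \<omega> \<in> space M then Lw (inv_into (space M) \<tau> \<omega>) (\<phi> (inv_into (space M) \<tau> \<omega>)) else 0)"

definition jlift :: "'w measure \<Rightarrow> ('v \<Rightarrow> 'v::real_vector) \<Rightarrow> ('w \<Rightarrow> 'v) \<Rightarrow> 'w \<Rightarrow> 'v" where
  "jlift M j \<phi> = (\<lambda>\<omega>. if \<omega> \<in> space M then j (\<phi> \<omega>) else 0)"

end

theory Submission
  imports Defs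
begin

text \<open>The fixed point \<open>f u\<close> satisfies \<open>L u (f u) = \<Lambda> u f u\<close>, a polynomial equation in \<open>f u\<close> whose
linearisation \<open>A u = \<Lambda> u (1 - P u)\<close> is boundedly invertible on every level \<open>X r\<close>, uniformly in \<open>u\<close>:
the cone condition makes \<open>P u\<close> shrink order intervals \<open>[a f, b f]\<close> by a fixed factor, so that the Neumann
series converges. The same contraction, applied to the ratio \<open>b / a\<close>, bounds \<open>f v - f u\<close> by
\<open>(L v - L u) (f v)\<close>. After embedding all levels into the weakest one, each derivative of \<open>f\<close> solves
\<open>A u x = y\<close> with a right-hand side built from derivatives of \<open>L\<close> and lower derivatives of \<open>f\<close>; a derivative
of order \<open>i\<close> costs \<open>i\<close> units on the scale of levels, and the bookkeeping of these costs is
compatible with products and with solving \<open>A u x = y\<close>.\<close>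


section \<open>Graded families of smooth maps\<close>

text \<open>\<open>L\<close> depends smoothly on \<open>u\<close> only as an operator from one level
  to a weaker one; on a fixed level neither \<open>L\<close> nor \<open>A\<close> need even be
  continuous in \<open>u\<close>, so an implicit function theorem in one Banach space is out of
  reach. Invertibility of \<open>A u\<close> cannot be inherited from nearby parameters and is
  proved for every \<open>u\<close> with constants that depend only on the cone data. The equation
  is kept as \<open>L x = b (L x) x\<close>, where \<open>b\<close> multiplies its second argument
  by the mass of the first: it is quadratic, no quotient has to be differentiated, and
  \<open>A u\<close> is the derivative of \<open>b (L u x) x - L u x\<close> at
  \<open>x = f u\<close>. Since \<open>A u\<close> contains \<open>f u\<close>, the first derivative
  of \<open>f\<close> comes from an exact quadratic expansion; only then does the linear theory of
  \<open>A u x = y\<close> take over. All bounds on orders are strict, so an order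
  \<open>q1 + q2 < R - l\<close> leaves room for an intermediate level. The derivatives supplied for
  different pairs of levels are unrelated choices; they are identified through directional
  derivatives in the weakest norm, which are unique.\<close>

locale seminormed_space =
  fixes Y :: "'y::real_vector set" and n :: "'y \<Rightarrow> real"
  assumes subspace: "subspace Y"
    and nonneg: "x \<in> Y \<Longrightarrow> 0 \<le> n x"
    and scale: "x \<in> Y \<Longrightarrow> n (a *\<^sub>R x) = \<bar>a\<bar> * n x"
    and triangle: "x \<in> Y \<Longrightarrow> y \<in> Y \<Longrightarrow> n (x + y) \<le> n x + n y"
begin

lemma add_mem: "x \<in> Y \<Longrightarrow> y \<in> Y \<Longrightarrow> x + y \<in> Y"
  using subspace by (rule subspace_add)

lemma diff_mem: "x \<in> Y \<Longrightarrow> y \<in> Y \<Longrightarrow> x - y \<in> Y"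
  using subspace by (rule subspace_diff)

lemma scale_mem: "x \<in> Y \<Longrightarrow> a *\<^sub>R x \<in> Y"
  using subspace by (rule subspace_scale)

lemma zero_mem: "0 \<in> Y"
  using subspace by (rule subspace_0)

lemma norm_zero: "n 0 = 0"
  using scale[OF zero_mem, of 0] by simp

lemma norm_minus: "x \<in> Y \<Longrightarrow> n (- x) = n x"
  using scale[of x "-1"] by simp

lemma triangle_diff: "x \<in> Y \<Longrightarrow> y \<in> Y \<Longrightarrow> n (x - y) \<le> n x + n y"
  using triangle[of x "- y"] norm_minus[of y] scale_mem[of y "-1"] by simp

lemma triangle3: "x \<in> Y \<Longrightarrow> y \<in> Y \<Longrightarrow> z \<in> Y \<Longrightarrow> n (x + y + z) \<le> n x + n y + n z"
  using triangle[of "x + y" z] triangle[of x y] add_mem[of x y] by simp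

end

locale bilin =
  L: seminormed_space Y1 n1 + R: seminormed_space Y2 n2 + T: seminormed_space Y3 n3
  for Y1 :: "'x::real_vector set" and n1 and Y2 :: "'y::real_vector set" and n2
    and Y3 :: "'z::real_vector set" and n3 +
  fixes \<beta> :: "'x \<Rightarrow> 'y \<Rightarrow> 'z"
  assumes mem: "x \<in> Y1 \<Longrightarrow> y \<in> Y2 \<Longrightarrow> \<beta> x y \<in> Y3"
    and add_left: "x \<in> Y1 \<Longrightarrow> x' \<in> Y1 \<Longrightarrow> y \<in> Y2 \<Longrightarrow> \<beta> (x + x') y = \<beta> x y + \<beta> x' y"
    and scale_left: "x \<in> Y1 \<Longrightarrow> y \<in> Y2 \<Longrightarrow> \<beta> (a *\<^sub>R x) y = a *\<^sub>R \<beta> x y"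
    and add_right: "x \<in> Y1 \<Longrightarrow> y \<in> Y2 \<Longrightarrow> y' \<in> Y2 \<Longrightarrow> \<beta> x (y + y') = \<beta> x y + \<beta> x y'"
    and scale_right: "x \<in> Y1 \<Longrightarrow> y \<in> Y2 \<Longrightarrow> \<beta> x (a *\<^sub>R y) = a *\<^sub>R \<beta> x y"
    and bound_ex: "\<exists>B\<ge>0. \<forall>x\<in>Y1. \<forall>y\<in>Y2. n3 (\<beta> x y) \<le> B * (n1 x * n2 y)"
begin

lemma diff_left: "x \<in> Y1 \<Longrightarrow> x' \<in> Y1 \<Longrightarrow> y \<in> Y2 \<Longrightarrow> \<beta> (x - x') y = \<beta> x y - \<beta> x' y"
  using add_left[of x "- x'" y] scale_left[of x' y "-1"] L.scale_mem[of x' "-1"] by simp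

lemma diff_right: "x \<in> Y1 \<Longrightarrow> y \<in> Y2 \<Longrightarrow> y' \<in> Y2 \<Longrightarrow> \<beta> x (y - y') = \<beta> x y - \<beta> x y'"
  using add_right[of x y "- y'"] scale_right[of x y' "-1"] R.scale_mem[of y' "-1"] by simp

text \<open>The free upper bounds \<open>r\<close> and \<open>s\<close> let the estimate of a
  product be chained directly with estimates of its factors.\<close>

lemma bound: obtains B where "B \<ge> 0"
  "\<And>x y r s. x \<in> Y1 \<Longrightarrow> y \<in> Y2 \<Longrightarrow> n1 x \<le> r \<Longrightarrow> n2 y \<le> s \<Longrightarrow> n3 (\<beta> x y) \<le> B * (r * s)"
proof -
  obtain B where B: "B \<ge> 0" "\<And>x y. x \<in> Y1 \<Longrightarrow> y \<in> Y2 \<Longrightarrow> n3 (\<beta> x y) \<le> B * (n1 x * n2 y)"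
    using bound_ex by blast
  have "n3 (\<beta> x y) \<le> B * (r * s)" if "x \<in> Y1" "y \<in> Y2" "n1 x \<le> r" "n2 y \<le> s" for x y r s
  proof -
    have "n1 x * n2 y \<le> r * s"
      using that L.nonneg[of x] R.nonneg[of y] by (intro mult_mono) auto
    then show ?thesis using B(1) B(2)[OF that(1,2)] by (meson mult_left_mono order_trans)
  qed
  with B(1) show ?thesis using that by blast
qed

end

section \<open>Families of directional derivatives with Holder bounds\<close>

definition wt :: "'b::real_normed_vector list \<Rightarrow> real" where
  "wt hs = prod_list (map norm hs)"

lemma wt_simps [simp]: "wt [] = 1" "wt (h # hs) = norm h * wt hs"
  by (auto simp: wt_def)

lemma wt_nonneg [simp]: "0 \<le> wt hs"
  by (induction hs) auto

text \<open>A level with \<open>c l \<le> 0\<close> carries no condition, so capacities may be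
  lowered below zero without harm. Bounds proportional to \<open>wt hs\<close> stand in for the
  multilinear norm; the family itself is not assumed to be multilinear.\<close>

definition holder_fam ::
  "'b::real_normed_vector set \<Rightarrow> ('l \<Rightarrow> 'y::real_vector set) \<Rightarrow> ('l \<Rightarrow> 'y \<Rightarrow> real) \<Rightarrow> nat \<Rightarrow> ('l \<Rightarrow> real) \<Rightarrow>
    ('b list \<Rightarrow> 'b \<Rightarrow> 'y) \<Rightarrow> bool" where
  "holder_fam U Y n m c x \<longleftrightarrow> (\<forall>l \<alpha>. 0 < \<alpha> \<longrightarrow> \<alpha> \<le> 1 \<longrightarrow> \<alpha> < c l \<longrightarrow>
     (\<exists>B\<ge>0. \<forall>hs. length hs = m \<longrightarrow> (\<forall>u\<in>U. x hs u \<in> Y l \<and> n l (x hs u) \<le> B * wt hs \<and>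
        (\<forall>v\<in>U. n l (x hs v - x hs u) \<le> B * wt hs * norm (v - u) powr \<alpha>))))"

text \<open>The error is compared with \<open>wt hs\<close> uniformly over the earlier directions,
  which is Frechet differentiability in the multilinear norm. Linearity in the new direction is
  required up to a null vector because \<open>n l\<close> is only a seminorm. Multilinearity in the
  earlier directions is recovered later from the difference quotients.\<close>

definition deriv_fam ::
  "'b::real_normed_vector set \<Rightarrow> ('l \<Rightarrow> 'y::real_vector set) \<Rightarrow> ('l \<Rightarrow> 'y \<Rightarrow> real) \<Rightarrow> nat \<Rightarrow> ('l \<Rightarrow> real) \<Rightarrow>
    ('b list \<Rightarrow> 'b \<Rightarrow> 'y) \<Rightarrow> ('b list \<Rightarrow> 'b \<Rightarrow> 'y) \<Rightarrow> bool" where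
  "deriv_fam U Y n m c x x' \<longleftrightarrow> (\<forall>l. 1 < c l \<longrightarrow> (\<forall>u\<in>U.
     (\<forall>hs h g a b. length hs = m \<longrightarrow>
        n l (x' ((a *\<^sub>R h + b *\<^sub>R g) # hs) u - a *\<^sub>R x' (h # hs) u - b *\<^sub>R x' (g # hs) u) = 0) \<and>
     (\<forall>e>0. \<exists>d>0. \<forall>hs h. length hs = m \<longrightarrow> norm h < d \<longrightarrow> u + h \<in> U \<longrightarrow>
        n l (x hs (u + h) - x hs u - x' (h # hs) u) \<le> e * norm h * wt hs)))"

text \<open>A family indexed by lists of \<open>m\<close> directions; at level \<open>l\<close> it may be differentiated as long as
the order stays below the capacity \<open>c l\<close>, and each derivative uses up one unit of capacity. The number
\<open>k\<close> caps the number of derivatives that are taken.\<close>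

primrec smooth_fam ::
  "'b::real_normed_vector set \<Rightarrow> ('l \<Rightarrow> 'y::real_vector set) \<Rightarrow> ('l \<Rightarrow> 'y \<Rightarrow> real) \<Rightarrow> nat \<Rightarrow> nat \<Rightarrow> ('l \<Rightarrow> real) \<Rightarrow>
    ('b list \<Rightarrow> 'b \<Rightarrow> 'y) \<Rightarrow> bool" where
  "smooth_fam U Y n 0 m c x \<longleftrightarrow> holder_fam U Y n m c x"
| "smooth_fam U Y n (Suc k) m c x \<longleftrightarrow> holder_fam U Y n m c x \<and>
     (\<exists>x'. deriv_fam U Y n m c x x' \<and> smooth_fam U Y n k (Suc m) (\<lambda>l. c l - 1) x')"

lemma smooth_fam_holder: "smooth_fam U Y n k m c x \<Longrightarrow> holder_fam U Y n m c x"
  by (cases k) auto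

lemma smooth_fam_mono: "smooth_fam U Y n (Suc k) m c x \<Longrightarrow> smooth_fam U Y n k m c x"
proof (induction k arbitrary: m c x)
  case (Suc k)
  then obtain x' where "holder_fam U Y n m c x" "deriv_fam U Y n m c x x'"
      "smooth_fam U Y n (Suc k) (Suc m) (\<lambda>l. c l - 1) x'"
    by (metis smooth_fam.simps(2))
  then show ?case using Suc.IH[of "Suc m" "\<lambda>l. c l - 1" x'] by auto
qed simp

lemma smooth_fam_cong:
  assumes "smooth_fam U Y n k m c x" and eq: "\<And>hs u. length hs = m \<Longrightarrow> u \<in> U \<Longrightarrow> x hs u = y hs u"
  shows "smooth_fam U Y n k m c y"
proof -
  have h: "holder_fam U Y n m c x \<Longrightarrow> holder_fam U Y n m c y"
    unfolding holder_fam_def by (simp add: eq cong: imp_cong)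
  have d: "deriv_fam U Y n m c x x' \<Longrightarrow> deriv_fam U Y n m c y x'" for x'
    unfolding deriv_fam_def by (simp add: eq cong: imp_cong)
  show ?thesis using assms(1) h d by (cases k) auto
qed

lemma holder_famD:
  assumes "holder_fam U Y n m c x" "0 < \<alpha>" "\<alpha> \<le> 1" "\<alpha> < c l"
  obtains B where "B \<ge> 0"
    "\<And>hs u. length hs = m \<Longrightarrow> u \<in> U \<Longrightarrow> x hs u \<in> Y l"
    "\<And>hs u. length hs = m \<Longrightarrow> u \<in> U \<Longrightarrow> n l (x hs u) \<le> B * wt hs"
    "\<And>hs u v. length hs = m \<Longrightarrow> u \<in> U \<Longrightarrow> v \<in> U \<Longrightarrow> n l (x hs v - x hs u) \<le> B * wt hs * norm (v - u) powr \<alpha>"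
proof -
  have "\<exists>B\<ge>0. \<forall>hs. length hs = m \<longrightarrow> (\<forall>u\<in>U. x hs u \<in> Y l \<and> n l (x hs u) \<le> B * wt hs \<and>
        (\<forall>v\<in>U. n l (x hs v - x hs u) \<le> B * wt hs * norm (v - u) powr \<alpha>))"
    using assms(1)[unfolded holder_fam_def, rule_format, OF assms(2-4)] .
  then obtain B where "B \<ge> 0" and "\<forall>hs. length hs = m \<longrightarrow> (\<forall>u\<in>U. x hs u \<in> Y l \<and> n l (x hs u) \<le> B * wt hs \<and>
        (\<forall>v\<in>U. n l (x hs v - x hs u) \<le> B * wt hs * norm (v - u) powr \<alpha>))" by (elim exE conjE)
  then show ?thesis by (intro that[of B]) simp_all
qed

lemma holder_fam_bound:
  assumes "holder_fam U Y n m c x" "0 < c l"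
  obtains B where "B \<ge> 0"
    "\<And>hs u. length hs = m \<Longrightarrow> u \<in> U \<Longrightarrow> x hs u \<in> Y l"
    "\<And>hs u. length hs = m \<Longrightarrow> u \<in> U \<Longrightarrow> n l (x hs u) \<le> B * wt hs"
proof -
  have "0 < min 1 (c l / 2)" "min 1 (c l / 2) \<le> 1" "min 1 (c l / 2) < c l"
    using assms(2) by auto
  from holder_famD[OF assms(1) this] show ?thesis using that by metis
qed

lemma holder_fam_mem:
  "holder_fam U Y n m c x \<Longrightarrow> 0 < c l \<Longrightarrow> length hs = m \<Longrightarrow> u \<in> U \<Longrightarrow> x hs u \<in> Y l"
  using holder_fam_bound by metis

lemma powr_small:
  assumes "0 < \<alpha>" "0 \<le> B" "0 < e"
  obtains d :: real where "d > 0" "\<And>t. 0 \<le> t \<Longrightarrow> t < d \<Longrightarrow> B * t powr \<alpha> \<le> e"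
proof
  \<comment> \<open>The added 1 covers \<open>B = 0\<close>.\<close>
  let ?d = "(e / (B + 1)) powr (1 / \<alpha>)"
  show "?d > 0" using assms by simp
  fix t :: real assume t: "0 \<le> t" "t < ?d"
  have "t powr \<alpha> \<le> ?d powr \<alpha>" using t assms by (intro powr_mono2) auto
  also have "\<dots> = e / (B + 1)" using assms by (simp add: powr_powr)
  finally have "B * t powr \<alpha> \<le> B * (e / (B + 1))" using assms by (intro mult_left_mono) auto
  also have "\<dots> \<le> e" using assms by (simp add: field_simps)
  finally show "B * t powr \<alpha> \<le> e" .
qed

lemma holder_fam_cont:
  assumes "holder_fam U Y n m c x" "0 < c l" "0 < e"
  obtains d where "d > 0" "\<And>hs u v. length hs = m \<Longrightarrow> u \<in> U \<Longrightarrow> v \<in> U \<Longrightarrow> norm (v - u) < d \<Longrightarrow>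
     n l (x hs v - x hs u) \<le> e * wt hs"
proof -
  define \<alpha> where "\<alpha> = min 1 (c l / 2)"
  have \<alpha>: "0 < \<alpha>" "\<alpha> \<le> 1" "\<alpha> < c l" using assms by (auto simp: \<alpha>_def min_def)
  obtain B where B: "B \<ge> 0"
    "\<And>hs u v. length hs = m \<Longrightarrow> u \<in> U \<Longrightarrow> v \<in> U \<Longrightarrow> n l (x hs v - x hs u) \<le> B * wt hs * norm (v - u) powr \<alpha>"
    using holder_famD[OF assms(1) \<alpha>] by metis
  obtain d where d: "d > 0" "\<And>t. 0 \<le> t \<Longrightarrow> t < d \<Longrightarrow> B * t powr \<alpha> \<le> e"
    using powr_small[OF \<alpha>(1) B(1) assms(3)] by metis
  have "n l (x hs v - x hs u) \<le> e * wt hs"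
    if "length hs = m" "u \<in> U" "v \<in> U" "norm (v - u) < d" for hs u v
  proof -
    have "n l (x hs v - x hs u) \<le> (B * norm (v - u) powr \<alpha>) * wt hs"
      using B(2)[OF that(1-3)] by (simp add: mult_ac)
    also have "\<dots> \<le> e * wt hs" using d(2)[OF _ that(4)] by (intro mult_right_mono) auto
    finally show ?thesis .
  qed
  with d(1) show ?thesis using that by blast
qed

lemma deriv_famD:
  assumes "deriv_fam U Y n m c x x'" "1 < c l" "u \<in> U" "0 < e"
  obtains d where "d > 0" "\<And>hs h. length hs = m \<Longrightarrow> norm h < d \<Longrightarrow> u + h \<in> U \<Longrightarrow>
     n l (x hs (u + h) - x hs u - x' (h # hs) u) \<le> e * norm h * wt hs"
  using assms unfolding deriv_fam_def by metis

lemma deriv_fam_lin: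
  assumes "deriv_fam U Y n m c x x'" "1 < c l" "u \<in> U" "length hs = m"
  shows "n l (x' ((a *\<^sub>R h + b *\<^sub>R g) # hs) u - a *\<^sub>R x' (h # hs) u - b *\<^sub>R x' (g # hs) u) = 0"
  using assms unfolding deriv_fam_def by metis

section \<open>Sums and constants\<close>

lemma holder_fam_add:
  fixes U :: "'b::real_normed_vector set"
  assumes sn: "\<And>l. 0 < c l \<Longrightarrow> seminormed_space (Y l) (n l)"
    and x: "holder_fam U Y n m c x" and y: "holder_fam U Y n m c y"
  shows "holder_fam U Y n m c (\<lambda>hs u. x hs u + y hs u)"
  unfolding holder_fam_def
proof (intro allI impI)
  fix l \<alpha> assume \<alpha>: "0 < (\<alpha>::real)" "\<alpha> \<le> 1" "\<alpha> < c l"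
  interpret seminormed_space "Y l" "n l" using sn \<alpha> by force
  obtain B1 where B1: "B1 \<ge> 0"
    "\<And>hs u. length hs = m \<Longrightarrow> u \<in> U \<Longrightarrow> x hs u \<in> Y l"
    "\<And>hs u. length hs = m \<Longrightarrow> u \<in> U \<Longrightarrow> n l (x hs u) \<le> B1 * wt hs"
    "\<And>hs u v. length hs = m \<Longrightarrow> u \<in> U \<Longrightarrow> v \<in> U \<Longrightarrow> n l (x hs v - x hs u) \<le> B1 * wt hs * norm (v - u) powr \<alpha>"
    using holder_famD[OF x \<alpha>] by metis
  obtain B2 where B2: "B2 \<ge> 0"
    "\<And>hs u. length hs = m \<Longrightarrow> u \<in> U \<Longrightarrow> y hs u \<in> Y l"
    "\<And>hs u. length hs = m \<Longrightarrow> u \<in> U \<Longrightarrow> n l (y hs u) \<le> B2 * wt hs"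
    "\<And>hs u v. length hs = m \<Longrightarrow> u \<in> U \<Longrightarrow> v \<in> U \<Longrightarrow> n l (y hs v - y hs u) \<le> B2 * wt hs * norm (v - u) powr \<alpha>"
    using holder_famD[OF y \<alpha>] by metis
  show "\<exists>B\<ge>0. \<forall>hs. length hs = m \<longrightarrow> (\<forall>u\<in>U. x hs u + y hs u \<in> Y l \<and> n l (x hs u + y hs u) \<le> B * wt hs \<and>
        (\<forall>v\<in>U. n l (x hs v + y hs v - (x hs u + y hs u)) \<le> B * wt hs * norm (v - u) powr \<alpha>))"
  proof (intro exI[of _ "B1 + B2"] conjI allI impI ballI)
    fix hs :: "'b list" and u v assume a: "length hs = m" "u \<in> U" "v \<in> U"
    have "n l (x hs v + y hs v - (x hs u + y hs u)) = n l ((x hs v - x hs u) + (y hs v - y hs u))"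
      by (simp add: algebra_simps)
    also have "\<dots> \<le> n l (x hs v - x hs u) + n l (y hs v - y hs u)"
      using B1(2) B2(2) a by (intro triangle diff_mem) auto
    also have "\<dots> \<le> (B1 + B2) * wt hs * norm (v - u) powr \<alpha>"
      using B1(4)[OF a] B2(4)[OF a] by (simp add: algebra_simps)
    finally show "n l (x hs v + y hs v - (x hs u + y hs u)) \<le> (B1 + B2) * wt hs * norm (v - u) powr \<alpha>" .
  next
    fix hs :: "'b list" and u assume a: "length hs = m" "u \<in> U"
    show "n l (x hs u + y hs u) \<le> (B1 + B2) * wt hs"
      using B1(3)[OF a] B2(3)[OF a] triangle[OF B1(2)[OF a] B2(2)[OF a]] by (simp add: algebra_simps)
  qed (use B1 B2 in \<open>auto intro: add_mem\<close>)
qed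

lemma deriv_fam_add:
  fixes U :: "'b::real_normed_vector set"
  assumes sn: "\<And>l. 0 < c l \<Longrightarrow> seminormed_space (Y l) (n l)"
    and x: "holder_fam U Y n m c x" and y: "holder_fam U Y n m c y"
    and x': "holder_fam U Y n (Suc m) (\<lambda>l. c l - 1) x'" and y': "holder_fam U Y n (Suc m) (\<lambda>l. c l - 1) y'"
    and dx: "deriv_fam U Y n m c x x'" and dy: "deriv_fam U Y n m c y y'"
  shows "deriv_fam U Y n m c (\<lambda>hs u. x hs u + y hs u) (\<lambda>hs u. x' hs u + y' hs u)"
  unfolding deriv_fam_def
proof (intro allI impI ballI conjI)
  fix l u assume l: "1 < c l" and u: "u \<in> U"
  interpret seminormed_space "Y l" "n l" using sn l by force
  have mx: "\<And>hs u. length hs = m \<Longrightarrow> u \<in> U \<Longrightarrow> x hs u \<in> Y l" using holder_fam_mem[OF x] l by simp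
  have my: "\<And>hs u. length hs = m \<Longrightarrow> u \<in> U \<Longrightarrow> y hs u \<in> Y l" using holder_fam_mem[OF y] l by simp
  have mx': "\<And>hs u. length hs = Suc m \<Longrightarrow> u \<in> U \<Longrightarrow> x' hs u \<in> Y l" using holder_fam_mem[OF x', of l] l by simp
  have my': "\<And>hs u. length hs = Suc m \<Longrightarrow> u \<in> U \<Longrightarrow> y' hs u \<in> Y l" using holder_fam_mem[OF y', of l] l by simp
  {
    fix hs :: "'b list" and h g a b assume hs: "length hs = m"
    let ?D = "\<lambda>x'. x' ((a *\<^sub>R h + b *\<^sub>R g) # hs) u - a *\<^sub>R x' (h # hs) u - b *\<^sub>R x' (g # hs) u"
    have "n l (?D (\<lambda>hs u. x' hs u + y' hs u)) = n l (?D x' + ?D y')" by (simp add: algebra_simps)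
    also have "\<dots> \<le> n l (?D x') + n l (?D y')"
      using mx' my' hs u by (intro triangle diff_mem scale_mem) auto
    also have "\<dots> = 0" using deriv_fam_lin[OF dx l u hs] deriv_fam_lin[OF dy l u hs] by simp
    finally show "n l (x' ((a *\<^sub>R h + b *\<^sub>R g) # hs) u + y' ((a *\<^sub>R h + b *\<^sub>R g) # hs) u -
        a *\<^sub>R (x' (h # hs) u + y' (h # hs) u) - b *\<^sub>R (x' (g # hs) u + y' (g # hs) u)) = 0"
      using mx' my' hs u by (intro antisym nonneg diff_mem scale_mem add_mem) auto
  }
  fix e :: real assume "e > 0"
  then have e: "e / 2 > 0" by simp
  obtain d1 where d1: "d1 > 0" "\<And>hs h. length hs = m \<Longrightarrow> norm h < d1 \<Longrightarrow> u + h \<in> U \<Longrightarrow>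
     n l (x hs (u + h) - x hs u - x' (h # hs) u) \<le> e / 2 * norm h * wt hs"
    using deriv_famD[OF dx l u e] by metis
  obtain d2 where d2: "d2 > 0" "\<And>hs h. length hs = m \<Longrightarrow> norm h < d2 \<Longrightarrow> u + h \<in> U \<Longrightarrow>
     n l (y hs (u + h) - y hs u - y' (h # hs) u) \<le> e / 2 * norm h * wt hs"
    using deriv_famD[OF dy l u e] by metis
  show "\<exists>d>0. \<forall>hs h. length hs = m \<longrightarrow> norm h < d \<longrightarrow> u + h \<in> U \<longrightarrow>
        n l (x hs (u + h) + y hs (u + h) - (x hs u + y hs u) - (x' (h # hs) u + y' (h # hs) u))
          \<le> e * norm h * wt hs"
  proof (intro exI[of _ "min d1 d2"] conjI allI impI)
    fix hs :: "'b list" and h assume a: "length hs = m" "norm h < min d1 d2" "u + h \<in> U"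
    have "n l (x hs (u + h) + y hs (u + h) - (x hs u + y hs u) - (x' (h # hs) u + y' (h # hs) u))
      = n l ((x hs (u + h) - x hs u - x' (h # hs) u) + (y hs (u + h) - y hs u - y' (h # hs) u))"
      by (simp add: algebra_simps)
    also have "\<dots> \<le> n l (x hs (u + h) - x hs u - x' (h # hs) u) + n l (y hs (u + h) - y hs u - y' (h # hs) u)"
      using mx my mx' my' a u by (intro triangle diff_mem) auto
    also have "\<dots> \<le> e / 2 * norm h * wt hs + e / 2 * norm h * wt hs"
      using a by (intro add_mono d1 d2) auto
    finally show "n l (x hs (u + h) + y hs (u + h) - (x hs u + y hs u) - (x' (h # hs) u + y' (h # hs) u))
          \<le> e * norm h * wt hs" by (simp add: algebra_simps)
  qed (use d1 d2 in auto)
qed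

lemma smooth_fam_add:
  assumes "\<And>l. 0 < c l \<Longrightarrow> seminormed_space (Y l) (n l)"
    and "smooth_fam U Y n k m c x" "smooth_fam U Y n k m c y"
  shows "smooth_fam U Y n k m c (\<lambda>hs u. x hs u + y hs u)"
  using assms
proof (induction k arbitrary: m c x y)
  case 0
  then show ?case using holder_fam_add[of c Y n U m x y] by simp
next
  case (Suc k)
  obtain x' where x': "deriv_fam U Y n m c x x'" "smooth_fam U Y n k (Suc m) (\<lambda>l. c l - 1) x'"
    using Suc.prems by auto
  obtain y' where y': "deriv_fam U Y n m c y y'" "smooth_fam U Y n k (Suc m) (\<lambda>l. c l - 1) y'"
    using Suc.prems by auto
  have hx: "holder_fam U Y n m c x" and hy: "holder_fam U Y n m c y"
    using Suc.prems by auto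
  have "smooth_fam U Y n k (Suc m) (\<lambda>l. c l - 1) (\<lambda>hs u. x' hs u + y' hs u)"
    by (rule Suc.IH[OF _ x'(2) y'(2)]) (use Suc.prems(1) in auto)
  moreover have "deriv_fam U Y n m c (\<lambda>hs u. x hs u + y hs u) (\<lambda>hs u. x' hs u + y' hs u)"
    by (rule deriv_fam_add[OF Suc.prems(1) hx hy smooth_fam_holder[OF x'(2)] smooth_fam_holder[OF y'(2)]
        x'(1) y'(1)])
  ultimately show ?case using holder_fam_add[OF Suc.prems(1) hx hy] by auto
qed

text \<open>A nonzero constant is bounded by a multiple of \<open>wt hs\<close> only if there are no
  directions, hence order 0. Its derivatives vanish, so the zero family is treated first, at every
  order.\<close>

lemma smooth_fam_const:
  fixes U :: "'b::real_normed_vector set"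
  assumes "\<And>l. 0 < c l \<Longrightarrow> seminormed_space (Y l) (n l) \<and> y \<in> Y l"
  shows "smooth_fam U Y n k 0 c (\<lambda>hs u. y)"
proof -
  have zero: "smooth_fam U Y n k m c (\<lambda>hs u. 0)" if "\<And>l. 0 < c l \<Longrightarrow> seminormed_space (Y l) (n l)" for m c
    using that
  proof (induction k arbitrary: m c)
    case 0
    show ?case
      by (auto simp: holder_fam_def seminormed_space.zero_mem[OF 0] seminormed_space.norm_zero[OF 0]
          intro!: exI[of _ "0::real"])
  next
    case (Suc k)
    have "holder_fam U Y n m c (\<lambda>hs u. 0)"
      by (auto simp: holder_fam_def seminormed_space.zero_mem[OF Suc.prems]
          seminormed_space.norm_zero[OF Suc.prems] intro!: exI[of _ "0::real"])
    moreover have "deriv_fam U Y n m c (\<lambda>hs u. 0) (\<lambda>hs u. 0)"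
      by (auto simp: deriv_fam_def seminormed_space.norm_zero[OF Suc.prems] intro!: exI[of _ "1::real"])
    moreover have "smooth_fam U Y n k (Suc m) (\<lambda>l. c l - 1) (\<lambda>hs u. 0)"
      using Suc.prems by (intro Suc.IH) auto
    ultimately show ?case by auto
  qed
  have n0: "n l 0 = 0" if "0 < c l" for l
    using assms[OF that] seminormed_space.norm_zero by metis
  have h: "holder_fam U Y n 0 c (\<lambda>hs u. y)"
    unfolding holder_fam_def
  proof (intro allI impI)
    fix l \<alpha> assume \<alpha>: "0 < (\<alpha>::real)" "\<alpha> \<le> 1" "\<alpha> < c l"
    then have "seminormed_space (Y l) (n l)" "y \<in> Y l" using assms[of l] by auto
    then show "\<exists>B\<ge>0. \<forall>hs::'b list. length hs = 0 \<longrightarrow> (\<forall>u\<in>U. y \<in> Y l \<and> n l y \<le> B * wt hs \<and>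
        (\<forall>v\<in>U. n l (y - y) \<le> B * wt hs * norm (v - u) powr \<alpha>))"
      using n0[of l] \<alpha> by (intro exI[of _ "n l y"]) (auto intro!: mult_nonneg_nonneg seminormed_space.nonneg[of "Y l" "n l"])
  qed
  show ?thesis
  proof (cases k)
    case (Suc j)
    have sn: "seminormed_space (Y l) (n l)" if "0 < c l - 1" for l
      using assms[of l] that by auto
    have "deriv_fam U Y n 0 c (\<lambda>hs u. y) (\<lambda>hs u. 0)"
      unfolding deriv_fam_def using n0 by (auto intro!: exI[of _ "1::real"])
    moreover have "smooth_fam U Y n j (Suc 0) (\<lambda>l. c l - 1) (\<lambda>hs u. 0)"
      by (rule smooth_fam_mono, rule zero[unfolded Suc], rule sn)
    ultimately show ?thesis using h Suc by auto
  qed (use h in simp)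
qed

text \<open>In \<open>\<beta> (p v - p u) (q v) + \<beta> (p u) (q v - q u)\<close> the two terms
  are estimated through different pairs of levels: one spends the order \<alpha> on
  \<open>p\<close>, the other spends it on \<open>q\<close>. The maps \<open>s1\<close> and
  \<open>s2\<close> distribute the directions between the factors, as the terms of a higher Leibniz
  rule require.\<close>

lemma holder_fam_bilin:
  fixes U :: "'b::real_normed_vector set"
  assumes B: "\<And>l q1 q2. 0 \<le> q1 \<Longrightarrow> 0 \<le> q2 \<Longrightarrow> q1 + q2 < c3 l \<Longrightarrow>
      \<exists>l1 l2. q1 < c1 l1 \<and> q2 < c2 l2 \<and> bilin (Y1 l1) (n1 l1) (Y2 l2) (n2 l2) (Y3 l) (n3 l) \<beta>"
    and s: "\<And>hs::'b list. length hs = m \<Longrightarrow>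
      length (s1 hs) = m1 \<and> length (s2 hs) = m2 \<and> wt (s1 hs) * wt (s2 hs) \<le> wt hs"
    and p: "holder_fam U Y1 n1 m1 c1 p" and q: "holder_fam U Y2 n2 m2 c2 q"
  shows "holder_fam U Y3 n3 m c3 (\<lambda>hs u. \<beta> (p (s1 hs) u) (q (s2 hs) u))"
  unfolding holder_fam_def
proof (intro allI impI)
  fix l and \<alpha> :: real assume \<alpha>: "0 < \<alpha>" "\<alpha> \<le> 1" "\<alpha> < c3 l"
  obtain l1 l2 where l: "\<alpha> < c1 l1" "0 < c2 l2" and "bilin (Y1 l1) (n1 l1) (Y2 l2) (n2 l2) (Y3 l) (n3 l) \<beta>"
    using B[of \<alpha> 0 l] \<alpha> by auto
  then interpret b: bilin "Y1 l1" "n1 l1" "Y2 l2" "n2 l2" "Y3 l" "n3 l" \<beta> by simp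
  obtain k1 k2 where k: "0 < c1 k1" "\<alpha> < c2 k2" and "bilin (Y1 k1) (n1 k1) (Y2 k2) (n2 k2) (Y3 l) (n3 l) \<beta>"
    using B[of 0 \<alpha> l] \<alpha> by auto
  then interpret b': bilin "Y1 k1" "n1 k1" "Y2 k2" "n2 k2" "Y3 l" "n3 l" \<beta> by simp
  obtain M where M: "M \<ge> 0" "\<And>x y r s. x \<in> Y1 l1 \<Longrightarrow> y \<in> Y2 l2 \<Longrightarrow> n1 l1 x \<le> r \<Longrightarrow> n2 l2 y \<le> s \<Longrightarrow> n3 l (\<beta> x y) \<le> M * (r * s)"
    using b.bound by metis
  obtain M' where M': "M' \<ge> 0" "\<And>x y r s. x \<in> Y1 k1 \<Longrightarrow> y \<in> Y2 k2 \<Longrightarrow> n1 k1 x \<le> r \<Longrightarrow> n2 k2 y \<le> s \<Longrightarrow> n3 l (\<beta> x y) \<le> M' * (r * s)"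
    using b'.bound by metis
  obtain P where P: "P \<ge> 0"
    "\<And>hs u. length hs = m1 \<Longrightarrow> u \<in> U \<Longrightarrow> p hs u \<in> Y1 l1"
    "\<And>hs u. length hs = m1 \<Longrightarrow> u \<in> U \<Longrightarrow> n1 l1 (p hs u) \<le> P * wt hs"
    "\<And>hs u v. length hs = m1 \<Longrightarrow> u \<in> U \<Longrightarrow> v \<in> U \<Longrightarrow> n1 l1 (p hs v - p hs u) \<le> P * wt hs * norm (v - u) powr \<alpha>"
    using holder_famD[OF p \<alpha>(1,2) l(1)] by metis
  obtain Q where Q: "Q \<ge> 0"
    "\<And>hs u. length hs = m2 \<Longrightarrow> u \<in> U \<Longrightarrow> q hs u \<in> Y2 l2"
    "\<And>hs u. length hs = m2 \<Longrightarrow> u \<in> U \<Longrightarrow> n2 l2 (q hs u) \<le> Q * wt hs"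
    using holder_fam_bound[OF q l(2)] by metis
  obtain P' where P': "P' \<ge> 0"
    "\<And>hs u. length hs = m1 \<Longrightarrow> u \<in> U \<Longrightarrow> p hs u \<in> Y1 k1"
    "\<And>hs u. length hs = m1 \<Longrightarrow> u \<in> U \<Longrightarrow> n1 k1 (p hs u) \<le> P' * wt hs"
    using holder_fam_bound[OF p k(1)] by metis
  obtain Q' where Q': "Q' \<ge> 0"
    "\<And>hs u. length hs = m2 \<Longrightarrow> u \<in> U \<Longrightarrow> q hs u \<in> Y2 k2"
    "\<And>hs u. length hs = m2 \<Longrightarrow> u \<in> U \<Longrightarrow> n2 k2 (q hs u) \<le> Q' * wt hs"
    "\<And>hs u v. length hs = m2 \<Longrightarrow> u \<in> U \<Longrightarrow> v \<in> U \<Longrightarrow> n2 k2 (q hs v - q hs u) \<le> Q' * wt hs * norm (v - u) powr \<alpha>"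
    using holder_famD[OF q \<alpha>(1,2) k(2)] by metis
  define C where "C = M * (P * Q) + M' * (P' * Q')"
  have C: "C \<ge> 0" "M * (P * Q) \<le> C" using M(1) M'(1) P(1) P'(1) Q(1) Q'(1) by (auto simp: C_def)
  show "\<exists>B\<ge>0. \<forall>hs. length hs = m \<longrightarrow> (\<forall>u\<in>U. \<beta> (p (s1 hs) u) (q (s2 hs) u) \<in> Y3 l \<and>
        n3 l (\<beta> (p (s1 hs) u) (q (s2 hs) u)) \<le> B * wt hs \<and>
        (\<forall>v\<in>U. n3 l (\<beta> (p (s1 hs) v) (q (s2 hs) v) - \<beta> (p (s1 hs) u) (q (s2 hs) u)) \<le>
           B * wt hs * norm (v - u) powr \<alpha>))"
  proof (intro exI[of _ C] conjI allI impI ballI)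
    fix hs :: "'b list" and u assume hs: "length hs = m" and u: "u \<in> U"
    have s': "length (s1 hs) = m1" "length (s2 hs) = m2" "wt (s1 hs) * wt (s2 hs) \<le> wt hs"
      using s[OF hs] by auto
    show "\<beta> (p (s1 hs) u) (q (s2 hs) u) \<in> Y3 l"
      by (intro b.mem P Q s' u)
    have "n3 l (\<beta> (p (s1 hs) u) (q (s2 hs) u)) \<le> M * ((P * wt (s1 hs)) * (Q * wt (s2 hs)))"
      by (intro M P Q s' u)
    also have "\<dots> = (M * (P * Q)) * (wt (s1 hs) * wt (s2 hs))" by (simp add: mult_ac)
    also have "\<dots> \<le> C * wt hs" using C s' by (intro mult_mono) auto
    finally show "n3 l (\<beta> (p (s1 hs) u) (q (s2 hs) u)) \<le> C * wt hs" .
    fix v assume v: "v \<in> U"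
    let ?p = "p (s1 hs)" and ?q = "q (s2 hs)" and ?t = "norm (v - u) powr \<alpha>"
    have m: "?p v - ?p u \<in> Y1 l1" "?q v - ?q u \<in> Y2 k2"
      using P(2) Q'(2) s' u v by (auto intro: b.L.diff_mem b'.R.diff_mem)
    have "\<beta> (?p v) (?q v) - \<beta> (?p u) (?q u) = \<beta> (?p v - ?p u) (?q v) + \<beta> (?p u) (?q v - ?q u)"
      using P(2) Q(2) P'(2) Q'(2) s' u v by (simp add: b.diff_left b'.diff_right)
    then have "n3 l (\<beta> (?p v) (?q v) - \<beta> (?p u) (?q u)) \<le> n3 l (\<beta> (?p v - ?p u) (?q v)) + n3 l (\<beta> (?p u) (?q v - ?q u))"
      using b.T.triangle[OF b.mem[OF m(1) Q(2)[OF s'(2) v]] b'.mem[OF P'(2)[OF s'(1) u] m(2)]] by simp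
    also have "\<dots> \<le> M * ((P * wt (s1 hs) * ?t) * (Q * wt (s2 hs))) + M' * ((P' * wt (s1 hs)) * (Q' * wt (s2 hs) * ?t))"
      by (intro add_mono M M' m P P' Q Q' s' u v)
    also have "\<dots> = C * (wt (s1 hs) * wt (s2 hs)) * ?t" by (simp add: C_def algebra_simps)
    also have "\<dots> \<le> C * wt hs * ?t"
      using s' C by (intro mult_mono mult_left_mono mult_nonneg_nonneg) auto
    finally show "n3 l (\<beta> (?p v) (?q v) - \<beta> (?p u) (?q u)) \<le> C * wt hs * ?t" .
  qed (rule C)
qed

text \<open>The remainder of a product splits into the remainder of \<open>p\<close> times
  \<open>q v\<close>, the derivative of \<open>p\<close> times an increment of \<open>q\<close>, and
  \<open>p u\<close> times the remainder of \<open>q\<close>. The first two are measured through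
  levels where \<open>p\<close> has capacity above 1, the last through levels where \<open>q\<close>
  has. The newest direction is put in front of the list of the factor that is
  differentiated.\<close>

lemma deriv_fam_bilin:
  fixes U :: "'b::real_normed_vector set"
  assumes B: "\<And>l q1 q2. 0 \<le> q1 \<Longrightarrow> 0 \<le> q2 \<Longrightarrow> q1 + q2 < c3 l \<Longrightarrow>
      \<exists>l1 l2. q1 < c1 l1 \<and> q2 < c2 l2 \<and> bilin (Y1 l1) (n1 l1) (Y2 l2) (n2 l2) (Y3 l) (n3 l) \<beta>"
    and s: "\<And>hs::'b list. length hs = m \<Longrightarrow>
      length (s1 hs) = m1 \<and> length (s2 hs) = m2 \<and> wt (s1 hs) * wt (s2 hs) \<le> wt hs"
    and p: "holder_fam U Y1 n1 m1 c1 p" and q: "holder_fam U Y2 n2 m2 c2 q"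
    and p': "holder_fam U Y1 n1 (Suc m1) (\<lambda>l. c1 l - 1) p'" and q': "holder_fam U Y2 n2 (Suc m2) (\<lambda>l. c2 l - 1) q'"
    and dp: "deriv_fam U Y1 n1 m1 c1 p p'" and dq: "deriv_fam U Y2 n2 m2 c2 q q'"
  shows "deriv_fam U Y3 n3 m c3 (\<lambda>hs u. \<beta> (p (s1 hs) u) (q (s2 hs) u))
     (\<lambda>hs u. \<beta> (p' (hd hs # s1 (tl hs)) u) (q (s2 (tl hs)) u) + \<beta> (p (s1 (tl hs)) u) (q' (hd hs # s2 (tl hs)) u))"
  unfolding deriv_fam_def
proof (intro allI impI ballI)
  fix l u assume l3: "1 < c3 l" and u: "u \<in> U"
  obtain l1 l2 where l: "1 < c1 l1" "0 < c2 l2" and "bilin (Y1 l1) (n1 l1) (Y2 l2) (n2 l2) (Y3 l) (n3 l) \<beta>"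
    using B[of 1 0 l] l3 by auto
  then interpret b: bilin "Y1 l1" "n1 l1" "Y2 l2" "n2 l2" "Y3 l" "n3 l" \<beta> by simp
  obtain k1 k2 where k: "0 < c1 k1" "1 < c2 k2" and "bilin (Y1 k1) (n1 k1) (Y2 k2) (n2 k2) (Y3 l) (n3 l) \<beta>"
    using B[of 0 1 l] l3 by auto
  then interpret b': bilin "Y1 k1" "n1 k1" "Y2 k2" "n2 k2" "Y3 l" "n3 l" \<beta> by simp
  obtain M where M: "M \<ge> 0" "\<And>x y r s. x \<in> Y1 l1 \<Longrightarrow> y \<in> Y2 l2 \<Longrightarrow> n1 l1 x \<le> r \<Longrightarrow> n2 l2 y \<le> s \<Longrightarrow> n3 l (\<beta> x y) \<le> M * (r * s)"
    using b.bound by metis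
  obtain M' where M': "M' \<ge> 0" "\<And>x y r s. x \<in> Y1 k1 \<Longrightarrow> y \<in> Y2 k2 \<Longrightarrow> n1 k1 x \<le> r \<Longrightarrow> n2 k2 y \<le> s \<Longrightarrow> n3 l (\<beta> x y) \<le> M' * (r * s)"
    using b'.bound by metis
  obtain P where P: "P \<ge> 0"
    "\<And>hs u. length hs = Suc m1 \<Longrightarrow> u \<in> U \<Longrightarrow> p' hs u \<in> Y1 l1"
    "\<And>hs u. length hs = Suc m1 \<Longrightarrow> u \<in> U \<Longrightarrow> n1 l1 (p' hs u) \<le> P * wt hs"
    using holder_fam_bound[OF p', of l1] l by auto
  obtain Q where Q: "Q \<ge> 0"
    "\<And>hs u. length hs = m2 \<Longrightarrow> u \<in> U \<Longrightarrow> q hs u \<in> Y2 l2"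
    "\<And>hs u. length hs = m2 \<Longrightarrow> u \<in> U \<Longrightarrow> n2 l2 (q hs u) \<le> Q * wt hs"
    using holder_fam_bound[OF q l(2)] by metis
  obtain P' where P': "P' \<ge> 0"
    "\<And>hs u. length hs = m1 \<Longrightarrow> u \<in> U \<Longrightarrow> p hs u \<in> Y1 k1"
    "\<And>hs u. length hs = m1 \<Longrightarrow> u \<in> U \<Longrightarrow> n1 k1 (p hs u) \<le> P' * wt hs"
    using holder_fam_bound[OF p k(1)] by metis
  have mp: "\<And>hs u. length hs = m1 \<Longrightarrow> u \<in> U \<Longrightarrow> p hs u \<in> Y1 l1" using holder_fam_mem[OF p] l by simp
  have mq: "\<And>hs u. length hs = m2 \<Longrightarrow> u \<in> U \<Longrightarrow> q hs u \<in> Y2 k2" using holder_fam_mem[OF q] k by simp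
  have mq': "\<And>hs u. length hs = Suc m2 \<Longrightarrow> u \<in> U \<Longrightarrow> q' hs u \<in> Y2 k2" using holder_fam_mem[OF q'] k by simp
  let ?x' = "\<lambda>hs u. \<beta> (p' (hd hs # s1 (tl hs)) u) (q (s2 (tl hs)) u) + \<beta> (p (s1 (tl hs)) u) (q' (hd hs # s2 (tl hs)) u)"
  let ?x = "\<lambda>hs u. \<beta> (p (s1 hs) u) (q (s2 hs) u)"
  show "(\<forall>hs h g a b. length hs = m \<longrightarrow>
        n3 l (?x' ((a *\<^sub>R h + b *\<^sub>R g) # hs) u - a *\<^sub>R ?x' (h # hs) u - b *\<^sub>R ?x' (g # hs) u) = 0) \<and>
     (\<forall>e>0. \<exists>d>0. \<forall>hs h. length hs = m \<longrightarrow> norm h < d \<longrightarrow> u + h \<in> U \<longrightarrow>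
        n3 l (?x hs (u + h) - ?x hs u - ?x' (h # hs) u) \<le> e * norm h * wt hs)"
  proof (intro allI impI ballI conjI)
    fix hs :: "'b list" and h g :: 'b and a b :: real assume hs: "length hs = m"
    have s': "length (s1 hs) = m1" "length (s2 hs) = m2" using s[OF hs] by auto
    let ?P = "p' ((a *\<^sub>R h + b *\<^sub>R g) # s1 hs) u - a *\<^sub>R p' (h # s1 hs) u - b *\<^sub>R p' (g # s1 hs) u"
    let ?Q = "q' ((a *\<^sub>R h + b *\<^sub>R g) # s2 hs) u - a *\<^sub>R q' (h # s2 hs) u - b *\<^sub>R q' (g # s2 hs) u"
    have P0: "?P \<in> Y1 l1" "n1 l1 ?P \<le> 0" and Q0: "?Q \<in> Y2 k2" "n2 k2 ?Q \<le> 0"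
      using P(2) mq' s' u deriv_fam_lin[OF dp l(1) u s'(1), of a h b g] deriv_fam_lin[OF dq k(2) u s'(2), of a h b g]
      by (auto intro!: b.L.diff_mem b.L.scale_mem b'.R.diff_mem b'.R.scale_mem)
    have e1: "\<beta> ?P (q (s2 hs) u) = \<beta> (p' ((a *\<^sub>R h + b *\<^sub>R g) # s1 hs) u) (q (s2 hs) u) -
        a *\<^sub>R \<beta> (p' (h # s1 hs) u) (q (s2 hs) u) - b *\<^sub>R \<beta> (p' (g # s1 hs) u) (q (s2 hs) u)"
      using P(2) Q(2) s' u by (simp add: b.diff_left b.scale_left b.L.diff_mem b.L.scale_mem)
    have e2: "\<beta> (p (s1 hs) u) ?Q = \<beta> (p (s1 hs) u) (q' ((a *\<^sub>R h + b *\<^sub>R g) # s2 hs) u) -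
        a *\<^sub>R \<beta> (p (s1 hs) u) (q' (h # s2 hs) u) - b *\<^sub>R \<beta> (p (s1 hs) u) (q' (g # s2 hs) u)"
      using P'(2) mq' s' u by (simp add: b'.diff_right b'.scale_right b'.R.diff_mem b'.R.scale_mem)
    have "?x' ((a *\<^sub>R h + b *\<^sub>R g) # hs) u - a *\<^sub>R ?x' (h # hs) u - b *\<^sub>R ?x' (g # hs) u
       = \<beta> ?P (q (s2 hs) u) + \<beta> (p (s1 hs) u) ?Q"
      unfolding e1 e2 list.sel by (simp add: algebra_simps)
    moreover have "n3 l (\<beta> ?P (q (s2 hs) u) + \<beta> (p (s1 hs) u) ?Q) \<le> M * (0 * (Q * wt (s2 hs))) + M' * (P' * wt (s1 hs) * 0)"
      using P0 Q0 P'(2,3) Q(2,3) s' u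
      by (intro order_trans[OF b.T.triangle] add_mono M M' b.mem b'.mem) auto
    moreover have "\<beta> ?P (q (s2 hs) u) + \<beta> (p (s1 hs) u) ?Q \<in> Y3 l"
      using P0 Q0 P'(2,3) Q(2,3) s' u by (intro b.T.add_mem b.mem b'.mem) auto
    ultimately show "n3 l (?x' ((a *\<^sub>R h + b *\<^sub>R g) # hs) u - a *\<^sub>R ?x' (h # hs) u - b *\<^sub>R ?x' (g # hs) u) = 0"
      using b.T.nonneg by (intro antisym) auto
  next
    fix e :: real assume e: "0 < e"
    \<comment> \<open>The summand 1 keeps \<open>C\<close> positive, so that \<open>e\<close> may be
      divided by it.\<close>
    define C where "C = 1 + M * Q + M * P + M' * P'"
    have C: "C > 0" using M(1) M'(1) P(1) P'(1) Q(1) by (auto simp: C_def intro!: add_pos_nonneg)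
    define e' where "e' = e / C"
    have e': "e' > 0" using e C by (simp add: e'_def)
    obtain d1 where d1: "d1 > 0" "\<And>hs h. length hs = m1 \<Longrightarrow> norm h < d1 \<Longrightarrow> u + h \<in> U \<Longrightarrow>
      n1 l1 (p hs (u + h) - p hs u - p' (h # hs) u) \<le> e' * norm h * wt hs"
      using deriv_famD[OF dp l(1) u e'] by metis
    obtain d2 where d2: "d2 > 0" "\<And>hs h. length hs = m2 \<Longrightarrow> norm h < d2 \<Longrightarrow> u + h \<in> U \<Longrightarrow>
      n2 k2 (q hs (u + h) - q hs u - q' (h # hs) u) \<le> e' * norm h * wt hs"
      using deriv_famD[OF dq k(2) u e'] by metis
    obtain d3 where d3: "d3 > 0" "\<And>hs u v. length hs = m2 \<Longrightarrow> u \<in> U \<Longrightarrow> v \<in> U \<Longrightarrow> norm (v - u) < d3 \<Longrightarrow>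
      n2 l2 (q hs v - q hs u) \<le> e' * wt hs"
      using holder_fam_cont[OF q l(2) e'] by metis
    show "\<exists>d>0. \<forall>hs h. length hs = m \<longrightarrow> norm h < d \<longrightarrow> u + h \<in> U \<longrightarrow>
        n3 l (?x hs (u + h) - ?x hs u - ?x' (h # hs) u) \<le> e * norm h * wt hs"
    proof (intro exI[of _ "min d1 (min d2 d3)"] conjI allI impI)
      fix hs :: "'b list" and h assume hs: "length hs = m" and h: "norm h < min d1 (min d2 d3)" "u + h \<in> U"
      have s': "length (s1 hs) = m1" "length (s2 hs) = m2" "wt (s1 hs) * wt (s2 hs) \<le> wt hs"
        using s[OF hs] by auto
      let ?v = "u + h" and ?p = "p (s1 hs)" and ?q = "q (s2 hs)"
      let ?P = "p' (h # s1 hs) u" and ?Q = "q' (h # s2 hs) u"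
      have m: "?p ?v \<in> Y1 l1" "?p u \<in> Y1 l1" "?p u \<in> Y1 k1" "?P \<in> Y1 l1" "?q ?v \<in> Y2 l2" "?q u \<in> Y2 l2"
        "?q ?v \<in> Y2 k2" "?q u \<in> Y2 k2" "?Q \<in> Y2 k2"
        using mp mq mq' P P' Q s' u h by auto
      have m': "?p ?v - ?p u \<in> Y1 l1" "?p ?v - ?p u - ?P \<in> Y1 l1" "?q ?v - ?q u \<in> Y2 l2" "?q ?v - ?q u - ?Q \<in> Y2 k2"
          "?q ?v - ?q u \<in> Y2 k2"
        using m by (auto intro!: b.L.diff_mem b.R.diff_mem b'.R.diff_mem)
      have eq: "\<beta> (?p ?v) (?q ?v) - \<beta> (?p u) (?q u) - (\<beta> ?P (?q u) + \<beta> (?p u) ?Q)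
         = \<beta> (?p ?v - ?p u - ?P) (?q ?v) + \<beta> ?P (?q ?v - ?q u) + \<beta> (?p u) (?q ?v - ?q u - ?Q)"
        using m m' by (simp add: b.diff_left b'.diff_right b.diff_right)
      have "n3 l (\<beta> (?p ?v - ?p u - ?P) (?q ?v) + \<beta> ?P (?q ?v - ?q u) + \<beta> (?p u) (?q ?v - ?q u - ?Q))
        \<le> n3 l (\<beta> (?p ?v - ?p u - ?P) (?q ?v)) + n3 l (\<beta> ?P (?q ?v - ?q u)) + n3 l (\<beta> (?p u) (?q ?v - ?q u - ?Q))"
        using m m' by (intro b.T.triangle3 b.mem b'.mem) auto
      also have "\<dots> \<le> M * ((e' * norm h * wt (s1 hs)) * (Q * wt (s2 hs))) + M * (P * wt (h # s1 hs) * (e' * wt (s2 hs)))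
         + M' * (P' * wt (s1 hs) * (e' * norm h * wt (s2 hs)))"
        using h m m' s' u by (intro add_mono M M' d1 d2 d3 P P' Q) auto
      also have "\<dots> = e' * (M * Q + M * P + M' * P') * norm h * (wt (s1 hs) * wt (s2 hs))"
        by (simp add: algebra_simps)
      also have "\<dots> \<le> e' * C * norm h * wt hs"
        using s' e' M(1) M'(1) P(1) P'(1) Q(1) by (intro mult_mono mult_nonneg_nonneg) (auto simp: C_def)
      also have "e' * C = e" using C by (simp add: e'_def)
      finally show "n3 l (?x hs ?v - ?x hs u - ?x' (h # hs) u) \<le> e * norm h * wt hs"
        unfolding list.sel eq .
    qed (use d1 d2 d3 in auto)
  qed
qed

text \<open>Each term of the Leibniz rule is again a product, with the capacity of one factor
  lowered by 1. The splitting hypothesis for \<open>c3 - 1\<close> follows from the one for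
  \<open>c3\<close> by raising \<open>q1\<close> or \<open>q2\<close> by 1, so the induction
  closes.\<close>

lemma smooth_fam_bilin:
  fixes U :: "'b::real_normed_vector set"
  assumes "\<And>l q1 q2. 0 \<le> q1 \<Longrightarrow> 0 \<le> q2 \<Longrightarrow> q1 + q2 < c3 l \<Longrightarrow>
      \<exists>l1 l2. q1 < c1 l1 \<and> q2 < c2 l2 \<and> bilin (Y1 l1) (n1 l1) (Y2 l2) (n2 l2) (Y3 l) (n3 l) \<beta>"
    and "\<And>hs::'b list. length hs = m \<Longrightarrow>
      length (s1 hs) = m1 \<and> length (s2 hs) = m2 \<and> wt (s1 hs) * wt (s2 hs) \<le> wt hs"
    and "smooth_fam U Y1 n1 k m1 c1 p" "smooth_fam U Y2 n2 k m2 c2 q"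
  shows "smooth_fam U Y3 n3 k m c3 (\<lambda>hs u. \<beta> (p (s1 hs) u) (q (s2 hs) u))"
  using assms
proof (induction k arbitrary: m m1 m2 c1 c2 c3 p q s1 s2)
  case 0
  then show ?case using holder_fam_bilin[of c3 c1 c2 Y1 n1 Y2 n2 Y3 n3 \<beta> m s1 m1 s2 m2 U p q] by simp
next
  case (Suc k)
  note B = Suc.prems(1) and s = Suc.prems(2)
  have hp: "holder_fam U Y1 n1 m1 c1 p" and hq: "holder_fam U Y2 n2 m2 c2 q"
    using Suc.prems(3,4) by auto
  obtain p' where p': "deriv_fam U Y1 n1 m1 c1 p p'" "smooth_fam U Y1 n1 k (Suc m1) (\<lambda>l. c1 l - 1) p'"
    using Suc.prems(3) by auto
  obtain q' where q': "deriv_fam U Y2 n2 m2 c2 q q'" "smooth_fam U Y2 n2 k (Suc m2) (\<lambda>l. c2 l - 1) q'"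
    using Suc.prems(4) by auto
  have sn: "seminormed_space (Y3 l) (n3 l)" if "0 < c3 l" for l
  proof -
    obtain l1 l2 where "bilin (Y1 l1) (n1 l1) (Y2 l2) (n2 l2) (Y3 l) (n3 l) \<beta>"
      using B[of 0 0 l] \<open>0 < c3 l\<close> by auto
    then interpret b: bilin "Y1 l1" "n1 l1" "Y2 l2" "n2 l2" "Y3 l" "n3 l" \<beta> .
    show ?thesis by unfold_locales
  qed
  have len: "length (tl hs) = m" "norm (hd hs) * wt (tl hs) = wt hs" if "length hs = Suc m" for hs :: "'b list"
    using that by (cases hs; simp)+
  have "smooth_fam U Y3 n3 k (Suc m) (\<lambda>l. c3 l - 1) (\<lambda>hs u. \<beta> (p' (hd hs # s1 (tl hs)) u) (q (s2 (tl hs)) u))"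
  proof (rule Suc.IH[of _ "\<lambda>l. c1 l - 1" c2 "Suc m" "\<lambda>hs. hd hs # s1 (tl hs)" "Suc m1" "\<lambda>hs. s2 (tl hs)" m2])
    show "\<exists>l1 l2. q1 < c1 l1 - 1 \<and> q2 < c2 l2 \<and> bilin (Y1 l1) (n1 l1) (Y2 l2) (n2 l2) (Y3 l) (n3 l) \<beta>"
      if "0 \<le> q1" "0 \<le> q2" "q1 + q2 < c3 l - 1" for l q1 q2
      using B[of "q1 + 1" q2 l] that by (force simp: algebra_simps)
    show "length (hd hs # s1 (tl hs)) = Suc m1 \<and> length (s2 (tl hs)) = m2 \<and>
         wt (hd hs # s1 (tl hs)) * wt (s2 (tl hs)) \<le> wt hs" if "length hs = Suc m" for hs :: "'b list"
      using s[OF len(1)[OF that]] len(2)[OF that]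
      by (auto simp: mult.assoc simp flip: len(2)[OF that] intro!: mult_left_mono)
  qed (use p' smooth_fam_mono[OF Suc.prems(4)] in auto)
  moreover have "smooth_fam U Y3 n3 k (Suc m) (\<lambda>l. c3 l - 1) (\<lambda>hs u. \<beta> (p (s1 (tl hs)) u) (q' (hd hs # s2 (tl hs)) u))"
  proof (rule Suc.IH[of _ c1 "\<lambda>l. c2 l - 1" "Suc m" "\<lambda>hs. s1 (tl hs)" m1 "\<lambda>hs. hd hs # s2 (tl hs)" "Suc m2"])
    show "\<exists>l1 l2. q1 < c1 l1 \<and> q2 < c2 l2 - 1 \<and> bilin (Y1 l1) (n1 l1) (Y2 l2) (n2 l2) (Y3 l) (n3 l) \<beta>"
      if "0 \<le> q1" "0 \<le> q2" "q1 + q2 < c3 l - 1" for l q1 q2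
      using B[of q1 "q2 + 1" l] that by (force simp: algebra_simps)
    show "length (s1 (tl hs)) = m1 \<and> length (hd hs # s2 (tl hs)) = Suc m2 \<and>
         wt (s1 (tl hs)) * wt (hd hs # s2 (tl hs)) \<le> wt hs" if "length hs = Suc m" for hs :: "'b list"
      using s[OF len(1)[OF that]] len(2)[OF that]
      by (auto simp: mult.left_commute simp flip: len(2)[OF that] intro!: mult_left_mono)
  qed (use q' smooth_fam_mono[OF Suc.prems(3)] in auto)
  ultimately have "smooth_fam U Y3 n3 k (Suc m) (\<lambda>l. c3 l - 1)
     (\<lambda>hs u. \<beta> (p' (hd hs # s1 (tl hs)) u) (q (s2 (tl hs)) u) + \<beta> (p (s1 (tl hs)) u) (q' (hd hs # s2 (tl hs)) u))"
    using sn by (intro smooth_fam_add) auto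
  moreover have "deriv_fam U Y3 n3 m c3 (\<lambda>hs u. \<beta> (p (s1 hs) u) (q (s2 hs) u))
     (\<lambda>hs u. \<beta> (p' (hd hs # s1 (tl hs)) u) (q (s2 (tl hs)) u) + \<beta> (p (s1 (tl hs)) u) (q' (hd hs # s2 (tl hs)) u))"
    by (rule deriv_fam_bilin[OF B s hp hq smooth_fam_holder[OF p'(2)] smooth_fam_holder[OF q'(2)] p'(1) q'(1)])
  moreover have "holder_fam U Y3 n3 m c3 (\<lambda>hs u. \<beta> (p (s1 hs) u) (q (s2 hs) u))"
    by (rule holder_fam_bilin[OF B s hp hq])
  ultimately show ?case by auto
qed

text \<open>A linear map is the product \<open>t *\<^sub>R \<Phi> x\<close> with the constant family
  \<open>t = 1\<close>. The second factor lives on copies of the reals indexed by their own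
  capacity, so its level \<open>q2 + 1\<close> always suffices.\<close>

lemma smooth_fam_linear:
  fixes U :: "'b::real_normed_vector set" and \<Phi> :: "'x::real_vector \<Rightarrow> 'y::real_vector"
  assumes \<Phi>: "\<And>l q. 0 \<le> q \<Longrightarrow> q < c l \<Longrightarrow> \<exists>l1. q < c1 l1 \<and> seminormed_space (Y1 l1) (n1 l1) \<and>
        seminormed_space (Y l) (n l) \<and> (\<forall>x\<in>Y1 l1. \<Phi> x \<in> Y l) \<and>
        (\<forall>x\<in>Y1 l1. \<forall>y\<in>Y1 l1. \<Phi> (x + y) = \<Phi> x + \<Phi> y) \<and> (\<forall>a. \<forall>x\<in>Y1 l1. \<Phi> (a *\<^sub>R x) = a *\<^sub>R \<Phi> x) \<and>
        (\<exists>B\<ge>0. \<forall>x\<in>Y1 l1. n l (\<Phi> x) \<le> B * n1 l1 x)"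
    and p: "smooth_fam U Y1 n1 k m c1 p"
  shows "smooth_fam U Y n k m c (\<lambda>hs u. \<Phi> (p hs u))"
proof -
  have abs: "seminormed_space (UNIV::real set) abs" by unfold_locales (auto simp: abs_mult)
  have one: "smooth_fam U (\<lambda>_. UNIV) (\<lambda>_. abs) k 0 (\<lambda>t::real. t) (\<lambda>hs u. 1::real)"
    by (rule smooth_fam_const) (use abs in auto)
  have "smooth_fam U Y n k m c (\<lambda>hs u. (\<lambda>x t. t *\<^sub>R \<Phi> x) (p (id hs) u) 1)"
  proof (rule smooth_fam_bilin[where ?s1.0 = id and ?s2.0 = "\<lambda>_. []", OF _ _ p one])
    fix l and q1 q2 :: real assume q: "0 \<le> q1" "0 \<le> q2" "q1 + q2 < c l"
    obtain l1 where l1: "q1 < c1 l1" and s1: "seminormed_space (Y1 l1) (n1 l1)" and s: "seminormed_space (Y l) (n l)"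
      and mem: "\<forall>x\<in>Y1 l1. \<Phi> x \<in> Y l"
      and add: "\<forall>x\<in>Y1 l1. \<forall>y\<in>Y1 l1. \<Phi> (x + y) = \<Phi> x + \<Phi> y" and scale: "\<forall>a. \<forall>x\<in>Y1 l1. \<Phi> (a *\<^sub>R x) = a *\<^sub>R \<Phi> x"
      and bnd: "\<exists>B\<ge>0. \<forall>x\<in>Y1 l1. n l (\<Phi> x) \<le> B * n1 l1 x"
      using \<Phi>[of q1 l] q by auto
    interpret S1: seminormed_space "Y1 l1" "n1 l1" by fact
    interpret S: seminormed_space "Y l" "n l" by fact
    interpret R: seminormed_space "UNIV::real set" abs by fact
    have "bilin (Y1 l1) (n1 l1) UNIV abs (Y l) (n l) (\<lambda>x t. t *\<^sub>R \<Phi> x)"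
    proof unfold_locales
      obtain B where B: "B \<ge> 0" "\<forall>x\<in>Y1 l1. n l (\<Phi> x) \<le> B * n1 l1 x" using bnd by auto
      have "n l (t *\<^sub>R \<Phi> x) \<le> B * (n1 l1 x * \<bar>t\<bar>)" if "x \<in> Y1 l1" for x t
        using mult_left_mono[of "n l (\<Phi> x)" "B * n1 l1 x" "\<bar>t\<bar>"] B that mem by (auto simp: S.scale mult_ac)
      then show "\<exists>B\<ge>0. \<forall>x\<in>Y1 l1. \<forall>t\<in>UNIV. n l (t *\<^sub>R \<Phi> x) \<le> B * (n1 l1 x * \<bar>t\<bar>)" using B(1) by blast
    qed (use add scale mem in \<open>auto simp: scaleR_right_distrib scaleR_left_distrib S.scale_mem\<close>)
    then show "\<exists>l1 l2. q1 < c1 l1 \<and> q2 < l2 \<and> bilin (Y1 l1) (n1 l1) UNIV abs (Y l) (n l) (\<lambda>x t. t *\<^sub>R \<Phi> x)"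
      using l1 by (intro exI[of _ l1] exI[of _ "q2 + 1"]) auto
  qed auto
  then show ?thesis by simp
qed

lemma smooth_fam_uminus:
  fixes U :: "'b::real_normed_vector set"
  assumes "\<And>l. 0 < c l \<Longrightarrow> seminormed_space (Y l) (n l)" and p: "smooth_fam U Y n k m c p"
  shows "smooth_fam U Y n k m c (\<lambda>hs u. - p hs u)"
proof (rule smooth_fam_linear[OF _ p])
  fix l q assume q: "0 \<le> q" "q < c l"
  then interpret seminormed_space "Y l" "n l" using assms(1)[of l] by simp
  show "\<exists>l1. q < c l1 \<and> seminormed_space (Y l1) (n l1) \<and>
        seminormed_space (Y l) (n l) \<and> (\<forall>x\<in>Y l1. - x \<in> Y l) \<and>
        (\<forall>x\<in>Y l1. \<forall>y\<in>Y l1. - (x + y) = - x + - y) \<and> (\<forall>a. \<forall>x\<in>Y l1. - (a *\<^sub>R x) = a *\<^sub>R (- x)) \<and>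
        (\<exists>B\<ge>0. \<forall>x\<in>Y l1. n l (- x) \<le> B * n l1 x)"
    using q by (intro exI[of _ l]) (auto simp: norm_minus seminormed_space_axioms subspace_neg[OF subspace] intro!: exI[of _ "1::real"])
qed

lemma smooth_fam_diff:
  fixes U :: "'b::real_normed_vector set"
  assumes "\<And>l. 0 < c l \<Longrightarrow> seminormed_space (Y l) (n l)"
    and "smooth_fam U Y n k m c x" "smooth_fam U Y n k m c y"
  shows "smooth_fam U Y n k m c (\<lambda>hs u. x hs u - y hs u)"
  using smooth_fam_add[OF assms(1) assms(2) smooth_fam_uminus[OF assms(1,3)]] by simp

text \<open>Applying \<open>A u\<close> leads from one level to a weaker one at the cost of
  capacity, whereas the bound on its inverse stays within each level. The solution operator
  \<open>g\<close> is common to all levels, so that a derivative obtained by solving is one function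
  on the whole scale.\<close>

locale inverse_scale =
  fixes U :: "'b::real_normed_vector set"
    and Y1 :: "'k \<Rightarrow> 'x::real_vector set" and n1 :: "'k \<Rightarrow> 'x \<Rightarrow> real" and c1 :: "'k \<Rightarrow> real"
    and Y :: "'l \<Rightarrow> 'y::real_vector set" and n :: "'l \<Rightarrow> 'y \<Rightarrow> real" and c :: "'l \<Rightarrow> real"
    and \<beta> :: "'x \<Rightarrow> 'y \<Rightarrow> 'y" and A :: "'b \<Rightarrow> 'x" and g :: "'b \<Rightarrow> 'y \<Rightarrow> 'y"
  assumes split: "\<And>l q1 q2. 0 \<le> q1 \<Longrightarrow> 0 \<le> q2 \<Longrightarrow> q1 + q2 < c l \<Longrightarrow>
      \<exists>l1 l2. q1 < c1 l1 \<and> q2 < c l2 \<and> bilin (Y1 l1) (n1 l1) (Y l2) (n l2) (Y l) (n l) \<beta>"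
    and inv_mem: "\<And>l u y. 0 < c l \<Longrightarrow> u \<in> U \<Longrightarrow> y \<in> Y l \<Longrightarrow> g u y \<in> Y l"
    and inv: "\<And>l u y. 0 < c l \<Longrightarrow> u \<in> U \<Longrightarrow> y \<in> Y l \<Longrightarrow> \<beta> (A u) (g u y) = y"
    and diff: "\<And>l u x y. 0 < c l \<Longrightarrow> u \<in> U \<Longrightarrow> x \<in> Y l \<Longrightarrow> y \<in> Y l \<Longrightarrow> \<beta> (A u) (x - y) = \<beta> (A u) x - \<beta> (A u) y"
    and scale: "\<And>l u x a. 0 < c l \<Longrightarrow> u \<in> U \<Longrightarrow> x \<in> Y l \<Longrightarrow> \<beta> (A u) (a *\<^sub>R x) = a *\<^sub>R \<beta> (A u) x"
    and bound: "\<And>l. 0 < c l \<Longrightarrow> \<exists>B\<ge>0. \<forall>u\<in>U. \<forall>x\<in>Y l. n l x \<le> B * n l (\<beta> (A u) x)"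
begin

lemma seminormed: "0 < c l \<Longrightarrow> seminormed_space (Y l) (n l)"
  using split[of 0 0 l] by (auto simp: bilin_def)

text \<open>A derivative of the solution has one unit of capacity less; in \<open>split\<close> the
  missing unit is charged to the second factor.\<close>

lemma reduced: "inverse_scale U Y1 n1 c1 Y n (\<lambda>l. c l - 1) \<beta> A g"
proof (unfold_locales, goal_cases)
  case (1 l q1 q2)
  then show ?case using split[of q1 "q2 + 1" l] by (force simp: algebra_simps)
next
  case (2 l u y)
  then show ?case using inv_mem[of l u y] by simp
next
  case (3 l u y)
  then show ?case using inv[of l u y] by simp
next
  case (4 l u x y)
  then show ?case using diff[of l u x y] by simp
next
  case (5 l u x a)
  then show ?case using scale[of l u x a] by simp
next
  case (6 l)
  then show ?case using bound[of l] by simp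
qed

text \<open>Subtracting the equations at \<open>u\<close> and \<open>v\<close> gives
  \<open>A u (x v - x u) = (y v - y u) - (A v - A u) (x v)\<close>. The inverse is bounded at level
  \<open>l\<close>, while \<open>x v\<close> is measured at the level from which
  \<open>A v - A u\<close> starts.\<close>

lemma holder:
  assumes A: "holder_fam U Y1 n1 0 c1 (\<lambda>hs. A)" and y: "holder_fam U Y n m c y"
    and x: "\<And>l hs u. 0 < c l \<Longrightarrow> length hs = m \<Longrightarrow> u \<in> U \<Longrightarrow> x hs u \<in> Y l"
    and eq: "\<And>hs u. length hs = m \<Longrightarrow> u \<in> U \<Longrightarrow> \<beta> (A u) (x hs u) = y hs u"
  shows "holder_fam U Y n m c x"
  unfolding holder_fam_def
proof (intro allI impI)
  fix l and \<alpha> :: real assume \<alpha>: "0 < \<alpha>" "\<alpha> \<le> 1" "\<alpha> < c l"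
  then have l: "0 < c l" by simp
  obtain l1 l2 where k: "\<alpha> < c1 l1" "0 < c l2" and "bilin (Y1 l1) (n1 l1) (Y l2) (n l2) (Y l) (n l) \<beta>"
    using split[of \<alpha> 0 l] \<alpha> by auto
  then interpret b: bilin "Y1 l1" "n1 l1" "Y l2" "n l2" "Y l" "n l" \<beta> by simp
  obtain M where M: "M \<ge> 0" "\<And>x y r s. x \<in> Y1 l1 \<Longrightarrow> y \<in> Y l2 \<Longrightarrow> n1 l1 x \<le> r \<Longrightarrow> n l2 y \<le> s \<Longrightarrow> n l (\<beta> x y) \<le> M * (r * s)"
    using b.bound by metis
  obtain B where B: "B \<ge> 0" "\<And>u x. u \<in> U \<Longrightarrow> x \<in> Y l \<Longrightarrow> n l x \<le> B * n l (\<beta> (A u) x)"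
    using bound[OF l] by auto
  obtain B2 where B2: "B2 \<ge> 0" "\<And>u x. u \<in> U \<Longrightarrow> x \<in> Y l2 \<Longrightarrow> n l2 x \<le> B2 * n l2 (\<beta> (A u) x)"
    using bound[OF k(2)] by auto
  obtain P where P: "P \<ge> 0" "\<And>u. u \<in> U \<Longrightarrow> A u \<in> Y1 l1"
    "\<And>u v. u \<in> U \<Longrightarrow> v \<in> U \<Longrightarrow> n1 l1 (A v - A u) \<le> P * norm (v - u) powr \<alpha>"
    using holder_famD[OF A \<alpha>(1,2) k(1)] by (metis list.size(3) wt_simps(1) mult.right_neutral)
  obtain Q where Q: "Q \<ge> 0"
    "\<And>hs u. length hs = m \<Longrightarrow> u \<in> U \<Longrightarrow> y hs u \<in> Y l"
    "\<And>hs u. length hs = m \<Longrightarrow> u \<in> U \<Longrightarrow> n l (y hs u) \<le> Q * wt hs"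
    "\<And>hs u v. length hs = m \<Longrightarrow> u \<in> U \<Longrightarrow> v \<in> U \<Longrightarrow> n l (y hs v - y hs u) \<le> Q * wt hs * norm (v - u) powr \<alpha>"
    using holder_famD[OF y \<alpha>] by metis
  obtain Q2 where Q2: "Q2 \<ge> 0"
    "\<And>hs u. length hs = m \<Longrightarrow> u \<in> U \<Longrightarrow> n l2 (y hs u) \<le> Q2 * wt hs"
    using holder_fam_bound[OF y k(2)] by metis
  have x2: "n l2 (x hs u) \<le> B2 * Q2 * wt hs" if "length hs = m" "u \<in> U" for hs u
    using B2(2)[OF that(2) x[OF k(2) that]] mult_left_mono[OF Q2(2)[OF that] B2(1)]
    unfolding eq[OF that] by (simp add: mult.assoc)
  define C where "C = B * (Q + M * (P * (B2 * Q2)))"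
  have C: "C \<ge> 0" "B * Q \<le> C" using M(1) B B2(1) P(1) Q(1) Q2(1)
    by (auto simp: C_def intro!: mult_left_mono)
  show "\<exists>B\<ge>0. \<forall>hs. length hs = m \<longrightarrow> (\<forall>u\<in>U. x hs u \<in> Y l \<and> n l (x hs u) \<le> B * wt hs \<and>
        (\<forall>v\<in>U. n l (x hs v - x hs u) \<le> B * wt hs * norm (v - u) powr \<alpha>))"
  proof (intro exI[of _ C] conjI allI impI ballI)
    fix hs :: "'b list" and u assume hs: "length hs = m" and u: "u \<in> U"
    show "x hs u \<in> Y l" using x[OF l hs u] .
    have "n l (x hs u) \<le> B * (Q * wt hs)"
      using B(2)[OF u x[OF l hs u]] mult_left_mono[OF Q(3)[OF hs u] B(1)] unfolding eq[OF hs u] by simp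
    also have "\<dots> \<le> C * wt hs" using mult_right_mono[OF C(2), of "wt hs"] by (simp add: mult.assoc)
    finally show "n l (x hs u) \<le> C * wt hs" .
    fix v assume v: "v \<in> U"
    let ?t = "norm (v - u) powr \<alpha>"
    have m: "x hs u \<in> Y l" "x hs v \<in> Y l" "x hs v \<in> Y l2" "A u \<in> Y1 l1" "A v \<in> Y1 l1" "y hs u \<in> Y l" "y hs v \<in> Y l"
      "A v - A u \<in> Y1 l1" "y hs v - y hs u \<in> Y l" "x hs v - x hs u \<in> Y l"
      using x[OF l hs] x[OF k(2) hs] P(2) Q(2)[OF hs] u v by (auto intro: b.T.diff_mem b.L.diff_mem)
    have "\<beta> (A u) (x hs v - x hs u) = (y hs v - y hs u) - \<beta> (A v - A u) (x hs v)"
      using m u v by (simp add: diff[OF l] eq[OF hs] b.diff_left)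
    then have "n l (x hs v - x hs u) \<le> B * n l ((y hs v - y hs u) - \<beta> (A v - A u) (x hs v))"
      using B(2)[OF u m(10)] by simp
    also have "\<dots> \<le> B * (n l (y hs v - y hs u) + n l (\<beta> (A v - A u) (x hs v)))"
      using m by (intro mult_left_mono B b.T.triangle_diff b.mem)
    also have "\<dots> \<le> B * (Q * wt hs * ?t + M * ((P * ?t) * (B2 * Q2 * wt hs)))"
      using m by (intro mult_left_mono B add_mono Q M P hs u v x2)
    also have "\<dots> = C * wt hs * ?t" by (simp add: C_def algebra_simps)
    finally show "n l (x hs v - x hs u) \<le> C * wt hs * ?t" .
  qed (rule C)
qed

text \<open>Differentiating the equation gives \<open>x'\<close> as the solution for the right-hand
  side \<open>y' - A' x\<close>. Applied to the remainder of \<open>x\<close>, the operator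
  \<open>A u\<close> yields the remainder of \<open>y\<close>, the remainder of \<open>A\<close>
  acting on \<open>x v\<close>, and \<open>A'\<close> acting on an increment of \<open>x\<close>,
  which is small because \<open>x\<close> is already known to be Holder.\<close>

lemma deriv:
  assumes A: "holder_fam U Y1 n1 0 c1 (\<lambda>hs. A)" and y: "holder_fam U Y n m c y"
    and A': "holder_fam U Y1 n1 (Suc 0) (\<lambda>l. c1 l - 1) A'" and y': "holder_fam U Y n (Suc m) (\<lambda>l. c l - 1) y'"
    and dA: "deriv_fam U Y1 n1 0 c1 (\<lambda>hs. A) A'" and dy: "deriv_fam U Y n m c y y'"
    and x: "\<And>l hs u. 0 < c l \<Longrightarrow> length hs = m \<Longrightarrow> u \<in> U \<Longrightarrow> x hs u \<in> Y l"
    and eq: "\<And>hs u. length hs = m \<Longrightarrow> u \<in> U \<Longrightarrow> \<beta> (A u) (x hs u) = y hs u"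
    and x': "\<And>l hs u. 0 < c l - 1 \<Longrightarrow> length hs = Suc m \<Longrightarrow> u \<in> U \<Longrightarrow> x' hs u \<in> Y l"
    and eq': "\<And>h hs u. length hs = m \<Longrightarrow> u \<in> U \<Longrightarrow> \<beta> (A u) (x' (h # hs) u) = y' (h # hs) u - \<beta> (A' [h] u) (x hs u)"
  shows "deriv_fam U Y n m c x x'"
  unfolding deriv_fam_def
proof (intro allI impI ballI)
  fix l u assume l1: "1 < c l" and u: "u \<in> U"
  then have l: "0 < c l" by simp
  obtain l1 l2 where k: "1 < c1 l1" "0 < c l2" and "bilin (Y1 l1) (n1 l1) (Y l2) (n l2) (Y l) (n l) \<beta>"
    using split[of 1 0 l] l1 by auto
  then interpret b: bilin "Y1 l1" "n1 l1" "Y l2" "n l2" "Y l" "n l" \<beta> by simp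
  obtain M where M: "M \<ge> 0" "\<And>x y r s. x \<in> Y1 l1 \<Longrightarrow> y \<in> Y l2 \<Longrightarrow> n1 l1 x \<le> r \<Longrightarrow> n l2 y \<le> s \<Longrightarrow> n l (\<beta> x y) \<le> M * (r * s)"
    using b.bound by metis
  obtain B where B: "B \<ge> 0" "\<And>u x. u \<in> U \<Longrightarrow> x \<in> Y l \<Longrightarrow> n l x \<le> B * n l (\<beta> (A u) x)"
    using bound[OF l] by auto
  have hx: "holder_fam U Y n m c x" using holder[OF A y x eq] .
  obtain X where X: "X \<ge> 0" "\<And>hs u. length hs = m \<Longrightarrow> u \<in> U \<Longrightarrow> x hs u \<in> Y l2"
    "\<And>hs u. length hs = m \<Longrightarrow> u \<in> U \<Longrightarrow> n l2 (x hs u) \<le> X * wt hs"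
    using holder_fam_bound[OF hx k(2)] by metis
  obtain P where P: "P \<ge> 0" "\<And>hs u. length hs = Suc 0 \<Longrightarrow> u \<in> U \<Longrightarrow> A' hs u \<in> Y1 l1"
    "\<And>hs u. length hs = Suc 0 \<Longrightarrow> u \<in> U \<Longrightarrow> n1 l1 (A' hs u) \<le> P * wt hs"
    using holder_fam_bound[OF A', of l1] k by auto
  have mA: "\<And>u. u \<in> U \<Longrightarrow> A u \<in> Y1 l1" using holder_fam_mem[OF A] k by simp
  have my: "\<And>hs u. length hs = m \<Longrightarrow> u \<in> U \<Longrightarrow> y hs u \<in> Y l" using holder_fam_mem[OF y] l by simp
  have my': "\<And>hs u. length hs = Suc m \<Longrightarrow> u \<in> U \<Longrightarrow> y' hs u \<in> Y l" using holder_fam_mem[OF y', of l] l1 by simp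
  have mx': "\<And>hs u. length hs = Suc m \<Longrightarrow> u \<in> U \<Longrightarrow> x' hs u \<in> Y l" using x' l1 by simp
  show "(\<forall>hs h g a b. length hs = m \<longrightarrow>
        n l (x' ((a *\<^sub>R h + b *\<^sub>R g) # hs) u - a *\<^sub>R x' (h # hs) u - b *\<^sub>R x' (g # hs) u) = 0) \<and>
     (\<forall>e>0. \<exists>d>0. \<forall>hs h. length hs = m \<longrightarrow> norm h < d \<longrightarrow> u + h \<in> U \<longrightarrow>
        n l (x hs (u + h) - x hs u - x' (h # hs) u) \<le> e * norm h * wt hs)"
  proof (intro allI impI ballI conjI)
    fix hs :: "'b list" and h g :: 'b and a b :: real assume hs: "length hs = m"
    let ?X = "x' ((a *\<^sub>R h + b *\<^sub>R g) # hs) u - a *\<^sub>R x' (h # hs) u - b *\<^sub>R x' (g # hs) u"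
    let ?P = "A' ((a *\<^sub>R h + b *\<^sub>R g) # []) u - a *\<^sub>R A' (h # []) u - b *\<^sub>R A' (g # []) u"
    let ?Q = "y' ((a *\<^sub>R h + b *\<^sub>R g) # hs) u - a *\<^sub>R y' (h # hs) u - b *\<^sub>R y' (g # hs) u"
    have P0: "?P \<in> Y1 l1" "n1 l1 ?P \<le> 0" and Q0: "?Q \<in> Y l" "n l ?Q \<le> 0"
      using P(2) my' hs u deriv_fam_lin[OF dA k(1) u, of "[]" a h b g] deriv_fam_lin[OF dy l1 u hs, of a h b g]
      by (auto intro!: b.L.diff_mem b.L.scale_mem b.T.diff_mem b.T.scale_mem)
    have X0: "?X \<in> Y l" using mx' hs u by (auto intro!: b.T.diff_mem b.T.scale_mem)
    have e1: "\<beta> (A u) ?X = \<beta> (A u) (x' ((a *\<^sub>R h + b *\<^sub>R g) # hs) u) - a *\<^sub>R \<beta> (A u) (x' (h # hs) u)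
       - b *\<^sub>R \<beta> (A u) (x' (g # hs) u)"
      using mx' hs u by (simp add: diff[OF l] scale[OF l] b.T.diff_mem b.T.scale_mem)
    have e2: "\<beta> ?P (x hs u) = \<beta> (A' ((a *\<^sub>R h + b *\<^sub>R g) # []) u) (x hs u) - a *\<^sub>R \<beta> (A' (h # []) u) (x hs u)
       - b *\<^sub>R \<beta> (A' (g # []) u) (x hs u)"
      using P(2) X(2) hs u by (simp add: b.diff_left b.scale_left b.L.diff_mem b.L.scale_mem)
    have "\<beta> (A u) ?X = ?Q - \<beta> ?P (x hs u)"
      unfolding e1 e2 eq'[OF hs u] by (simp add: algebra_simps)
    then have "n l ?X \<le> B * n l (?Q - \<beta> ?P (x hs u))" using B(2)[OF u X0] by simp
    also have "\<dots> \<le> B * (n l ?Q + n l (\<beta> ?P (x hs u)))"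
      using P0 Q0 X hs u by (intro mult_left_mono B b.T.triangle_diff b.mem) auto
    also have "\<dots> \<le> B * (0 + M * (0 * (X * wt hs)))"
      using P0 Q0 X hs u by (intro mult_left_mono B add_mono M) auto
    finally show "n l ?X = 0" using b.T.nonneg[OF X0] by simp
  next
    fix e :: real assume e: "0 < e"
    define C where "C = 1 + B * (1 + M * X + M * P)"
    have C: "C > 0" using M(1) B(1) X(1) P(1) by (auto simp: C_def intro!: add_pos_nonneg)
    define e' where "e' = e / C"
    have e': "e' > 0" using e C by (simp add: e'_def)
    obtain d1 where d1: "d1 > 0" "\<And>hs h. length hs = 0 \<Longrightarrow> norm h < d1 \<Longrightarrow> u + h \<in> U \<Longrightarrow>
      n1 l1 (A (u + h) - A u - A' (h # hs) u) \<le> e' * norm h * wt hs"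
      using deriv_famD[OF dA k(1) u e'] by metis
    obtain d2 where d2: "d2 > 0" "\<And>hs h. length hs = m \<Longrightarrow> norm h < d2 \<Longrightarrow> u + h \<in> U \<Longrightarrow>
      n l (y hs (u + h) - y hs u - y' (h # hs) u) \<le> e' * norm h * wt hs"
      using deriv_famD[OF dy l1 u e'] by metis
    obtain d3 where d3: "d3 > 0" "\<And>hs u v. length hs = m \<Longrightarrow> u \<in> U \<Longrightarrow> v \<in> U \<Longrightarrow> norm (v - u) < d3 \<Longrightarrow>
      n l2 (x hs v - x hs u) \<le> e' * wt hs"
      using holder_fam_cont[OF hx k(2) e'] by metis
    show "\<exists>d>0. \<forall>hs h. length hs = m \<longrightarrow> norm h < d \<longrightarrow> u + h \<in> U \<longrightarrow>
        n l (x hs (u + h) - x hs u - x' (h # hs) u) \<le> e * norm h * wt hs"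
    proof (intro exI[of _ "min d1 (min d2 d3)"] conjI allI impI)
      fix hs :: "'b list" and h assume hs: "length hs = m" and h: "norm h < min d1 (min d2 d3)" "u + h \<in> U"
      let ?v = "u + h"
      let ?A = "A' [h] u" and ?X = "x' (h # hs) u" and ?Y = "y' (h # hs) u"
      have m: "x hs u \<in> Y l" "x hs ?v \<in> Y l" "?X \<in> Y l" "?Y \<in> Y l" "x hs ?v \<in> Y l2" "x hs u \<in> Y l2"
        "A u \<in> Y1 l1" "A ?v \<in> Y1 l1" "?A \<in> Y1 l1" "y hs u \<in> Y l" "y hs ?v \<in> Y l"
        using x[OF l hs] mx' my my' X mA P h u hs by auto
      have m': "x hs ?v - x hs u \<in> Y l" "x hs ?v - x hs u - ?X \<in> Y l" "x hs ?v - x hs u \<in> Y l2"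
        "A ?v - A u \<in> Y1 l1" "A ?v - A u - ?A \<in> Y1 l1" "y hs ?v - y hs u - ?Y \<in> Y l"
        using m by (auto intro!: b.L.diff_mem b.R.diff_mem b.T.diff_mem)
      have f1: "n1 l1 (A ?v - A u - ?A) \<le> e' * norm h * wt ([]::'b list)" using d1(2)[of "[]" h] h by simp
      have "\<beta> (A u) (x hs ?v - x hs u - ?X) = (y hs ?v - y hs u - ?Y) - \<beta> (A ?v - A u - ?A) (x hs ?v)
          - \<beta> ?A (x hs ?v - x hs u)"
        using m m' u h by (simp add: diff[OF l] b.diff_left b.diff_right eq[OF hs] eq'[OF hs])
      then have "n l (x hs ?v - x hs u - ?X) \<le> B * n l ((y hs ?v - y hs u - ?Y) - \<beta> (A ?v - A u - ?A) (x hs ?v)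
          - \<beta> ?A (x hs ?v - x hs u))"
        using B(2)[OF u m'(2)] by simp
      also have "\<dots> \<le> B * (n l (y hs ?v - y hs u - ?Y) + n l (\<beta> (A ?v - A u - ?A) (x hs ?v))
          + n l (\<beta> ?A (x hs ?v - x hs u)))"
        using m m' by (intro mult_left_mono B order_trans[OF b.T.triangle_diff] add_mono order_refl b.T.diff_mem b.mem b.T.triangle_diff)
      also have "\<dots> \<le> B * (e' * norm h * wt hs + M * ((e' * norm h * wt ([]::'b list)) * (X * wt hs)) + M * ((P * wt [h]) * (e' * wt hs)))"
        using m m' h hs u by (intro mult_left_mono B add_mono M f1 d2 d3 P X) auto
      also have "\<dots> = e' * (B * (1 + M * X + M * P)) * norm h * wt hs"
        by (simp add: algebra_simps)
      also have "\<dots> \<le> e' * C * norm h * wt hs"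
        using e' by (intro mult_right_mono mult_left_mono) (auto simp: C_def)
      also have "e' * C = e" using C by (simp add: e'_def)
      finally show "n l (x hs ?v - x hs u - ?X) \<le> e * norm h * wt hs" .
    qed (use d1 d2 d3 in auto)
  qed
qed

end

text \<open>The right-hand side of the equation for \<open>x'\<close> contains \<open>x\<close>
  itself but none of its derivatives. The induction hypothesis is therefore used twice: for
  \<open>x\<close> at order \<open>k\<close>, and then for \<open>x'\<close> with all capacities
  lowered by 1.\<close>

lemma smooth_fam_solve:
  fixes U :: "'b::real_normed_vector set"
  assumes "inverse_scale U Y1 n1 c1 Y n c \<beta> A g"
    and A: "smooth_fam U Y1 n1 k 0 c1 (\<lambda>hs. A)" and "smooth_fam U Y n k m c y"
    and "\<And>l hs u. 0 < c l \<Longrightarrow> length hs = m \<Longrightarrow> u \<in> U \<Longrightarrow> x hs u \<in> Y l"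
    and "\<And>hs u. length hs = m \<Longrightarrow> u \<in> U \<Longrightarrow> \<beta> (A u) (x hs u) = y hs u"
  shows "smooth_fam U Y n k m c x"
  using assms
proof (induction k arbitrary: m c x y)
  case 0
  then show ?case using inverse_scale.holder[OF 0(1), of m y x] by simp
next
  case (Suc k)
  interpret inverse_scale U Y1 n1 c1 Y n c \<beta> A g by fact
  note x = Suc.prems(4) and eq = Suc.prems(5)
  have hA: "holder_fam U Y1 n1 0 c1 (\<lambda>hs. A)" and hy: "holder_fam U Y n m c y"
    using Suc.prems(2,3) by auto
  have A: "smooth_fam U Y1 n1 k 0 c1 (\<lambda>hs. A)" and y: "smooth_fam U Y n k m c y"
    by (rule smooth_fam_mono, rule Suc.prems)+
  have xs: "smooth_fam U Y n k m c x" by (rule Suc.IH[OF Suc.prems(1) A y x eq])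
  obtain A' where A': "deriv_fam U Y1 n1 0 c1 (\<lambda>hs. A) A'" "smooth_fam U Y1 n1 k (Suc 0) (\<lambda>l. c1 l - 1) A'"
    using Suc.prems(2) by auto
  obtain y' where y': "deriv_fam U Y n m c y y'" "smooth_fam U Y n k (Suc m) (\<lambda>l. c l - 1) y'"
    using Suc.prems(3) by auto
  define r where "r = (\<lambda>hs u. y' hs u - \<beta> (A' [hd hs] u) (x (tl hs) u))"
  define x' where "x' = (\<lambda>hs u. g u (r hs u))"
  have "smooth_fam U Y n k (Suc m) (\<lambda>l. c l - 1) (\<lambda>hs u. \<beta> (A' [hd hs] u) (x (tl hs) u))"
  proof (rule smooth_fam_bilin[OF _ _ A'(2) xs])
    show "\<exists>l1 l2. q1 < c1 l1 - 1 \<and> q2 < c l2 \<and> bilin (Y1 l1) (n1 l1) (Y l2) (n l2) (Y l) (n l) \<beta>"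
      if "0 \<le> q1" "0 \<le> q2" "q1 + q2 < c l - 1" for l q1 q2
      using split[of "q1 + 1" q2 l] that by (force simp: algebra_simps)
    show "length [hd hs] = Suc 0 \<and> length (tl hs) = m \<and> wt [hd hs] * wt (tl hs) \<le> wt hs"
      if "length hs = Suc m" for hs :: "'b list"
      using that by (cases hs) auto
  qed
  then have r: "smooth_fam U Y n k (Suc m) (\<lambda>l. c l - 1) r"
    unfolding r_def using seminormed y'(2) by (intro smooth_fam_diff) auto
  have mr: "r hs u \<in> Y l" if "0 < c l - 1" "length hs = Suc m" "u \<in> U" for l hs u
    using holder_fam_mem[OF smooth_fam_holder[OF r]] that by blast
  have mx': "x' hs u \<in> Y l" if "0 < c l - 1" "length hs = Suc m" "u \<in> U" for l hs u
    unfolding x'_def using inv_mem[OF _ that(3) mr[OF that]] that by simp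
  show ?case
  proof (cases "\<exists>l. 0 < c l - 1")
    case True
    then obtain l where l: "0 < c l - 1" by auto
    have eq': "\<beta> (A u) (x' hs u) = r hs u" if "length hs = Suc m" "u \<in> U" for hs u
      unfolding x'_def using inv[OF _ that(2) mr[OF l that]] l by simp
    have "smooth_fam U Y n k (Suc m) (\<lambda>l. c l - 1) x'"
      by (rule Suc.IH[OF reduced A r mx' eq'])
    moreover have "deriv_fam U Y n m c x x'"
      by (rule deriv[OF hA hy smooth_fam_holder[OF A'(2)] smooth_fam_holder[OF y'(2)] A'(1) y'(1) x eq mx'])
        (auto simp: eq' r_def)
    ultimately show ?thesis using smooth_fam_holder[OF xs] by auto
  next
    case False
    have c: "c l \<le> 1" for l using False by (meson diff_gt_0_iff_gt not_less)
    have "holder_fam U Y n j (\<lambda>l. c l - d) z" if "d \<ge> 1" for j z d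
      unfolding holder_fam_def
    proof (intro allI impI)
      fix l and \<alpha> :: real assume "0 < \<alpha>" "\<alpha> < c l - d"
      then have False using c[of l] that by simp
      then show "\<exists>B\<ge>0. \<forall>hs. length hs = j \<longrightarrow> (\<forall>u\<in>U. z hs u \<in> Y l \<and> n l (z hs u) \<le> B * wt hs \<and>
          (\<forall>v\<in>U. n l (z hs v - z hs u) \<le> B * wt hs * norm (v - u) powr \<alpha>))" ..
    qed
    moreover have d: "deriv_fam U Y n j (\<lambda>l. c l - d) z z'" if "d \<ge> 0" for j z z' d
      unfolding deriv_fam_def using c that by (smt (verit))
    ultimately have "smooth_fam U Y n i j (\<lambda>l. c l - d) z" if "d \<ge> 1" for i j z d
      using that
    proof (induction i arbitrary: j d z)
      case (Suc i)
      have "(\<lambda>l. c l - d - 1) = (\<lambda>l. c l - (d + 1))" by (auto simp: algebra_simps)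
      then show ?case using Suc by auto
    qed simp
    moreover have "deriv_fam U Y n m c x y'"
      using d[of 0 m x y'] by simp
    ultimately show ?thesis using smooth_fam_holder[OF xs] by force
  qed
qed

section \<open>Comparison with C^t maps\<close>

lemma normed_subspace_seminormed: "normed_subspace Y n \<Longrightarrow> seminormed_space Y n"
  by unfold_locales (auto simp: normed_subspace_def subspace_def)

lemma normed_subspace_eq_0: "normed_subspace Y n \<Longrightarrow> x \<in> Y \<Longrightarrow> n x = 0 \<longleftrightarrow> x = 0"
  by (auto simp: normed_subspace_def)

definition multilin :: "nat \<Rightarrow> ('b::real_vector list \<Rightarrow> 'y::real_vector) \<Rightarrow> bool" where
  "multilin k T \<longleftrightarrow> (\<forall>pre post x y c a. length pre + length post + 1 = k \<longrightarrow>
     T (pre @ (c *\<^sub>R x + a *\<^sub>R y) # post) = c *\<^sub>R T (pre @ x # post) + a *\<^sub>R T (pre @ y # post))"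

lemma multilinD:
  "multilin k T \<Longrightarrow> length pre + length post + 1 = k \<Longrightarrow>
     T (pre @ (c *\<^sub>R x + a *\<^sub>R y) # post) = c *\<^sub>R T (pre @ x # post) + a *\<^sub>R T (pre @ y # post)"
  unfolding multilin_def by blast

lemma multilin_scale1:
  "multilin k T \<Longrightarrow> length pre + length post + 1 = k \<Longrightarrow> T (pre @ (c *\<^sub>R x) # post) = c *\<^sub>R T (pre @ x # post)"
  using multilinD[of k T pre post c x 0 0] by simp

lemma multilin_scale:
  "multilin k T \<Longrightarrow> length pre + length hs = k \<Longrightarrow>
     T (pre @ map (\<lambda>h. c h *\<^sub>R h) hs) = prod_list (map c hs) *\<^sub>R T (pre @ hs)"
proof (induction hs arbitrary: pre)
  case (Cons h hs)
  have "T (pre @ map (\<lambda>h. c h *\<^sub>R h) (h # hs)) = c h *\<^sub>R T ((pre @ [h]) @ map (\<lambda>h. c h *\<^sub>R h) hs)"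
    using multilin_scale1[OF Cons.prems(1), of pre "map (\<lambda>h. c h *\<^sub>R h) hs" "c h" h] Cons.prems by simp
  also have "T ((pre @ [h]) @ map (\<lambda>h. c h *\<^sub>R h) hs) = prod_list (map c hs) *\<^sub>R T ((pre @ [h]) @ hs)"
    using Cons.prems by (intro Cons.IH) auto
  finally show ?case by simp
qed simp

lemma wt_le_1: "\<forall>h\<in>set hs. norm h \<le> 1 \<Longrightarrow> wt hs \<le> 1"
  by (induction hs) (auto intro!: mult_le_one)

lemma wt_eq_0: "wt hs = 0 \<longleftrightarrow> 0 \<in> set hs"
  by (induction hs) auto

lemma mnorm_le:
  assumes "0 \<le> B" "\<And>hs. length hs = k \<Longrightarrow> n (T hs) \<le> B * wt hs"
  shows "mnorm k n T \<le> B"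
  unfolding mnorm_def
proof (rule cSup_least)
  show "{n (T hs) |hs. length hs = k \<and> (\<forall>h\<in>set hs. norm h \<le> 1)} \<noteq> {}"
    by (auto intro!: exI[of _ "replicate k 0"])
  fix y assume "y \<in> {n (T hs) |hs. length hs = k \<and> (\<forall>h\<in>set hs. norm h \<le> 1)}"
  then obtain hs where hs: "y = n (T hs)" "length hs = k" "\<forall>h\<in>set hs. norm h \<le> 1" by auto
  have "n (T hs) \<le> B * wt hs" using assms hs by auto
  also have "\<dots> \<le> B" using mult_left_mono[OF wt_le_1[OF hs(3)] assms(1)] by simp
  finally show "y \<le> B" using hs by simp
qed

lemma mnorm_bdd:
  assumes "\<And>hs. length hs = k \<Longrightarrow> n (T hs) \<le> B * wt hs"
  shows "bdd_above {n (T hs) |hs. length hs = k \<and> (\<forall>h\<in>set hs. norm h \<le> 1)}"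
proof (rule bdd_aboveI[of _ "\<bar>B\<bar>"])
  fix y assume "y \<in> {n (T hs) |hs. length hs = k \<and> (\<forall>h\<in>set hs. norm h \<le> 1)}"
  then obtain hs where hs: "y = n (T hs)" "length hs = k" "\<forall>h\<in>set hs. norm h \<le> 1" by auto
  have "n (T hs) \<le> B * wt hs" using assms hs by auto
  also have "\<dots> \<le> \<bar>B\<bar> * 1" using wt_le_1[OF hs(3)] by (intro mult_mono) auto
  finally show "y \<le> \<bar>B\<bar>" using hs by simp
qed

lemma mnorm_nonneg:
  assumes "\<And>hs. length hs = k \<Longrightarrow> 0 \<le> n (T hs)" "\<And>hs. length hs = k \<Longrightarrow> n (T hs) \<le> B * wt hs"
  shows "0 \<le> mnorm k n T"
proof -
  have "n (T (replicate k 0)) \<le> mnorm k n T"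
    unfolding mnorm_def by (rule cSup_upper) (auto intro!: exI[of _ "replicate k 0"] mnorm_bdd[where B = B] assms(2))
  then show ?thesis using assms(1)[of "replicate k 0"] by simp
qed

text \<open>Scaling every direction to norm 1 reduces the bound to the supremum, and a zero
  direction annihilates \<open>T\<close>. The constant \<open>B\<close> makes the supremum
  finite.\<close>

lemma mnorm_bound:
  assumes sn: "seminormed_space Y n" and T: "multilin k T" "\<And>hs. length hs = k \<Longrightarrow> T hs \<in> Y"
    "\<And>hs. length hs = k \<Longrightarrow> n (T hs) \<le> B * wt hs" and hs: "length hs = k"
  shows "n (T hs) \<le> mnorm k n T * wt hs"
proof (cases "0 \<in> set hs")
  case True
  then obtain pre post where p: "hs = pre @ 0 # post" by (auto simp: in_set_conv_decomp)
  have "T hs = 0" using multilin_scale1[OF T(1), of pre post 0 0] p hs by simp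
  then show ?thesis using True wt_eq_0[of hs] seminormed_space.norm_zero[OF sn] by simp
next
  case False
  let ?c = "\<lambda>h. 1 / norm h"
  have prod: "prod_list (map ?c hs) = 1 / wt hs" by (induction hs) auto
  have eq: "T (map (\<lambda>h. ?c h *\<^sub>R h) hs) = (1 / wt hs) *\<^sub>R T hs"
    using multilin_scale[OF T(1), of "[]" hs ?c] hs prod by simp
  have w: "wt hs > 0" using False wt_eq_0[of hs] wt_nonneg[of hs] by linarith
  have "n (T (map (\<lambda>h. ?c h *\<^sub>R h) hs)) \<le> mnorm k n T"
    unfolding mnorm_def
  proof (rule cSup_upper)
    show "bdd_above {n (T hs) |hs. length hs = k \<and> (\<forall>h\<in>set hs. norm h \<le> 1)}" by (rule mnorm_bdd[where B = B]) (rule T(3))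
  qed (use hs in \<open>auto intro!: exI[of _ "map (\<lambda>h. ?c h *\<^sub>R h) hs"]\<close>)
  then show ?thesis
    unfolding eq using seminormed_space.scale[OF sn T(2)[OF hs], of "1 / wt hs"] w by (simp add: field_simps)
qed

text \<open>The data behind \<open>C_holder\<close> for fixed \<open>k\<close> and \<alpha>, with
  the suprema unfolded into bounds by \<open>wt hs\<close> and the order of a derivative read off
  from the length of the list.\<close>

definition jet ::
  "'b::real_normed_vector set \<Rightarrow> 'y::real_vector set \<Rightarrow> ('y \<Rightarrow> real) \<Rightarrow> nat \<Rightarrow> real \<Rightarrow> ('b list \<Rightarrow> 'b \<Rightarrow> 'y) \<Rightarrow> bool" where
  "jet U Y n k \<alpha> D \<longleftrightarrow>
     (\<exists>B\<ge>0. \<forall>hs. length hs \<le> k \<longrightarrow> (\<forall>u\<in>U. D hs u \<in> Y \<and> n (D hs u) \<le> B * wt hs)) \<and>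
     (\<exists>B\<ge>0. \<forall>hs. length hs = k \<longrightarrow> (\<forall>u\<in>U. \<forall>v\<in>U. n (D hs v - D hs u) \<le> B * wt hs * norm (v - u) powr \<alpha>)) \<and>
     (\<forall>u\<in>U. \<forall>i<k. \<forall>e>0. \<exists>d>0. \<forall>hs h. length hs = i \<longrightarrow> norm h < d \<longrightarrow> u + h \<in> U \<longrightarrow>
        n (D hs (u + h) - D hs u - D (h # hs) u) \<le> e * norm h * wt hs) \<and>
     (\<forall>u\<in>U. \<forall>hs h g a b. length hs < k \<longrightarrow> D ((a *\<^sub>R h + b *\<^sub>R g) # hs) u = a *\<^sub>R D (h # hs) u + b *\<^sub>R D (g # hs) u)"

lemma C_holder_imp_jet:
  fixes U :: "'b::banach set"
  assumes ns: "normed_subspace Y n" and U: "open U" and \<alpha>: "0 < \<alpha>" "\<alpha> \<le> 1"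
    and C: "C_holder U Y n (real k + \<alpha>) g"
  obtains D where "jet U Y n k \<alpha> D" "\<And>u. u \<in> U \<Longrightarrow> D [] u = g u"
proof -
  interpret seminormed_space Y n by (rule normed_subspace_seminormed[OF ns])
  have "real k + \<alpha> \<noteq> 0" using \<alpha> by linarith
  then obtain k' \<alpha>' D where k': "real k + \<alpha> = real k' + \<alpha>'" "0 < \<alpha>'" "\<alpha>' \<le> 1"
    and D0: "\<forall>u\<in>U. D 0 u [] = g u" and ml: "\<forall>i\<le>k'. \<forall>u\<in>U. multilinear_bdd i Y n (D i u)"
    and df: "\<forall>i<k'. \<forall>u\<in>U. ((\<lambda>h. mnorm i n (\<lambda>hs. D i (u + h) hs - D i u hs - D (Suc i) u (h # hs)) / norm h) \<longlongrightarrow> 0) (at 0)"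
    and bd: "\<forall>i\<le>k'. \<exists>C. \<forall>u\<in>U. mnorm i n (D i u) \<le> C"
    and ho: "\<exists>C. \<forall>u\<in>U. \<forall>v\<in>U. mnorm k' n (\<lambda>hs. D k' u hs - D k' v hs) \<le> C * norm (u - v) powr \<alpha>'"
    using C unfolding C_holder_def by (auto split: if_splits)
  \<comment> \<open>Both \<alpha> and \<open>\<alpha>'\<close> lie in \<open>(0,1]\<close>, so they
    differ by less than 1; hence the decomposition of the order is unique.\<close>
  have "\<bar>real k - real k'\<bar> < 1" using k' \<alpha> by linarith
  then have "k' = k" by linarith
  with k' have "\<alpha>' = \<alpha>" by simp
  note k = \<open>k' = k\<close> \<open>\<alpha>' = \<alpha>\<close>
  have mlb: "multilinear_bdd i Y n (D i u)" if "i \<le> k" "u \<in> U" for i u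
    using ml that unfolding k by blast
  have mlin: "multilin i (D i u)" if "i \<le> k" "u \<in> U" for i u
    using mlb[OF that] unfolding multilinear_bdd_def multilin_def by (elim conjE)
  have mem: "D i u hs \<in> Y" if "i \<le> k" "u \<in> U" "length hs = i" for i u hs
    using mlb[OF that(1,2)] that(3) unfolding multilinear_bdd_def by (elim conjE) simp
  have bnd: "\<exists>B. \<forall>hs. length hs = i \<longrightarrow> n (D i u hs) \<le> B * wt hs" if "i \<le> k" "u \<in> U" for i u
    using mlb[OF that] unfolding multilinear_bdd_def wt_def by (elim conjE)
  have bnd2: "\<exists>B. \<forall>hs. length hs = i \<longrightarrow> n (D i v hs - D i u hs) \<le> B * wt hs" if iuv: "i \<le> k" "u \<in> U" "v \<in> U" for i u v
  proof -
    obtain B1 where B1: "\<forall>hs. length hs = i \<longrightarrow> n (D i u hs) \<le> B1 * wt hs" using bnd[OF iuv(1,2)] by blast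
    obtain B2 where B2: "\<forall>hs. length hs = i \<longrightarrow> n (D i v hs) \<le> B2 * wt hs" using bnd[OF iuv(1,3)] by blast
    have "n (D i v hs - D i u hs) \<le> (B2 + B1) * wt hs" if l: "length hs = i" for hs
    proof -
      have "n (D i v hs - D i u hs) \<le> n (D i v hs) + n (D i u hs)"
        by (rule triangle_diff[OF mem[OF iuv(1,3) l] mem[OF iuv(1,2) l]])
      also have "\<dots> \<le> B2 * wt hs + B1 * wt hs" using B1 B2 l by (intro add_mono) simp_all
      finally show ?thesis by (simp add: distrib_right)
    qed
    then show ?thesis by blast
  qed
  have mlin2: "multilin i (\<lambda>hs. D i v hs - D i u hs)" if "i \<le> k" "u \<in> U" "v \<in> U" for i u v
    using mlin[OF that(1,2)] mlin[OF that(1,3)] unfolding multilin_def by (simp add: algebra_simps)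
  let ?D = "\<lambda>hs u. D (length hs) u hs"
  have "\<exists>B\<ge>0. \<forall>hs. length hs \<le> k \<longrightarrow> (\<forall>u\<in>U. D (length hs) u hs \<in> Y \<and> n (D (length hs) u hs) \<le> B * wt hs)"
  proof -
    from bd[unfolded k] obtain c where c: "\<forall>i\<le>k. \<forall>u\<in>U. mnorm i n (D i u) \<le> c i" by metis
    define B where "B = (\<Sum>i\<le>k. \<bar>c i\<bar>)"
    have "n (D (length hs) u hs) \<le> B * wt hs" if hu: "length hs \<le> k" "u \<in> U" for hs u
    proof -
      let ?i = "length hs"
      obtain B' where "\<forall>hs. length hs = ?i \<longrightarrow> n (D ?i u hs) \<le> B' * wt hs" using bnd[OF hu] by blast
      then have "n (D ?i u hs) \<le> mnorm ?i n (D ?i u) * wt hs"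
        using mnorm_bound[OF seminormed_space_axioms mlin[OF hu] mem[OF hu]] by blast
      also have "mnorm ?i n (D ?i u) \<le> \<bar>c ?i\<bar>" using c hu by fastforce
      also have "\<bar>c ?i\<bar> \<le> B" unfolding B_def using hu by (intro member_le_sum) auto
      finally show ?thesis by (simp add: mult_right_mono)
    qed
    moreover have "B \<ge> 0" unfolding B_def by (intro sum_nonneg) auto
    ultimately show ?thesis using mem by blast
  qed
  moreover have "\<exists>B\<ge>0. \<forall>hs. length hs = k \<longrightarrow> (\<forall>u\<in>U. \<forall>v\<in>U. n (?D hs v - ?D hs u) \<le> B * wt hs * norm (v - u) powr \<alpha>)"
  proof -
    obtain B where B: "\<forall>u\<in>U. \<forall>v\<in>U. mnorm k n (\<lambda>hs. D k u hs - D k v hs) \<le> B * norm (u - v) powr \<alpha>"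
      using ho[unfolded k] by blast
    have "n (?D hs v - ?D hs u) \<le> \<bar>B\<bar> * wt hs * norm (v - u) powr \<alpha>" if huv: "length hs = k" "u \<in> U" "v \<in> U" for hs u v
    proof -
      obtain B' where B': "\<forall>hs. length hs = k \<longrightarrow> n (D k v hs - D k u hs) \<le> B' * wt hs"
        using bnd2[OF order_refl huv(2,3)] by blast
      have "n (D k v hs - D k u hs) \<le> mnorm k n (\<lambda>hs. D k v hs - D k u hs) * wt hs"
        by (rule mnorm_bound[OF seminormed_space_axioms mlin2[OF order_refl that(2,3)], of B'])
           (use B' that mem[OF order_refl] in \<open>auto intro!: diff_mem\<close>)
      also have "\<dots> \<le> (\<bar>B\<bar> * norm (v - u) powr \<alpha>) * wt hs"
        using B that by (intro mult_right_mono) (auto intro: order_trans[OF _ mult_right_mono[OF abs_ge_self]])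
      finally show ?thesis using that by (simp add: mult_ac)
    qed
    then show ?thesis by (intro exI[of _ "\<bar>B\<bar>"]) auto
  qed
  moreover have "\<forall>u\<in>U. \<forall>i<k. \<forall>e>0. \<exists>d>0. \<forall>hs h. length hs = i \<longrightarrow> norm h < d \<longrightarrow> u + h \<in> U \<longrightarrow>
        n (?D hs (u + h) - ?D hs u - ?D (h # hs) u) \<le> e * norm h * wt hs"
  proof (intro ballI allI impI)
    fix u i and e :: real assume u: "u \<in> U" and i: "i < k" and e: "0 < e"
    have "\<forall>\<^sub>F h in at 0. dist (mnorm i n (\<lambda>hs. D i (u + h) hs - D i u hs - D (Suc i) u (h # hs)) / norm h) 0 < e"
      using df u i e unfolding k by (intro tendstoD) auto
    then obtain d where d: "d > 0" "\<And>h. h \<noteq> 0 \<Longrightarrow> norm h < d \<Longrightarrow>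
       \<bar>mnorm i n (\<lambda>hs. D i (u + h) hs - D i u hs - D (Suc i) u (h # hs)) / norm h\<bar> < e"
      by (auto simp: eventually_at)
    show "\<exists>d>0. \<forall>hs h. length hs = i \<longrightarrow> norm h < d \<longrightarrow> u + h \<in> U \<longrightarrow>
        n (?D hs (u + h) - ?D hs u - ?D (h # hs) u) \<le> e * norm h * wt hs"
    proof (intro exI[of _ d] conjI allI impI d(1))
      fix hs :: "'b list" and h assume a: "length hs = i" "norm h < d" "u + h \<in> U"
      let ?T = "\<lambda>hs. D i (u + h) hs - D i u hs - D (Suc i) u (h # hs)"
      obtain B1 where B1: "\<forall>hs. length hs = i \<longrightarrow> n (D i (u + h) hs - D i u hs) \<le> B1 * wt hs"
        using bnd2[of i u "u + h"] i u a by auto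
      obtain B2 where B2: "\<forall>hs. length hs = Suc i \<longrightarrow> n (D (Suc i) u hs) \<le> B2 * wt hs"
        using bnd[of "Suc i" u] i u by auto
      have m1: "D i (u + h) hs - D i u hs \<in> Y" "D (Suc i) u (h # hs) \<in> Y" if "length hs = i" for hs
        using i u a mem that by (auto intro!: diff_mem)
      have m2: "multilin i ?T"
        using mlin2[of i u "u + h"] mlin[of "Suc i" u] i u a
        unfolding multilin_def
        by (auto simp: algebra_simps simp flip: append_Cons)
      have "n (?T hs) \<le> mnorm i n ?T * wt hs"
      proof (rule mnorm_bound[OF seminormed_space_axioms m2, of "B1 + B2 * norm h"])
        fix hs' :: "'b list" assume l: "length hs' = i"
        show "?T hs' \<in> Y" using m1[OF l] by (rule diff_mem)
        have "n (?T hs') \<le> n (D i (u + h) hs' - D i u hs') + n (D (Suc i) u (h # hs'))"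
          using m1[OF l] by (rule triangle_diff)
        also have "\<dots> \<le> B1 * wt hs' + B2 * wt (h # hs')" using B1[rule_format, of hs'] B2[rule_format, of "h # hs'"] l by (intro add_mono) simp_all
        finally show "n (?T hs') \<le> (B1 + B2 * norm h) * wt hs'" by (simp add: algebra_simps)
      qed (use a in auto)
      also have "mnorm i n ?T \<le> e * norm h"
      \<comment> \<open>The limit says nothing at \<open>h = 0\<close>; there the remainder vanishes
        because the next derivative is linear in its first direction.\<close>
      proof (cases "h = 0")
        case True
        have z: "D (Suc i) u (0 # hs) = 0" if "length hs = i" for hs
          using multilin_scale1[OF mlin[of "Suc i" u], of "[]" hs 0 0] i u that by simp
        have "mnorm i n ?T \<le> 0" by (rule mnorm_le) (use True z norm_zero in auto)
        then show ?thesis using True by simp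
      next
        case False
        then show ?thesis using d(2)[OF False a(2)] by (simp add: field_simps abs_if split: if_splits)
      qed
      finally show "n (?D hs (u + h) - ?D hs u - ?D (h # hs) u) \<le> e * norm h * wt hs"
        using a by (simp add: mult_right_mono)
    qed
  qed
  moreover have "\<forall>u\<in>U. \<forall>hs h g a b. length hs < k \<longrightarrow>
     ?D ((a *\<^sub>R h + b *\<^sub>R g) # hs) u = a *\<^sub>R ?D (h # hs) u + b *\<^sub>R ?D (g # hs) u"
  proof (intro ballI allI impI)
    fix u and hs :: "'b list" and h g a b assume "u \<in> U" "length hs < k"
    then show "?D ((a *\<^sub>R h + b *\<^sub>R g) # hs) u = a *\<^sub>R ?D (h # hs) u + b *\<^sub>R ?D (g # hs) u"
      using multilinD[OF mlin[of "Suc (length hs)" u], of "[]" hs a h b g] by auto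
  qed
  ultimately have "jet U Y n k \<alpha> ?D" unfolding jet_def by blast
  moreover have "\<And>u. u \<in> U \<Longrightarrow> ?D [] u = g u" using D0 by simp
  ultimately show ?thesis using that by blast
qed

text \<open>Difference quotients inherit linearity in the earlier directions. The defect \<Delta> of
  the derivative, multiplied by a small \<open>t\<close>, is a combination of three remainders and
  hence at most \<open>t * (e * W)\<close> with \<open>W\<close> independent of \<open>t\<close>; as
  \<open>e\<close> is arbitrary, the defect is zero.\<close>

lemma deriv_fam_multilin:
  fixes U :: "'b::real_normed_vector set"
  assumes ns: "normed_subspace (Y l) (n l)" and l: "1 < c l" and U: "open U" and u: "u \<in> U"
    and d: "deriv_fam U Y n m c x x'" and x': "\<And>hs. length hs = Suc m \<Longrightarrow> x' hs u \<in> Y l"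
    and x: "\<And>hs u. length hs = m \<Longrightarrow> u \<in> U \<Longrightarrow> x hs u \<in> Y l"
    and ml: "\<And>u. u \<in> U \<Longrightarrow> multilin m (\<lambda>hs. x hs u)"
  shows "multilin (Suc m) (\<lambda>hs. x' hs u)"
proof -
  interpret seminormed_space "Y l" "n l" by (rule normed_subspace_seminormed[OF ns])
  have lin: "x' ((a *\<^sub>R h + b *\<^sub>R g) # hs) u = a *\<^sub>R x' (h # hs) u + b *\<^sub>R x' (g # hs) u"
    if "length hs = m" for a b h g hs
  proof -
    have "x' ((a *\<^sub>R h + b *\<^sub>R g) # hs) u - a *\<^sub>R x' (h # hs) u - b *\<^sub>R x' (g # hs) u \<in> Y l"
      using x' that by (intro diff_mem scale_mem) auto
    then have "x' ((a *\<^sub>R h + b *\<^sub>R g) # hs) u - a *\<^sub>R x' (h # hs) u - b *\<^sub>R x' (g # hs) u = 0"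
      using deriv_fam_lin[OF d l u that, of a h b g] normed_subspace_eq_0[OF ns] by blast
    then show ?thesis by (simp add: algebra_simps)
  qed
  have later: "x' (h # pre @ (a *\<^sub>R p + b *\<^sub>R q) # post) u =
     a *\<^sub>R x' (h # pre @ p # post) u + b *\<^sub>R x' (h # pre @ q # post) u"
    if len: "Suc (length pre + length post) = m" for h pre p q post a b
  proof -
    define ps where "ps = pre @ p # post"
    define qs where "qs = pre @ q # post"
    define rs where "rs = pre @ (a *\<^sub>R p + b *\<^sub>R q) # post"
    have len': "length ps = m" "length qs = m" "length rs = m" using len by (auto simp: ps_def qs_def rs_def)
    have xr: "x rs v = a *\<^sub>R x ps v + b *\<^sub>R x qs v" if "v \<in> U" for v
      using multilinD[OF ml[OF that], of pre post a p b q] len by (simp add: ps_def qs_def rs_def)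
    define \<Delta> where "\<Delta> = x' (h # rs) u - a *\<^sub>R x' (h # ps) u - b *\<^sub>R x' (h # qs) u"
    have \<Delta>: "\<Delta> \<in> Y l" unfolding \<Delta>_def using x' len' by (intro diff_mem scale_mem) auto
    obtain r where r: "r > 0" "ball u r \<subseteq> U" using U u open_contains_ball by blast
    define W where "W = norm h * (wt rs + \<bar>a\<bar> * wt ps + \<bar>b\<bar> * wt qs)"
    have "n l \<Delta> \<le> e * W" if e: "e > 0" for e
    proof -
      obtain d' where d': "d' > 0" "\<And>hs h. length hs = m \<Longrightarrow> norm h < d' \<Longrightarrow> u + h \<in> U \<Longrightarrow>
          n l (x hs (u + h) - x hs u - x' (h # hs) u) \<le> e * norm h * wt hs"
        using deriv_famD[OF d l u e] by metis
      \<comment> \<open>Makes \<open>t *\<^sub>R h\<close> shorter than \<open>d'\<close> and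
        \<open>r\<close>; the added 1 covers \<open>h = 0\<close>.\<close>
      define t where "t = min d' r / (2 * (norm h + 1))"
      have t: "t > 0" "t * norm h < min d' r"
      proof -
        show t: "t > 0" unfolding t_def using d' r by (auto intro!: divide_pos_pos add_nonneg_pos)
        have "t * (norm h + 1) = min d' r / 2"
          unfolding t_def using norm_ge_zero[of h] by (simp add: field_simps add_nonneg_eq_0_iff)
        moreover have "t * norm h \<le> t * (norm h + 1)" using t by simp
        ultimately have "t * norm h \<le> min d' r / 2" by linarith
        then show "t * norm h < min d' r" using d' r by (auto simp: min_def split: if_splits)
      qed
      have uh: "u + t *\<^sub>R h \<in> U" "norm (t *\<^sub>R h) < d'" using r t by (auto simp: dist_norm)
      have th: "x' ((t *\<^sub>R h) # hs) u = t *\<^sub>R x' (h # hs) u" if "length hs = m" for hs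
        using lin[OF that, of t h 0 0] by simp
      let ?r = "\<lambda>hs. x hs (u + t *\<^sub>R h) - x hs u - x' ((t *\<^sub>R h) # hs) u"
      have mr: "?r hs \<in> Y l" if "length hs = m" for hs
        using that x[OF that uh(1)] x[OF that u] x' by (intro diff_mem) auto
      \<comment> \<open>The increments of \<open>x\<close> cancel by \<open>xr\<close>, so that only
        remainders survive.\<close>
      have eq: "t *\<^sub>R \<Delta> = a *\<^sub>R ?r ps + b *\<^sub>R ?r qs - ?r rs"
        unfolding \<Delta>_def using len' by (simp add: th xr[OF u] xr[OF uh(1)] algebra_simps)
      have nr: "n l (?r hs) \<le> e * (t * norm h) * wt hs" if "length hs = m" for hs
        using d'(2)[OF that uh(2,1)] t by simp
      have "t * n l \<Delta> = n l (a *\<^sub>R ?r ps + b *\<^sub>R ?r qs - ?r rs)"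
        using scale[OF \<Delta>, of t] t eq by simp
      also have "\<dots> \<le> n l (a *\<^sub>R ?r ps + b *\<^sub>R ?r qs) + n l (?r rs)"
        using mr len' by (intro triangle_diff add_mem scale_mem) auto
      also have "\<dots> \<le> (n l (a *\<^sub>R ?r ps) + n l (b *\<^sub>R ?r qs)) + n l (?r rs)"
        using mr len' by (intro add_mono triangle scale_mem) auto
      also have "\<dots> \<le> (\<bar>a\<bar> * (e * (t * norm h) * wt ps) + \<bar>b\<bar> * (e * (t * norm h) * wt qs)) + e * (t * norm h) * wt rs"
        using mr len' unfolding scale[OF mr[OF len'(1)]] scale[OF mr[OF len'(2)]]
        by (intro add_mono mult_left_mono nr) auto
      also have "\<dots> = t * (e * W)" by (simp add: W_def algebra_simps)
      finally show ?thesis using t by simp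
    qed
    then have "n l \<Delta> \<le> 0"
    proof (cases "W > 0")
      case True
      show ?thesis
      proof (rule field_le_epsilon)
        fix e :: real assume "e > 0"
        then show "n l \<Delta> \<le> 0 + e" using \<open>\<And>e. e > 0 \<Longrightarrow> n l \<Delta> \<le> e * W\<close>[of "e / W"] True by simp
      qed
    next
      case False
      moreover have "n l \<Delta> \<le> 1 * W" using \<open>\<And>e. e > 0 \<Longrightarrow> n l \<Delta> \<le> e * W\<close>[of 1] by simp
      ultimately show ?thesis by simp
    qed
    then have "\<Delta> = 0" using normed_subspace_eq_0[OF ns \<Delta>] nonneg[OF \<Delta>] by simp
    then show ?thesis by (simp add: \<Delta>_def ps_def qs_def rs_def algebra_simps)
  qed
  show ?thesis
    unfolding multilin_def
  proof (intro allI impI)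
    fix pre post :: "'b list" and x y :: 'b and c a assume len: "length pre + length post + 1 = Suc m"
    show "x' (pre @ (c *\<^sub>R x + a *\<^sub>R y) # post) u = c *\<^sub>R x' (pre @ x # post) u + a *\<^sub>R x' (pre @ y # post) u"
      using lin[of post c x a y] later[of "tl pre" post "hd pre" c x a y] len by (cases pre) auto
  qed
qed

text \<open>The offset \<open>m\<close> is there for the induction: a derivative of a family with
  \<open>m\<close> directions has \<open>m + 1\<close>, and the derivatives obtained for it are
  shifted by one place to make room for the family itself.\<close>

lemma smooth_fam_C_holder_aux:
  fixes U :: "'b::banach set"
  assumes ns: "normed_subspace (Y l) (n l)" and U: "open U"
    and x: "smooth_fam U Y n k m c x" and l: "real k + \<alpha> < c l" and \<alpha>: "0 < \<alpha>" "\<alpha> \<le> 1"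
    and ml: "\<And>u. u \<in> U \<Longrightarrow> multilin m (\<lambda>hs. x hs u)"
  shows "\<exists>D :: nat \<Rightarrow> 'b \<Rightarrow> 'b list \<Rightarrow> _.
           (\<forall>u\<in>U. \<forall>hs. D 0 u hs = x hs u) \<and>
           (\<forall>i\<le>k. \<forall>u\<in>U. multilinear_bdd (m + i) (Y l) (n l) (D i u)) \<and>
           (\<forall>i<k. \<forall>u\<in>U.
              ((\<lambda>h. mnorm (m + i) (n l) (\<lambda>hs. D i (u + h) hs - D i u hs - D (Suc i) u (h # hs)) / norm h)
                 \<longlongrightarrow> 0) (at 0)) \<and>
           (\<forall>i\<le>k. \<exists>C. \<forall>u\<in>U. mnorm (m + i) (n l) (D i u) \<le> C) \<and>
           (\<exists>C. \<forall>u\<in>U. \<forall>v\<in>U. mnorm (m + k) (n l) (\<lambda>hs. D k u hs - D k v hs) \<le> C * norm (u - v) powr \<alpha>)"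
  using x l ml
proof (induction k arbitrary: m c x)
  case (0 m c x)
  have l: "0 < c l" using 0 \<alpha> by simp
  obtain B where B: "B \<ge> 0"
    "\<And>hs u. length hs = m \<Longrightarrow> u \<in> U \<Longrightarrow> x hs u \<in> Y l"
    "\<And>hs u. length hs = m \<Longrightarrow> u \<in> U \<Longrightarrow> n l (x hs u) \<le> B * wt hs"
    "\<And>hs u v. length hs = m \<Longrightarrow> u \<in> U \<Longrightarrow> v \<in> U \<Longrightarrow> n l (x hs v - x hs u) \<le> B * wt hs * norm (v - u) powr \<alpha>"
    using holder_famD[of U Y n m c x \<alpha> l] 0 \<alpha> by auto
  have "mnorm m (n l) (\<lambda>hs. x hs u) \<le> B" if "u \<in> U" for u using B that by (intro mnorm_le) auto
  moreover have "mnorm m (n l) (\<lambda>hs. x hs u - x hs v) \<le> B * norm (u - v) powr \<alpha>" if "u \<in> U" "v \<in> U" for u v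
    using B that by (intro mnorm_le) (auto simp: mult_ac)
  moreover have "multilinear_bdd m (Y l) (n l) (\<lambda>hs. x hs u)" if "u \<in> U" for u
    using B 0(3)[OF that] that unfolding multilinear_bdd_def multilin_def wt_def by (intro conjI exI[of _ B]) auto
  ultimately show ?case by (intro exI[of _ "\<lambda>i u hs. x hs u"]) auto
next
  case (Suc k m c x)
  interpret seminormed_space "Y l" "n l" by (rule normed_subspace_seminormed[OF ns])
  have l: "1 < c l" "0 < c l" using Suc.prems(2) \<alpha> by auto
  obtain x' where x': "deriv_fam U Y n m c x x'" "smooth_fam U Y n k (Suc m) (\<lambda>l. c l - 1) x'"
    using Suc.prems by auto
  have hx: "holder_fam U Y n m c x" and hx': "holder_fam U Y n (Suc m) (\<lambda>l. c l - 1) x'"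
    using Suc.prems smooth_fam_holder x' by auto
  obtain B where B: "B \<ge> 0"
    "\<And>hs u. length hs = m \<Longrightarrow> u \<in> U \<Longrightarrow> x hs u \<in> Y l"
    "\<And>hs u. length hs = m \<Longrightarrow> u \<in> U \<Longrightarrow> n l (x hs u) \<le> B * wt hs"
    using holder_fam_bound[OF hx l(2)] by metis
  obtain B' where B': "B' \<ge> 0"
    "\<And>hs u. length hs = Suc m \<Longrightarrow> u \<in> U \<Longrightarrow> x' hs u \<in> Y l"
    "\<And>hs u. length hs = Suc m \<Longrightarrow> u \<in> U \<Longrightarrow> n l (x' hs u) \<le> B' * wt hs"
    using holder_fam_bound[OF hx', of l] l by auto
  have "multilin (Suc m) (\<lambda>hs. x' hs u)" if "u \<in> U" for u
    by (rule deriv_fam_multilin[where x = x and c = c and l = l and Y = Y and n = n and U = U])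
       (use ns U l that x' B B' Suc.prems(3) in auto)
  from Suc.IH[OF x'(2) _ this] Suc.prems(2)
  obtain D :: "nat \<Rightarrow> 'b \<Rightarrow> 'b list \<Rightarrow> _" where
    D0: "\<forall>u\<in>U. \<forall>hs. D 0 u hs = x' hs u" and
    Dm: "\<forall>i\<le>k. \<forall>u\<in>U. multilinear_bdd (Suc m + i) (Y l) (n l) (D i u)" and
    Dd: "\<forall>i<k. \<forall>u\<in>U. ((\<lambda>h. mnorm (Suc m + i) (n l) (\<lambda>hs. D i (u + h) hs - D i u hs - D (Suc i) u (h # hs)) / norm h) \<longlongrightarrow> 0) (at 0)" and
    Db: "\<forall>i\<le>k. \<exists>C. \<forall>u\<in>U. mnorm (Suc m + i) (n l) (D i u) \<le> C" and
    Dh: "\<exists>C. \<forall>u\<in>U. \<forall>v\<in>U. mnorm (Suc m + k) (n l) (\<lambda>hs. D k u hs - D k v hs) \<le> C * norm (u - v) powr \<alpha>"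
    by auto
  define D' where "D' = (\<lambda>i. case i of 0 \<Rightarrow> (\<lambda>u hs. x hs u) | Suc j \<Rightarrow> D j)"
  have m0: "multilinear_bdd m (Y l) (n l) (\<lambda>hs. x hs u)" if "u \<in> U" for u
    using B Suc.prems(3)[OF that] that unfolding multilinear_bdd_def multilin_def wt_def by (intro conjI exI[of _ B]) auto
  have d0: "((\<lambda>h. mnorm m (n l) (\<lambda>hs. x hs (u + h) - x hs u - D 0 u (h # hs)) / norm h) \<longlongrightarrow> 0) (at 0)" if u: "u \<in> U" for u
  proof (rule tendstoI)
    fix e :: real assume e: "e > 0"
    then have e2: "e / 2 > 0" by simp
    obtain d where d: "d > 0" "\<And>hs h. length hs = m \<Longrightarrow> norm h < d \<Longrightarrow> u + h \<in> U \<Longrightarrow>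
       n l (x hs (u + h) - x hs u - x' (h # hs) u) \<le> e / 2 * norm h * wt hs"
      using deriv_famD[OF x'(1) l(1) u e2] by metis
    obtain r where r: "r > 0" "ball u r \<subseteq> U" using U u open_contains_ball by blast
    show "\<forall>\<^sub>F h in at 0. dist (mnorm m (n l) (\<lambda>hs. x hs (u + h) - x hs u - D 0 u (h # hs)) / norm h) 0 < e"
      unfolding eventually_at
    proof (intro exI[of _ "min d r"] conjI ballI impI)
      fix h :: 'b assume h: "h \<noteq> 0 \<and> dist h 0 < min d r"
      then have uh: "u + h \<in> U" using r by (auto simp: dist_norm)
      let ?T = "\<lambda>hs. x hs (u + h) - x hs u - D 0 u (h # hs)"
      have T: "n l (?T hs) \<le> (e / 2 * norm h) * wt hs" if "length hs = m" for hs
        using d(2)[OF that _ uh] h D0 u by simp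
      have "mnorm m (n l) ?T \<le> e / 2 * norm h"
        using T e by (intro mnorm_le) auto
      moreover have "0 \<le> mnorm m (n l) ?T"
        using B(2) B'(2) D0 u uh T by (intro mnorm_nonneg[where B = "e / 2 * norm h"] nonneg diff_mem) auto
      moreover have "e / 2 * norm h < e * norm h" using h e by simp
      ultimately have "\<bar>mnorm m (n l) ?T\<bar> < e * norm h" by linarith
      then show "dist (mnorm m (n l) ?T / norm h) 0 < e"
        using h by (simp add: field_simps)
    qed (use d r in auto)
  qed
  have b0: "\<exists>C. \<forall>u\<in>U. mnorm m (n l) (\<lambda>hs. x hs u) \<le> C"
    using B by (intro exI[of _ B] ballI mnorm_le) auto
  show ?case
  proof (intro exI[of _ D'] conjI)
    show "\<forall>u\<in>U. \<forall>hs. D' 0 u hs = x hs u" by (simp add: D'_def)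
    show "\<forall>i\<le>Suc k. \<forall>u\<in>U. multilinear_bdd (m + i) (Y l) (n l) (D' i u)"
      using m0 Dm by (auto simp: D'_def split: nat.splits)
    show "\<forall>i<Suc k. \<forall>u\<in>U. ((\<lambda>h. mnorm (m + i) (n l) (\<lambda>hs. D' i (u + h) hs - D' i u hs - D' (Suc i) u (h # hs)) / norm h) \<longlongrightarrow> 0) (at 0)"
      using d0 Dd by (auto simp: D'_def split: nat.splits)
    show "\<forall>i\<le>Suc k. \<exists>C. \<forall>u\<in>U. mnorm (m + i) (n l) (D' i u) \<le> C"
      using b0 Db by (auto simp: D'_def split: nat.splits)
    show "\<exists>C. \<forall>u\<in>U. \<forall>v\<in>U. mnorm (m + Suc k) (n l) (\<lambda>hs. D' (Suc k) u hs - D' (Suc k) v hs) \<le> C * norm (u - v) powr \<alpha>"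
      using Dh by (simp add: D'_def)
  qed
qed

lemma smooth_fam_C_holder:
  fixes U :: "'b::banach set" and g :: "'b \<Rightarrow> 'y::real_vector"
  assumes ns: "normed_subspace (Y l) (n l)" and U: "open U"
    and g: "\<And>k. smooth_fam U Y n k 0 c (\<lambda>hs. g)" and t: "0 < t" "t < c l"
  shows "C_holder U (Y l) (n l) t g"
proof -
  \<comment> \<open>The ceiling puts the fractional part into \<open>(0,1]\<close>; an integer
    \<open>t\<close> is read as Lipschitz derivatives of order \<open>t - 1\<close>.\<close>
  define k where "k = nat (\<lceil>t\<rceil> - 1)"
  define \<alpha> where "\<alpha> = t - real k"
  have "real k = real_of_int (\<lceil>t\<rceil> - 1)" using t unfolding k_def by simp
  then have \<alpha>: "0 < \<alpha>" "\<alpha> \<le> 1" unfolding \<alpha>_def by linarith+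
  have tk: "t = real k + \<alpha>" by (simp add: \<alpha>_def)
  have "multilin 0 (\<lambda>hs. g u)" for u unfolding multilin_def by simp
  from smooth_fam_C_holder_aux[OF ns U g[of k] _ \<alpha> this] t
  obtain D :: "nat \<Rightarrow> 'b \<Rightarrow> 'b list \<Rightarrow> 'y" where D: "\<forall>u\<in>U. \<forall>hs. D 0 u hs = g u"
     "\<forall>i\<le>k. \<forall>u\<in>U. multilinear_bdd i (Y l) (n l) (D i u)"
     "\<forall>i<k. \<forall>u\<in>U. ((\<lambda>h. mnorm i (n l) (\<lambda>hs. D i (u + h) hs - D i u hs - D (Suc i) u (h # hs)) / norm h) \<longlongrightarrow> 0) (at 0)"
     "\<forall>i\<le>k. \<exists>C. \<forall>u\<in>U. mnorm i (n l) (D i u) \<le> C"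
     "\<exists>C. \<forall>u\<in>U. \<forall>v\<in>U. mnorm k (n l) (\<lambda>hs. D k u hs - D k v hs) \<le> C * norm (u - v) powr \<alpha>"
    using tk by auto
  have "\<forall>u\<in>U. D 0 u [] = g u" using D(1) by simp
  then show ?thesis
    unfolding C_holder_def using t tk \<alpha> D(2-5) by (simp, blast)
qed

section \<open>Operators on scales of spaces\<close>

text \<open>In contrast to \<open>Lspace\<close> nothing is required off the carrier, so that one
  total function can represent an operator on many levels at once. The price is that
  \<open>opnorm\<close> is only a seminorm here.\<close>

definition op_space ::
  "'v::real_vector set \<Rightarrow> ('v \<Rightarrow> real) \<Rightarrow> 'y::real_vector set \<Rightarrow> ('y \<Rightarrow> real) \<Rightarrow> ('v \<Rightarrow> 'y) set" where
  "op_space X nX Y nY = {T. bounded_linear_on X nX Y nY T}"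

lemma op_space_mem: "T \<in> op_space X nX Y nY \<Longrightarrow> x \<in> X \<Longrightarrow> T x \<in> Y"
  by (auto simp: op_space_def bounded_linear_on_def)

lemma op_space_lin:
  "T \<in> op_space X nX Y nY \<Longrightarrow> x \<in> X \<Longrightarrow> y \<in> X \<Longrightarrow> T (c *\<^sub>R x + a *\<^sub>R y) = c *\<^sub>R T x + a *\<^sub>R T y"
  by (auto simp: op_space_def bounded_linear_on_def linear_on_def)

lemma op_space_add: "T \<in> op_space X nX Y nY \<Longrightarrow> x \<in> X \<Longrightarrow> y \<in> X \<Longrightarrow> T (x + y) = T x + T y"
  using op_space_lin[of T X nX Y nY x y 1 1] by simp

lemma op_space_scale: "T \<in> op_space X nX Y nY \<Longrightarrow> x \<in> X \<Longrightarrow> T (c *\<^sub>R x) = c *\<^sub>R T x"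
  using op_space_lin[of T X nX Y nY x x c 0] by simp

lemma op_space_diff: "T \<in> op_space X nX Y nY \<Longrightarrow> x \<in> X \<Longrightarrow> y \<in> X \<Longrightarrow> T (x - y) = T x - T y"
  using op_space_lin[of T X nX Y nY x y 1 "-1"] by simp

lemma op_spaceI:
  assumes "\<And>x. x \<in> X \<Longrightarrow> T x \<in> Y" "\<And>x y. x \<in> X \<Longrightarrow> y \<in> X \<Longrightarrow> T (x + y) = T x + T y"
    "\<And>c x. x \<in> X \<Longrightarrow> T (c *\<^sub>R x) = c *\<^sub>R T x" "\<And>x. x \<in> X \<Longrightarrow> nY (T x) \<le> B * nX x" "subspace X"
  shows "T \<in> op_space X nX Y nY"
  using assms unfolding op_space_def bounded_linear_on_def linear_on_def
  by (intro CollectI conjI exI[of _ B]) (auto simp: subspace_scale)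

lemma op_space_bound:
  assumes "T \<in> op_space X nX Y nY" "seminormed_space X nX"
  obtains B where "B \<ge> 0" "\<And>x. x \<in> X \<Longrightarrow> nY (T x) \<le> B * nX x"
proof -
  obtain C where C: "\<forall>x\<in>X. nY (T x) \<le> C * nX x"
    using assms(1) by (auto simp: op_space_def bounded_linear_on_def)
  have "nY (T x) \<le> \<bar>C\<bar> * nX x" if "x \<in> X" for x
    using C that seminormed_space.nonneg[OF assms(2) that]
    by (meson abs_ge_self mult_right_mono order_trans)
  then show ?thesis using that[of "\<bar>C\<bar>"] by simp
qed

lemma opnorm_le:
  assumes "0 \<in> X" "nX 0 = 0" "0 \<le> B" "\<And>x. x \<in> X \<Longrightarrow> nY (T x) \<le> B * nX x"
  shows "opnorm X nX nY T \<le> B"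
  unfolding opnorm_def
proof (rule cSup_least)
  show "{nY (T x) |x. x \<in> X \<and> nX x \<le> 1} \<noteq> {}" using assms(1,2) by (auto intro!: exI[of _ 0])
  fix y assume "y \<in> {nY (T x) |x. x \<in> X \<and> nX x \<le> 1}"
  then obtain x where x: "y = nY (T x)" "x \<in> X" "nX x \<le> 1" by auto
  then show "y \<le> B" using assms(4)[OF x(2)] mult_left_mono[OF x(3) assms(3)] by simp
qed

lemma opnorm_upper:
  assumes T: "T \<in> op_space X nX Y nY" and X: "seminormed_space X nX" and x: "x \<in> X" "nX x \<le> 1"
  shows "nY (T x) \<le> opnorm X nX nY T"
proof -
  obtain B where B: "B \<ge> 0" "\<And>x. x \<in> X \<Longrightarrow> nY (T x) \<le> B * nX x" using op_space_bound[OF T X] by metis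
  have "bdd_above {nY (T x) |x. x \<in> X \<and> nX x \<le> 1}"
  proof (rule bdd_aboveI[of _ B])
    fix y assume "y \<in> {nY (T x) |x. x \<in> X \<and> nX x \<le> 1}"
    then obtain x where x: "y = nY (T x)" "x \<in> X" "nX x \<le> 1" by auto
    then show "y \<le> B" using B(2)[OF x(2)] mult_left_mono[OF x(3) B(1)] by simp
  qed
  then show ?thesis unfolding opnorm_def using x by (intro cSup_upper) auto
qed

lemma opnorm_bound:
  assumes T: "T \<in> op_space X nX Y nY" and X: "seminormed_space X nX" and Y: "seminormed_space Y nY" and x: "x \<in> X"
  shows "nY (T x) \<le> opnorm X nX nY T * nX x"
proof -
  interpret X: seminormed_space X nX by fact
  interpret Y: seminormed_space Y nY by fact
  obtain B where B: "B \<ge> 0" "\<And>x. x \<in> X \<Longrightarrow> nY (T x) \<le> B * nX x" using op_space_bound[OF T X] by metis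
  show ?thesis
  proof (cases "nX x = 0")
    case True
    then show ?thesis using B(2)[OF x] by simp
  next
    case False
    then have pos: "nX x > 0" using X.nonneg[OF x] by simp
    let ?x = "(1 / nX x) *\<^sub>R x"
    have "nY (T ?x) \<le> opnorm X nX nY T"
      using x pos by (intro opnorm_upper[OF T X]) (auto simp: X.scale_mem X.scale)
    then show ?thesis
      using pos x op_space_mem[OF T x] by (simp add: op_space_scale[OF T x] Y.scale field_simps)
  qed
qed

lemma op_space_cong: "(\<And>x. x \<in> X \<Longrightarrow> T x = T' x) \<Longrightarrow> subspace X \<Longrightarrow> T \<in> op_space X nX Y nY \<longleftrightarrow> T' \<in> op_space X nX Y nY"
  unfolding op_space_def bounded_linear_on_def linear_on_def by (simp add: subspace_add subspace_scale)

lemma opnorm_cong: "(\<And>x. x \<in> X \<Longrightarrow> T x = T' x) \<Longrightarrow> opnorm X nX nY T = opnorm X nX nY T'"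
  unfolding opnorm_def by (rule arg_cong[where f = Sup], rule Collect_cong) (metis (no_types, lifting))

lemma op_space_seminormed:
  assumes X: "seminormed_space X nX" and Y: "seminormed_space Y nY"
  shows "seminormed_space (op_space X nX Y nY) (opnorm X nX nY)"
proof -
  interpret X: seminormed_space X nX by fact
  interpret Y: seminormed_space Y nY by fact
  have add: "S + T \<in> op_space X nX Y nY" if S: "S \<in> op_space X nX Y nY" and T: "T \<in> op_space X nX Y nY" for S T
  proof -
    obtain B where B: "B \<ge> 0" "\<And>x. x \<in> X \<Longrightarrow> nY (S x) \<le> B * nX x" using op_space_bound[OF S X] by metis
    obtain C where C: "C \<ge> 0" "\<And>x. x \<in> X \<Longrightarrow> nY (T x) \<le> C * nX x" using op_space_bound[OF T X] by metis
    show ?thesis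
    proof (rule op_spaceI[where B = "B + C"])
      fix x assume x: "x \<in> X"
      show "nY ((S + T) x) \<le> (B + C) * nX x"
        using Y.triangle[OF op_space_mem[OF S x] op_space_mem[OF T x]] B(2)[OF x] C(2)[OF x]
        by (simp add: plus_fun_def algebra_simps)
    qed (use op_space_mem[OF S] op_space_mem[OF T] op_space_add[OF S] op_space_add[OF T]
         op_space_scale[OF S] op_space_scale[OF T] in \<open>auto simp: plus_fun_def scaleR_right_distrib Y.add_mem X.subspace\<close>)
  qed
  have scale: "c *\<^sub>R T \<in> op_space X nX Y nY" if T: "T \<in> op_space X nX Y nY" for T c
  proof -
    obtain C where C: "C \<ge> 0" "\<And>x. x \<in> X \<Longrightarrow> nY (T x) \<le> C * nX x" using op_space_bound[OF T X] by metis
    show ?thesis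
    proof (rule op_spaceI[where B = "\<bar>c\<bar> * C"])
      fix x assume x: "x \<in> X"
      show "nY ((c *\<^sub>R T) x) \<le> \<bar>c\<bar> * C * nX x"
        using C(2)[OF x] op_space_mem[OF T x] by (simp add: scaleR_fun_def Y.scale mult.assoc mult_left_mono)
    qed (use op_space_mem[OF T] op_space_add[OF T] op_space_scale[OF T] in
        \<open>auto simp: scaleR_fun_def scaleR_right_distrib Y.scale_mem X.subspace\<close>)
  qed
  have zero: "0 \<in> op_space X nX Y nY"
    by (rule op_spaceI[where B = 0]) (auto simp: zero_fun_def Y.zero_mem Y.norm_zero X.subspace)
  have nonneg: "0 \<le> opnorm X nX nY T" if T: "T \<in> op_space X nX Y nY" for T
    using opnorm_upper[OF T X X.zero_mem] X.norm_zero Y.nonneg[OF op_space_mem[OF T X.zero_mem]] by simp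
  have le: "opnorm X nX nY (c *\<^sub>R T) \<le> \<bar>c\<bar> * opnorm X nX nY T" if T: "T \<in> op_space X nX Y nY" for T c
    using opnorm_bound[OF T X Y] op_space_mem[OF T] nonneg[OF T]
    by (intro opnorm_le X.zero_mem X.norm_zero) (auto simp: scaleR_fun_def Y.scale mult.assoc mult_left_mono)
  show ?thesis
  proof unfold_locales
    show "subspace (op_space X nX Y nY)" using add scale zero by (auto simp: subspace_def)
    show "opnorm X nX nY (S + T) \<le> opnorm X nX nY S + opnorm X nX nY T"
      if S: "S \<in> op_space X nX Y nY" and T: "T \<in> op_space X nX Y nY" for S T
    proof (intro opnorm_le X.zero_mem X.norm_zero)
      fix x assume x: "x \<in> X"
      show "nY ((S + T) x) \<le> (opnorm X nX nY S + opnorm X nX nY T) * nX x"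
        using Y.triangle[OF op_space_mem[OF S x] op_space_mem[OF T x]] opnorm_bound[OF S X Y x] opnorm_bound[OF T X Y x]
        by (simp add: plus_fun_def algebra_simps)
    qed (use nonneg[OF S] nonneg[OF T] in simp)
    show "opnorm X nX nY (a *\<^sub>R T) = \<bar>a\<bar> * opnorm X nX nY T" if T: "T \<in> op_space X nX Y nY" for T a
    proof (rule antisym[OF le[OF T]])
      show "\<bar>a\<bar> * opnorm X nX nY T \<le> opnorm X nX nY (a *\<^sub>R T)"
      proof (cases "a = 0")
        case True
        then show ?thesis using nonneg[OF scale[OF T, of 0]] by simp
      next
        case False
        then show ?thesis using le[OF scale[OF T], of "1 / a" a] by (simp add: field_simps abs_mult)
      qed
    qed
  qed (rule nonneg)
qed

lemma op_space_apply_bilin: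
  assumes X: "seminormed_space X nX" and Y: "seminormed_space Y nY"
  shows "bilin (op_space X nX Y nY) (opnorm X nX nY) X nX Y nY (\<lambda>T x. T x)"
proof -
  interpret X: seminormed_space X nX by fact
  interpret Y: seminormed_space Y nY by fact
  interpret O: seminormed_space "op_space X nX Y nY" "opnorm X nX nY" by (rule op_space_seminormed[OF X Y])
  show ?thesis
  proof unfold_locales
    show "\<exists>B\<ge>0. \<forall>T\<in>op_space X nX Y nY. \<forall>x\<in>X. nY (T x) \<le> B * (opnorm X nX nY T * nX x)"
      using opnorm_bound[OF _ X Y] by (intro exI[of _ 1]) auto
  qed (auto simp: op_space_mem op_space_add op_space_scale plus_fun_def scaleR_fun_def)
qed

section \<open>Nested levels, larger index meaning stronger norm, and their capacities\<close>

locale scale =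
  fixes U :: "'b::real_normed_vector set" and X :: "real \<Rightarrow> 'x::real_vector set" and N :: "real \<Rightarrow> 'x \<Rightarrow> real"
    and \<sigma> R :: real
  assumes open_U: "open U"
    and normed: "\<And>r. \<sigma> \<le> r \<Longrightarrow> r \<le> R \<Longrightarrow> normed_subspace (X r) (N r)"
    and incl: "\<And>s r. \<sigma> \<le> s \<Longrightarrow> s \<le> r \<Longrightarrow> r \<le> R \<Longrightarrow> X r \<subseteq> X s \<and> (\<exists>B\<ge>0. \<forall>x\<in>X r. N s x \<le> B * N r x)"
begin

definition OY :: "real \<times> real \<Rightarrow> ('x \<Rightarrow> 'x) set" where
  "OY l = op_space (X (snd l)) (N (snd l)) (X (fst l)) (N (fst l))"
definition ON :: "real \<times> real \<Rightarrow> ('x \<Rightarrow> 'x) \<Rightarrow> real" where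
  "ON l = opnorm (X (snd l)) (N (snd l)) (N (fst l))"
text \<open>A pair \<open>l\<close> consists of target level and source level; derivatives of an
  operator family are available up to the gap between them. Meaningless pairs get capacity 0 and so
  carry no condition. Likewise \<open>cV r\<close> is the distance from \<open>r\<close> to the top
  level.\<close>

definition cO :: "real \<times> real \<Rightarrow> real" where
  "cO l = (if \<sigma> \<le> fst l \<and> fst l < snd l \<and> snd l \<le> R then snd l - fst l else 0)"
definition cV :: "real \<Rightarrow> real" where
  "cV r = (if \<sigma> \<le> r \<and> r \<le> R then R - r else 0)"

lemma seminormed: "\<sigma> \<le> r \<Longrightarrow> r \<le> R \<Longrightarrow> seminormed_space (X r) (N r)"
  by (rule normed_subspace_seminormed[OF normed])

lemma cO_pos: "0 \<le> q \<Longrightarrow> q < cO l \<Longrightarrow> \<sigma> \<le> fst l \<and> fst l < snd l \<and> snd l \<le> R \<and> q < snd l - fst l"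
  by (auto simp: cO_def split: if_splits)

lemma cV_pos: "0 \<le> q \<Longrightarrow> q < cV r \<Longrightarrow> \<sigma> \<le> r \<and> r < R \<and> q < R - r"
  by (auto simp: cV_def split: if_splits)

lemma op_seminormed: "0 < cO l \<Longrightarrow> seminormed_space (OY l) (ON l)"
  unfolding OY_def ON_def using cO_pos[of 0 l] by (auto intro!: op_space_seminormed seminormed)

lemma apply_bilin: "0 < cO l \<Longrightarrow> bilin (OY l) (ON l) (X (snd l)) (N (snd l)) (X (fst l)) (N (fst l)) (\<lambda>T x. T x)"
  unfolding OY_def ON_def using cO_pos[of 0 l] by (auto intro!: op_space_apply_bilin seminormed)

text \<open>An order \<open>q1 + q2\<close> below \<open>R - l\<close> leaves a level
  \<open>r\<close> with \<open>l + q1 < r < R - q2\<close>: the operator gets the gap from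
  \<open>r\<close> to \<open>l\<close>, the vector the gap from \<open>R\<close> to
  \<open>r\<close>. The midpoint of the admissible interval is taken.\<close>

lemma apply_split:
  assumes "0 \<le> q1" "0 \<le> q2" "q1 + q2 < cV l"
  shows "\<exists>l1 l2. q1 < cO l1 \<and> q2 < cV l2 \<and> bilin (OY l1) (ON l1) (X l2) (N l2) (X l) (N l) (\<lambda>T x. T x)"
proof -
  have l: "\<sigma> \<le> l" "l < R" "q1 + q2 < R - l" using cV_pos[of "q1 + q2" l] assms by auto
  define r where "r = (l + q1 + R - q2) / 2"
  have r: "l + q1 < r" "r < R - q2" using l by (auto simp: r_def field_simps)
  have "q1 < cO (l, r)" "q2 < cV r" using l r assms by (auto simp: cO_def cV_def)
  moreover have "bilin (OY (l, r)) (ON (l, r)) (X r) (N r) (X l) (N l) (\<lambda>T x. T x)"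
    using apply_bilin[of "(l, r)"] assms calculation by auto
  ultimately show ?thesis by blast
qed

text \<open>One-sided limits suffice for uniqueness since \<open>U\<close> is open, and a derivative
  in any stronger norm supplies them.\<close>

definition is_ddir :: "('b \<Rightarrow> 'x) \<Rightarrow> 'b \<Rightarrow> 'b \<Rightarrow> 'x \<Rightarrow> bool" where
  "is_ddir F u h y \<longleftrightarrow> y \<in> X \<sigma> \<and>
     (\<forall>e>0. \<exists>d>0. \<forall>t. 0 < t \<longrightarrow> t < d \<longrightarrow> u + t *\<^sub>R h \<in> U \<longrightarrow> N \<sigma> (F (u + t *\<^sub>R h) - F u - t *\<^sub>R y) \<le> e * t)"

text \<open>Iterated directional derivatives in the weakest norm: one function that represents the
derivatives at all levels at once.\<close>

primrec ddir :: "('b \<Rightarrow> 'x) \<Rightarrow> 'b list \<Rightarrow> 'b \<Rightarrow> 'x" where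
  "ddir F [] u = F u"
| "ddir F (h # hs) u = (SOME y. is_ddir (ddir F hs) u h y)"

lemma is_ddir_unique:
  assumes y: "is_ddir F u h y" "is_ddir F u h z" and u: "u \<in> U" and F: "\<And>v. v \<in> U \<Longrightarrow> F v \<in> X \<sigma>" and R: "\<sigma> \<le> R"
  shows "y = z"
proof -
  interpret seminormed_space "X \<sigma>" "N \<sigma>" using seminormed R by simp
  have m: "y \<in> X \<sigma>" "z \<in> X \<sigma>" using y by (auto simp: is_ddir_def)
  have "N \<sigma> (y - z) \<le> 0 + e" if "e > 0" for e
  proof -
    have e: "e / 2 > 0" using that by simp
    obtain d1 where d1: "d1 > 0" "\<And>t. 0 < t \<Longrightarrow> t < d1 \<Longrightarrow> u + t *\<^sub>R h \<in> U \<Longrightarrow> N \<sigma> (F (u + t *\<^sub>R h) - F u - t *\<^sub>R y) \<le> e / 2 * t"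
      using y(1) e unfolding is_ddir_def by blast
    obtain d2 where d2: "d2 > 0" "\<And>t. 0 < t \<Longrightarrow> t < d2 \<Longrightarrow> u + t *\<^sub>R h \<in> U \<Longrightarrow> N \<sigma> (F (u + t *\<^sub>R h) - F u - t *\<^sub>R z) \<le> e / 2 * t"
      using y(2) e unfolding is_ddir_def by blast
    obtain r where r: "r > 0" "ball u r \<subseteq> U" using open_U u open_contains_ball by blast
    define q where "q = r / (norm h + 1)"
    define t where "t = min (min d1 d2) q / 2"
    have "q > 0" unfolding q_def using r by (intro divide_pos_pos add_nonneg_pos) auto
    then have t: "t > 0" "t < d1" "t < d2" "t < q"
      using d1(1) d2(1) by (auto simp: t_def min_def)
    have "t * (norm h + 1) < r" using t(4)[unfolded q_def] norm_ge_zero[of h] by (simp add: pos_less_divide_eq add_nonneg_pos)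
    then have "t * norm h < r" using t by (simp add: algebra_simps)
    then have uh: "u + t *\<^sub>R h \<in> U" using r t by (auto simp: dist_norm)
    have Fm: "F (u + t *\<^sub>R h) - F u \<in> X \<sigma>" using F u uh by (intro diff_mem) auto
    have "t * N \<sigma> (y - z) = N \<sigma> (t *\<^sub>R (y - z))" using t m by (simp add: scale diff_mem)
    also have "t *\<^sub>R (y - z) = (F (u + t *\<^sub>R h) - F u - t *\<^sub>R z) - (F (u + t *\<^sub>R h) - F u - t *\<^sub>R y)"
      by (simp add: algebra_simps)
    also have "N \<sigma> \<dots> \<le> N \<sigma> (F (u + t *\<^sub>R h) - F u - t *\<^sub>R z) + N \<sigma> (F (u + t *\<^sub>R h) - F u - t *\<^sub>R y)"
      using Fm m by (intro triangle_diff diff_mem[OF Fm] scale_mem)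
    also have "\<dots> \<le> e / 2 * t + e / 2 * t" using t uh by (intro add_mono d1 d2)
    also have "\<dots> = t * e" by simp
    finally show ?thesis using t by simp
  qed
  then have "N \<sigma> (y - z) \<le> 0" by (rule field_le_epsilon)
  then have "y - z = 0"
    using normed_subspace_eq_0[OF normed[OF order_refl R] diff_mem[OF m]] nonneg[OF diff_mem[OF m]] by simp
  then show ?thesis by simp
qed

text \<open>Smallness of a remainder in operator norm from level \<open>r\<close> to level
  \<open>s\<close> implies smallness of its value at \<phi> in the norm of level \<sigma>. By
  uniqueness of \<open>is_ddir\<close>, jets chosen for different levels, orders and exponents must
  then agree at every \<phi> on which they act.\<close>

lemma jet_ddir:
  assumes D: "jet U (OY (s, r)) (ON (s, r)) k \<alpha> D" "\<And>u \<phi>. u \<in> U \<Longrightarrow> \<phi> \<in> X r \<Longrightarrow> D [] u \<phi> = L u \<phi>"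
    and sr: "\<sigma> \<le> s" "s < r" "r \<le> R" and \<phi>: "\<phi> \<in> X r"
  shows "length hs \<le> k \<Longrightarrow> u \<in> U \<Longrightarrow> ddir (\<lambda>u. L u \<phi>) hs u = D hs u \<phi>"
proof (induction hs arbitrary: u)
  case Nil
  then show ?case using D(2) \<phi> by simp
next
  case (Cons h hs)
  have c: "0 < cO (s, r)" using sr by (simp add: cO_def)
  interpret b: bilin "OY (s, r)" "ON (s, r)" "X r" "N r" "X s" "N s" "\<lambda>T x. T x"
    using apply_bilin[OF c] by simp
  have mem: "D gs v \<in> OY (s, r)" if "length gs \<le> k" "v \<in> U" for gs v
  proof -
    have "\<exists>B\<ge>0. \<forall>hs. length hs \<le> k \<longrightarrow> (\<forall>u\<in>U. D hs u \<in> OY (s, r) \<and> ON (s, r) (D hs u) \<le> B * wt hs)"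
      using D(1) unfolding jet_def by (elim conjE)
    then show ?thesis using that by auto
  qed
  obtain B where B: "B \<ge> 0" "\<And>x. x \<in> X s \<Longrightarrow> N \<sigma> x \<le> B * N s x" using incl[of \<sigma> s] sr by auto
  have sub: "X s \<subseteq> X \<sigma>" using incl[of \<sigma> s] sr by auto
  have len: "length hs < k" using Cons.prems by simp
  have lin: "D ((t *\<^sub>R h) # hs) u = t *\<^sub>R D (h # hs) u" for t
  proof -
    have "\<forall>u\<in>U. \<forall>hs h g a b. length hs < k \<longrightarrow> D ((a *\<^sub>R h + b *\<^sub>R g) # hs) u = a *\<^sub>R D (h # hs) u + b *\<^sub>R D (g # hs) u"
      using D(1) unfolding jet_def by (elim conjE)
    from this[rule_format, OF Cons.prems(2) len, of t h 0 0] show ?thesis by simp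
  qed
  have dir: "is_ddir (ddir (\<lambda>u. L u \<phi>) hs) u h (D (h # hs) u \<phi>)"
    unfolding is_ddir_def
  proof (intro conjI allI impI)
    show "D (h # hs) u \<phi> \<in> X \<sigma>" using b.mem[OF mem[OF Cons.prems] \<phi>] sub by blast
    fix e :: real assume e: "e > 0"
    define W where "W = B * (norm h * wt hs * N r \<phi>)"
    have W: "W \<ge> 0" using B \<phi> b.R.nonneg by (simp add: W_def)
    \<comment> \<open>\<open>W\<close> collects the embedding constant, the directions and the norm
      of \<phi>, and may vanish; hence the summand 1.\<close>
    then have e': "e / (1 + W) > 0" using e by (intro divide_pos_pos) auto
    have "\<forall>u\<in>U. \<forall>i<k. \<forall>e>0. \<exists>d>0. \<forall>hs h. length hs = i \<longrightarrow> norm h < d \<longrightarrow> u + h \<in> U \<longrightarrow>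
        ON (s, r) (D hs (u + h) - D hs u - D (h # hs) u) \<le> e * norm h * wt hs"
      using D(1) unfolding jet_def by (elim conjE)
    from this[rule_format, OF Cons.prems(2) len e']
    obtain d where d: "d > 0" "\<And>hs' h'. length hs' = length hs \<Longrightarrow> norm h' < d \<Longrightarrow> u + h' \<in> U \<Longrightarrow>
        ON (s, r) (D hs' (u + h') - D hs' u - D (h' # hs') u) \<le> e / (1 + W) * norm h' * wt hs'"
      by blast
    show "\<exists>d>0. \<forall>t. 0 < t \<longrightarrow> t < d \<longrightarrow> u + t *\<^sub>R h \<in> U \<longrightarrow>
       N \<sigma> (ddir (\<lambda>u. L u \<phi>) hs (u + t *\<^sub>R h) - ddir (\<lambda>u. L u \<phi>) hs u - t *\<^sub>R D (h # hs) u \<phi>) \<le> e * t"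
    proof (intro exI[of _ "d / (norm h + 1)"] conjI allI impI)
      show "0 < d / (norm h + 1)" using d by (intro divide_pos_pos add_nonneg_pos) auto
      fix t assume t: "0 < t" "t < d / (norm h + 1)" "u + t *\<^sub>R h \<in> U"
      have "t * (norm h + 1) < d" using t(2) norm_ge_zero[of h] by (simp add: pos_less_divide_eq add_nonneg_pos)
      then have td: "norm (t *\<^sub>R h) < d" using t by (simp add: algebra_simps)
      let ?T = "D hs (u + t *\<^sub>R h) - D hs u - D ((t *\<^sub>R h) # hs) u"
      have T: "?T \<in> OY (s, r)" using mem t Cons.prems by (auto intro!: b.L.diff_mem)
      have eq: "ddir (\<lambda>u. L u \<phi>) hs (u + t *\<^sub>R h) - ddir (\<lambda>u. L u \<phi>) hs u - t *\<^sub>R D (h # hs) u \<phi> = ?T \<phi>"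
        using Cons.IH t Cons.prems by (simp add: lin fun_diff_def scaleR_fun_def)
      have "N \<sigma> (?T \<phi>) \<le> B * N s (?T \<phi>)" using b.mem[OF T \<phi>] by (rule B)
      also have "N s (?T \<phi>) \<le> ON (s, r) ?T * N r \<phi>"
      proof -
        have "?T \<in> op_space (X r) (N r) (X s) (N s)" using T by (simp add: OY_def)
        from opnorm_bound[OF this seminormed seminormed \<phi>] show ?thesis using sr by (simp add: ON_def)
      qed
      also have "\<dots> \<le> (e / (1 + W) * norm (t *\<^sub>R h) * wt hs) * N r \<phi>"
        using \<phi> b.R.nonneg by (intro mult_right_mono d td t) auto
      also have "B * ((e / (1 + W) * norm (t *\<^sub>R h) * wt hs) * N r \<phi>) = e * t * (W / (1 + W))"
        using t by (simp add: W_def mult_ac)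
      also have "\<dots> \<le> e * t * 1" using W e t by (intro mult_left_mono) auto
      finally show "N \<sigma> (ddir (\<lambda>u. L u \<phi>) hs (u + t *\<^sub>R h) - ddir (\<lambda>u. L u \<phi>) hs u - t *\<^sub>R D (h # hs) u \<phi>) \<le> e * t"
        unfolding eq using B by (simp add: mult_left_mono)
    qed
  qed
  have mX: "ddir (\<lambda>u. L u \<phi>) hs v \<in> X \<sigma>" if "v \<in> U" for v
    using Cons.IH[of v] that Cons.prems b.mem[OF mem \<phi>, of hs v] sub by auto
  have "is_ddir (ddir (\<lambda>u. L u \<phi>) hs) u h (ddir (\<lambda>u. L u \<phi>) (h # hs) u)"
    using dir by (auto intro: someI)
  then show ?case using is_ddir_unique[OF _ dir Cons.prems(2) mX] sr by auto
qed

text \<open>The hypothesis provides a separate jet for each pair of levels and each order, while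
  \<open>smooth_fam\<close> demands one family for all of them. The directional derivatives
  \<open>ddir\<close> provide it.\<close>

lemma jets_smooth_fam:
  fixes L :: "'b \<Rightarrow> 'x \<Rightarrow> 'x"
  assumes J: "\<And>s r k \<alpha>. \<sigma> \<le> s \<Longrightarrow> s < r \<Longrightarrow> r \<le> R \<Longrightarrow> 0 < \<alpha> \<Longrightarrow> \<alpha> \<le> 1 \<Longrightarrow> real k + \<alpha> < r - s \<Longrightarrow>
     \<exists>D. jet U (OY (s, r)) (ON (s, r)) k \<alpha> D \<and> (\<forall>u\<in>U. \<forall>\<phi>\<in>X r. D [] u \<phi> = L u \<phi>)"
  shows "smooth_fam U OY ON k 0 cO (\<lambda>hs. L)"
proof -
  \<comment> \<open>Since the list carries the order, \<open>p\<close> is its own derivative family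
    at every order.\<close>
  define p where "p = (\<lambda>hs u \<phi>. ddir (\<lambda>u. L u \<phi>) hs u)"
  have J': "\<exists>D. jet U (OY l) (ON l) k \<alpha> D \<and> (\<forall>hs. length hs \<le> k \<longrightarrow> (\<forall>u\<in>U. \<forall>\<phi>\<in>X (snd l). p hs u \<phi> = D hs u \<phi>))"
    if \<alpha>: "0 < \<alpha>" "\<alpha> \<le> 1" "real k + \<alpha> < cO l" for k \<alpha> l
  proof -
    obtain s r where l: "l = (s, r)" by (cases l)
    have sr: "\<sigma> \<le> s" "s < r" "r \<le> R" "real k + \<alpha> < r - s" using cO_pos[of "real k + \<alpha>" l] \<alpha> l by auto
    obtain D where "jet U (OY (s, r)) (ON (s, r)) k \<alpha> D" "\<forall>u\<in>U. \<forall>\<phi>\<in>X r. D [] u \<phi> = L u \<phi>"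
      using J[OF sr(1-3) \<alpha>(1,2) sr(4)] by blast
    then show ?thesis using jet_ddir[of s r k \<alpha> D L] sr l unfolding p_def by (intro exI[of _ D]) auto
  qed
  \<comment> \<open>\<open>OY\<close> and \<open>ON\<close> see only the values on the source level,
    which is where \<open>p\<close> and the jet coincide.\<close>
  have cong: "(\<forall>\<phi>\<in>X (snd l). T \<phi> = T' \<phi>) \<Longrightarrow> 0 < cO l \<Longrightarrow> (T \<in> OY l \<longleftrightarrow> T' \<in> OY l) \<and> ON l T = ON l T'" for T T' l
    unfolding OY_def ON_def
    using op_space_cong[of "X (snd l)" T T'] opnorm_cong[of "X (snd l)" T T'] cO_pos[of 0 l]
      seminormed_space.subspace[OF seminormed, of "snd l"] by auto
  have h: "holder_fam U OY ON i (\<lambda>l. cO l - real i) p" for i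
    unfolding holder_fam_def
  proof (intro allI impI)
    fix l and \<alpha> :: real assume \<alpha>: "0 < \<alpha>" "\<alpha> \<le> 1" "\<alpha> < cO l - real i"
    obtain D where D: "jet U (OY l) (ON l) i \<alpha> D"
      "\<forall>hs. length hs \<le> i \<longrightarrow> (\<forall>u\<in>U. \<forall>\<phi>\<in>X (snd l). p hs u \<phi> = D hs u \<phi>)"
      using J'[OF \<alpha>(1,2), of i l] \<alpha> by auto
    have c: "0 < cO l" using \<alpha> by auto
    obtain B1 where B1: "B1 \<ge> 0" "\<forall>hs. length hs \<le> i \<longrightarrow> (\<forall>u\<in>U. D hs u \<in> OY l \<and> ON l (D hs u) \<le> B1 * wt hs)"
      using D(1) unfolding jet_def by (elim conjE exE)
    obtain B2 where B2: "B2 \<ge> 0" "\<forall>hs. length hs = i \<longrightarrow> (\<forall>u\<in>U. \<forall>v\<in>U. ON l (D hs v - D hs u) \<le> B2 * wt hs * norm (v - u) powr \<alpha>)"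
      using D(1) unfolding jet_def by (elim conjE exE)
    show "\<exists>B\<ge>0. \<forall>hs. length hs = i \<longrightarrow> (\<forall>u\<in>U. p hs u \<in> OY l \<and> ON l (p hs u) \<le> B * wt hs \<and>
        (\<forall>v\<in>U. ON l (p hs v - p hs u) \<le> B * wt hs * norm (v - u) powr \<alpha>))"
    proof (intro exI[of _ "B1 + B2"] conjI allI impI ballI)
      fix hs :: "'b list" and u assume a: "length hs = i" "u \<in> U"
      have e: "p hs u \<in> OY l \<longleftrightarrow> D hs u \<in> OY l" "ON l (p hs u) = ON l (D hs u)"
        using cong[of l "p hs u" "D hs u"] D(2) a c by auto
      show "p hs u \<in> OY l" using e B1 a by auto
      have "ON l (p hs u) \<le> B1 * wt hs" using e B1 a by auto
      also have "\<dots> \<le> (B1 + B2) * wt hs" using B2 by (intro mult_right_mono) auto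
      finally show "ON l (p hs u) \<le> (B1 + B2) * wt hs" .
      fix v assume v: "v \<in> U"
      have "ON l (p hs v - p hs u) = ON l (D hs v - D hs u)"
        using cong[of l "p hs v - p hs u" "D hs v - D hs u"] D(2) a v c by (auto simp: fun_diff_def)
      also have "\<dots> \<le> B2 * (wt hs * norm (v - u) powr \<alpha>)" using B2 a v by (auto simp: mult.assoc)
      also have "\<dots> \<le> (B1 + B2) * (wt hs * norm (v - u) powr \<alpha>)" using B1 by (intro mult_right_mono) auto
      finally show "ON l (p hs v - p hs u) \<le> (B1 + B2) * wt hs * norm (v - u) powr \<alpha>" by (simp add: mult.assoc)
    qed (use B1 B2 in auto)
  qed
  have d: "deriv_fam U OY ON i (\<lambda>l. cO l - real i) p p" for i
    unfolding deriv_fam_def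
  proof (intro allI impI ballI)
    fix l u assume l: "1 < cO l - real i" and u: "u \<in> U"
    define \<alpha> where "\<alpha> = min 1 ((cO l - real i - 1) / 2)"
    have \<alpha>: "0 < \<alpha>" "\<alpha> \<le> 1" "real (Suc i) + \<alpha> < cO l" using l by (auto simp: \<alpha>_def min_def field_simps)
    obtain D where D: "jet U (OY l) (ON l) (Suc i) \<alpha> D"
      "\<forall>hs. length hs \<le> Suc i \<longrightarrow> (\<forall>u\<in>U. \<forall>\<phi>\<in>X (snd l). p hs u \<phi> = D hs u \<phi>)"
      using J'[OF \<alpha>] by auto
    have c: "0 < cO l" using l by auto
    interpret seminormed_space "OY l" "ON l" by (rule op_seminormed[OF c])
    have lin: "\<forall>u\<in>U. \<forall>hs h g a b. length hs < Suc i \<longrightarrow> D ((a *\<^sub>R h + b *\<^sub>R g) # hs) u = a *\<^sub>R D (h # hs) u + b *\<^sub>R D (g # hs) u"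
      using D(1) unfolding jet_def by (elim conjE)
    have df: "\<forall>u\<in>U. \<forall>i'<Suc i. \<forall>e>0. \<exists>d>0. \<forall>hs h. length hs = i' \<longrightarrow> norm h < d \<longrightarrow> u + h \<in> U \<longrightarrow>
        ON l (D hs (u + h) - D hs u - D (h # hs) u) \<le> e * norm h * wt hs"
      using D(1) unfolding jet_def by (elim conjE)
    show "(\<forall>hs h g a b. length hs = i \<longrightarrow>
        ON l (p ((a *\<^sub>R h + b *\<^sub>R g) # hs) u - a *\<^sub>R p (h # hs) u - b *\<^sub>R p (g # hs) u) = 0) \<and>
     (\<forall>e>0. \<exists>d>0. \<forall>hs h. length hs = i \<longrightarrow> norm h < d \<longrightarrow> u + h \<in> U \<longrightarrow>
        ON l (p hs (u + h) - p hs u - p (h # hs) u) \<le> e * norm h * wt hs)"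
    proof (intro conjI allI impI)
      fix hs :: "'b list" and h g :: 'b and a b :: real assume hs: "length hs = i"
      have "ON l (p ((a *\<^sub>R h + b *\<^sub>R g) # hs) u - a *\<^sub>R p (h # hs) u - b *\<^sub>R p (g # hs) u)
        = ON l (D ((a *\<^sub>R h + b *\<^sub>R g) # hs) u - a *\<^sub>R D (h # hs) u - b *\<^sub>R D (g # hs) u)"
        using D(2) hs u c by (intro cong[THEN conjunct2]) (auto simp: fun_diff_def scaleR_fun_def)
      also have "\<dots> = 0" using lin hs u norm_zero by auto
      finally show "ON l (p ((a *\<^sub>R h + b *\<^sub>R g) # hs) u - a *\<^sub>R p (h # hs) u - b *\<^sub>R p (g # hs) u) = 0" .
    next
      fix e :: real assume e: "0 < e"
      from df[rule_format, OF u lessI e]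
      obtain d where d: "d > 0" "\<forall>hs h. length hs = i \<longrightarrow> norm h < d \<longrightarrow> u + h \<in> U \<longrightarrow>
          ON l (D hs (u + h) - D hs u - D (h # hs) u) \<le> e * norm h * wt hs" by blast
      have "ON l (p hs (u + h) - p hs u - p (h # hs) u) = ON l (D hs (u + h) - D hs u - D (h # hs) u)"
        if "length hs = i" "u + h \<in> U" for hs h
        using D(2) that u c by (intro cong[THEN conjunct2]) (auto simp: fun_diff_def)
      then show "\<exists>d>0. \<forall>hs h. length hs = i \<longrightarrow> norm h < d \<longrightarrow> u + h \<in> U \<longrightarrow>
        ON l (p hs (u + h) - p hs u - p (h # hs) u) \<le> e * norm h * wt hs"
        using d by (intro exI[of _ d]) auto
    qed
  qed
  have "smooth_fam U OY ON k i (\<lambda>l. cO l - real i) p" for i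
  proof (induction k arbitrary: i)
    case 0
    then show ?case using h by simp
  next
    case (Suc k)
    have "(\<lambda>l. cO l - real i - 1) = (\<lambda>l. cO l - real (Suc i))" by auto
    then show ?case using h[of i] d[of i] Suc.IH[of "Suc i"] by auto
  qed
  from this[of 0] have "smooth_fam U OY ON k 0 cO p" by simp
  then show ?thesis by (rule smooth_fam_cong) (auto simp: p_def)
qed

end

section \<open>Fixed points on a scale of spaces\<close>

text \<open>The product \<open>b\<close> is bilinear on the whole type because the families in \<open>OY\<close> are only controlled on
\<open>X r\<close>, whereas identities between operators are identities of total functions.\<close>

locale graded_fixpoint = scale U X N \<sigma> R
  for U :: "'b::real_normed_vector set" and X :: "real \<Rightarrow> 'x::real_vector set" and N \<sigma> R +
  fixes L :: "'b \<Rightarrow> 'x \<Rightarrow> 'x" and b :: "'x \<Rightarrow> 'x \<Rightarrow> 'x" and f :: "'b \<Rightarrow> 'x" and g :: "'b \<Rightarrow> 'x \<Rightarrow> 'x"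
    and A :: "'b \<Rightarrow> 'x \<Rightarrow> 'x"
  defines A_def: "A \<equiv> \<lambda>u \<psi>. b (L u (f u)) \<psi> - L u \<psi> + b (L u \<psi>) (f u)"
  assumes L_smooth: "\<And>k. smooth_fam U OY ON k 0 cO (\<lambda>hs. L)"
    and L_mem: "\<And>r u. \<sigma> \<le> r \<Longrightarrow> r < R \<Longrightarrow> u \<in> U \<Longrightarrow> L u \<in> op_space (X r) (N r) (X r) (N r)"
    and b_add_left: "\<And>x y z. b (x + y) z = b x z + b y z"
    and b_scale_left: "\<And>x z a. b (a *\<^sub>R x) z = a *\<^sub>R b x z"
    and b_add_right: "\<And>x y z. b x (y + z) = b x y + b x z"
    and b_scale_right: "\<And>x y a. b x (a *\<^sub>R y) = a *\<^sub>R b x y"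
    and b: "\<And>r. \<sigma> \<le> r \<Longrightarrow> r < R \<Longrightarrow> bilin (X r) (N r) (X r) (N r) (X r) (N r) b"
    and f_mem: "\<And>r u. \<sigma> \<le> r \<Longrightarrow> r < R \<Longrightarrow> u \<in> U \<Longrightarrow> f u \<in> X r"
    and f_bound: "\<And>r. \<sigma> \<le> r \<Longrightarrow> r < R \<Longrightarrow> \<exists>B. \<forall>u\<in>U. N r (f u) \<le> B"
    and f_eq: "\<And>u. u \<in> U \<Longrightarrow> L u (f u) = b (L u (f u)) (f u)"
    and apriori: "\<And>r. \<sigma> \<le> r \<Longrightarrow> r < R \<Longrightarrow> \<exists>C\<ge>0. \<forall>u\<in>U. \<forall>v\<in>U. N r (f v - f u) \<le> C * N r (L v (f v) - L u (f v))"
    and inv_mem: "\<And>r u y. \<sigma> \<le> r \<Longrightarrow> r < R \<Longrightarrow> u \<in> U \<Longrightarrow> y \<in> X r \<Longrightarrow> g u y \<in> X r"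
    and inv: "\<And>r u y. \<sigma> \<le> r \<Longrightarrow> r < R \<Longrightarrow> u \<in> U \<Longrightarrow> y \<in> X r \<Longrightarrow> A u (g u y) = y"
    and inv_bound: "\<And>r. \<sigma> \<le> r \<Longrightarrow> r < R \<Longrightarrow> \<exists>B\<ge>0. \<forall>u\<in>U. \<forall>x\<in>X r. N r x \<le> B * N r (A u x)"
begin

lemma sn: "0 < cV r \<Longrightarrow> seminormed_space (X r) (N r)"
  using cV_pos[of 0 r] seminormed by auto

sublocale inverse_scale U OY ON cO X N cV "\<lambda>T x. T x" A g
proof (unfold_locales, goal_cases)
  case (1 l q1 q2)
  then show ?case by (rule apply_split)
next
  case (2 l u y)
  then show ?case using inv_mem[of l u y] cV_pos[of 0 l] by auto
next
  case (3 l u y)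
  then show ?case using inv[of l u y] cV_pos[of 0 l] by auto
next
  case (4 l u x y)
  have l: "\<sigma> \<le> l" "l < R" using cV_pos[of 0 l] 4 by auto
  interpret b: bilin "X l" "N l" "X l" "N l" "X l" "N l" b by (rule b[OF l])
  note L = L_mem[OF l \<open>u \<in> U\<close>]
  show ?case unfolding A_def
    using 4(3,4) op_space_mem[OF L] f_mem[OF l \<open>u \<in> U\<close>]
    by (simp add: op_space_diff[OF L] b.diff_left b.diff_right)
next
  case (5 l u x a)
  have l: "\<sigma> \<le> l" "l < R" using cV_pos[of 0 l] 5 by auto
  interpret b: bilin "X l" "N l" "X l" "N l" "X l" "N l" b by (rule b[OF l])
  note L = L_mem[OF l \<open>u \<in> U\<close>]
  show ?case unfolding A_def
    using 5(3) op_space_mem[OF L] f_mem[OF l \<open>u \<in> U\<close>]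
    by (simp add: op_space_scale[OF L] b.scale_left b.scale_right algebra_simps)
next
  case (6 l)
  then show ?case using inv_bound[of l] cV_pos[of 0 l] by auto
qed

text \<open>The a priori estimate bounds \<open>f v - f u\<close> at level \<open>l\<close> by
  \<open>(L v - L u) (f v)\<close>, and \<open>f v\<close> is bounded at the stronger level
  \<open>l2\<close>; so the Holder exponent of \<open>L\<close> between these two levels passes to
  \<open>f\<close>.\<close>

lemma f_holder: "holder_fam U X N 0 cV (\<lambda>hs. f)"
  unfolding holder_fam_def
proof (intro allI impI)
  fix l and \<alpha> :: real assume \<alpha>: "0 < \<alpha>" "\<alpha> \<le> 1" "\<alpha> < cV l"
  have l: "\<sigma> \<le> l" "l < R" using cV_pos[of \<alpha> l] \<alpha> by auto
  obtain l1 l2 where k: "\<alpha> < cO l1" "0 < cV l2" and "bilin (OY l1) (ON l1) (X l2) (N l2) (X l) (N l) (\<lambda>T x. T x)"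
    using apply_split[of \<alpha> 0 l] \<alpha> by auto
  then interpret bilin "OY l1" "ON l1" "X l2" "N l2" "X l" "N l" "\<lambda>T x. T x" by simp
  have l2: "\<sigma> \<le> l2" "l2 < R" using cV_pos[of 0 l2] k by auto
  obtain M where M: "M \<ge> 0" "\<And>x y r s. x \<in> OY l1 \<Longrightarrow> y \<in> X l2 \<Longrightarrow> ON l1 x \<le> r \<Longrightarrow> N l2 y \<le> s \<Longrightarrow> N l (x y) \<le> M * (r * s)"
    using bound by metis
  obtain P where P: "P \<ge> 0" "\<And>u. u \<in> U \<Longrightarrow> L u \<in> OY l1"
    "\<And>u v. u \<in> U \<Longrightarrow> v \<in> U \<Longrightarrow> ON l1 (L v - L u) \<le> P * norm (v - u) powr \<alpha>"
    using holder_famD[OF smooth_fam_holder[OF L_smooth[of 0]] \<alpha>(1,2) k(1)]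
    by (metis list.size(3) wt_simps(1) mult.right_neutral)
  obtain B0 where B0: "\<forall>u\<in>U. N l (f u) \<le> B0" using f_bound[OF l] by auto
  obtain F where F: "\<forall>u\<in>U. N l2 (f u) \<le> F" using f_bound[OF l2] by auto
  obtain C where C: "C \<ge> 0" "\<forall>u\<in>U. \<forall>v\<in>U. N l (f v - f u) \<le> C * N l (L v (f v) - L u (f v))"
    using apriori[OF l] by auto
  define H where "H = \<bar>B0\<bar> + C * (M * (P * \<bar>F\<bar>))"
  show "\<exists>B\<ge>0. \<forall>hs::'b list. length hs = 0 \<longrightarrow> (\<forall>u\<in>U. f u \<in> X l \<and> N l (f u) \<le> B * wt hs \<and>
        (\<forall>v\<in>U. N l (f v - f u) \<le> B * wt hs * norm (v - u) powr \<alpha>))"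
  proof (intro exI[of _ H] conjI allI impI ballI)
    show "H \<ge> 0" using C M P by (simp add: H_def)
    fix hs :: "'b list" and u assume hs: "length hs = 0" and u: "u \<in> U"
    show "f u \<in> X l" using f_mem[OF l u] .
    have "0 \<le> C * (M * (P * \<bar>F\<bar>))" using C M P by simp
    moreover have "N l (f u) \<le> \<bar>B0\<bar>" using B0 u by fastforce
    ultimately show "N l (f u) \<le> H * wt hs" using hs by (simp add: H_def)
    fix v assume v: "v \<in> U"
    have "N l (f v - f u) \<le> C * N l ((L v - L u) (f v))" using C u v by (simp add: fun_diff_def)
    also have "\<dots> \<le> C * (M * ((P * norm (v - u) powr \<alpha>) * \<bar>F\<bar>))"
    proof (intro mult_left_mono M(2)[of "L v - L u" "f v"] C(1))
      show "L v - L u \<in> OY l1" using P u v by (intro L.diff_mem) auto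
      show "f v \<in> X l2" by (rule f_mem[OF l2 v])
      show "ON l1 (L v - L u) \<le> P * norm (v - u) powr \<alpha>" by (rule P(3)[OF u v])
      show "N l2 (f v) \<le> \<bar>F\<bar>" using F v by (meson abs_ge_self order_trans)
    qed
    also have "\<dots> \<le> H * norm (v - u) powr \<alpha>" by (simp add: H_def algebra_simps)
    finally show "N l (f v - f u) \<le> H * wt hs * norm (v - u) powr \<alpha>" using hs by simp
  qed
qed

text \<open>The product is formed at the target level \<open>fst l\<close>, where \<open>w\<close>
  has capacity \<open>R - fst l\<close>, at least the gap \<open>snd l - fst l\<close>. The vector
  \<psi> merely has to be included from the source level.\<close>

lemma left_mult_smooth:
  assumes w: "smooth_fam U X N k 0 cV (\<lambda>hs. w)"
  shows "smooth_fam U OY ON k 0 cO (\<lambda>hs u \<psi>. b (w u) \<psi>)"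
proof (rule smooth_fam_linear[OF _ w])
  fix l q assume q: "0 \<le> q" "q < cO l"
  have l: "\<sigma> \<le> fst l" "fst l < snd l" "snd l \<le> R" "q < snd l - fst l" using cO_pos[OF q] by auto
  interpret b: bilin "X (fst l)" "N (fst l)" "X (fst l)" "N (fst l)" "X (fst l)" "N (fst l)" b
    using b l by simp
  obtain J where J: "J \<ge> 0" "\<And>x. x \<in> X (snd l) \<Longrightarrow> N (fst l) x \<le> J * N (snd l) x"
    using incl[of "fst l" "snd l"] l by auto
  have sub: "x \<in> X (snd l) \<Longrightarrow> x \<in> X (fst l)" for x using incl[of "fst l" "snd l"] l by auto
  obtain M where M: "M \<ge> 0" "\<And>x y r s. x \<in> X (fst l) \<Longrightarrow> y \<in> X (fst l) \<Longrightarrow> N (fst l) x \<le> r \<Longrightarrow> N (fst l) y \<le> s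
     \<Longrightarrow> N (fst l) (b x y) \<le> M * (r * s)" using b.bound by metis
  have S: "seminormed_space (X (snd l)) (N (snd l))"
    by (rule normed_subspace_seminormed[OF normed]) (use l in auto)
  have bnd: "N (fst l) (b x y) \<le> M * J * N (fst l) x * N (snd l) y" if "x \<in> X (fst l)" "y \<in> X (snd l)" for x y
    using M(2)[OF that(1) sub[OF that(2)] order_refl J(2)[OF that(2)]] by (simp add: mult_ac)
  have mem: "(\<lambda>\<psi>. b x \<psi>) \<in> OY l" if "x \<in> X (fst l)" for x
    unfolding OY_def using that sub bnd[OF that]
    by (intro op_spaceI[where B = "M * J * N (fst l) x"])
      (auto simp: b.mem b.add_right b.scale_right seminormed_space.subspace[OF S])
  have mem': "ON l (\<lambda>\<psi>. b x \<psi>) \<le> M * J * N (fst l) x" if "x \<in> X (fst l)" for x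
    unfolding ON_def using bnd[OF that] M J b.L.nonneg[OF that]
    by (intro opnorm_le) (auto simp: seminormed_space.zero_mem[OF S] seminormed_space.norm_zero[OF S])
  show "\<exists>l1. q < cV l1 \<and> seminormed_space (X l1) (N l1) \<and> seminormed_space (OY l) (ON l) \<and>
      (\<forall>x\<in>X l1. (\<lambda>\<psi>. b x \<psi>) \<in> OY l) \<and>
      (\<forall>x\<in>X l1. \<forall>y\<in>X l1. (\<lambda>\<psi>. b (x + y) \<psi>) = (\<lambda>\<psi>. b x \<psi>) + (\<lambda>\<psi>. b y \<psi>)) \<and>
      (\<forall>a. \<forall>x\<in>X l1. (\<lambda>\<psi>. b (a *\<^sub>R x) \<psi>) = a *\<^sub>R (\<lambda>\<psi>. b x \<psi>)) \<and>
      (\<exists>B\<ge>0. \<forall>x\<in>X l1. ON l (\<lambda>\<psi>. b x \<psi>) \<le> B * N l1 x)"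
    using l q mem mem' M J op_seminormed[of l] b.L.seminormed_space_axioms
    by (intro exI[of _ "fst l"] conjI exI[of _ "M * J"])
      (auto simp: cV_def b_add_left b_scale_left plus_fun_def scaleR_fun_def)
qed

lemma right_mult_bilin:
  assumes l: "0 < cO l"
  shows "bilin (OY l) (ON l) (X (fst l)) (N (fst l)) (OY l) (ON l) (\<lambda>T \<phi> \<psi>. b (T \<psi>) \<phi>)"
proof -
  have l': "\<sigma> \<le> fst l" "fst l < snd l" "snd l \<le> R" using cO_pos[of 0 l] l by auto
  interpret b: bilin "X (fst l)" "N (fst l)" "X (fst l)" "N (fst l)" "X (fst l)" "N (fst l)" b
    using b l' by simp
  interpret O: seminormed_space "OY l" "ON l" by (rule op_seminormed[OF l])
  have S: "seminormed_space (X (snd l)) (N (snd l))"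
    by (rule normed_subspace_seminormed[OF normed]) (use l' in auto)
  obtain M where M: "M \<ge> 0" "\<And>x y r s. x \<in> X (fst l) \<Longrightarrow> y \<in> X (fst l) \<Longrightarrow> N (fst l) x \<le> r \<Longrightarrow> N (fst l) y \<le> s
     \<Longrightarrow> N (fst l) (b x y) \<le> M * (r * s)" using b.bound by metis
  have Tb: "N (fst l) (T \<psi>) \<le> ON l T * N (snd l) \<psi>" and Tm: "T \<psi> \<in> X (fst l)"
    if "T \<in> OY l" "\<psi> \<in> X (snd l)" for T \<psi>
    using that opnorm_bound[OF _ S b.L.seminormed_space_axioms, of T \<psi>] op_space_mem[of T]
    unfolding OY_def ON_def by auto
  have bnd: "N (fst l) (b (T \<psi>) \<phi>) \<le> M * (ON l T * N (fst l) \<phi>) * N (snd l) \<psi>"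
    if "T \<in> OY l" "\<phi> \<in> X (fst l)" "\<psi> \<in> X (snd l)" for T \<phi> \<psi>
    using M(2)[OF Tm[OF that(1,3)] that(2) Tb[OF that(1,3)] order_refl] by (simp add: mult_ac)
  have mem: "(\<lambda>\<psi>. b (T \<psi>) \<phi>) \<in> OY l" if T: "T \<in> OY l" and \<phi>: "\<phi> \<in> X (fst l)" for T \<phi>
    unfolding OY_def
  proof (rule op_spaceI[where B = "M * (ON l T * N (fst l) \<phi>)"])
    note T' = T[unfolded OY_def]
    show "b (T (x + y)) \<phi> = b (T x) \<phi> + b (T y) \<phi>" if "x \<in> X (snd l)" "y \<in> X (snd l)" for x y
      using that by (simp add: op_space_add[OF T'] b_add_left)
    show "b (T (a *\<^sub>R x)) \<phi> = a *\<^sub>R b (T x) \<phi>" if "x \<in> X (snd l)" for x a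
      using that by (simp add: op_space_scale[OF T'] b_scale_left)
  qed (use bnd[OF T \<phi>] b.mem Tm[OF T] \<phi> in \<open>auto simp: seminormed_space.subspace[OF S]\<close>)
  show ?thesis
  proof unfold_locales
    show "\<exists>B\<ge>0. \<forall>T\<in>OY l. \<forall>\<phi>\<in>X (fst l). ON l (\<lambda>\<psi>. b (T \<psi>) \<phi>) \<le> B * (ON l T * N (fst l) \<phi>)"
    proof (intro exI[of _ M] conjI ballI)
      fix T \<phi> assume T: "T \<in> OY l" and \<phi>: "\<phi> \<in> X (fst l)"
      show "ON l (\<lambda>\<psi>. b (T \<psi>) \<phi>) \<le> M * (ON l T * N (fst l) \<phi>)"
      proof -
        have "opnorm (X (snd l)) (N (snd l)) (N (fst l)) (\<lambda>\<psi>. b (T \<psi>) \<phi>) \<le> M * (ON l T * N (fst l) \<phi>)"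
          using bnd[OF T \<phi>] M(1) O.nonneg[OF T] b.L.nonneg[OF \<phi>]
          by (intro opnorm_le) (auto simp: seminormed_space.zero_mem[OF S] seminormed_space.norm_zero[OF S])
        then show ?thesis by (simp only: ON_def)
      qed
    qed (rule M)
  qed (use mem in \<open>auto simp: plus_fun_def scaleR_fun_def b_add_left b_add_right b_scale_left b_scale_right\<close>)
qed

lemma w_smooth:
  assumes f: "smooth_fam U X N k 0 cV (\<lambda>hs. f)"
  shows "smooth_fam U X N k 0 cV (\<lambda>hs u. L u (f u))"
  by (rule smooth_fam_bilin[where ?s1.0 = id and ?s2.0 = id and ?m1.0 = 0 and ?m2.0 = 0, OF apply_split _ L_smooth f]) auto

lemma A_smooth:
  assumes f: "smooth_fam U X N k 0 cV (\<lambda>hs. f)"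
  shows "smooth_fam U OY ON k 0 cO (\<lambda>hs. A)"
proof -
  have "smooth_fam U OY ON k 0 cO (\<lambda>hs u. (\<lambda>\<psi>. b (L u (f u)) \<psi>) - L u)"
    using op_seminormed by (intro smooth_fam_diff left_mult_smooth w_smooth f L_smooth)
  moreover have "smooth_fam U OY ON k 0 cO (\<lambda>hs u. (\<lambda>T \<phi> \<psi>. b (T \<psi>) \<phi>) (L u) (f u))"
  proof (rule smooth_fam_bilin[where ?s1.0 = id and ?s2.0 = id and ?m1.0 = 0 and ?m2.0 = 0, OF _ _ L_smooth f])
    fix l and q1 q2 :: real assume q: "0 \<le> q1" "0 \<le> q2" "q1 + q2 < cO l"
    then have l: "\<sigma> \<le> fst l \<and> fst l < snd l \<and> snd l \<le> R \<and> q1 + q2 < snd l - fst l" "0 < cO l"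
      using cO_pos[of "q1 + q2" l] by auto
    \<comment> \<open>No intermediate level is needed: the capacity of \<open>f\<close> at
      \<open>fst l\<close> is at least the gap of \<open>l\<close>, so each factor can bear its
      order by itself.\<close>
    then show "\<exists>l1 l2. q1 < cO l1 \<and> q2 < cV l2 \<and>
        bilin (OY l1) (ON l1) (X l2) (N l2) (OY l) (ON l) (\<lambda>T \<phi> \<psi>. b (T \<psi>) \<phi>)"
      using q right_mult_bilin[OF l(2)]
      by (intro exI[of _ l] exI[of _ "fst l"]) (auto simp: cV_def)
  qed auto
  ultimately have "smooth_fam U OY ON k 0 cO (\<lambda>hs u. ((\<lambda>\<psi>. b (L u (f u)) \<psi>) - L u) + (\<lambda>\<psi>. b (L u \<psi>) (f u)))"
    using op_seminormed by (intro smooth_fam_add) auto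
  moreover have "((\<lambda>\<psi>. b (L u (f u)) \<psi>) - L u) + (\<lambda>\<psi>. b (L u \<psi>) (f u)) = A u" for u
    by (simp add: A_def plus_fun_def fun_diff_def)
  ultimately show ?thesis by simp
qed

text \<open>\<open>smooth_fam_solve\<close> cannot give this first derivative because
  \<open>A\<close> is built from \<open>f\<close>. Write \<open>w v = L v (f v)\<close>, let
  \<open>x\<close> be the candidate derivative in direction \<open>h = v - u\<close>, and let
  \<open>D\<close> be the remainder of \<open>L v (f v) - L u (f v)\<close>. The equations at
  \<open>u\<close> and \<open>v\<close> give exactly \<open>A u (f v - f u - x) = D - b D (f u) - b
  (w v - w u) (f v - f u)\<close>, whose last term is a product of two small increments.\<close>

lemma f_deriv:
  assumes L': "deriv_fam U OY ON 0 cO (\<lambda>hs. L) L'" and hL': "holder_fam U OY ON (Suc 0) (\<lambda>l. cO l - 1) L'"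
    and f': "\<And>l hs u. 0 < cV l - 1 \<Longrightarrow> length hs = Suc 0 \<Longrightarrow> u \<in> U \<Longrightarrow> f' hs u \<in> X l"
    and eq': "\<And>hs u. length hs = Suc 0 \<Longrightarrow> u \<in> U \<Longrightarrow> A u (f' hs u) = L' hs u (f u) - b (L' hs u (f u)) (f u)"
  shows "deriv_fam U X N 0 cV (\<lambda>hs. f) f'"
  unfolding deriv_fam_def
proof (intro allI impI ballI)
  fix l u assume l1: "1 < cV l" and u: "u \<in> U"
  then have c: "0 < cV l" by simp
  have l: "\<sigma> \<le> l" "l < R" using cV_pos[of 1 l] l1 by auto
  obtain l1 l2 where k: "1 < cO l1" "0 < cV l2" and "bilin (OY l1) (ON l1) (X l2) (N l2) (X l) (N l) (\<lambda>T x. T x)"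
    using split[of 1 0 l] l1 by auto
  then interpret O: bilin "OY l1" "ON l1" "X l2" "N l2" "X l" "N l" "\<lambda>T x. T x" by simp
  interpret b: bilin "X l" "N l" "X l" "N l" "X l" "N l" b by (rule b[OF l])
  have hL: "holder_fam U OY ON 0 cO (\<lambda>hs. L)" by (rule smooth_fam_holder[OF L_smooth])
  obtain M where M: "M \<ge> 0" "\<And>x y r s. x \<in> OY l1 \<Longrightarrow> y \<in> X l2 \<Longrightarrow> ON l1 x \<le> r \<Longrightarrow> N l2 y \<le> s \<Longrightarrow> N l (x y) \<le> M * (r * s)"
    using O.bound by metis
  obtain M' where M': "M' \<ge> 0" "\<And>x y r s. x \<in> X l \<Longrightarrow> y \<in> X l \<Longrightarrow> N l x \<le> r \<Longrightarrow> N l y \<le> s \<Longrightarrow> N l (b x y) \<le> M' * (r * s)"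
    using b.bound by metis
  obtain B where B: "B \<ge> 0" "\<And>u x. u \<in> U \<Longrightarrow> x \<in> X l \<Longrightarrow> N l x \<le> B * N l (A u x)"
    using bound[OF c] by auto
  obtain F where F: "F \<ge> 0" "\<And>u. u \<in> U \<Longrightarrow> f u \<in> X l2" "\<And>u. u \<in> U \<Longrightarrow> N l2 (f u) \<le> F"
  proof -
    obtain F where F: "F \<ge> 0" "\<And>hs u. length (hs::'b list) = 0 \<Longrightarrow> u \<in> U \<Longrightarrow> f u \<in> X l2"
      "\<And>hs u. length (hs::'b list) = 0 \<Longrightarrow> u \<in> U \<Longrightarrow> N l2 (f u) \<le> F * wt hs"
      using holder_fam_bound[OF f_holder k(2)] by metis
    show ?thesis by (rule that[OF F(1)]) (use F(2,3)[of "[]"] in simp_all)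
  qed
  \<comment> \<open>Capacity above 1 admits the exponent 1, so \<open>f\<close> is Lipschitz at
    level \<open>l\<close>; together with continuity of \<open>w\<close> this makes the quadratic
    term of smaller order than \<open>h\<close>.\<close>
  obtain G where G: "G \<ge> 0" "\<And>u. u \<in> U \<Longrightarrow> f u \<in> X l" "\<And>u. u \<in> U \<Longrightarrow> N l (f u) \<le> G"
      "\<And>u v. u \<in> U \<Longrightarrow> v \<in> U \<Longrightarrow> N l (f v - f u) \<le> G * norm (v - u)"
  proof -
    obtain G where G: "G \<ge> 0" "\<And>hs u. length (hs::'b list) = 0 \<Longrightarrow> u \<in> U \<Longrightarrow> f u \<in> X l"
      "\<And>hs u. length (hs::'b list) = 0 \<Longrightarrow> u \<in> U \<Longrightarrow> N l (f u) \<le> G * wt hs"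
      "\<And>hs u v. length (hs::'b list) = 0 \<Longrightarrow> u \<in> U \<Longrightarrow> v \<in> U \<Longrightarrow> N l (f v - f u) \<le> G * wt hs * norm (v - u) powr 1"
      using holder_famD[OF f_holder _ _ l1] by (metis order_refl zero_less_one)
    show ?thesis by (rule that[OF G(1)]) (use G(2-4)[of "[]"] in simp_all)
  qed
  obtain P where P: "P \<ge> 0" "\<And>hs u. length hs = Suc 0 \<Longrightarrow> u \<in> U \<Longrightarrow> L' hs u \<in> OY l1"
    "\<And>hs u. length hs = Suc 0 \<Longrightarrow> u \<in> U \<Longrightarrow> ON l1 (L' hs u) \<le> P * wt hs"
    using holder_fam_bound[OF hL', of l1] k by auto
  have mL: "\<And>u. u \<in> U \<Longrightarrow> L u \<in> OY l1" using holder_fam_mem[OF hL] k by simp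
  have mf': "\<And>hs u. length hs = Suc 0 \<Longrightarrow> u \<in> U \<Longrightarrow> f' hs u \<in> X l" using f' l1 by simp
  show "(\<forall>hs h g a b. length hs = 0 \<longrightarrow>
        N l (f' ((a *\<^sub>R h + b *\<^sub>R g) # hs) u - a *\<^sub>R f' (h # hs) u - b *\<^sub>R f' (g # hs) u) = 0) \<and>
     (\<forall>e>0. \<exists>d>0. \<forall>hs h. length hs = 0 \<longrightarrow> norm h < d \<longrightarrow> u + h \<in> U \<longrightarrow>
        N l (f (u + h) - f u - f' (h # hs) u) \<le> e * norm h * wt hs)"
  proof (intro allI impI ballI conjI)
    fix hs :: "'b list" and h g' :: 'b and a a' :: real assume hs: "length hs = 0"
    let ?X = "f' ((a *\<^sub>R h + a' *\<^sub>R g') # hs) u - a *\<^sub>R f' (h # hs) u - a' *\<^sub>R f' (g' # hs) u"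
    let ?P = "L' ((a *\<^sub>R h + a' *\<^sub>R g') # hs) u - a *\<^sub>R L' (h # hs) u - a' *\<^sub>R L' (g' # hs) u"
    have P0: "?P \<in> OY l1" "ON l1 ?P \<le> 0"
      using P(2) hs u deriv_fam_lin[OF L' k(1) u hs, of a h a' g']
      by (auto intro!: O.L.diff_mem O.L.scale_mem)
    have X0: "?X \<in> X l" using mf' hs u by (auto intro!: O.T.diff_mem O.T.scale_mem)
    have mP: "?P (f u) \<in> X l" using O.mem[OF P0(1) F(2)[OF u]] .
    have nP: "N l (?P (f u)) \<le> 0" using M(2)[OF P0(1) F(2)[OF u] P0(2) F(3)[OF u]] by simp
    have e1: "A u ?X = A u (f' ((a *\<^sub>R h + a' *\<^sub>R g') # hs) u) - a *\<^sub>R A u (f' (h # hs) u) - a' *\<^sub>R A u (f' (g' # hs) u)"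
      using mf' hs u by (simp add: diff[OF c] scale[OF c] O.T.diff_mem O.T.scale_mem)
    have e2: "?P (f u) = L' ((a *\<^sub>R h + a' *\<^sub>R g') # hs) u (f u) - a *\<^sub>R L' (h # hs) u (f u) - a' *\<^sub>R L' (g' # hs) u (f u)"
      by (simp add: fun_diff_def scaleR_fun_def)
    have b_minus: "b (x - y) z = b x z - b y z" for x y z
      using b_add_left[of "x - y" y z] by (simp add: algebra_simps)
    have "A u ?X = ?P (f u) - b (?P (f u)) (f u)"
      unfolding e1 e2 using hs u by (simp add: eq' b_minus b_scale_left b_add_left algebra_simps)
    then have "N l ?X \<le> B * N l (?P (f u) - b (?P (f u)) (f u))" using B(2)[OF u X0] by simp
    also have "\<dots> \<le> B * (N l (?P (f u)) + N l (b (?P (f u)) (f u)))"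
      using mP G u by (intro mult_left_mono B O.T.triangle_diff b.mem) auto
    also have "\<dots> \<le> B * (0 + M' * (0 * G))"
      using mP nP G u by (intro mult_left_mono B add_mono M') auto
    finally show "N l ?X = 0" using O.T.nonneg[OF X0] by simp
  next
    fix e :: real assume e: "0 < e"
    define \<delta> where "\<delta> = F * M + M * P"
    define C where "C = 1 + B * (\<delta> + M' * (\<delta> * G) + M' * G)"
    have \<delta>: "\<delta> \<ge> 0" using F M P by (simp add: \<delta>_def)
    have C: "C > 0" using \<delta> B M' G by (auto simp: C_def intro!: add_pos_nonneg)
    define e' where "e' = e / C"
    have e': "e' > 0" using e C by (simp add: e'_def)
    obtain d1 where d1: "d1 > 0" "\<And>hs h. length hs = 0 \<Longrightarrow> norm h < d1 \<Longrightarrow> u + h \<in> U \<Longrightarrow>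
      ON l1 (L (u + h) - L u - L' (h # hs) u) \<le> e' * norm h * wt hs"
      using deriv_famD[OF L' k(1) u e'] by metis
    obtain d2 where d2: "d2 > 0" "\<And>hs u v. length hs = 0 \<Longrightarrow> u \<in> U \<Longrightarrow> v \<in> U \<Longrightarrow> norm (v - u) < d2 \<Longrightarrow>
      N l2 (f v - f u) \<le> e' * wt (hs::'b list)"
      using holder_fam_cont[OF f_holder k(2) e'] by metis
    have hw: "holder_fam U X N 0 cV (\<lambda>hs u. L u (f u))"
      using w_smooth[of 0] f_holder by simp
    obtain d3 where d3: "d3 > 0" "\<And>hs u v. length hs = 0 \<Longrightarrow> u \<in> U \<Longrightarrow> v \<in> U \<Longrightarrow> norm (v - u) < d3 \<Longrightarrow>
      N l (L v (f v) - L u (f u)) \<le> e' * wt (hs::'b list)"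
      using holder_fam_cont[OF hw c e'] by metis
    show "\<exists>d>0. \<forall>hs h. length hs = 0 \<longrightarrow> norm h < d \<longrightarrow> u + h \<in> U \<longrightarrow>
        N l (f (u + h) - f u - f' (h # hs) u) \<le> e * norm h * wt hs"
    proof (intro exI[of _ "min d1 (min d2 d3)"] conjI allI impI)
      fix hs :: "'b list" and h assume "length hs = 0" and h: "norm h < min d1 (min d2 d3)" "u + h \<in> U"
      then have hs: "hs = []" by simp
      define v where "v = u + h"
      have v: "v \<in> U" "norm (v - u) < d2" "norm (v - u) < d3" using h by (auto simp: v_def)
      define d where "d = L v (f v) - L u (f v)"
      define z where "z = L' [h] u (f u)"
      define D where "D = d - z"
      define x where "x = f' [h] u"
      note Lu = L_mem[OF l u] and Lv = L_mem[OF l v(1)]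
      have m: "f u \<in> X l" "f v \<in> X l" "x \<in> X l" "L u (f u) \<in> X l" "L v (f v) \<in> X l" "L u (f v) \<in> X l" "z \<in> X l" "d \<in> X l"
        using G(2) mf' u v op_space_mem[OF Lu] op_space_mem[OF Lv] O.mem[OF P(2) F(2)]
        by (auto simp: x_def z_def d_def intro!: O.T.diff_mem)
      have m2: "f v \<in> X l2" "f u \<in> X l2" "f v - f u \<in> X l2" "L v - L u - L' [h] u \<in> OY l1" "L' [h] u \<in> OY l1"
        using F u v mL P by (auto intro!: O.R.diff_mem O.L.diff_mem)
      have m3: "D \<in> X l" "f v - f u \<in> X l" "f v - f u - x \<in> X l" "L v (f v) - L u (f u) \<in> X l"
        using m by (auto simp: D_def intro!: O.T.diff_mem)
      have D_eq: "D = (L v - L u - L' [h] u) (f v) + L' [h] u (f v - f u)"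
        using O.diff_right[OF m2(5,1,2)] by (simp add: D_def d_def z_def fun_diff_def)
      have f1: "ON l1 (L v - L u - L' [h] u) \<le> e' * norm h" using d1(2)[of "[]" h] h by (simp add: v_def)
      have f2: "N l2 (f v - f u) \<le> e'" using d2(2)[of "[]" u v] u v by simp
      have f3: "N l (L v (f v) - L u (f u)) \<le> e'" using d3(2)[of "[]" u v] u v by simp
      have f4: "ON l1 (L' [h] u) \<le> P * norm h" using P(3)[of "[h]" u] u by simp
      have f5: "N l (f v - f u) \<le> G * norm h" using G(4)[OF u v(1)] by (simp add: v_def)
      have "N l D \<le> N l ((L v - L u - L' [h] u) (f v)) + N l (L' [h] u (f v - f u))"
        unfolding D_eq using m2 by (intro O.T.triangle O.mem)
      also have "\<dots> \<le> M * ((e' * norm h) * F) + M * ((P * norm h) * e')"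
        using m2 f1 f2 f4 F(3)[OF v(1)] by (intro add_mono M)
      also have "\<dots> = \<delta> * (e' * norm h)" by (simp add: \<delta>_def algebra_simps)
      finally have ND: "N l D \<le> \<delta> * (e' * norm h)" .
      have wv: "L v (f v) = b (L v (f v)) (f v)" and wu: "L u (f u) = b (L u (f u)) (f u)"
        using f_eq u v by auto
      have Luv: "L u (f v) = L v (f v) - d" by (simp add: d_def)
      have "A u (f v - f u - x) = A u (f v) - A u (f u) - A u x"
        using m u m3 by (simp add: diff[OF c])
      also have "A u x = z - b z (f u)" using eq'[of "[h]" u] u by (simp add: x_def z_def)
      also have "A u (f u) = L u (f u)" unfolding A_def using wu by simp
      also have "A u (f v) = b (L u (f u)) (f v) - (L v (f v) - d) + (b (L v (f v)) (f u) - b d (f u))"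
        unfolding A_def Luv using m by (simp add: b.diff_left)
      also have "b (L u (f u)) (f v) - (L v (f v) - d) + (b (L v (f v)) (f u) - b d (f u)) - L u (f u) - (z - b z (f u))
          = D - b D (f u) - b (L v (f v) - L u (f u)) (f v - f u)"
      proof -
        have "b (L v (f v) - L u (f u)) (f v - f u) =
            L v (f v) - b (L v (f v)) (f u) - (b (L u (f u)) (f v) - L u (f u))"
          using m m3 wv[symmetric] wu[symmetric] by (simp add: b.diff_left b.diff_right)
        moreover have "b D (f u) = b d (f u) - b z (f u)" unfolding D_def using m by (simp add: b.diff_left)
        ultimately show ?thesis by (simp add: D_def algebra_simps)
      qed
      finally have Aeq: "A u (f v - f u - x) = D - b D (f u) - b (L v (f v) - L u (f u)) (f v - f u)" .
      have "N l (f v - f u - x) \<le> B * N l (D - b D (f u) - b (L v (f v) - L u (f u)) (f v - f u))"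
        using B(2)[OF u m3(3)] Aeq by simp
      also have "\<dots> \<le> B * (N l D + N l (b D (f u)) + N l (b (L v (f v) - L u (f u)) (f v - f u)))"
        using m m3 by (intro mult_left_mono B order_trans[OF O.T.triangle_diff] add_mono order_refl O.T.diff_mem b.mem O.T.triangle_diff)
      also have "\<dots> \<le> B * (\<delta> * (e' * norm h) + M' * (\<delta> * (e' * norm h) * G) + M' * (e' * (G * norm h)))"
        using m m3 ND f3 f5 G(3)[OF u] by (intro mult_left_mono B add_mono M')
      also have "\<dots> = e' * (B * (\<delta> + M' * (\<delta> * G) + M' * G)) * norm h"
        by (simp add: algebra_simps)
      also have "\<dots> \<le> e' * C * norm h"
        using e' by (intro mult_right_mono mult_left_mono) (auto simp: C_def)
      also have "e' * C = e" using C by (simp add: e'_def)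
      finally show "N l (f (u + h) - f u - f' (h # hs) u) \<le> e * norm h * wt hs"
        by (simp add: v_def x_def hs)
    qed (use d1 d2 d3 in auto)
  qed
qed

text \<open>Bootstrapping: order \<open>k\<close> of \<open>f\<close> gives order \<open>k\<close>
  of \<open>A\<close> and of \<open>y = L' f - b (L' f) f\<close>. The derivative of
  \<open>f\<close> solves \<open>A u f' = y\<close> with one unit of capacity less, hence has order
  \<open>k\<close>, and \<open>f\<close> has order \<open>k + 1\<close>.\<close>

theorem f_smooth: "smooth_fam U X N k 0 cV (\<lambda>hs. f)"
proof (induction k)
  case 0
  show ?case using f_holder by simp
next
  case (Suc k)
  obtain L' where L': "deriv_fam U OY ON 0 cO (\<lambda>hs. L) L'" "smooth_fam U OY ON k (Suc 0) (\<lambda>l. cO l - 1) L'"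
    using L_smooth[of "Suc k"] by auto
  define z where "z = (\<lambda>hs u. L' hs u (f u))"
  have z: "smooth_fam U X N k (Suc 0) (\<lambda>l. cV l - 1) z"
    unfolding z_def
  proof (rule smooth_fam_bilin[where ?s1.0 = id and ?s2.0 = "\<lambda>_. []", OF _ _ L'(2) Suc.IH, unfolded id_def])
    show "\<exists>l1 l2. q1 < cO l1 - 1 \<and> q2 < cV l2 \<and> bilin (OY l1) (ON l1) (X l2) (N l2) (X l) (N l) (\<lambda>T x. T x)"
      if "0 \<le> q1" "0 \<le> q2" "q1 + q2 < cV l - 1" for l q1 q2
      using split[of "q1 + 1" q2 l] that by (force simp: algebra_simps)
  qed auto
  have bz: "smooth_fam U X N k (Suc 0) (\<lambda>l. cV l - 1) (\<lambda>hs u. b (z hs u) (f u))"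
  proof (rule smooth_fam_bilin[where ?s1.0 = id and ?s2.0 = "\<lambda>_. []", OF _ _ z Suc.IH, unfolded id_def])
    show "\<exists>l1 l2. q1 < cV l1 - 1 \<and> q2 < cV l2 \<and> bilin (X l1) (N l1) (X l2) (N l2) (X l) (N l) b"
      if "0 \<le> q1" "0 \<le> q2" "q1 + q2 < cV l - 1" for l q1 q2
      using that cV_pos[of "q1 + q2 + 1" l] b[of l] by (intro exI[of _ l]) auto
  qed auto
  define y where "y = (\<lambda>hs u. z hs u - b (z hs u) (f u))"
  have y: "smooth_fam U X N k (Suc 0) (\<lambda>l. cV l - 1) y"
    unfolding y_def using sn by (intro smooth_fam_diff z bz) auto
  define f' where "f' = (\<lambda>hs u. g u (y hs u))"
  show ?case
  \<comment> \<open>The level \<sigma> has the largest capacity. If it exceeds 1, membership of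
    \<open>y\<close> in that level alone yields the equation for \<open>f'\<close>, which does not
    mention a level; otherwise there is no derivative condition to meet.\<close>
  proof (cases "0 < cV \<sigma> - 1")
    case True
    have mf': "f' hs u \<in> X l" if "0 < cV l - 1" "length hs = Suc 0" "u \<in> U" for l hs u
      unfolding f'_def using inv_mem[of l u "y hs u"] cV_pos[of 1 l] holder_fam_mem[OF smooth_fam_holder[OF y] that(1-3)] that
      by auto
    have eq': "A u (f' hs u) = y hs u" if "length hs = Suc 0" "u \<in> U" for hs u
      unfolding f'_def using inv[of \<sigma> u "y hs u"] cV_pos[of 1 \<sigma>] holder_fam_mem[OF smooth_fam_holder[OF y] True that] True that
      by auto
    have "smooth_fam U X N k (Suc 0) (\<lambda>l. cV l - 1) f'"
      by (rule smooth_fam_solve[where \<beta> = "\<lambda>T x. T x" and A = A and x = f' and y = y, OF reduced A_smooth[OF Suc.IH] y mf' eq'])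
    moreover have "deriv_fam U X N 0 cV (\<lambda>hs. f) f'"
      by (rule f_deriv[OF L'(1) smooth_fam_holder[OF L'(2)] mf']) (auto simp: eq' y_def z_def)
    ultimately show ?thesis using f_holder by auto
  next
    case False
    have le: "cV l \<le> 1" for l using False by (auto simp: cV_def split: if_splits)
    have "deriv_fam U X N 0 cV (\<lambda>hs. f) y"
      unfolding deriv_fam_def using le by (smt (verit))
    then show ?thesis using f_holder y by auto
  qed
qed

end

section \<open>Contraction of cones\<close>

locale cone_space =
  fixes E :: "'v::real_vector set" and n :: "'v \<Rightarrow> real" and C :: "'v set" and ell :: "'v \<Rightarrow> real"
    and K \<rho> :: real
  assumes banach: "banach_subspace E n" and cone: "closed_convex_cone E n C"
    and ell: "bounded_linear_on E n UNIV abs ell" and ell_norm: "opnorm E n abs ell = 1"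
    and K: "1 \<le> K" and \<rho>: "0 < \<rho>" "\<rho> \<le> 1"
    and ell_low: "\<forall>\<phi>\<in>C. ell \<phi> \<ge> n \<phi> / K"
begin

lemma normed: "normed_subspace E n"
  using banach by (simp add: banach_subspace_def)

sublocale seminormed_space E n
  by (rule normed_subspace_seminormed[OF normed])

abbreviation "CR \<equiv> cone_rho E n C \<rho>"

lemma C_E: "x \<in> C \<Longrightarrow> x \<in> E"
  using cone by (auto simp: closed_convex_cone_def)

lemma C_scale: "x \<in> C \<Longrightarrow> 0 \<le> c \<Longrightarrow> c *\<^sub>R x \<in> C"
  using cone by (auto simp: closed_convex_cone_def)

lemma C_zero: "0 \<in> C"
  using cone C_scale[of _ 0] by (auto simp: closed_convex_cone_def)

lemma C_add:
  assumes "x \<in> C" "y \<in> C"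
  shows "x + y \<in> C"
proof -
  have "\<forall>x\<in>C. \<forall>y\<in>C. \<forall>a. 0 \<le> a \<and> a \<le> 1 \<longrightarrow> a *\<^sub>R x + (1 - a) *\<^sub>R y \<in> C"
    using cone unfolding closed_convex_cone_def by (elim conjE)
  from this[rule_format, OF assms, of "1/2"] have "(1/2) *\<^sub>R x + (1/2) *\<^sub>R y \<in> C" by simp
  from C_scale[OF this, of 2] show ?thesis by (simp add: scaleR_right_distrib)
qed

lemma CR_C: "x \<in> CR \<Longrightarrow> x \<in> C"
  by (simp add: cone_rho_def)

lemma CR_add: "x \<in> CR \<Longrightarrow> y \<in> E \<Longrightarrow> n y < \<rho> * n x \<Longrightarrow> x + y \<in> C"
  unfolding cone_rho_def using add_mem[OF C_E] by auto

lemma CR_diff: "x \<in> CR \<Longrightarrow> y \<in> E \<Longrightarrow> n y < \<rho> * n x \<Longrightarrow> x - y \<in> C"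
  using CR_add[of x "- y"] norm_minus[of y] subspace_neg[OF subspace, of y] by simp

lemma CR_scale:
  assumes x: "x \<in> CR" and c: "0 \<le> c"
  shows "c *\<^sub>R x \<in> CR"
proof (cases "c = 0")
  case True
  \<comment> \<open>At 0 the ball in \<open>cone_rho\<close> has radius 0 and is empty, so the
    condition holds trivially.\<close>
  then show ?thesis using C_zero norm_zero nonneg by (force simp: cone_rho_def)
next
  case False
  then have c: "c > 0" using c by simp
  show ?thesis unfolding cone_rho_def
  proof (intro CollectI conjI ballI impI)
    show "c *\<^sub>R x \<in> C" using C_scale[OF CR_C[OF x]] c by simp
    fix y assume y: "y \<in> E" "n (y - c *\<^sub>R x) < \<rho> * n (c *\<^sub>R x)"
    have xE: "x \<in> E" using C_E[OF CR_C[OF x]] .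
    define z where "z = (1 / c) *\<^sub>R (y - c *\<^sub>R x)"
    have zE: "z \<in> E" unfolding z_def using y xE by (intro scale_mem diff_mem) auto
    have "n z = n (y - c *\<^sub>R x) / c"
      unfolding z_def using y(1) c xE scale[of "y - c *\<^sub>R x" "1 / c"] by (simp add: diff_mem scale_mem)
    also have "\<dots> < \<rho> * n x"
      using y c xE by (simp add: scale pos_divide_less_eq mult_ac)
    finally have "n z < \<rho> * n x" .
    from C_scale[OF CR_add[OF x zE this], of c] show "y \<in> C" using c by (simp add: z_def scaleR_right_distrib)
  qed
qed

lemma ell_op: "ell \<in> op_space E n UNIV abs"
  using ell by (simp add: op_space_def)

lemmas ell_add = op_space_add[OF ell_op]
lemmas ell_diff = op_space_diff[OF ell_op]
lemmas ell_scale = op_space_scale[OF ell_op]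

lemma abs_seminormed: "seminormed_space (UNIV::real set) abs"
  by unfold_locales (auto simp: abs_mult)

lemma ell_le: "x \<in> E \<Longrightarrow> \<bar>ell x\<bar> \<le> n x"
  using opnorm_bound[OF ell_op seminormed_space_axioms abs_seminormed, of x] ell_norm by simp

lemma norm_le_ell: "x \<in> C \<Longrightarrow> n x \<le> K * ell x"
  using ell_low K by (force simp: field_simps)

lemma ell_nonneg: "x \<in> C \<Longrightarrow> 0 \<le> ell x"
  using norm_le_ell[of x] nonneg[OF C_E, of x] K by (smt (verit) mult_pos_neg)

lemma norm_ge_1: "x \<in> C \<Longrightarrow> ell x = 1 \<Longrightarrow> 1 \<le> n x"
  using ell_le[OF C_E, of x] by simp

lemma norm_le_K: "x \<in> C \<Longrightarrow> ell x = 1 \<Longrightarrow> n x \<le> K"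
  using norm_le_ell[of x] by simp

text \<open>Contraction factor of an order interval. In \<open>\<rho> / (4 * K)\<close> one factor 2
  comes from keeping the half of the interval with the larger mass, the other makes an estimate
  strict, and \<open>K\<close> bounds the norm of a cone vector of mass 1.\<close>

definition \<gamma> :: real where "\<gamma> = 1 - \<rho> / (4 * K)"

lemma \<gamma>: "0 < \<gamma>" "\<gamma> < 1"
  using K \<rho> by (auto simp: \<gamma>_def field_simps)

definition pos_op :: "('v \<Rightarrow> 'v) \<Rightarrow> bool" where
  "pos_op T \<longleftrightarrow> T \<in> op_space E n E n \<and> T ` (C - {0}) \<subseteq> CR - {0}"

lemma pos_op_op: "pos_op T \<Longrightarrow> T \<in> op_space E n E n"
  by (simp add: pos_op_def)

lemma pos_op_CR: "pos_op T \<Longrightarrow> x \<in> C \<Longrightarrow> x \<noteq> 0 \<Longrightarrow> T x \<in> CR"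
  unfolding pos_op_def by auto

lemma pos_op_C: "pos_op T \<Longrightarrow> x \<in> C \<Longrightarrow> T x \<in> C"
  using pos_op_CR[of T x] CR_C op_space_scale[OF pos_op_op, of T 0 0] C_zero zero_mem by (cases "x = 0") auto

text \<open>Of the two elements \<open>x - a f\<close> and \<open>b f - x\<close> of the cone one has at least half of the mass of
their sum \<open>(b - a) f\<close>, and its image dominates a fixed fraction of \<open>(b - a) T f\<close>.\<close>

lemma interval_step:
  assumes T: "pos_op T" and f: "f \<in> C" and f1: "f1 \<in> C" "ell f1 = 1" "T f = \<Lambda> *\<^sub>R f1" "0 < \<Lambda>"
    and x: "x \<in> E" "x - a *\<^sub>R f \<in> C" "b *\<^sub>R f - x \<in> C" and ab: "a \<le> b"
  obtains a' b' where "a \<le> a'" "b' \<le> b" "b' - a' = \<gamma> * (b - a)" "T x - a' *\<^sub>R T f \<in> C" "b' *\<^sub>R T f - T x \<in> C"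
proof -
  note Top = pos_op_op[OF T]
  have fE: "f \<in> E" and f1E: "f1 \<in> E" using f f1 C_E by auto
  define y where "y = T x - a *\<^sub>R T f"
  define z where "z = b *\<^sub>R T f - T x"
  have yT: "y = T (x - a *\<^sub>R f)" and zT: "z = T (b *\<^sub>R f - x)"
    using x fE by (auto simp: y_def z_def op_space_diff[OF Top] op_space_scale[OF Top] scale_mem)
  have yC: "y \<in> C" and zC: "z \<in> C" unfolding yT zT using T x by (auto intro: pos_op_C)
  have "y + z = ((b - a) * \<Lambda>) *\<^sub>R f1" by (simp add: y_def z_def f1 algebra_simps)
  then have sum: "ell y + ell z = (b - a) * \<Lambda>"
    using ell_add[of y z] yC zC C_E ell_scale[OF f1E] f1 by simp
  have key: "w - (\<rho> / (4 * K) * (b - a)) *\<^sub>R T f \<in> C"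
    if w: "w \<in> C" "w = T w'" "w' \<in> C" "(b - a) * \<Lambda> / 2 \<le> ell w" for w w'
  proof (cases "b = a")
    case False
    then have ba: "b - a > 0" using ab by simp
    then have p: "(b - a) * \<Lambda> > 0" using f1 by simp
    have "w' \<noteq> 0"
    proof
      assume "w' = 0"
      then have "w = 0" using w op_space_scale[OF Top zero_mem, of 0] by simp
      then have "ell w = 0" using ell_scale[OF zero_mem, of 0] by simp
      then show False using w p by simp
    qed
    then have wCR: "w \<in> CR" using w pos_op_CR[OF T] by simp
    \<comment> \<open>The vector to be subtracted must be shorter than \<open>\<rho> * n w\<close>,
      and \<open>n w\<close> is at least the mass \<open>(b - a) * \<Lambda> / 2\<close> of
      \<open>w\<close>.\<close>
    have "n ((\<rho> / (4 * K) * (b - a)) *\<^sub>R T f) = \<rho> / (4 * K) * ((b - a) * \<Lambda>) * n f1"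
      using f1 f1E K \<rho> ba by (simp add: scale scale_mem abs_mult)
    also have "\<dots> \<le> \<rho> / (4 * K) * ((b - a) * \<Lambda>) * K"
      using norm_le_K[OF f1(1,2)] K \<rho> p by (intro mult_left_mono) auto
    also have "\<dots> = \<rho> * ((b - a) * \<Lambda> / 4)" using K by simp
    also have "\<dots> < \<rho> * ((b - a) * \<Lambda> / 2)" using p \<rho> by (intro mult_strict_left_mono) linarith+
    also have "\<dots> \<le> \<rho> * n w" using w(4) ell_le[OF C_E[OF w(1)]] \<rho> by (intro mult_left_mono) auto
    finally show ?thesis using wCR f1 f1E by (intro CR_diff) (auto simp: scale_mem)
  qed (use w in simp)
  show ?thesis
  proof (cases "(b - a) * \<Lambda> / 2 \<le> ell y")
    case True
    have "y - (\<rho> / (4 * K) * (b - a)) *\<^sub>R T f \<in> C" by (rule key[OF yC yT x(2) True])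
    then have "T x - (a + \<rho> / (4 * K) * (b - a)) *\<^sub>R T f \<in> C" by (simp add: y_def algebra_simps)
    then show ?thesis using K \<rho> ab zC
      by (intro that[of "a + \<rho> / (4 * K) * (b - a)" b]) (auto simp: \<gamma>_def z_def algebra_simps)
  next
    case False
    then have "(b - a) * \<Lambda> / 2 \<le> ell z" using sum by simp
    then have "z - (\<rho> / (4 * K) * (b - a)) *\<^sub>R T f \<in> C" by (rule key[OF zC zT x(3)])
    then have "(b - \<rho> / (4 * K) * (b - a)) *\<^sub>R T f - T x \<in> C" by (simp add: z_def algebra_simps)
    then show ?thesis using K \<rho> ab yC
      by (intro that[of a "b - \<rho> / (4 * K) * (b - a)"]) (auto simp: \<gamma>_def y_def algebra_simps)
  qed
qed

text \<open>The lower bound on the operator norm concerns vectors \<open>x\<close> that may lie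
  outside the cone. Since \<open>f\<close> is interior, \<open>f + (\<rho> / 2) x\<close> and
  \<open>f - (\<rho> / 2) x\<close> are in the cone, and so are their images. The difference of the
  images is \<open>\<rho> T x\<close>, while their masses add up to twice the mass of
  \<open>T f\<close>; on the cone the norm is at most \<open>K\<close> times the mass.\<close>

lemma mass_lower_bound:
  assumes T: "pos_op T" and \<theta>: "1 \<le> \<theta>" "1 / \<theta> \<le> opnorm E n n T" and f: "f \<in> CR" "ell f = 1"
  shows "\<rho> / (4 * K * \<theta>) \<le> ell (T f)"
proof -
  note Top = pos_op_op[OF T]
  have fC: "f \<in> C" and fE: "f \<in> E" using f CR_C C_E by auto
  \<comment> \<open>The supremum need not be attained, so half of its lower bound is used.\<close>
  have "\<exists>x\<in>E. n x \<le> 1 \<and> 1 / (2 * \<theta>) < n (T x)"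
  proof (rule ccontr)
    assume *: "\<not> (\<exists>x\<in>E. n x \<le> 1 \<and> 1 / (2 * \<theta>) < n (T x))"
    have "opnorm E n n T \<le> 1 / (2 * \<theta>)"
      unfolding opnorm_def using * zero_mem norm_zero
      by (intro cSup_least) (auto simp: not_less intro!: exI[of _ 0])
    then show False using \<theta> by (simp add: field_simps)
  qed
  then obtain x where x: "x \<in> E" "n x \<le> 1" "1 / (2 * \<theta>) < n (T x)" by auto
  let ?x = "(\<rho> / 2) *\<^sub>R x"
  have xE: "?x \<in> E" using x by (intro scale_mem)
  have "n ?x \<le> \<rho> / 2" using x \<rho> by (simp add: scale mult_left_le)
  also have "\<dots> < \<rho> * n f" using mult_left_mono[OF norm_ge_1[OF fC f(2)], of \<rho>] \<rho> by simp
  finally have lt: "n ?x < \<rho> * n f" .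
  have y1: "T f + T ?x \<in> C" using pos_op_C[OF T CR_add[OF f(1) xE lt]] op_space_add[OF Top fE xE] by simp
  have y2: "T f - T ?x \<in> C" using pos_op_C[OF T CR_diff[OF f(1) xE lt]] op_space_diff[OF Top fE xE] by simp
  have m: "T f \<in> E" "T ?x \<in> E" "T x \<in> E" using op_space_mem[OF Top] fE xE x by auto
  have "\<rho> * n (T x) = n ((T f + T ?x) - (T f - T ?x))"
  proof -
    have "(T f + T ?x) - (T f - T ?x) = \<rho> *\<^sub>R T x"
      using op_space_scale[OF Top x(1), of "\<rho> / 2"] by (simp flip: scaleR_left.add)
    then show ?thesis using m \<rho> by (simp add: scale)
  qed
  also have "\<dots> \<le> n (T f + T ?x) + n (T f - T ?x)" using m by (intro triangle_diff add_mem diff_mem)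
  also have "\<dots> \<le> K * ell (T f + T ?x) + K * ell (T f - T ?x)" by (intro add_mono norm_le_ell y1 y2)
  also have "\<dots> = 2 * K * ell (T f)" using m by (simp add: ell_add ell_diff algebra_simps)
  finally have "\<rho> * n (T x) \<le> 2 * K * ell (T f)" .
  moreover have "\<rho> * (1 / (2 * \<theta>)) \<le> \<rho> * n (T x)" using x \<rho> by (intro mult_left_mono) auto
  ultimately have "\<rho> * (1 / (2 * \<theta>)) \<le> 2 * K * ell (T f)" by simp
  then show ?thesis using K \<theta> by (simp add: field_simps)
qed

text \<open>Both \<open>x - a f\<close> and \<open>(t - a) f\<close> are cone vectors of mass
  \<open>t - a\<close>, so each has norm at most \<open>K * (t - a)\<close>, and their difference is
  \<open>x - t f\<close>.\<close>

lemma between_norm: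
  assumes f: "f \<in> C" "ell f = 1" and x: "x \<in> E" "x - a *\<^sub>R f \<in> C" "b *\<^sub>R f - x \<in> C" and t: "ell x = t"
  shows "a \<le> t" "t \<le> b" "n (x - t *\<^sub>R f) \<le> 2 * K * (b - a)"
proof -
  have fE: "f \<in> E" using f C_E by auto
  have e1: "ell (x - a *\<^sub>R f) = t - a" "ell (b *\<^sub>R f - x) = b - t"
    using x fE f t by (auto simp: ell_diff ell_scale scale_mem)
  show a: "a \<le> t" and b: "t \<le> b" using ell_nonneg[OF x(2)] ell_nonneg[OF x(3)] e1 by auto
  have "x - t *\<^sub>R f = (x - a *\<^sub>R f) - (t - a) *\<^sub>R f" by (simp add: algebra_simps)
  then have "n (x - t *\<^sub>R f) \<le> n (x - a *\<^sub>R f) + n ((t - a) *\<^sub>R f)"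
    using x fE by (metis triangle_diff diff_mem scale_mem)
  also have "\<dots> \<le> K * (t - a) + (t - a) * K"
    using norm_le_ell[OF x(2)] norm_le_K[OF f] a e1 fE by (intro add_mono) (auto simp: scale mult_left_mono)
  also have "\<dots> \<le> 2 * K * (b - a)" using b K by (simp add: algebra_simps)
  finally show "n (x - t *\<^sub>R f) \<le> 2 * K * (b - a)" .
qed

end

section \<open>Cocycles of cone contractions with an invariant section\<close>

locale cone_cocycle = cone_space E n C ell K \<rho>
  for E :: "'v::real_vector set" and n C ell K \<rho> +
  fixes \<Omega> :: "'w set" and \<pi> :: "'w \<Rightarrow> 'w" and T :: "'w \<Rightarrow> 'v \<Rightarrow> 'v" and f :: "'w \<Rightarrow> 'v" and \<Lambda> :: "'w \<Rightarrow> real"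
  assumes \<pi>: "\<omega> \<in> \<Omega> \<Longrightarrow> \<pi> \<omega> \<in> \<Omega>"
    and T: "\<omega> \<in> \<Omega> \<Longrightarrow> pos_op (T \<omega>)"
    and f: "\<omega> \<in> \<Omega> \<Longrightarrow> f \<omega> \<in> CR" "\<omega> \<in> \<Omega> \<Longrightarrow> ell (f \<omega>) = 1"
    and eig: "\<omega> \<in> \<Omega> \<Longrightarrow> T (\<pi> \<omega>) (f (\<pi> \<omega>)) = \<Lambda> \<omega> *\<^sub>R f \<omega>"
    and \<Lambda>: "\<omega> \<in> \<Omega> \<Longrightarrow> 0 < \<Lambda> \<omega>"
begin

lemma f': "\<omega> \<in> \<Omega> \<Longrightarrow> f \<omega> \<in> C" "\<omega> \<in> \<Omega> \<Longrightarrow> f \<omega> \<in> E" "\<omega> \<in> \<Omega> \<Longrightarrow> 1 \<le> n (f \<omega>)" "\<omega> \<in> \<Omega> \<Longrightarrow> n (f \<omega>) \<le> K"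
  using f CR_C C_E norm_ge_1 norm_le_K by auto

text \<open>The derivative at \<open>f\<close> of the normalised map that sends \<psi> to its image
  divided by the mass of that image: the operator divided by \<Lambda>, followed by the projection
  along \<open>f\<close> onto the kernel of \<open>ell\<close>.\<close>

definition P :: "('w \<Rightarrow> 'v) \<Rightarrow> 'w \<Rightarrow> 'v" where
  "P \<psi> \<omega> = (1 / \<Lambda> \<omega>) *\<^sub>R (T (\<pi> \<omega>) (\<psi> (\<pi> \<omega>)) - ell (T (\<pi> \<omega>) (\<psi> (\<pi> \<omega>))) *\<^sub>R f \<omega>)"

lemma T_mem: "\<omega> \<in> \<Omega> \<Longrightarrow> x \<in> E \<Longrightarrow> T \<omega> x \<in> E"
  using op_space_mem[OF pos_op_op[OF T]] .

lemma P_mem: "(\<And>\<omega>. \<omega> \<in> \<Omega> \<Longrightarrow> \<psi> \<omega> \<in> E) \<Longrightarrow> \<omega> \<in> \<Omega> \<Longrightarrow> P \<psi> \<omega> \<in> E"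
  unfolding P_def using \<pi> T_mem f' by (intro scale_mem diff_mem) auto

lemma P_ell:
  assumes "\<And>\<omega>. \<omega> \<in> \<Omega> \<Longrightarrow> \<psi> \<omega> \<in> E" "\<omega> \<in> \<Omega>"
  shows "ell (P \<psi> \<omega>) = 0"
proof -
  have "T (\<pi> \<omega>) (\<psi> (\<pi> \<omega>)) \<in> E" using assms \<pi> T_mem by auto
  then show ?thesis unfolding P_def using f f' assms
    by (simp add: ell_scale ell_diff scale_mem diff_mem)
qed

text \<open>Subtracting a multiple of \<open>f\<close> shifts both ends of an order interval by the
  same amount. Its length therefore depends on \<open>T\<close> alone, which shrinks it by
  \<gamma>.\<close>

lemma P_between:
  assumes \<psi>: "\<And>\<omega>. \<omega> \<in> \<Omega> \<Longrightarrow> \<psi> \<omega> \<in> E" and D: "0 \<le> D"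
    and bt: "\<And>\<omega>. \<omega> \<in> \<Omega> \<Longrightarrow> \<exists>a. \<psi> \<omega> - a *\<^sub>R f \<omega> \<in> C \<and> (a + D) *\<^sub>R f \<omega> - \<psi> \<omega> \<in> C" and \<omega>: "\<omega> \<in> \<Omega>"
  shows "\<exists>a. P \<psi> \<omega> - a *\<^sub>R f \<omega> \<in> C \<and> (a + \<gamma> * D) *\<^sub>R f \<omega> - P \<psi> \<omega> \<in> C"
proof -
  define v where "v = \<pi> \<omega>"
  have v: "v \<in> \<Omega>" using \<pi> \<omega> by (simp add: v_def)
  obtain a where a: "\<psi> v - a *\<^sub>R f v \<in> C" "(a + D) *\<^sub>R f v - \<psi> v \<in> C" using bt[OF v] by auto
  have le: "a \<le> a + D" using D by simp
  obtain a' b' where a': "b' - a' = \<gamma> * (a + D - a)" "T v (\<psi> v) - a' *\<^sub>R T v (f v) \<in> C" "b' *\<^sub>R T v (f v) - T v (\<psi> v) \<in> C"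
    using interval_step[OF T[OF v] f'(1)[OF v] f'(1)[OF \<omega>] f(2)[OF \<omega>] eig[OF \<omega>, folded v_def] \<Lambda>[OF \<omega>] \<psi>[OF v] a le]
    by metis
  have b': "b' = a' + \<gamma> * D" using a'(1) by simp
  define c where "c = ell (T v (\<psi> v)) / \<Lambda> \<omega>"
  have eigv: "T v (f v) = \<Lambda> \<omega> *\<^sub>R f \<omega>" using eig[OF \<omega>] by (simp add: v_def)
  have e1: "P \<psi> \<omega> - (a' - c) *\<^sub>R f \<omega> = (1 / \<Lambda> \<omega>) *\<^sub>R (T v (\<psi> v) - a' *\<^sub>R T v (f v))"
    unfolding P_def v_def[symmetric] eigv using \<Lambda>[OF \<omega>] by (simp add: c_def algebra_simps)
  have e2: "(a' - c + \<gamma> * D) *\<^sub>R f \<omega> - P \<psi> \<omega> = (1 / \<Lambda> \<omega>) *\<^sub>R (b' *\<^sub>R T v (f v) - T v (\<psi> v))"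
    unfolding P_def v_def[symmetric] eigv b' using \<Lambda>[OF \<omega>] by (simp add: c_def algebra_simps)
  have "P \<psi> \<omega> - (a' - c) *\<^sub>R f \<omega> \<in> C" "(a' - c + \<gamma> * D) *\<^sub>R f \<omega> - P \<psi> \<omega> \<in> C"
    unfolding e1 e2 using a' \<Lambda>[OF \<omega>] by (auto intro!: C_scale)
  then show ?thesis by blast
qed

lemma P_power_bound:
  assumes \<psi>: "\<And>\<omega>. \<omega> \<in> \<Omega> \<Longrightarrow> \<psi> \<omega> \<in> E" "\<And>\<omega>. \<omega> \<in> \<Omega> \<Longrightarrow> n (\<psi> \<omega>) \<le> m" and \<omega>: "\<omega> \<in> \<Omega>"
  shows "n ((P ^^ k) \<psi> \<omega>) \<le> 8 * K / \<rho> * \<gamma> ^ k * m"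
proof -
  \<comment> \<open>With this length \<open>(2 / D) * \<psi>\<close> has norm at most
    \<open>\<rho> / 2\<close>, below the radius of a ball around \<open>f\<close> inside the cone,
    and so \<psi> lies between \<open>- (D / 2) f\<close> and \<open>(D / 2) f\<close>.\<close>
  define D where "D = 4 * m / \<rho>"
  have m: "0 \<le> m" using nonneg[OF \<psi>(1)[OF \<omega>]] \<psi>(2)[OF \<omega>] by simp
  have D: "0 \<le> D" using m \<rho> by (simp add: D_def)
  have init: "\<exists>a. \<psi> \<omega> - a *\<^sub>R f \<omega> \<in> C \<and> (a + D) *\<^sub>R f \<omega> - \<psi> \<omega> \<in> C" if \<omega>: "\<omega> \<in> \<Omega>" for \<omega>
  proof (cases "m = 0")
    case True
    then have "\<psi> \<omega> = 0" using \<psi>[OF \<omega>] nonneg[OF \<psi>(1)[OF \<omega>]] normed_subspace_eq_0[OF normed \<psi>(1)[OF \<omega>]] by simp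
    then show ?thesis using True C_zero by (intro exI[of _ 0]) (simp add: D_def)
  next
    case False
    then have mp: "m > 0" using m by simp
    then have Dp: "D > 0" using \<rho> by (simp add: D_def)
    let ?y = "(2 / D) *\<^sub>R \<psi> \<omega>"
    have y: "?y \<in> E" using \<psi>[OF \<omega>] by (intro scale_mem)
    have "n ?y \<le> 2 / D * m" using \<psi>[OF \<omega>] Dp by (simp add: scale divide_right_mono)
    also have "\<dots> = \<rho> / 2" using mp by (simp add: D_def)
    also have "\<dots> < \<rho> * n (f \<omega>)" using mult_left_mono[OF f'(3)[OF \<omega>], of \<rho>] \<rho> by simp
    finally have "f \<omega> + ?y \<in> C" "f \<omega> - ?y \<in> C" using CR_add CR_diff f(1)[OF \<omega>] y by auto
    from C_scale[OF this(1), of "D / 2"] C_scale[OF this(2), of "D / 2"] Dp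
    have "\<psi> \<omega> - (- D / 2) *\<^sub>R f \<omega> \<in> C" "(- D / 2 + D) *\<^sub>R f \<omega> - \<psi> \<omega> \<in> C"
      by (simp_all add: algebra_simps)
    then show ?thesis by blast
  qed
  have ind: "\<forall>\<omega>\<in>\<Omega>. (P ^^ k) \<psi> \<omega> \<in> E \<and> (\<exists>a. (P ^^ k) \<psi> \<omega> - a *\<^sub>R f \<omega> \<in> C \<and> (a + \<gamma> ^ k * D) *\<^sub>R f \<omega> - (P ^^ k) \<psi> \<omega> \<in> C)" for k
  proof (induction k)
    case 0
    then show ?case using init \<psi> by simp
  next
    case (Suc k)
    have p: "0 \<le> \<gamma> ^ k * D" using D \<gamma> by simp
    show ?case
    proof (intro ballI conjI)
      fix \<omega> assume \<omega>: "\<omega> \<in> \<Omega>"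
      show "(P ^^ Suc k) \<psi> \<omega> \<in> E" using P_mem[of "(P ^^ k) \<psi>" \<omega>] Suc \<omega> by simp
      show "\<exists>a. (P ^^ Suc k) \<psi> \<omega> - a *\<^sub>R f \<omega> \<in> C \<and> (a + \<gamma> ^ Suc k * D) *\<^sub>R f \<omega> - (P ^^ Suc k) \<psi> \<omega> \<in> C"
        using P_between[of "(P ^^ k) \<psi>" "\<gamma> ^ k * D" \<omega>] Suc \<omega> p by (simp add: mult.assoc)
    qed
  qed
  show ?thesis
  \<comment> \<open>For \<open>k > 0\<close> the iterate has mass 0, and an interval of length
    \<open>\<gamma> ^ k * D\<close> bounds its norm by \<open>2 * K\<close> times that length. For
    \<open>k = 0\<close> the mass is arbitrary, but the constant \<open>8 * K / \<rho>\<close> is at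
    least 1.\<close>
  proof (cases k)
    case 0
    have "m \<le> 8 * K / \<rho> * m"
    proof -
      have "1 * m \<le> 8 * K / \<rho> * m" using K \<rho> m by (intro mult_right_mono) (auto simp: field_simps)
      then show ?thesis by simp
    qed
    then show ?thesis using \<psi>(2)[OF \<omega>] 0 by simp
  next
    case (Suc j)
    have e: "ell ((P ^^ k) \<psi> \<omega>) = 0" using P_ell[of "(P ^^ j) \<psi>" \<omega>] ind[of j] \<omega> Suc by simp
    obtain a where "(P ^^ k) \<psi> \<omega> - a *\<^sub>R f \<omega> \<in> C" "(a + \<gamma> ^ k * D) *\<^sub>R f \<omega> - (P ^^ k) \<psi> \<omega> \<in> C" "(P ^^ k) \<psi> \<omega> \<in> E"
      using ind[of k] \<omega> by auto
    from between_norm(3)[OF f'(1)[OF \<omega>] f(2)[OF \<omega>] this(3,1,2) e]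
    show ?thesis by (simp add: D_def mult_ac)
  qed
qed

text \<open>The ratio \<open>b / a\<close> of an order interval \<open>a f \<le> x \<le> b f\<close> does not change when \<open>x\<close> and \<open>f\<close> are rescaled, so that the
unknown normalising factors of the two cocycles play no role.\<close>

lemma compare:
  assumes S: "\<And>\<omega>. \<omega> \<in> \<Omega> \<Longrightarrow> S (\<pi> \<omega>) (g (\<pi> \<omega>)) = \<Lambda>' \<omega> *\<^sub>R g \<omega>" "\<And>\<omega>. \<omega> \<in> \<Omega> \<Longrightarrow> S \<omega> (g \<omega>) \<in> E"
    and g: "\<And>\<omega>. \<omega> \<in> \<Omega> \<Longrightarrow> g \<omega> \<in> CR" "\<And>\<omega>. \<omega> \<in> \<Omega> \<Longrightarrow> ell (g \<omega>) = 1"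
    and m: "0 < m" "\<And>\<omega>. \<omega> \<in> \<Omega> \<Longrightarrow> m \<le> \<Lambda>' \<omega>" "\<And>\<omega>. \<omega> \<in> \<Omega> \<Longrightarrow> m \<le> ell (T \<omega> (g \<omega>))"
    and \<epsilon>: "0 < \<epsilon>" "\<epsilon> \<le> (1 - \<gamma>) / 8"
    and close: "\<And>\<omega>. \<omega> \<in> \<Omega> \<Longrightarrow> n (S \<omega> (g \<omega>) - T \<omega> (g \<omega>)) < \<epsilon> * (\<rho> * m)" and \<omega>: "\<omega> \<in> \<Omega>"
  shows "n (g \<omega> - f \<omega>) \<le> 16 * K / (1 - \<gamma>) * \<epsilon>"
proof -
  \<comment> \<open>A rate halfway to 1 absorbs the perturbation: \<epsilon> is at most
    \<open>(1 - \<gamma>) / 8\<close>, hence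
    \<open>\<gamma> + 4 * \<epsilon> \<le> \<gamma>'\<close>.\<close>
  define \<gamma>' where "\<gamma>' = (1 + \<gamma>) / 2"
  have \<gamma>': "0 < \<gamma>'" "\<gamma>' < 1" "\<gamma> + 4 * \<epsilon> \<le> \<gamma>'" using \<gamma> \<epsilon> by (auto simp: \<gamma>'_def field_simps)
  have \<epsilon>1: "\<epsilon> \<le> 1 / 8" using \<epsilon> \<gamma> by (auto simp: field_simps)
  \<comment> \<open>\<open>R k\<close> bounds the excess \<open>b / a - 1\<close> after
    \<open>k\<close> steps. It obeys \<open>R (Suc k) = \<gamma>' * R k + 4 * \<epsilon>\<close>,
    whose fixed point is its second summand. The value \<open>R0\<close> is
    \<open>(1 / a) / a\<close> for the initial \<open>a = \<rho> / (2 * K)\<close>.\<close>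
  define R0 where "R0 = 4 * K^2 / \<rho>^2"
  define R where "R k = \<gamma>' ^ k * R0 + 4 * \<epsilon> / (1 - \<gamma>')" for k
  have R_nonneg: "0 \<le> R k" for k using \<gamma>' \<epsilon> by (auto simp: R_def R0_def intro!: add_nonneg_nonneg)
  have R_Suc: "R (Suc k) = \<gamma>' * R k + 4 * \<epsilon>" for k
  proof -
    have "\<gamma>' * (4 * \<epsilon> / (1 - \<gamma>')) + 4 * \<epsilon> = 4 * \<epsilon> / (1 - \<gamma>')" using \<gamma>' by (simp add: field_simps)
    then show ?thesis by (simp add: R_def algebra_simps)
  qed
  have g': "g \<omega> \<in> C" "g \<omega> \<in> E" "1 \<le> n (g \<omega>)" "n (g \<omega>) \<le> K" if "\<omega> \<in> \<Omega>" for \<omega>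
    using g that CR_C C_E norm_ge_1 norm_le_K by auto
  have ind: "\<forall>\<omega>\<in>\<Omega>. \<exists>a b. 0 < a \<and> g \<omega> - a *\<^sub>R f \<omega> \<in> C \<and> b *\<^sub>R f \<omega> - g \<omega> \<in> C \<and> b \<le> (1 + R k) * a" for k
  proof (induction k)
    case 0
    show ?case
    proof
      fix \<omega> assume \<omega>: "\<omega> \<in> \<Omega>"
      \<comment> \<open>Then \<open>a * K = \<rho> / 2\<close>, so \<open>a f\<close> and
        \<open>a g\<close> are short enough to be subtracted from the interior vectors
        \<open>g\<close> and \<open>f\<close>.\<close>
      define a where "a = \<rho> / (2 * K)"
      have a: "a > 0" unfolding a_def using \<rho> K by (intro divide_pos_pos) auto
      have lt: "a * K < \<rho>" using \<rho> K by (simp add: a_def)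
      have "n (a *\<^sub>R f \<omega>) \<le> a * K" using a f'[OF \<omega>] by (simp add: scale)
      also have "\<dots> < \<rho> * n (g \<omega>)" using lt mult_left_mono[OF g'(3)[OF \<omega>], of \<rho>] \<rho> by linarith
      finally have 1: "g \<omega> - a *\<^sub>R f \<omega> \<in> C" using f' \<omega> g by (intro CR_diff scale_mem) auto
      have "n (a *\<^sub>R g \<omega>) \<le> a * K" using a g'[OF \<omega>] by (simp add: scale)
      also have "\<dots> < \<rho> * n (f \<omega>)" using lt mult_left_mono[OF f'(3)[OF \<omega>], of \<rho>] \<rho> by linarith
      finally have "f \<omega> - a *\<^sub>R g \<omega> \<in> C" using f g' \<omega> by (intro CR_diff scale_mem) auto
      from C_scale[OF this, of "1 / a"] have 2: "(1 / a) *\<^sub>R f \<omega> - g \<omega> \<in> C" using a by (simp add: algebra_simps)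
      have "1 / a = R0 * a" using K \<rho> by (simp add: a_def R0_def power2_eq_square field_simps)
      also have "\<dots> \<le> (1 + R 0) * a" using a \<gamma>' \<epsilon> by (intro mult_right_mono) (auto simp: R_def)
      finally show "\<exists>a b. 0 < a \<and> g \<omega> - a *\<^sub>R f \<omega> \<in> C \<and> b *\<^sub>R f \<omega> - g \<omega> \<in> C \<and> b \<le> (1 + R 0) * a"
        using a 1 2 by blast
    qed
  next
    case (Suc k)
    show ?case
    proof
      fix \<omega> assume \<omega>: "\<omega> \<in> \<Omega>"
      define v where "v = \<pi> \<omega>"
      have v: "v \<in> \<Omega>" using \<pi> \<omega> by (simp add: v_def)
      obtain a b where ab: "0 < a" "g v - a *\<^sub>R f v \<in> C" "b *\<^sub>R f v - g v \<in> C" "b \<le> (1 + R k) * a"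
        using Suc v by blast
      have le: "a \<le> b" using between_norm(1,2)[OF f'(1)[OF v] f(2)[OF v] g'(2)[OF v] ab(2,3) g(2)[OF v]] by simp
      obtain a' b' where ab': "a \<le> a'" "b' - a' = \<gamma> * (b - a)" "T v (g v) - a' *\<^sub>R T v (f v) \<in> C" "b' *\<^sub>R T v (f v) - T v (g v) \<in> C"
        using interval_step[OF T[OF v] f'(1)[OF v] f'(1)[OF \<omega>] f(2)[OF \<omega>] eig[OF \<omega>, folded v_def] \<Lambda>[OF \<omega>] g'(2)[OF v] ab(2,3) le]
        by metis
      have eigv: "T v (f v) = \<Lambda> \<omega> *\<^sub>R f \<omega>" "S v (g v) = \<Lambda>' \<omega> *\<^sub>R g \<omega>" using eig[OF \<omega>] S[OF \<omega>] by (simp_all add: v_def)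
      define d where "d = S v (g v) - T v (g v)"
      have Tg: "T v (g v) \<in> CR" "T v (g v) \<in> E"
      proof -
        have "g v \<noteq> 0" using g'(3)[OF v] norm_zero by auto
        then show "T v (g v) \<in> CR" using pos_op_CR[OF T[OF v] g'(1)[OF v]] by simp
        then show "T v (g v) \<in> E" using CR_C C_E by blast
      qed
      have \<Lambda>'p: "0 < \<Lambda>' \<omega>" using m \<omega> by (meson less_le_trans)
      have Sg: "S v (g v) \<in> CR" "S v (g v) \<in> E"
        using CR_scale[OF g(1)[OF \<omega>], of "\<Lambda>' \<omega>"] \<Lambda>'p CR_C C_E unfolding eigv by auto
      have dE: "d \<in> E" unfolding d_def using Tg Sg by (intro diff_mem)
      have nd: "n d < \<epsilon> * (\<rho> * m)" using close[OF v] by (simp add: d_def)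
      \<comment> \<open>The aim is
        \<open>(1 - \<epsilon>) T g \<le> S g \<le> (1 + \<epsilon>) T g\<close> in the cone order.
        The two differences are \<open>\<epsilon> S g + (1 - \<epsilon>) d\<close> and
        \<open>\<epsilon> T g - d\<close>, small perturbations of vectors in
        \<open>CR\<close>.\<close>
      have "(1 - \<epsilon>) * n d \<le> n d" using mult_nonneg_nonneg[OF less_imp_le[OF \<epsilon>(1)] nonneg[OF dE]] by (simp add: algebra_simps)
      moreover have "n ((1 - \<epsilon>) *\<^sub>R d) = (1 - \<epsilon>) * n d" using dE \<epsilon>1 by (simp add: scale)
      moreover have "\<epsilon> * (\<rho> * m) \<le> \<rho> * n (\<epsilon> *\<^sub>R S v (g v))"
      proof -
        have "m \<le> n (S v (g v))"
        proof -
          have "n (S v (g v)) = \<Lambda>' \<omega> * n (g \<omega>)" unfolding eigv using g'[OF \<omega>] \<Lambda>'p by (simp add: scale)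
          then show ?thesis using m(2)[OF \<omega>] \<Lambda>'p mult_left_mono[OF g'(3)[OF \<omega>], of "\<Lambda>' \<omega>"] by linarith
        qed
        then have "\<rho> * (\<epsilon> * m) \<le> \<rho> * (\<epsilon> * n (S v (g v)))" using \<rho> \<epsilon> by (intro mult_left_mono) auto
        then show ?thesis using \<epsilon> Sg by (simp add: scale mult_ac)
      qed
      ultimately have "n ((1 - \<epsilon>) *\<^sub>R d) < \<rho> * n (\<epsilon> *\<^sub>R S v (g v))" using nd by linarith
      then have "\<epsilon> *\<^sub>R S v (g v) + (1 - \<epsilon>) *\<^sub>R d \<in> C"
        using CR_scale[OF Sg(1)] \<epsilon> dE by (intro CR_add scale_mem) auto
      moreover have "\<epsilon> *\<^sub>R S v (g v) + (1 - \<epsilon>) *\<^sub>R d = S v (g v) - (1 - \<epsilon>) *\<^sub>R T v (g v)"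
        by (simp add: d_def algebra_simps)
      ultimately have c1: "S v (g v) - (1 - \<epsilon>) *\<^sub>R T v (g v) \<in> C" by simp
      have "\<epsilon> * (\<rho> * m) \<le> \<rho> * n (\<epsilon> *\<^sub>R T v (g v))"
      proof -
        have "m \<le> n (T v (g v))" using m(3)[OF v] ell_le[OF Tg(2)] by simp
        then have "\<rho> * (\<epsilon> * m) \<le> \<rho> * (\<epsilon> * n (T v (g v)))" using \<rho> \<epsilon> by (intro mult_left_mono) auto
        then show ?thesis using \<epsilon> Tg by (simp add: scale mult_ac)
      qed
      then have "n d < \<rho> * n (\<epsilon> *\<^sub>R T v (g v))" using nd by linarith
      then have "\<epsilon> *\<^sub>R T v (g v) - d \<in> C"
        using CR_scale[OF Tg(1)] \<epsilon> dE by (intro CR_diff) auto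
      moreover have "\<epsilon> *\<^sub>R T v (g v) - d = (1 + \<epsilon>) *\<^sub>R T v (g v) - S v (g v)"
        by (simp add: d_def algebra_simps)
      ultimately have c2: "(1 + \<epsilon>) *\<^sub>R T v (g v) - S v (g v) \<in> C" by simp
      have "S v (g v) - ((1 - \<epsilon>) * a') *\<^sub>R T v (f v) \<in> C"
        using C_add[OF c1 C_scale[OF ab'(3), of "1 - \<epsilon>"]] \<epsilon>1 by (simp add: algebra_simps)
      from C_scale[OF this, of "1 / \<Lambda>' \<omega>"] \<Lambda>'p
      have 1: "g \<omega> - ((1 - \<epsilon>) * a' * (\<Lambda> \<omega> / \<Lambda>' \<omega>)) *\<^sub>R f \<omega> \<in> C"
        unfolding eigv by (simp add: scaleR_diff_right mult_ac)
      have "((1 + \<epsilon>) * b') *\<^sub>R T v (f v) - S v (g v) \<in> C"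
        using C_add[OF c2 C_scale[OF ab'(4), of "1 + \<epsilon>"]] \<epsilon> by (simp add: algebra_simps)
      from C_scale[OF this, of "1 / \<Lambda>' \<omega>"] \<Lambda>'p
      have 2: "((1 + \<epsilon>) * b' * (\<Lambda> \<omega> / \<Lambda>' \<omega>)) *\<^sub>R f \<omega> - g \<omega> \<in> C"
        unfolding eigv by (simp add: scaleR_diff_right mult_ac)
      have q: "0 < \<Lambda> \<omega> / \<Lambda>' \<omega>" using \<Lambda>[OF \<omega>] \<Lambda>'p by simp
      have a'p: "0 < a'" using ab ab' by simp
      have "b - a \<le> R k * a" using ab by (simp add: algebra_simps)
      also have "\<dots> \<le> R k * a'" using ab' R_nonneg by (intro mult_left_mono)
      finally have "\<gamma> * (b - a) \<le> \<gamma> * (R k * a')" using \<gamma> by (intro mult_left_mono) auto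
      then have b': "b' \<le> (1 + \<gamma> * R k) * a'" using ab'(2) by (simp add: algebra_simps)
      \<comment> \<open>The perturbation multiplies the ratio of the ends by
        \<open>(1 + \<epsilon>) / (1 - \<epsilon>)\<close>, which is at most
        \<open>1 + 4 * \<epsilon>\<close> for these small \<epsilon>.\<close>
      have "(1 + \<epsilon>) * b' \<le> ((1 + 4 * \<epsilon>) * (1 - \<epsilon>)) * ((1 + \<gamma> * R k) * a')"
      proof (intro mult_mono b')
        have "\<epsilon> * (4 * \<epsilon>) \<le> \<epsilon> * 2" using \<epsilon> \<epsilon>1 by (intro mult_left_mono) auto
        then show "1 + \<epsilon> \<le> (1 + 4 * \<epsilon>) * (1 - \<epsilon>)" by (simp add: algebra_simps)
        show "0 \<le> b'" proof -
          have "0 \<le> \<gamma> * (b - a)" using \<gamma> le by (intro mult_nonneg_nonneg) auto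
          then show ?thesis using a'p ab'(2) by linarith
        qed
        show "0 \<le> (1 + 4 * \<epsilon>) * (1 - \<epsilon>)" using \<epsilon> \<epsilon>1 by (intro mult_nonneg_nonneg) auto
      qed
      also have "\<dots> = ((1 + 4 * \<epsilon>) * (1 + \<gamma> * R k)) * ((1 - \<epsilon>) * a')" by (simp add: mult_ac)
      also have "\<dots> \<le> (1 + R (Suc k)) * ((1 - \<epsilon>) * a')"
      proof (rule mult_right_mono)
        have "\<gamma> * (4 * \<epsilon> * R k) \<le> 1 * (4 * \<epsilon> * R k)" using \<gamma> \<epsilon> R_nonneg[of k] by (intro mult_right_mono) auto
        moreover have "(\<gamma> + 4 * \<epsilon>) * R k \<le> \<gamma>' * R k" using \<gamma>' R_nonneg by (intro mult_right_mono)
        ultimately show "(1 + 4 * \<epsilon>) * (1 + \<gamma> * R k) \<le> 1 + R (Suc k)" by (simp add: R_Suc algebra_simps)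
      qed (use \<epsilon>1 a'p in auto)
      finally have "(1 + \<epsilon>) * b' \<le> (1 + R (Suc k)) * ((1 - \<epsilon>) * a')" .
      from mult_right_mono[OF this, of "\<Lambda> \<omega> / \<Lambda>' \<omega>"] q
      have 3: "(1 + \<epsilon>) * b' * (\<Lambda> \<omega> / \<Lambda>' \<omega>) \<le> (1 + R (Suc k)) * ((1 - \<epsilon>) * a' * (\<Lambda> \<omega> / \<Lambda>' \<omega>))"
        by (simp add: mult_ac)
      have 4: "0 < (1 - \<epsilon>) * a' * (\<Lambda> \<omega> / \<Lambda>' \<omega>)" using q a'p \<epsilon>1 by (intro mult_pos_pos) auto
      show "\<exists>a b. 0 < a \<and> g \<omega> - a *\<^sub>R f \<omega> \<in> C \<and> b *\<^sub>R f \<omega> - g \<omega> \<in> C \<and> b \<le> (1 + R (Suc k)) * a"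
        using 1 2 3 4 by blast
    qed
  qed
  have "n (g \<omega> - f \<omega>) \<le> 2 * K * R k" for k
  proof -
    obtain a b where ab: "0 < a" "g \<omega> - a *\<^sub>R f \<omega> \<in> C" "b *\<^sub>R f \<omega> - g \<omega> \<in> C" "b \<le> (1 + R k) * a"
      using ind[of k] \<omega> by blast
    note bn = between_norm[OF f'(1)[OF \<omega>] f(2)[OF \<omega>] g'(2)[OF \<omega>] ab(2,3) g(2)[OF \<omega>]]
    have "b - a \<le> R k * a" using ab by (simp add: algebra_simps)
    \<comment> \<open>Comparing masses gives \<open>a \<le> 1\<close>.\<close>
    also have "\<dots> \<le> R k" using bn(1) R_nonneg[of k] by (simp add: mult_left_le)
    finally have "2 * K * (b - a) \<le> 2 * K * R k" using K by (intro mult_left_mono) auto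
    then show ?thesis using bn(3) by simp
  qed
  \<comment> \<open>Only the fixed point \<open>4 * \<epsilon> / (1 - \<gamma>')\<close> of the
    recursion survives. As \<open>1 - \<gamma>'\<close> is half of \<open>1 - \<gamma>\<close>, the
    factor becomes \<open>16 * K / (1 - \<gamma>)\<close>.\<close>
  moreover have "(\<lambda>k. 2 * K * R k) \<longlonglongrightarrow> 2 * K * (0 * R0 + 4 * \<epsilon> / (1 - \<gamma>'))"
    unfolding R_def using \<gamma>' by (intro tendsto_intros LIMSEQ_realpow_zero) auto
  ultimately have "n (g \<omega> - f \<omega>) \<le> 2 * K * (0 * R0 + 4 * \<epsilon> / (1 - \<gamma>'))"
    by (intro LIMSEQ_le_const) auto
  also have "\<dots> = 16 * K / (1 - \<gamma>) * \<epsilon>" using \<gamma> by (simp add: \<gamma>'_def field_simps)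
  finally show ?thesis .
qed

end

section \<open>Bounded Bochner measurable sections\<close>

lemma supnorm_le: "space M \<noteq> {} \<Longrightarrow> (\<And>\<omega>. \<omega> \<in> space M \<Longrightarrow> n (\<phi> \<omega>) \<le> B) \<Longrightarrow> supnorm M n \<phi> \<le> B"
  unfolding supnorm_def by (rule cSUP_least) auto

lemma supnorm_ge: "(\<And>\<omega>. \<omega> \<in> space M \<Longrightarrow> n (\<phi> \<omega>) \<le> B) \<Longrightarrow> \<omega> \<in> space M \<Longrightarrow> n (\<phi> \<omega>) \<le> supnorm M n \<phi>"
  unfolding supnorm_def by (rule cSUP_upper) (auto intro!: bdd_aboveI[of _ B])

lemma countably_valued_combine:
  assumes g: "countably_valued_meas M E1 g" and h: "countably_valued_meas M E2 h"
    and F: "\<And>x y. x \<in> E1 \<Longrightarrow> y \<in> E2 \<Longrightarrow> F x y \<in> E3"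
  shows "countably_valued_meas M E3 (\<lambda>\<omega>. F (g \<omega>) (h \<omega>))"
  unfolding countably_valued_meas_def
proof (intro conjI ballI allI)
  have cnt: "countable (g ` space M \<times> h ` space M)"
    using g h by (auto simp: countably_valued_meas_def)
  have "(\<lambda>\<omega>. F (g \<omega>) (h \<omega>)) ` space M \<subseteq> (\<lambda>(x, y). F x y) ` (g ` space M \<times> h ` space M)" by auto
  then show "countable ((\<lambda>\<omega>. F (g \<omega>) (h \<omega>)) ` space M)"
    using cnt by (meson countable_image countable_subset)
  fix v
  let ?I = "{p \<in> g ` space M \<times> h ` space M. F (fst p) (snd p) = v}"
  have eq: "{\<omega> \<in> space M. F (g \<omega>) (h \<omega>) = v} = (\<Union>p\<in>?I. {\<omega> \<in> space M. g \<omega> = fst p} \<inter> {\<omega> \<in> space M. h \<omega> = snd p})"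
    by (auto, metis)
  have "countable ?I" using cnt by (rule countable_subset[rotated]) auto
  then show "{\<omega> \<in> space M. F (g \<omega>) (h \<omega>) = v} \<in> sets M"
    unfolding eq using g h by (intro sets.countable_UN'') (auto simp: countably_valued_meas_def)
qed (use g h F in \<open>auto simp: countably_valued_meas_def\<close>)

lemma bochner_approx:
  assumes "bochner_measurable M E n \<phi>" "0 < e"
  obtains g where "countably_valued_meas M E g" "\<And>\<omega>. \<omega> \<in> space M \<Longrightarrow> n (g \<omega> - \<phi> \<omega>) < e"
proof -
  obtain g where g: "\<forall>k::nat. countably_valued_meas M E (g k)"
    "\<forall>e>0. \<exists>N. \<forall>k\<ge>N. \<forall>\<omega>\<in>space M. n (g k \<omega> - \<phi> \<omega>) < e"
    using assms(1) unfolding bochner_measurable_def by blast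
  then obtain N where "\<forall>k\<ge>N. \<forall>\<omega>\<in>space M. n (g k \<omega> - \<phi> \<omega>) < e" using assms(2) by blast
  then show ?thesis using g that[of "g N"] by blast
qed

lemma bochner_measurableI:
  assumes E: "\<And>\<omega>. \<omega> \<in> space M \<Longrightarrow> \<phi> \<omega> \<in> E"
    and g: "\<And>e. 0 < e \<Longrightarrow> \<exists>g. countably_valued_meas M E g \<and> (\<forall>\<omega>\<in>space M. n (g \<omega> - \<phi> \<omega>) < e)"
  shows "bochner_measurable M E n \<phi>"
proof -
  have "\<forall>k::nat. \<exists>g. countably_valued_meas M E g \<and> (\<forall>\<omega>\<in>space M. n (g \<omega> - \<phi> \<omega>) < 1 / real (Suc k))"
    using g by auto
  then obtain G where G: "\<forall>k. countably_valued_meas M E (G k) \<and> (\<forall>\<omega>\<in>space M. n (G k \<omega> - \<phi> \<omega>) < 1 / real (Suc k))"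
    by metis
  have "\<exists>N. \<forall>k\<ge>N. \<forall>\<omega>\<in>space M. n (G k \<omega> - \<phi> \<omega>) < e" if e: "e > 0" for e
  proof -
    obtain N where N: "1 / real (Suc N) < e" using nat_approx_posE[OF e] by blast
    have "n (G k \<omega> - \<phi> \<omega>) < e" if k: "k \<ge> N" and \<omega>: "\<omega> \<in> space M" for k \<omega>
    proof -
      have "n (G k \<omega> - \<phi> \<omega>) < 1 / real (Suc k)" using G \<omega> by blast
      also have "\<dots> \<le> 1 / real (Suc N)" using k by (intro divide_left_mono) auto
      finally show ?thesis using N by simp
    qed
    then show ?thesis by blast
  qed
  then show ?thesis unfolding bochner_measurable_def using E G by blast
qed

text \<open>Continuity of \<open>F\<close> is demanded only near the values of \<phi> and \<psi>,
  but uniformly in \<omega>. This covers scalar multiplication of bounded sections, which is not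
  uniformly continuous globally.\<close>

lemma bochner_combine:
  assumes \<phi>: "bochner_measurable M E1 n1 \<phi>" and \<psi>: "bochner_measurable M E2 n2 \<psi>"
    and F: "\<And>x y. x \<in> E1 \<Longrightarrow> y \<in> E2 \<Longrightarrow> F x y \<in> E3"
    and cont: "\<And>e. 0 < e \<Longrightarrow> \<exists>d>0. \<forall>\<omega>\<in>space M. \<forall>x\<in>E1. \<forall>y\<in>E2. n1 (x - \<phi> \<omega>) < d \<longrightarrow> n2 (y - \<psi> \<omega>) < d \<longrightarrow>
       n3 (F x y - F (\<phi> \<omega>) (\<psi> \<omega>)) < e"
  shows "bochner_measurable M E3 n3 (\<lambda>\<omega>. F (\<phi> \<omega>) (\<psi> \<omega>))"
proof (rule bochner_measurableI)
  show "F (\<phi> \<omega>) (\<psi> \<omega>) \<in> E3" if "\<omega> \<in> space M" for \<omega>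
    using \<phi> \<psi> F that by (auto simp: bochner_measurable_def)
  fix e :: real assume "e > 0"
  then obtain d where d: "d > 0" "\<forall>\<omega>\<in>space M. \<forall>x\<in>E1. \<forall>y\<in>E2. n1 (x - \<phi> \<omega>) < d \<longrightarrow> n2 (y - \<psi> \<omega>) < d \<longrightarrow>
       n3 (F x y - F (\<phi> \<omega>) (\<psi> \<omega>)) < e" using cont by blast
  obtain g where g: "countably_valued_meas M E1 g" "\<And>\<omega>. \<omega> \<in> space M \<Longrightarrow> n1 (g \<omega> - \<phi> \<omega>) < d"
    using bochner_approx[OF \<phi> d(1)] by blast
  obtain h where h: "countably_valued_meas M E2 h" "\<And>\<omega>. \<omega> \<in> space M \<Longrightarrow> n2 (h \<omega> - \<psi> \<omega>) < d"
    using bochner_approx[OF \<psi> d(1)] by blast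
  have "countably_valued_meas M E3 (\<lambda>\<omega>. F (g \<omega>) (h \<omega>))"
    by (rule countably_valued_combine[OF g(1) h(1) F])
  moreover have "n3 (F (g \<omega>) (h \<omega>) - F (\<phi> \<omega>) (\<psi> \<omega>)) < e" if "\<omega> \<in> space M" for \<omega>
    using d(2) g h that by (auto simp: countably_valued_meas_def)
  ultimately show "\<exists>g. countably_valued_meas M E3 g \<and> (\<forall>\<omega>\<in>space M. n3 (g \<omega> - F (\<phi> \<omega>) (\<psi> \<omega>)) < e)" by blast
qed

lemma bochner_uniform_limit:
  assumes sn: "seminormed_space E n" and \<phi>: "\<And>\<omega>. \<omega> \<in> space M \<Longrightarrow> \<phi> \<omega> \<in> E"
    and lim: "\<And>e. 0 < e \<Longrightarrow> \<exists>\<psi>. bochner_measurable M E n \<psi> \<and> (\<forall>\<omega>\<in>space M. n (\<psi> \<omega> - \<phi> \<omega>) < e)"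
  shows "bochner_measurable M E n \<phi>"
proof (rule bochner_measurableI[OF \<phi>])
  interpret seminormed_space E n by fact
  fix e :: real assume e: "e > 0"
  then have e2: "e / 2 > 0" by simp
  obtain \<psi> where \<psi>: "bochner_measurable M E n \<psi>" "\<forall>\<omega>\<in>space M. n (\<psi> \<omega> - \<phi> \<omega>) < e / 2"
    using lim[OF e2] by blast
  obtain g where g: "countably_valued_meas M E g" "\<And>\<omega>. \<omega> \<in> space M \<Longrightarrow> n (g \<omega> - \<psi> \<omega>) < e / 2"
    using bochner_approx[OF \<psi>(1) e2] by blast
  have "n (g \<omega> - \<phi> \<omega>) < e" if \<omega>: "\<omega> \<in> space M" for \<omega>
  proof -
    have m: "g \<omega> - \<psi> \<omega> \<in> E" "\<psi> \<omega> - \<phi> \<omega> \<in> E"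
      using g(1) \<psi>(1) \<phi> \<omega> by (auto simp: countably_valued_meas_def bochner_measurable_def intro!: diff_mem)
    have "n (g \<omega> - \<phi> \<omega>) = n ((g \<omega> - \<psi> \<omega>) + (\<psi> \<omega> - \<phi> \<omega>))" by simp
    also have "\<dots> \<le> n (g \<omega> - \<psi> \<omega>) + n (\<psi> \<omega> - \<phi> \<omega>)" using m by (rule triangle)
    also have "\<dots> < e / 2 + e / 2" using g(2)[OF \<omega>] \<psi>(2) \<omega> by (intro add_strict_mono) auto
    finally show ?thesis by simp
  qed
  then show "\<exists>g. countably_valued_meas M E g \<and> (\<forall>\<omega>\<in>space M. n (g \<omega> - \<phi> \<omega>) < e)" using g by blast
qed

lemma bochner_real: "bochner_measurable M UNIV abs (\<phi> :: 'w \<Rightarrow> real) \<longleftrightarrow> \<phi> \<in> borel_measurable M"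
proof
  assume \<phi>: "bochner_measurable M UNIV abs \<phi>"
  then obtain g where g: "\<forall>k::nat. countably_valued_meas M UNIV (g k)"
    "\<forall>e>0. \<exists>N. \<forall>k\<ge>N. \<forall>\<omega>\<in>space M. \<bar>g k \<omega> - \<phi> \<omega>\<bar> < e"
    unfolding bochner_measurable_def by blast
  have gm: "g k \<in> borel_measurable M" for k
  proof (rule measurableI)
    fix A :: "real set" assume "A \<in> sets borel"
    have eq: "g k -` A \<inter> space M = (\<Union>v\<in>g k ` space M \<inter> A. {\<omega> \<in> space M. g k \<omega> = v})" by auto
    show "g k -` A \<inter> space M \<in> sets M"
      unfolding eq using g(1) by (intro sets.countable_UN'') (auto simp: countably_valued_meas_def)
  qed simp
  have lim: "(\<lambda>k. g k \<omega>) \<longlonglongrightarrow> \<phi> \<omega>" if "\<omega> \<in> space M" for \<omega>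
    unfolding LIMSEQ_def dist_real_def using g(2) that by blast
  show "\<phi> \<in> borel_measurable M" by (rule borel_measurable_LIMSEQ_real[OF lim gm])
next
  assume \<phi>: "\<phi> \<in> borel_measurable M"
  show "bochner_measurable M UNIV abs \<phi>"
  proof (rule bochner_measurableI)
    fix e :: real assume e: "e > 0"
    \<comment> \<open>Rounding down to the grid of multiples of \<open>e\<close> leaves countably
      many values and an error below \<open>e\<close>.\<close>
    define g where "g = (\<lambda>\<omega>. real_of_int \<lfloor>\<phi> \<omega> / e\<rfloor> * e)"
    have gm: "g \<in> borel_measurable M" unfolding g_def using \<phi> by measurable
    have "g ` space M \<subseteq> (\<lambda>i. real_of_int i * e) ` UNIV" by (auto simp: g_def)
    then have "countable (g ` space M)" by (meson countable_image countable_subset countableI_type)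
    moreover have "{\<omega> \<in> space M. g \<omega> = v} \<in> sets M" for v
      using measurable_sets[OF gm, of "{v}"] by (simp add: vimage_def Int_def conj_commute)
    moreover have "\<bar>g \<omega> - \<phi> \<omega>\<bar> < e" for \<omega>
    proof -
      have "\<phi> \<omega> / e - 1 < real_of_int \<lfloor>\<phi> \<omega> / e\<rfloor>" "real_of_int \<lfloor>\<phi> \<omega> / e\<rfloor> \<le> \<phi> \<omega> / e" by linarith+
      then have "(\<phi> \<omega> / e - 1) * e < g \<omega>" "g \<omega> \<le> \<phi> \<omega> / e * e"
        unfolding g_def using e by (auto intro: mult_strict_right_mono simp: pos_le_divide_eq[symmetric])
      then show ?thesis using e by (simp add: algebra_simps abs_if)
    qed
    ultimately show "\<exists>g. countably_valued_meas M UNIV g \<and> (\<forall>\<omega>\<in>space M. \<bar>g \<omega> - \<phi> \<omega>\<bar> < e)"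
      by (auto simp: countably_valued_meas_def)
  qed simp
qed

section \<open>The space of bounded sections\<close>

lemma Linf_mem: "\<phi> \<in> Linf M E n \<Longrightarrow> \<omega> \<in> space M \<Longrightarrow> \<phi> \<omega> \<in> E"
  by (auto simp: Linf_def bochner_measurable_def)

lemma Linf_off: "\<phi> \<in> Linf M E n \<Longrightarrow> \<omega> \<notin> space M \<Longrightarrow> \<phi> \<omega> = 0"
  by (auto simp: Linf_def)

lemma Linf_bochner: "\<phi> \<in> Linf M E n \<Longrightarrow> bochner_measurable M E n \<phi>"
  by (auto simp: Linf_def)

lemma Linf_bound: "\<phi> \<in> Linf M E n \<Longrightarrow> \<omega> \<in> space M \<Longrightarrow> n (\<phi> \<omega>) \<le> supnorm M n \<phi>"
proof -
  assume \<phi>: "\<phi> \<in> Linf M E n" and \<omega>: "\<omega> \<in> space M"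
  obtain B where "\<forall>\<omega>\<in>space M. n (\<phi> \<omega>) \<le> B" using \<phi> by (auto simp: Linf_def)
  then show ?thesis using supnorm_ge[of M n \<phi> B \<omega>] \<omega> by blast
qed

lemma LinfI:
  "bochner_measurable M E n \<phi> \<Longrightarrow> (\<And>\<omega>. \<omega> \<in> space M \<Longrightarrow> n (\<phi> \<omega>) \<le> B) \<Longrightarrow> (\<And>\<omega>. \<omega> \<notin> space M \<Longrightarrow> \<phi> \<omega> = 0) \<Longrightarrow> \<phi> \<in> Linf M E n"
  by (auto simp: Linf_def)

lemma Linf_eqI:
  assumes "\<phi> \<in> Linf M E n" "\<psi> \<in> Linf M E n" "\<And>\<omega>. \<omega> \<in> space M \<Longrightarrow> \<phi> \<omega> = \<psi> \<omega>"
  shows "\<phi> = \<psi>"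
proof
  fix \<omega> show "\<phi> \<omega> = \<psi> \<omega>"
    using assms Linf_off[OF assms(1)] Linf_off[OF assms(2)] by (cases "\<omega> \<in> space M") auto
qed

lemma Linf_real: "\<phi> \<in> Linf M UNIV abs \<longleftrightarrow> \<phi> \<in> borel_measurable M \<and> (\<exists>B. \<forall>\<omega>\<in>space M. \<bar>\<phi> \<omega>\<bar> \<le> B) \<and> (\<forall>\<omega>. \<omega> \<notin> space M \<longrightarrow> \<phi> \<omega> = (0::real))"
  by (simp add: Linf_def bochner_real)

lemma Linf_smul:
  assumes sn: "seminormed_space E n" and c: "c \<in> Linf M UNIV abs" and \<phi>: "\<phi> \<in> Linf M E n"
  shows "(\<lambda>\<omega>. c \<omega> *\<^sub>R \<phi> \<omega>) \<in> Linf M E n"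
proof -
  interpret seminormed_space E n by fact
  have mem: "\<phi> \<omega> \<in> E" if "\<omega> \<in> space M" for \<omega> using Linf_mem[OF \<phi> that] .
  define a where "a = \<bar>supnorm M abs c\<bar> + 1"
  define b where "b = \<bar>supnorm M n \<phi>\<bar> + 1"
  have ab: "0 < a" "0 < b" by (auto simp: a_def b_def)
  have ca: "\<bar>c \<omega>\<bar> \<le> a" if "\<omega> \<in> space M" for \<omega> using Linf_bound[OF c that] by (simp add: a_def)
  have \<phi>b: "n (\<phi> \<omega>) \<le> b" if "\<omega> \<in> space M" for \<omega> using Linf_bound[OF \<phi> that] by (simp add: b_def)
  show ?thesis
  proof (rule LinfI)
    show "bochner_measurable M E n (\<lambda>\<omega>. c \<omega> *\<^sub>R \<phi> \<omega>)"
    proof (rule bochner_combine[OF Linf_bochner[OF c] Linf_bochner[OF \<phi>], where F = scaleR])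
      fix e :: real assume e: "0 < e"
      \<comment> \<open>With \<open>d \<le> 1\<close> the perturbed scalar is at most
        \<open>a + 1\<close> and the section at most \<open>b\<close>, so the total error is at most
        \<open>d * s\<close>.\<close>
      define s where "s = a + 1 + b"
      have s: "s > 0" using ab by (simp add: s_def)
      define d where "d = min 1 (e / (2 * s))"
      have d: "d > 0" "d \<le> 1" "d * s \<le> e / 2"
      proof -
        show "d > 0" "d \<le> 1" using e s by (auto simp: d_def)
        have "d \<le> e / (2 * s)" by (simp add: d_def)
        then show "d * s \<le> e / 2" using s by (simp add: pos_le_divide_eq)
      qed
      have "n (t *\<^sub>R y - c \<omega> *\<^sub>R \<phi> \<omega>) < e"
        if \<omega>: "\<omega> \<in> space M" and y: "y \<in> E" "\<bar>t - c \<omega>\<bar> < d" "n (y - \<phi> \<omega>) < d" for t y \<omega>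
      proof -
        have "n (t *\<^sub>R y - c \<omega> *\<^sub>R \<phi> \<omega>) = n (t *\<^sub>R (y - \<phi> \<omega>) + (t - c \<omega>) *\<^sub>R \<phi> \<omega>)" by (simp add: algebra_simps)
        also have "\<dots> \<le> n (t *\<^sub>R (y - \<phi> \<omega>)) + n ((t - c \<omega>) *\<^sub>R \<phi> \<omega>)"
          using mem[OF \<omega>] y by (intro triangle scale_mem diff_mem)
        also have "\<dots> = \<bar>t\<bar> * n (y - \<phi> \<omega>) + \<bar>t - c \<omega>\<bar> * n (\<phi> \<omega>)" using mem[OF \<omega>] y by (simp add: scale diff_mem)
        also have "\<dots> \<le> (a + 1) * d + d * b"
          using y d ca[OF \<omega>] \<phi>b[OF \<omega>] ab nonneg[OF mem[OF \<omega>]] nonneg[OF diff_mem[OF y(1) mem[OF \<omega>]]]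
          by (intro add_mono mult_mono) auto
        also have "\<dots> = d * s" by (simp add: s_def algebra_simps)
        also have "\<dots> < e" using d e by linarith
        finally show ?thesis .
      qed
      then show "\<exists>d>0. \<forall>\<omega>\<in>space M. \<forall>x\<in>UNIV. \<forall>y\<in>E. \<bar>x - c \<omega>\<bar> < d \<longrightarrow> n (y - \<phi> \<omega>) < d \<longrightarrow>
          n (x *\<^sub>R y - c \<omega> *\<^sub>R \<phi> \<omega>) < e"
        using d by blast
    qed (rule scale_mem)
    show "n (c \<omega> *\<^sub>R \<phi> \<omega>) \<le> a * b" if "\<omega> \<in> space M" for \<omega>
      using ca[OF that] \<phi>b[OF that] ab nonneg[OF mem[OF that]] mem[OF that]
      by (auto simp: scale intro!: mult_mono)
    show "c \<omega> *\<^sub>R \<phi> \<omega> = 0" if "\<omega> \<notin> space M" for \<omega> using Linf_off[OF c that] by simp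
  qed
qed

lemma Linf_add:
  assumes sn: "seminormed_space E n" and \<phi>: "\<phi> \<in> Linf M E n" and \<psi>: "\<psi> \<in> Linf M E n"
  shows "\<phi> + \<psi> \<in> Linf M E n"
  unfolding plus_fun_def
proof -
  interpret seminormed_space E n by fact
  show "(\<lambda>\<omega>. \<phi> \<omega> + \<psi> \<omega>) \<in> Linf M E n"
  proof (rule LinfI)
    show "bochner_measurable M E n (\<lambda>\<omega>. \<phi> \<omega> + \<psi> \<omega>)"
    proof (rule bochner_combine[OF Linf_bochner[OF \<phi>] Linf_bochner[OF \<psi>], where F = plus])
      fix e :: real assume e: "0 < e"
      have "n (x + y - (\<phi> \<omega> + \<psi> \<omega>)) < e"
        if \<omega>: "\<omega> \<in> space M" and xy: "x \<in> E" "y \<in> E" "n (x - \<phi> \<omega>) < e / 2" "n (y - \<psi> \<omega>) < e / 2" for x y \<omega>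
      proof -
        have "n (x + y - (\<phi> \<omega> + \<psi> \<omega>)) = n ((x - \<phi> \<omega>) + (y - \<psi> \<omega>))" by (simp add: algebra_simps)
        also have "\<dots> \<le> n (x - \<phi> \<omega>) + n (y - \<psi> \<omega>)"
          using Linf_mem[OF \<phi> \<omega>] Linf_mem[OF \<psi> \<omega>] xy by (intro triangle diff_mem)
        finally show ?thesis using xy by simp
      qed
      then show "\<exists>d>0. \<forall>\<omega>\<in>space M. \<forall>x\<in>E. \<forall>y\<in>E. n (x - \<phi> \<omega>) < d \<longrightarrow> n (y - \<psi> \<omega>) < d \<longrightarrow> n (x + y - (\<phi> \<omega> + \<psi> \<omega>)) < e"
        using e by (intro exI[of _ "e / 2"]) auto
    qed (rule add_mem)
    show "n (\<phi> \<omega> + \<psi> \<omega>) \<le> supnorm M n \<phi> + supnorm M n \<psi>" if "\<omega> \<in> space M" for \<omega>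
      using triangle[OF Linf_mem[OF \<phi> that] Linf_mem[OF \<psi> that]] Linf_bound[OF \<phi> that] Linf_bound[OF \<psi> that] by simp
    show "\<phi> \<omega> + \<psi> \<omega> = 0" if "\<omega> \<notin> space M" for \<omega> using Linf_off[OF \<phi> that] Linf_off[OF \<psi> that] by simp
  qed
qed

lemma Linf_const_real: "(\<lambda>\<omega>. if \<omega> \<in> space M then (c::real) else 0) \<in> Linf M UNIV abs"
  unfolding Linf_real by (auto intro!: exI[of _ "\<bar>c\<bar>"] measurable_If_set[where A = "space M", unfolded Int_absorb])

lemma Linf_scale:
  assumes sn: "seminormed_space E n" and \<phi>: "\<phi> \<in> Linf M E n"
  shows "a *\<^sub>R \<phi> \<in> Linf M E n"
proof -
  have "(\<lambda>\<omega>. (if \<omega> \<in> space M then a else 0) *\<^sub>R \<phi> \<omega>) = a *\<^sub>R \<phi>"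
    using Linf_off[OF \<phi>] by (auto simp: scaleR_fun_def fun_eq_iff)
  then show ?thesis using Linf_smul[OF sn Linf_const_real \<phi>, of a] by simp
qed

lemma Linf_normed:
  assumes ns: "normed_subspace E n" and ne: "space M \<noteq> {}"
  shows "normed_subspace (Linf M E n) (supnorm M n)"
proof -
  interpret seminormed_space E n by (rule normed_subspace_seminormed[OF ns])
  note sn = seminormed_space_axioms
  obtain \<omega>0 where \<omega>0: "\<omega>0 \<in> space M" using ne by auto
  have "countable ((\<lambda>_. 0 :: 'a) ` space M)" by (rule countable_subset[of _ "{0}"]) auto
  then have cv: "countably_valued_meas M E (\<lambda>_. 0)" by (simp add: countably_valued_meas_def zero_mem)
  have zero: "0 \<in> Linf M E n"
    by (rule LinfI[where B = 0])
      (auto simp: zero_fun_def norm_zero zero_mem intro!: bochner_measurableI exI[of _ "\<lambda>_. 0"] cv)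
  have nonneg': "0 \<le> supnorm M n \<phi>" if "\<phi> \<in> Linf M E n" for \<phi>
    using Linf_bound[OF that \<omega>0] nonneg[OF Linf_mem[OF that \<omega>0]] by linarith
  have scale_le: "supnorm M n (a *\<^sub>R \<phi>) \<le> \<bar>a\<bar> * supnorm M n \<phi>" if \<phi>: "\<phi> \<in> Linf M E n" for a \<phi>
    using Linf_bound[OF \<phi>] Linf_mem[OF \<phi>]
    by (intro supnorm_le[OF ne]) (auto simp: scaleR_fun_def scale intro!: mult_left_mono)
  show ?thesis
    unfolding normed_subspace_def
  proof (intro conjI ballI allI)
    show "0 \<in> Linf M E n" by (rule zero)
    fix \<phi> assume \<phi>: "\<phi> \<in> Linf M E n"
    show "0 \<le> supnorm M n \<phi>" by (rule nonneg'[OF \<phi>])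
    show sc: "c *\<^sub>R \<phi> \<in> Linf M E n" for c by (rule Linf_scale[OF sn \<phi>])
    show "supnorm M n (c *\<^sub>R \<phi>) = \<bar>c\<bar> * supnorm M n \<phi>" for c
    proof (cases "c = 0")
      case True
      have "supnorm M n (c *\<^sub>R \<phi>) \<le> 0" using scale_le[OF \<phi>, of c] True by simp
      then show ?thesis using nonneg'[OF sc[of c]] True by simp
    next
      case False
      have "supnorm M n \<phi> \<le> \<bar>1 / c\<bar> * supnorm M n (c *\<^sub>R \<phi>)" using scale_le[OF sc[of c], of "1 / c"] False by simp
      then show ?thesis using scale_le[OF \<phi>, of c] False by (simp add: field_simps)
    qed
    show "(supnorm M n \<phi> = 0) = (\<phi> = 0)"
    proof
      assume z: "supnorm M n \<phi> = 0"
      have "\<phi> \<omega> = 0" if "\<omega> \<in> space M" for \<omega>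
        using Linf_bound[OF \<phi> that] z nonneg[OF Linf_mem[OF \<phi> that]] normed_subspace_eq_0[OF ns Linf_mem[OF \<phi> that]] by simp
      then show "\<phi> = 0" using Linf_eqI[OF \<phi> zero] by simp
    next
      assume "\<phi> = 0"
      then have "supnorm M n \<phi> \<le> 0" by (intro supnorm_le[OF ne]) (simp add: norm_zero)
      then show "supnorm M n \<phi> = 0" using nonneg'[OF \<phi>] by simp
    qed
    fix \<psi> assume \<psi>: "\<psi> \<in> Linf M E n"
    show "\<phi> + \<psi> \<in> Linf M E n" by (rule Linf_add[OF sn \<phi> \<psi>])
    show "supnorm M n (\<phi> + \<psi>) \<le> supnorm M n \<phi> + supnorm M n \<psi>"
    proof (rule supnorm_le[OF ne])
      fix \<omega> assume \<omega>: "\<omega> \<in> space M"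
      show "n ((\<phi> + \<psi>) \<omega>) \<le> supnorm M n \<phi> + supnorm M n \<psi>"
        using triangle[OF Linf_mem[OF \<phi> \<omega>] Linf_mem[OF \<psi> \<omega>]] Linf_bound[OF \<phi> \<omega>] Linf_bound[OF \<psi> \<omega>]
        by (simp add: plus_fun_def)
    qed
  qed
qed

text \<open>A Cauchy sequence in the sup norm is Cauchy in every fibre at a common rate. The
  fibrewise limits, which exist by completeness of \<open>E\<close>, are therefore uniform, and
  uniform limits remain Bochner measurable.\<close>

lemma Linf_banach:
  assumes bs: "banach_subspace E n" and ne: "space M \<noteq> {}"
  shows "banach_subspace (Linf M E n) (supnorm M n)"
  unfolding banach_subspace_def
proof (intro conjI allI impI)
  have ns: "normed_subspace E n" using bs by (simp add: banach_subspace_def)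
  show "normed_subspace (Linf M E n) (supnorm M n)" by (rule Linf_normed[OF ns ne])
  interpret seminormed_space E n by (rule normed_subspace_seminormed[OF ns])
  interpret L: seminormed_space "Linf M E n" "supnorm M n"
    by (rule normed_subspace_seminormed[OF Linf_normed[OF ns ne]])
  fix x :: "nat \<Rightarrow> _ \<Rightarrow> _"
  assume x: "(\<forall>k. x k \<in> Linf M E n) \<and> (\<forall>e>0. \<exists>N. \<forall>k\<ge>N. \<forall>m\<ge>N. supnorm M n (x k - x m) < e)"
  then have xL: "x k \<in> Linf M E n" for k by blast
  have le: "n (x k \<omega> - x m \<omega>) \<le> supnorm M n (x k - x m)" if "\<omega> \<in> space M" for k m \<omega>
    using Linf_bound[OF L.diff_mem[OF xL xL] that, of k m] by (simp add: fun_diff_def)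
  have "\<exists>y\<in>E. (\<lambda>k. n (x k \<omega> - y)) \<longlonglongrightarrow> 0" if \<omega>: "\<omega> \<in> space M" for \<omega>
  proof -
    have "(\<forall>k. x k \<omega> \<in> E) \<and> (\<forall>e>0. \<exists>N. \<forall>k\<ge>N. \<forall>m\<ge>N. n (x k \<omega> - x m \<omega>) < e)"
      using x Linf_mem[OF xL \<omega>] le[OF \<omega>] by (meson le_less_trans)
    then show ?thesis using bs unfolding banach_subspace_def by (elim conjE allE[of _ "\<lambda>k. x k \<omega>"]) blast
  qed
  then obtain y where y: "\<And>\<omega>. \<omega> \<in> space M \<Longrightarrow> y \<omega> \<in> E \<and> (\<lambda>k. n (x k \<omega> - y \<omega>)) \<longlonglongrightarrow> 0" by metis
  define z where "z = (\<lambda>\<omega>. if \<omega> \<in> space M then y \<omega> else 0)"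
  have close: "\<exists>N. \<forall>k\<ge>N. \<forall>\<omega>\<in>space M. n (x k \<omega> - z \<omega>) \<le> e" if e: "e > 0" for e
  proof -
    obtain N where N: "\<forall>k\<ge>N. \<forall>m\<ge>N. supnorm M n (x k - x m) < e" using x e by blast
    have "n (x k \<omega> - z \<omega>) \<le> e" if k: "k \<ge> N" and \<omega>: "\<omega> \<in> space M" for k \<omega>
    proof -
      have "n (x k \<omega> - y \<omega>) \<le> e + n (x m \<omega> - y \<omega>)" if "m \<ge> N" for m
      proof -
        have "n (x k \<omega> - y \<omega>) = n ((x k \<omega> - x m \<omega>) + (x m \<omega> - y \<omega>))" by simp
        also have "\<dots> \<le> n (x k \<omega> - x m \<omega>) + n (x m \<omega> - y \<omega>)"
          using Linf_mem[OF xL \<omega>] y[OF \<omega>] by (intro triangle diff_mem) auto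
        also have "n (x k \<omega> - x m \<omega>) \<le> e" using le[OF \<omega>, of k m] N k that by force
        finally show ?thesis by simp
      qed
      moreover have "(\<lambda>m. e + n (x m \<omega> - y \<omega>)) \<longlonglongrightarrow> e + 0" using y[OF \<omega>] by (intro tendsto_intros) auto
      ultimately have "n (x k \<omega> - y \<omega>) \<le> e + 0" by (intro LIMSEQ_le_const) auto
      then show ?thesis using \<omega> by (simp add: z_def)
    qed
    then show ?thesis by blast
  qed
  have zE: "z \<omega> \<in> E" if "\<omega> \<in> space M" for \<omega> using y that by (simp add: z_def)
  have zL: "z \<in> Linf M E n"
  proof -
    obtain N where N: "\<forall>k\<ge>N. \<forall>\<omega>\<in>space M. n (x k \<omega> - z \<omega>) \<le> 1" using close[of 1] by auto
    show ?thesis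
    proof (rule LinfI)
      show "bochner_measurable M E n z"
      proof (rule bochner_uniform_limit[OF seminormed_space_axioms zE])
        fix e :: real assume "e > 0"
        then have "e / 2 > 0" by simp
        from close[OF this] obtain N where N: "\<forall>k\<ge>N. \<forall>\<omega>\<in>space M. n (x k \<omega> - z \<omega>) \<le> e / 2" by blast
        have "\<forall>\<omega>\<in>space M. n (x N \<omega> - z \<omega>) < e" using N \<open>e > 0\<close> by force
        then show "\<exists>\<psi>. bochner_measurable M E n \<psi> \<and> (\<forall>\<omega>\<in>space M. n (\<psi> \<omega> - z \<omega>) < e)"
          using Linf_bochner[OF xL, of N] by blast
      qed
      show "n (z \<omega>) \<le> supnorm M n (x N) + 1" if \<omega>: "\<omega> \<in> space M" for \<omega>
      proof -
        have "n (z \<omega>) = n (x N \<omega> - (x N \<omega> - z \<omega>))" by simp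
        also have "\<dots> \<le> n (x N \<omega>) + n (x N \<omega> - z \<omega>)"
          using Linf_mem[OF xL \<omega>] zE[OF \<omega>] by (intro triangle_diff diff_mem) auto
        finally show ?thesis using Linf_bound[OF xL \<omega>, of N] N \<omega> by force
      qed
    qed (simp add: z_def)
  qed
  have "(\<lambda>k. supnorm M n (x k - z)) \<longlonglongrightarrow> 0"
  proof (rule LIMSEQ_I)
    fix e :: real assume "e > 0"
    then have "e / 2 > 0" by simp
    from close[OF this] obtain N where N: "\<forall>k\<ge>N. \<forall>\<omega>\<in>space M. n (x k \<omega> - z \<omega>) \<le> e / 2" by blast
    have "norm (supnorm M n (x k - z) - 0) < e" if "k \<ge> N" for k
    proof -
      have "supnorm M n (x k - z) \<le> e / 2" using N that by (intro supnorm_le[OF ne]) (simp add: fun_diff_def)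
      then show ?thesis using L.nonneg[OF L.diff_mem[OF xL zL], of k] \<open>e > 0\<close> by simp
    qed
    then show "\<exists>no. \<forall>k\<ge>no. norm (supnorm M n (x k - z) - 0) < e" by blast
  qed
  then show "\<exists>y\<in>Linf M E n. (\<lambda>k. supnorm M n (x k - y)) \<longlonglongrightarrow> 0" using zL by blast
qed

text \<open>Only the powers of \<open>P\<close> are controlled; \<open>c\<close> may exceed 1, so
  \<open>P\<close> itself need not contract. The partial sums of \<open>(P ^^ k) y\<close> are
  Cauchy and converge to a solution, while telescoping writes \<open>x\<close> as such a sum for
  \<open>x - P x\<close> plus \<open>(P ^^ N) x\<close>, which gives the bound.\<close>

lemma neumann_inverse:
  fixes P :: "'v::real_vector \<Rightarrow> 'v"
  assumes bs: "banach_subspace X n"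
    and P: "\<And>x. x \<in> X \<Longrightarrow> P x \<in> X" "\<And>x y. x \<in> X \<Longrightarrow> y \<in> X \<Longrightarrow> P (x - y) = P x - P y"
    and bnd: "\<And>x k. x \<in> X \<Longrightarrow> n ((P ^^ k) x) \<le> c * q ^ k * n x" and c: "0 \<le> c" and q: "0 < q" "q < 1"
  shows "\<And>y. y \<in> X \<Longrightarrow> \<exists>x\<in>X. x - P x = y" and "\<And>x. x \<in> X \<Longrightarrow> n x \<le> c / (1 - q) * n (x - P x)"
proof -
  have ns: "normed_subspace X n" using bs by (simp add: banach_subspace_def)
  interpret seminormed_space X n by (rule normed_subspace_seminormed[OF ns])
  have Pk: "(P ^^ k) x \<in> X" if "x \<in> X" for x k using that P by (induction k) auto
  have Pkd: "(P ^^ k) (x - y) = (P ^^ k) x - (P ^^ k) y" if "x \<in> X" "y \<in> X" for x y k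
    using that P Pk by (induction k) auto
  have Sm: "(\<Sum>k<N. (P ^^ k) x) \<in> X" if "x \<in> X" for x N
    using that Pk subspace by (intro subspace_sum) auto
  have geo: "(\<Sum>k=M..<M+N. q ^ k) \<le> q ^ M / (1 - q)" for M N
  proof -
    have "(\<Sum>k=M..<M+N. q ^ k) = q ^ M * (\<Sum>k<N. q ^ k)"
      by (induction N) (auto simp: power_add algebra_simps)
    also have "(\<Sum>k<N. q ^ k) \<le> 1 / (1 - q)" using q by (simp add: sum_gp_strict divide_right_mono)
    finally show ?thesis using q by (simp add: mult_left_mono)
  qed
  have dif: "n ((\<Sum>k<M+N. (P ^^ k) x) - (\<Sum>k<M. (P ^^ k) x)) \<le> c * (\<Sum>k=M..<M+N. q ^ k) * n x" if x: "x \<in> X" for x M N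
  proof (induction N)
    case 0
    then show ?case by (simp add: norm_zero)
  next
    case (Suc N)
    have "(\<Sum>k<M+Suc N. (P ^^ k) x) - (\<Sum>k<M. (P ^^ k) x) = ((\<Sum>k<M+N. (P ^^ k) x) - (\<Sum>k<M. (P ^^ k) x)) + (P ^^ (M+N)) x"
      by simp
    then have "n ((\<Sum>k<M+Suc N. (P ^^ k) x) - (\<Sum>k<M. (P ^^ k) x)) \<le> n ((\<Sum>k<M+N. (P ^^ k) x) - (\<Sum>k<M. (P ^^ k) x)) + n ((P ^^ (M+N)) x)"
      using triangle[OF diff_mem[OF Sm[OF x, of "M+N"] Sm[OF x, of M]] Pk[OF x, of "M+N"]] by (simp only:)
    also have "\<dots> \<le> c * (\<Sum>k=M..<M+N. q ^ k) * n x + c * q ^ (M+N) * n x" using Suc bnd[OF x] by (intro add_mono)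
    finally show ?case by (simp add: algebra_simps)
  qed
  have dif': "n ((\<Sum>k<M+N. (P ^^ k) x) - (\<Sum>k<M. (P ^^ k) x)) \<le> c / (1 - q) * n x * q ^ M" if x: "x \<in> X" for x M N
  proof -
    have "c * (\<Sum>k=M..<M+N. q ^ k) * n x \<le> c * (q ^ M / (1 - q)) * n x"
      using geo c nonneg[OF x] by (intro mult_right_mono mult_left_mono) auto
    then show ?thesis using dif[OF x, of M N] by (simp add: mult_ac)
  qed
  have tele: "(\<Sum>k<N. (P ^^ k) (x - P x)) = x - (P ^^ N) x" if x: "x \<in> X" for x N
  proof (induction N)
    case (Suc N)
    have "(P ^^ N) (x - P x) = (P ^^ N) x - (P ^^ Suc N) x"
      using Pkd[OF x P(1)[OF x], of N] by (simp add: funpow_swap1)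
    then show ?case using Suc by simp
  qed simp
  have pow0: "(\<lambda>N. A * q ^ N) \<longlonglongrightarrow> 0" for A
    using tendsto_mult_right_zero[OF LIMSEQ_realpow_zero[of q]] q by simp
  {
    fix x assume x: "x \<in> X"
    let ?y = "x - P x"
    have y: "?y \<in> X" using x P by (intro diff_mem)
    have "n x \<le> c / (1 - q) * n ?y + c * n x * q ^ N" for N
    proof -
      have "x = (\<Sum>k<N. (P ^^ k) ?y) + (P ^^ N) x" using tele[OF x, of N] by simp
      then have "n x \<le> n (\<Sum>k<N. (P ^^ k) ?y) + n ((P ^^ N) x)"
        using triangle[OF Sm[OF y] Pk[OF x]] by metis
      also have "\<dots> \<le> c / (1 - q) * n ?y + c * n x * q ^ N"
        using dif'[OF y, of 0 N] bnd[OF x, of N] by (simp add: mult_ac)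
      finally show ?thesis .
    qed
    moreover have "(\<lambda>N. c / (1 - q) * n ?y + c * n x * q ^ N) \<longlonglongrightarrow> c / (1 - q) * n ?y + 0"
      by (intro tendsto_add tendsto_const pow0)
    ultimately have "n x \<le> c / (1 - q) * n ?y + 0" by (intro LIMSEQ_le_const) auto
    then show "n x \<le> c / (1 - q) * n (x - P x)" by simp
  }
  fix y assume y: "y \<in> X"
  let ?S = "\<lambda>N. \<Sum>k<N. (P ^^ k) y"
  have cauchy: "\<forall>e>0. \<exists>N. \<forall>k\<ge>N. \<forall>m\<ge>N. n (?S k - ?S m) < e"
  proof (intro allI impI)
    fix e :: real assume e: "e > 0"
    have "\<forall>\<^sub>F N in sequentially. dist (c / (1 - q) * n y * q ^ N) 0 < e / 2"
      by (rule tendstoD[OF pow0]) (use e in simp)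
    then obtain N where "\<forall>N'\<ge>N. dist (c / (1 - q) * n y * q ^ N') 0 < e / 2"
      unfolding eventually_sequentially by blast
    then have "dist (c / (1 - q) * n y * q ^ N) 0 < e / 2" by blast
    then have N: "c / (1 - q) * n y * q ^ N < e / 2" unfolding dist_real_def by linarith
    have near: "n (?S k - ?S N) < e / 2" if "k \<ge> N" for k
      using order.strict_trans1[OF dif'[OF y, of N "k - N"] N] that by simp
    have "n (?S k - ?S m) < e" if "k \<ge> N" "m \<ge> N" for k m
    proof -
      have "n (?S k - ?S m) = n ((?S k - ?S N) - (?S m - ?S N))" by simp
      also have "\<dots> \<le> n (?S k - ?S N) + n (?S m - ?S N)" using Sm[OF y] by (intro triangle_diff diff_mem)
      finally show ?thesis using near[OF that(1)] near[OF that(2)] by simp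
    qed
    then show "\<exists>N. \<forall>k\<ge>N. \<forall>m\<ge>N. n (?S k - ?S m) < e" by blast
  qed
  have "\<forall>x :: nat \<Rightarrow> 'v. (\<forall>k. x k \<in> X) \<and> (\<forall>e>0. \<exists>N. \<forall>k\<ge>N. \<forall>m\<ge>N. n (x k - x m) < e) \<longrightarrow> (\<exists>y\<in>X. (\<lambda>k. n (x k - y)) \<longlonglongrightarrow> 0)"
    using bs unfolding banach_subspace_def by (elim conjE)
  from this[rule_format, of ?S] obtain x where x: "x \<in> X" "(\<lambda>k. n (?S k - x)) \<longlonglongrightarrow> 0"
    using Sm[OF y] cauchy by blast
  \<comment> \<open>The power bound at exponent 1 is the continuity of \<open>P\<close> needed to
    pass to the limit in \<open>y + P (S N) = S (Suc N)\<close>.\<close>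
  have P1: "n (P z) \<le> c * q * n z" if "z \<in> X" for z using bnd[OF that, of 1] by simp
  have PS: "y + P (?S N) = ?S (Suc N)" for N
  proof -
    have Pa: "P (a + b) = P a + P b" if "a \<in> X" "b \<in> X" for a b
      using P(2)[OF add_mem[OF that] that(2)] by simp
    have P0: "P 0 = 0" using P(2)[OF zero_mem zero_mem] by simp
    have "P (?S N) = (\<Sum>k<N. (P ^^ Suc k) y)"
      by (induction N) (auto simp: P0 Pa[OF Sm[OF y] Pk[OF y]])
    then show ?thesis by (simp add: sum.lessThan_Suc_shift del: sum.lessThan_Suc)
  qed
  have r: "x - P x - y \<in> X" using x(1) P(1) y by (intro diff_mem)
  have "n (x - P x - y) \<le> n (?S (Suc N) - x) + c * q * n (?S N - x)" for N
  proof -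
    have "x - P x - y = P (?S N - x) - (?S (Suc N) - x)"
      using P(2)[OF Sm[OF y] x(1), of N] PS[of N] by (simp add: algebra_simps)
    then have "n (x - P x - y) \<le> n (P (?S N - x)) + n (?S (Suc N) - x)"
      using triangle_diff[OF P(1)[OF diff_mem[OF Sm[OF y] x(1)]] diff_mem[OF Sm[OF y] x(1)], of N "Suc N"] by metis
    also have "n (P (?S N - x)) \<le> c * q * n (?S N - x)" using Sm[OF y] x(1) by (intro P1 diff_mem)
    finally show ?thesis by simp
  qed
  moreover have "(\<lambda>N. n (?S (Suc N) - x) + c * q * n (?S N - x)) \<longlonglongrightarrow> 0 + c * q * 0"
    by (intro tendsto_intros x(2) LIMSEQ_Suc[OF x(2)])
  ultimately have "n (x - P x - y) \<le> 0 + c * q * 0" by (intro LIMSEQ_le_const) auto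
  then have "x - P x - y = 0" using nonneg[OF r] normed_subspace_eq_0[OF ns r] by simp
  then show "\<exists>x\<in>X. x - P x = y" using x(1) by (intro bexI[of _ x]) auto
qed

section \<open>Random products of cone contractions\<close>

text \<open>Letting \<epsilon> decrease to \<open>\<delta> / \<mu>\<close> turns the hypothesis into
  \<open>D \<le> c / \<mu> * \<delta>\<close>. If \<delta> is too large for any admissible
  \<epsilon>, that is at least \<open>\<epsilon>0 * \<mu>\<close>, the crude bound \<open>B\<close>
  is itself at most \<open>B / (\<epsilon>0 * \<mu>) * \<delta>\<close>.\<close>

lemma linear_bound_from_scales:
  fixes D :: real
  assumes "0 < \<epsilon>0" "0 < c" "0 < \<mu>" "0 \<le> \<delta>" "0 \<le> B" "D \<le> B"
    and *: "\<And>\<epsilon>. 0 < \<epsilon> \<Longrightarrow> \<epsilon> \<le> \<epsilon>0 \<Longrightarrow> \<delta> < \<epsilon> * \<mu> \<Longrightarrow> D \<le> c * \<epsilon>"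
  shows "D \<le> (c / \<mu> + B / (\<epsilon>0 * \<mu>)) * \<delta>"
proof -
  have p: "0 \<le> c / \<mu> * \<delta>" "0 \<le> B / (\<epsilon>0 * \<mu>) * \<delta>" using assms by auto
  show ?thesis
  proof (cases "\<epsilon>0 * \<mu> \<le> \<delta>")
    case True
    have "B / (\<epsilon>0 * \<mu>) * (\<epsilon>0 * \<mu>) \<le> B / (\<epsilon>0 * \<mu>) * \<delta>" using True assms by (intro mult_left_mono) auto
    then have "B \<le> B / (\<epsilon>0 * \<mu>) * \<delta>" using assms by simp
    then show ?thesis unfolding distrib_right using p assms(6) by linarith
  next
    case False
    then have lt: "\<delta> / \<mu> < \<epsilon>0" using assms by (simp add: field_simps)
    have "D / c \<le> \<delta> / \<mu>"
    proof (rule dense_ge_bounded[OF lt])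
      fix \<epsilon> assume e: "\<delta> / \<mu> < \<epsilon>" "\<epsilon> < \<epsilon>0"
      have "0 \<le> \<delta> / \<mu>" using assms by simp
      then have "0 < \<epsilon>" using e by simp
      moreover have "\<delta> < \<epsilon> * \<mu>" using e assms by (simp add: pos_divide_less_eq)
      ultimately have "D \<le> c * \<epsilon>" using * e by simp
      then show "D / c \<le> \<epsilon>" using assms by (simp add: field_simps)
    qed
    then have "D \<le> c / \<mu> * \<delta>" using assms by (simp add: field_simps)
    then show ?thesis unfolding distrib_right using p by linarith
  qed
qed

text \<open>The scalar factor enters as the mass of another section, so that the eigenvalue equation
  is quadratic within one space of sections and needs no separate space of scalar functions.\<close>

definition bmul :: "('v \<Rightarrow> real) \<Rightarrow> ('w \<Rightarrow> 'v::real_vector) \<Rightarrow> ('w \<Rightarrow> 'v) \<Rightarrow> 'w \<Rightarrow> 'v" where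
  "bmul e \<phi> \<psi> = (\<lambda>\<omega>. e (\<phi> \<omega>) *\<^sub>R \<psi> \<omega>)"

locale cocycle_level = cone_space E n C ell K \<rho>
  for E :: "'v::real_vector set" and n C ell K \<rho> +
  fixes M :: "'w measure" and \<tau> :: "'w \<Rightarrow> 'w" and U :: "'b set" and \<theta> :: real
    and L :: "'b \<Rightarrow> 'w \<Rightarrow> 'v \<Rightarrow> 'v" and f :: "'b \<Rightarrow> 'w \<Rightarrow> 'v" and e :: "'v \<Rightarrow> real"
  assumes ne: "space M \<noteq> {}" and bij: "bij_betw \<tau> (space M) (space M)" and \<theta>: "1 \<le> \<theta>"
    and L: "\<And>u \<omega>. u \<in> U \<Longrightarrow> \<omega> \<in> space M \<Longrightarrow> pos_op (L u \<omega>)"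
      "\<And>u \<omega>. u \<in> U \<Longrightarrow> \<omega> \<in> space M \<Longrightarrow> 1 / \<theta> \<le> opnorm E n n (L u \<omega>)"
      "\<And>u \<omega>. u \<in> U \<Longrightarrow> \<omega> \<in> space M \<Longrightarrow> opnorm E n n (L u \<omega>) \<le> \<theta>"
    and L_meas: "\<And>u \<phi>. u \<in> U \<Longrightarrow> \<phi> \<in> Linf M E n \<Longrightarrow> Lop M \<tau> (L u) \<phi> \<in> Linf M E n"
    and f_X: "\<And>u. u \<in> U \<Longrightarrow> f u \<in> Linf M E n"
    and f: "\<And>u \<omega>. u \<in> U \<Longrightarrow> \<omega> \<in> space M \<Longrightarrow> f u \<omega> \<in> CR" "\<And>u \<omega>. u \<in> U \<Longrightarrow> \<omega> \<in> space M \<Longrightarrow> ell (f u \<omega>) = 1"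
    and fix_eq: "\<And>u \<omega>. u \<in> U \<Longrightarrow> \<omega> \<in> space M \<Longrightarrow>
      f u \<omega> = (1 / ell (Lop M \<tau> (L u) (f u) \<omega>)) *\<^sub>R Lop M \<tau> (L u) (f u) \<omega>"
    and e: "\<And>x. x \<in> E \<Longrightarrow> e x = ell x"
begin

abbreviation "X \<equiv> Linf M E n"
abbreviation "N \<equiv> supnorm M n"
abbreviation "LX u \<equiv> Lop M \<tau> (L u)"
abbreviation "\<pi> \<equiv> inv_into (space M) \<tau>"

definition m0 :: real where "m0 = \<rho> / (4 * K * \<theta>)"

lemma m0: "0 < m0"
  using K \<rho> \<theta> by (simp add: m0_def)

lemma \<pi>: "\<omega> \<in> space M \<Longrightarrow> \<pi> \<omega> \<in> space M"
  using bij by (metis bij_betw_def inv_into_into)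

lemma \<pi>_\<tau>: "\<omega> \<in> space M \<Longrightarrow> \<pi> (\<tau> \<omega>) = \<omega>" and \<tau>: "\<omega> \<in> space M \<Longrightarrow> \<tau> \<omega> \<in> space M"
  using bij by (auto simp: bij_betw_def)

lemma Lop_eq: "\<omega> \<in> space M \<Longrightarrow> LX u \<phi> \<omega> = L u (\<pi> \<omega>) (\<phi> (\<pi> \<omega>))"
  by (simp add: Lop_def)

lemma LX_mem: "u \<in> U \<Longrightarrow> \<phi> \<in> X \<Longrightarrow> \<omega> \<in> space M \<Longrightarrow> LX u \<phi> \<omega> \<in> E"
  using Linf_mem[OF L_meas] .

definition \<Lambda> :: "'b \<Rightarrow> 'w \<Rightarrow> real" where
  "\<Lambda> u \<omega> = (if \<omega> \<in> space M then ell (LX u (f u) \<omega>) else 0)"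

lemma mass: "u \<in> U \<Longrightarrow> \<omega> \<in> space M \<Longrightarrow> x \<in> CR \<Longrightarrow> ell x = 1 \<Longrightarrow> m0 \<le> ell (L u \<omega> x)"
  unfolding m0_def using mass_lower_bound L \<theta> by blast

lemma \<Lambda>_lower: "u \<in> U \<Longrightarrow> \<omega> \<in> space M \<Longrightarrow> m0 \<le> \<Lambda> u \<omega>"
  unfolding \<Lambda>_def using mass f \<pi> by (simp add: Lop_eq)

lemma \<Lambda>_pos: "u \<in> U \<Longrightarrow> \<omega> \<in> space M \<Longrightarrow> 0 < \<Lambda> u \<omega>"
  using \<Lambda>_lower m0 by (meson less_le_trans)

lemma eig: "u \<in> U \<Longrightarrow> \<omega> \<in> space M \<Longrightarrow> LX u (f u) \<omega> = \<Lambda> u \<omega> *\<^sub>R f u \<omega>"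
  using fix_eq[of u \<omega>] \<Lambda>_pos[of u \<omega>] by (simp add: \<Lambda>_def)

lemma cocycle: "u \<in> U \<Longrightarrow> cone_cocycle E n C ell K \<rho> (space M) \<pi> (L u) (f u) (\<Lambda> u)"
  by unfold_locales (use \<pi> L f eig \<Lambda>_pos in \<open>auto simp: Lop_eq\<close>)

lemma normedX: "normed_subspace X N"
  by (rule Linf_normed[OF normed ne])

sublocale X: seminormed_space X N
  by (rule normed_subspace_seminormed[OF normedX])

lemma f_norm: "u \<in> U \<Longrightarrow> N (f u) \<le> K"
  using norm_le_K[OF CR_C[OF f(1)] f(2)] by (intro supnorm_le[OF ne]) auto

lemma L_bound: "u \<in> U \<Longrightarrow> \<omega> \<in> space M \<Longrightarrow> x \<in> E \<Longrightarrow> n (L u \<omega> x) \<le> \<theta> * n x"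
  using opnorm_bound[OF pos_op_op[OF L(1)] seminormed_space_axioms seminormed_space_axioms, of u \<omega> x]
    mult_right_mono[OF L(3) nonneg, of u \<omega> x] by simp

lemma LX_op: "u \<in> U \<Longrightarrow> LX u \<in> op_space X N X N"
proof (rule op_spaceI[where B = \<theta>])
  assume u: "u \<in> U"
  have Lop: "L u \<omega> \<in> op_space E n E n" if "\<omega> \<in> space M" for \<omega> using pos_op_op[OF L(1)[OF u that]] .
  show "LX u \<phi> \<in> X" if "\<phi> \<in> X" for \<phi> by (rule L_meas[OF u that])
  show "LX u (\<phi> + \<psi>) = LX u \<phi> + LX u \<psi>" if "\<phi> \<in> X" "\<psi> \<in> X" for \<phi> \<psi>
    using \<pi> op_space_add[OF Lop] Linf_mem[OF that(1)] Linf_mem[OF that(2)]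
    by (auto simp: Lop_def plus_fun_def fun_eq_iff)
  show "LX u (c *\<^sub>R \<phi>) = c *\<^sub>R LX u \<phi>" if "\<phi> \<in> X" for c \<phi>
    using \<pi> op_space_scale[OF Lop] Linf_mem[OF that]
    by (auto simp: Lop_def scaleR_fun_def fun_eq_iff)
  show "N (LX u \<phi>) \<le> \<theta> * N \<phi>" if \<phi>: "\<phi> \<in> X" for \<phi>
  proof (rule supnorm_le[OF ne])
    fix \<omega> assume \<omega>: "\<omega> \<in> space M"
    have "n (LX u \<phi> \<omega>) \<le> \<theta> * n (\<phi> (\<pi> \<omega>))"
      using L_bound[OF u \<pi>[OF \<omega>] Linf_mem[OF \<phi> \<pi>[OF \<omega>]]] \<omega> by (simp add: Lop_eq)
    also have "\<dots> \<le> \<theta> * N \<phi>" using Linf_bound[OF \<phi> \<pi>[OF \<omega>]] \<theta> by (intro mult_left_mono) auto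
    finally show "n (LX u \<phi> \<omega>) \<le> \<theta> * N \<phi>" .
  qed
qed (rule X.subspace)

lemma ell_Linf:
  assumes \<phi>: "\<phi> \<in> X"
  shows "(\<lambda>\<omega>. if \<omega> \<in> space M then ell (\<phi> \<omega>) else 0) \<in> Linf M UNIV abs"
proof (rule LinfI)
  have "bochner_measurable M UNIV abs (\<lambda>\<omega>. ell (\<phi> \<omega>))"
  proof (rule bochner_combine[OF Linf_bochner[OF \<phi>] Linf_bochner[OF \<phi>], where F = "\<lambda>x y. ell x"])
    fix r :: real assume r: "0 < r"
    have "\<bar>ell x - ell (\<phi> \<omega>)\<bar> < r" if "\<omega> \<in> space M" "x \<in> E" "n (x - \<phi> \<omega>) < r" for \<omega> x
      using ell_le[OF diff_mem[OF that(2) Linf_mem[OF \<phi> that(1)]]] that Linf_mem[OF \<phi> that(1)]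
      by (simp add: ell_diff)
    then show "\<exists>d>0. \<forall>\<omega>\<in>space M. \<forall>x\<in>E. \<forall>y\<in>E. n (x - \<phi> \<omega>) < d \<longrightarrow> n (y - \<phi> \<omega>) < d \<longrightarrow> \<bar>ell x - ell (\<phi> \<omega>)\<bar> < r"
      using r by (intro exI[of _ r]) auto
  qed simp
  then have "(\<lambda>\<omega>. ell (\<phi> \<omega>)) \<in> borel_measurable M" by (simp add: bochner_real)
  then show "bochner_measurable M UNIV abs (\<lambda>\<omega>. if \<omega> \<in> space M then ell (\<phi> \<omega>) else 0)"
    unfolding bochner_real by (rule measurable_cong[THEN iffD1, rotated]) auto
  show "\<bar>if \<omega> \<in> space M then ell (\<phi> \<omega>) else 0\<bar> \<le> N \<phi>" if "\<omega> \<in> space M" for \<omega>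
    using ell_le[OF Linf_mem[OF \<phi> that]] Linf_bound[OF \<phi> that] that by simp
qed auto

lemma bmul_mem:
  assumes \<phi>: "\<phi> \<in> X" and \<psi>: "\<psi> \<in> X"
  shows "bmul e \<phi> \<psi> \<in> X"
proof -
  have "(\<lambda>\<omega>. (if \<omega> \<in> space M then ell (\<phi> \<omega>) else 0) *\<^sub>R \<psi> \<omega>) = bmul e \<phi> \<psi>"
    using Linf_off[OF \<psi>] Linf_mem[OF \<phi>] e by (auto simp: bmul_def fun_eq_iff)
  then show ?thesis using Linf_smul[OF seminormed_space_axioms ell_Linf[OF \<phi>] \<psi>] by simp
qed

lemma bmul_bilin: "bilin X N X N X N (bmul e)"
proof unfold_locales
  show "\<exists>B\<ge>0. \<forall>\<phi>\<in>X. \<forall>\<psi>\<in>X. N (bmul e \<phi> \<psi>) \<le> B * (N \<phi> * N \<psi>)"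
  proof (intro exI[of _ 1] conjI ballI)
    fix \<phi> \<psi> assume \<phi>: "\<phi> \<in> X" and \<psi>: "\<psi> \<in> X"
    show "N (bmul e \<phi> \<psi>) \<le> 1 * (N \<phi> * N \<psi>)"
    proof (rule supnorm_le[OF ne])
      fix \<omega> assume \<omega>: "\<omega> \<in> space M"
      have "n (bmul e \<phi> \<psi> \<omega>) = \<bar>ell (\<phi> \<omega>)\<bar> * n (\<psi> \<omega>)"
        using Linf_mem[OF \<phi> \<omega>] Linf_mem[OF \<psi> \<omega>] e by (simp add: bmul_def scale)
      also have "\<dots> \<le> N \<phi> * N \<psi>"
        using ell_le[OF Linf_mem[OF \<phi> \<omega>]] Linf_bound[OF \<phi> \<omega>] Linf_bound[OF \<psi> \<omega>] nonneg[OF Linf_mem[OF \<psi> \<omega>]]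
          X.nonneg[OF \<phi>] by (intro mult_mono) auto
      finally show "n (bmul e \<phi> \<psi> \<omega>) \<le> 1 * (N \<phi> * N \<psi>)" by simp
    qed
  qed simp
  fix \<phi> \<phi>' \<psi> a assume \<phi>: "\<phi> \<in> X" and \<psi>: "\<psi> \<in> X"
  show "bmul e \<phi> \<psi> \<in> X" by (rule bmul_mem[OF \<phi> \<psi>])
  show "bmul e (a *\<^sub>R \<phi>) \<psi> = a *\<^sub>R bmul e \<phi> \<psi>"
  proof
    fix \<omega> show "bmul e (a *\<^sub>R \<phi>) \<psi> \<omega> = (a *\<^sub>R bmul e \<phi> \<psi>) \<omega>"
      using Linf_mem[OF \<phi>] Linf_off[OF \<psi>] e ell_scale
      by (cases "\<omega> \<in> space M") (auto simp: bmul_def scaleR_fun_def scale_mem)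
  qed
  show "bmul e \<phi> (a *\<^sub>R \<psi>) = a *\<^sub>R bmul e \<phi> \<psi>" by (auto simp: bmul_def scaleR_fun_def)
next
  fix \<phi> \<phi>' \<psi> assume \<phi>: "\<phi> \<in> X" and \<phi>': "\<phi>' \<in> X" and \<psi>: "\<psi> \<in> X"
  show "bmul e (\<phi> + \<phi>') \<psi> = bmul e \<phi> \<psi> + bmul e \<phi>' \<psi>"
  proof
    fix \<omega> show "bmul e (\<phi> + \<phi>') \<psi> \<omega> = (bmul e \<phi> \<psi> + bmul e \<phi>' \<psi>) \<omega>"
      using Linf_mem[OF \<phi>] Linf_mem[OF \<phi>'] Linf_off[OF \<psi>] e ell_add
      by (cases "\<omega> \<in> space M") (auto simp: bmul_def plus_fun_def add_mem scaleR_left_distrib)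
  qed
qed (auto simp: bmul_def plus_fun_def scaleR_right_distrib)

lemma f_bmul_eq: "u \<in> U \<Longrightarrow> LX u (f u) = bmul e (LX u (f u)) (f u)"
proof
  fix \<omega> assume u: "u \<in> U"
  show "LX u (f u) \<omega> = bmul e (LX u (f u)) (f u) \<omega>"
  proof (cases "\<omega> \<in> space M")
    case True
    have "e (LX u (f u) \<omega>) = \<Lambda> u \<omega>" using e LX_mem[OF u f_X[OF u] True] True by (simp add: \<Lambda>_def)
    then show ?thesis using eig[OF u True] by (simp add: bmul_def)
  next
    case False
    then show ?thesis using Linf_off[OF f_X[OF u]] Linf_off[OF L_meas[OF u f_X[OF u]]] by (simp add: bmul_def)
  qed
qed

definition A :: "'b \<Rightarrow> ('w \<Rightarrow> 'v) \<Rightarrow> 'w \<Rightarrow> 'v" where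
  "A u \<psi> = bmul e (LX u (f u)) \<psi> - LX u \<psi> + bmul e (LX u \<psi>) (f u)"

lemma A_mem: "u \<in> U \<Longrightarrow> \<psi> \<in> X \<Longrightarrow> A u \<psi> \<in> X"
  unfolding A_def using f_X L_meas by (intro X.add_mem X.diff_mem bmul_mem) auto

text \<open>The operator \<open>P\<close> of the cocycle on sections. The scalar factor is cut off
  outside \<open>space M\<close>, so that the result is again an element of
  \<open>X\<close>.\<close>

definition PX :: "'b \<Rightarrow> ('w \<Rightarrow> 'v) \<Rightarrow> 'w \<Rightarrow> 'v" where
  "PX u \<psi> = (\<lambda>\<omega>. (if \<omega> \<in> space M then 1 / \<Lambda> u \<omega> else 0) *\<^sub>R (LX u \<psi> - bmul e (LX u \<psi>) (f u)) \<omega>)"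

lemma inv\<Lambda>_Linf:
  assumes u: "u \<in> U"
  shows "(\<lambda>\<omega>. if \<omega> \<in> space M then 1 / \<Lambda> u \<omega> else 0) \<in> Linf M UNIV abs"
proof -
  have "\<Lambda> u \<in> Linf M UNIV abs" using ell_Linf[OF L_meas[OF u f_X[OF u]]] by (simp add: \<Lambda>_def[abs_def])
  then have "\<Lambda> u \<in> borel_measurable M" by (simp add: Linf_real)
  then have "(\<lambda>\<omega>. 1 / \<Lambda> u \<omega>) \<in> borel_measurable M" by measurable
  then have m: "(\<lambda>\<omega>. if \<omega> \<in> space M then 1 / \<Lambda> u \<omega> else 0) \<in> borel_measurable M"
    by (rule measurable_cong[THEN iffD1, rotated]) auto
  have "\<bar>1 / \<Lambda> u \<omega>\<bar> \<le> 1 / m0" if "\<omega> \<in> space M" for \<omega>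
    using \<Lambda>_lower[OF u that] \<Lambda>_pos[OF u that] m0 by (simp add: frac_le)
  then show ?thesis using m unfolding Linf_real by auto
qed

lemma PX_mem: "u \<in> U \<Longrightarrow> \<psi> \<in> X \<Longrightarrow> PX u \<psi> \<in> X"
  unfolding PX_def using f_X L_meas
  by (intro Linf_smul[OF seminormed_space_axioms inv\<Lambda>_Linf] X.diff_mem bmul_mem) auto

lemma A_eq: "u \<in> U \<Longrightarrow> \<psi> \<in> X \<Longrightarrow> \<omega> \<in> space M \<Longrightarrow> A u \<psi> \<omega> = \<Lambda> u \<omega> *\<^sub>R (\<psi> - PX u \<psi>) \<omega>"
  using \<Lambda>_pos[of u \<omega>] e LX_mem[OF _ f_X, of u u \<omega>]
  by (simp add: A_def PX_def plus_fun_def fun_diff_def bmul_def \<Lambda>_def algebra_simps)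

text \<open>Off \<open>space M\<close> the formula for \<open>P\<close> involves arbitrary values of
  the inverse of \<tau>, so the iterates can be compared on \<open>space M\<close> only; the sup
  norm looks no further.\<close>

lemma PX_power:
  assumes u: "u \<in> U" and \<psi>: "\<psi> \<in> X"
  shows "(PX u ^^ k) \<psi> \<in> X \<and> (\<forall>\<omega>\<in>space M. (PX u ^^ k) \<psi> \<omega> = (cone_cocycle.P ell \<pi> (L u) (f u) (\<Lambda> u) ^^ k) \<psi> \<omega>)"
proof (induction k)
  case 0
  then show ?case using \<psi> by simp
next
  case (Suc k)
  interpret cc: cone_cocycle E n C ell K \<rho> "space M" \<pi> "L u" "f u" "\<Lambda> u" by (rule cocycle[OF u])
  have step: "PX u \<zeta> \<omega> = cc.P \<xi> \<omega>" if \<omega>: "\<omega> \<in> space M" and \<zeta>: "\<zeta> \<in> X" "\<forall>\<omega>\<in>space M. \<zeta> \<omega> = \<xi> \<omega>" for \<omega> \<zeta> \<xi>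
    using \<omega> \<pi>[OF \<omega>] LX_mem[OF u \<zeta>(1) \<omega>] e \<zeta>(2)
    by (simp add: PX_def cc.P_def bmul_def fun_diff_def Lop_eq)
  have "PX u ((PX u ^^ k) \<psi>) \<omega> = cc.P ((cc.P ^^ k) \<psi>) \<omega>" if \<omega>: "\<omega> \<in> space M" for \<omega>
    using Suc \<omega> by (intro step) auto
  then show ?case using PX_mem[OF u] Suc by simp
qed

text \<open>\<open>A u\<close> is multiplication by \<open>\<Lambda> u\<close> after
  \<open>1 - PX u\<close>. The first factor is at least \<open>m0\<close> and the second is inverted
  by the Neumann series with the constants of \<open>P_power_bound\<close>; all of these depend only
  on \<open>K\<close>, \<rho> and \<theta>, which makes the bound uniform in
  \<open>u\<close>.\<close>

lemma inverse:
  obtains B where "0 \<le> B" "\<And>u x. u \<in> U \<Longrightarrow> x \<in> X \<Longrightarrow> N x \<le> B * N (A u x)"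
    and "\<And>u y. u \<in> U \<Longrightarrow> y \<in> X \<Longrightarrow> \<exists>x\<in>X. A u x = y"
proof -
  define c where "c = 8 * K / \<rho>"
  have c: "0 \<le> c" using K \<rho> by (simp add: c_def)
  have bs: "banach_subspace X N" by (rule Linf_banach[OF banach ne])
  have PXd: "PX u (x - y) = PX u x - PX u y" if u: "u \<in> U" and x: "x \<in> X" and y: "y \<in> X" for u x y
  proof -
    interpret b: bilin X N X N X N "bmul e" by (rule bmul_bilin)
    have "LX u (x - y) - bmul e (LX u (x - y)) (f u) =
        (LX u x - bmul e (LX u x) (f u)) - (LX u y - bmul e (LX u y) (f u))"
      using op_space_diff[OF LX_op[OF u] x y] b.diff_left[OF L_meas[OF u x] L_meas[OF u y] f_X[OF u]] by simp
    then show ?thesis unfolding PX_def by (auto simp: fun_diff_def scaleR_diff_right)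
  qed
  have bnd: "N ((PX u ^^ k) x) \<le> c * \<gamma> ^ k * N x" if u: "u \<in> U" and x: "x \<in> X" for u x k
  proof (rule supnorm_le[OF ne])
    interpret cc: cone_cocycle E n C ell K \<rho> "space M" \<pi> "L u" "f u" "\<Lambda> u" by (rule cocycle[OF u])
    fix \<omega> assume \<omega>: "\<omega> \<in> space M"
    show "n ((PX u ^^ k) x \<omega>) \<le> c * \<gamma> ^ k * N x"
      using PX_power[OF u x, where k = k] cc.P_power_bound[where k = k, OF Linf_mem[OF x] Linf_bound[OF x] \<omega>] \<omega>
      by (simp add: c_def)
  qed
  have neu: "(\<forall>y\<in>X. \<exists>x\<in>X. x - PX u x = y) \<and> (\<forall>x\<in>X. N x \<le> c / (1 - \<gamma>) * N (x - PX u x))" if u: "u \<in> U" for u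
  proof (intro conjI ballI)
    show "\<exists>x\<in>X. x - PX u x = y" if "y \<in> X" for y
      by (rule neumann_inverse(1)[where P = "PX u" and c = c and q = \<gamma> and n = N])
         (use bs PX_mem[OF u] PXd[OF u] bnd[OF u] c \<gamma> that in simp_all)
    show "N x \<le> c / (1 - \<gamma>) * N (x - PX u x)" if "x \<in> X" for x
      by (rule neumann_inverse(2)[where P = "PX u" and c = c and q = \<gamma> and n = N and X = X])
         (use bs PX_mem[OF u] PXd[OF u] bnd[OF u] c \<gamma> that in simp_all)
  qed
  have Asm: "A u x = (\<lambda>\<omega>. \<Lambda> u \<omega> *\<^sub>R (x - PX u x) \<omega>)" if "u \<in> U" "x \<in> X" for u x
  proof
    fix \<omega> show "A u x \<omega> = \<Lambda> u \<omega> *\<^sub>R (x - PX u x) \<omega>"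
      using A_eq[OF that] Linf_off[OF A_mem[OF that]] by (cases "\<omega> \<in> space M") (auto simp: \<Lambda>_def)
  qed
  show ?thesis
  proof (rule that[of "c / (1 - \<gamma>) * (1 / m0)"])
    show "0 \<le> c / (1 - \<gamma>) * (1 / m0)" using c \<gamma> m0 by simp
    fix u assume u: "u \<in> U"
    {
      fix x assume x: "x \<in> X"
      have "N (x - PX u x) \<le> 1 / m0 * N (A u x)"
      proof (rule supnorm_le[OF ne])
        fix \<omega> assume \<omega>: "\<omega> \<in> space M"
        have m: "(x - PX u x) \<omega> \<in> E" using Linf_mem[OF X.diff_mem[OF x PX_mem[OF u x]] \<omega>] .
        have "m0 * n ((x - PX u x) \<omega>) \<le> \<Lambda> u \<omega> * n ((x - PX u x) \<omega>)"
          using \<Lambda>_lower[OF u \<omega>] nonneg[OF m] by (rule mult_right_mono)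
        also have "\<dots> = n (A u x \<omega>)" using A_eq[OF u x \<omega>] \<Lambda>_pos[OF u \<omega>] m by (simp add: scale)
        also have "\<dots> \<le> N (A u x)" by (rule Linf_bound[OF A_mem[OF u x] \<omega>])
        finally show "n ((x - PX u x) \<omega>) \<le> 1 / m0 * N (A u x)" using m0 by (simp add: field_simps)
      qed
      then have "c / (1 - \<gamma>) * N (x - PX u x) \<le> c / (1 - \<gamma>) * (1 / m0 * N (A u x))"
        using c \<gamma> by (intro mult_left_mono) auto
      then show "N x \<le> c / (1 - \<gamma>) * (1 / m0) * N (A u x)" using neu[OF u] x by fastforce
    }
    fix y assume y: "y \<in> X"
    define z where "z = (\<lambda>\<omega>. (if \<omega> \<in> space M then 1 / \<Lambda> u \<omega> else 0) *\<^sub>R y \<omega>)"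
    have "z \<in> X" unfolding z_def by (rule Linf_smul[OF seminormed_space_axioms inv\<Lambda>_Linf[OF u] y])
    then obtain x where x: "x \<in> X" "x - PX u x = z" using neu[OF u] by blast
    have "A u x = y"
      unfolding Asm[OF u x(1)] x(2)
    proof
      fix \<omega> show "\<Lambda> u \<omega> *\<^sub>R z \<omega> = y \<omega>"
        using \<Lambda>_pos[OF u, of \<omega>] Linf_off[OF y, of \<omega>] by (cases "\<omega> \<in> space M") (auto simp: z_def)
    qed
    then show "\<exists>x\<in>X. A u x = y" using x by blast
  qed
qed

text \<open>Serves two ends: with \<open>v = u\<close> it compares two invariant sections of one
  cocycle and gives uniqueness, with \<open>g = f v\<close> it compares the cocycles of two
  parameters.\<close>

lemma compare_fixed:
  assumes u: "u \<in> U" and v: "v \<in> U" and \<epsilon>: "0 < \<epsilon>" "\<epsilon> \<le> (1 - \<gamma>) / 8"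
    and g: "\<And>\<omega>. \<omega> \<in> space M \<Longrightarrow> g \<omega> \<in> CR" "\<And>\<omega>. \<omega> \<in> space M \<Longrightarrow> ell (g \<omega>) = 1"
    and geq: "\<And>\<omega>. \<omega> \<in> space M \<Longrightarrow> L v (\<pi> \<omega>) (g (\<pi> \<omega>)) = \<Lambda>' \<omega> *\<^sub>R g \<omega>"
    and close: "\<And>\<omega>. \<omega> \<in> space M \<Longrightarrow> n (L v \<omega> (g \<omega>) - L u \<omega> (g \<omega>)) < \<epsilon> * (\<rho> * m0)"
    and \<omega>: "\<omega> \<in> space M"
  shows "n (g \<omega> - f u \<omega>) \<le> 16 * K / (1 - \<gamma>) * \<epsilon>"
proof -
  interpret cc: cone_cocycle E n C ell K \<rho> "space M" \<pi> "L u" "f u" "\<Lambda> u" by (rule cocycle[OF u])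
  have gE: "g \<omega> \<in> E" if "\<omega> \<in> space M" for \<omega> using C_E[OF CR_C[OF g(1)[OF that]]] .
  show ?thesis
  proof (rule cc.compare[where S = "L v" and \<Lambda>' = \<Lambda>' and m = m0])
    show "m0 \<le> \<Lambda>' \<omega>" if "\<omega> \<in> space M" for \<omega>
    proof -
      have "ell (L v (\<pi> \<omega>) (g (\<pi> \<omega>))) = \<Lambda>' \<omega>" using geq[OF that] g(2)[OF that] gE[OF that] by (simp add: ell_scale)
      then show ?thesis using mass[OF v \<pi>[OF that] g(1)[OF \<pi>[OF that]] g(2)[OF \<pi>[OF that]]] by simp
    qed
    show "L v \<omega> (g \<omega>) \<in> E" if "\<omega> \<in> space M" for \<omega>
      using op_space_mem[OF pos_op_op[OF L(1)[OF v that]] gE[OF that]] .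
  qed (use geq g m0 mass[OF u] \<epsilon> close \<omega> in auto)
qed

text \<open>With \<open>v = u\<close> the two cocycles agree, so the comparison holds at every small
  scale \<epsilon> and the distance is at most a multiple of 0.\<close>

lemma fixed_unique:
  assumes u: "u \<in> U"
    and g: "\<And>\<omega>. \<omega> \<in> space M \<Longrightarrow> g \<omega> \<in> CR" "\<And>\<omega>. \<omega> \<in> space M \<Longrightarrow> ell (g \<omega>) = 1"
    and geq: "\<And>\<omega>. \<omega> \<in> space M \<Longrightarrow> L u (\<pi> \<omega>) (g (\<pi> \<omega>)) = \<Lambda>' \<omega> *\<^sub>R g \<omega>"
    and \<omega>: "\<omega> \<in> space M"
  shows "g \<omega> = f u \<omega>"
proof -
  have m: "g \<omega> - f u \<omega> \<in> E" using C_E[OF CR_C] g f[OF u] \<omega> by (intro diff_mem) auto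
  have "n (g \<omega> - f u \<omega>) \<le> (16 * K / (1 - \<gamma>) / 1 + 2 * K / ((1 - \<gamma>) / 8 * 1)) * 0"
  proof (rule linear_bound_from_scales)
    have "n (g \<omega> - f u \<omega>) \<le> n (g \<omega>) + n (f u \<omega>)" using C_E[OF CR_C] g f[OF u] \<omega> by (intro triangle_diff) auto
    also have "\<dots> \<le> K + K" using CR_C g f[OF u] \<omega> by (intro add_mono norm_le_K) auto
    finally show "n (g \<omega> - f u \<omega>) \<le> 2 * K" by simp
    show "n (g \<omega> - f u \<omega>) \<le> 16 * K / (1 - \<gamma>) * \<epsilon>" if "0 < \<epsilon>" "\<epsilon> \<le> (1 - \<gamma>) / 8" for \<epsilon>
      using that m0 \<rho> norm_zero by (intro compare_fixed[OF u u that g geq _ \<omega>]) auto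
  qed (use \<gamma> K in auto)
  then show ?thesis using nonneg[OF m] normed_subspace_eq_0[OF normed m] by simp
qed

text \<open>The comparison speaks only about differences small against \<open>\<rho> * m0\<close>;
  for larger ones both sections have norm at most \<open>K\<close>. The two regimes are joined by
  \<open>linear_bound_from_scales\<close>.\<close>

lemma apriori: "\<exists>c\<ge>0. \<forall>u\<in>U. \<forall>v\<in>U. N (f v - f u) \<le> c * N (LX v (f v) - LX u (f v))"
proof (intro exI[of _ "16 * K / (1 - \<gamma>) / (\<rho> * m0) + 2 * K / ((1 - \<gamma>) / 8 * (\<rho> * m0))"] conjI ballI)
  show "0 \<le> 16 * K / (1 - \<gamma>) / (\<rho> * m0) + 2 * K / ((1 - \<gamma>) / 8 * (\<rho> * m0))"
    using \<gamma> K \<rho> m0 by (intro add_nonneg_nonneg divide_nonneg_nonneg) auto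
  fix u v assume u: "u \<in> U" and v: "v \<in> U"
  let ?d = "LX v (f v) - LX u (f v)"
  have d: "?d \<in> X" using u v f_X L_meas by (intro X.diff_mem) auto
  show "N (f v - f u) \<le> (16 * K / (1 - \<gamma>) / (\<rho> * m0) + 2 * K / ((1 - \<gamma>) / 8 * (\<rho> * m0))) * N ?d"
  proof (rule linear_bound_from_scales)
    have "N (f v - f u) \<le> N (f v) + N (f u)" using f_X u v by (intro X.triangle_diff) auto
    then show "N (f v - f u) \<le> 2 * K" using f_norm[OF u] f_norm[OF v] by simp
    show "0 \<le> N ?d" by (rule X.nonneg[OF d])
    fix \<epsilon> assume \<epsilon>: "0 < \<epsilon>" "\<epsilon> \<le> (1 - \<gamma>) / 8" "N ?d < \<epsilon> * (\<rho> * m0)"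
    show "N (f v - f u) \<le> 16 * K / (1 - \<gamma>) * \<epsilon>"
    proof (rule supnorm_le[OF ne])
      fix \<omega> assume \<omega>: "\<omega> \<in> space M"
      have "n (f v \<omega> - f u \<omega>) \<le> 16 * K / (1 - \<gamma>) * \<epsilon>"
      proof (rule compare_fixed[OF u v \<epsilon>(1,2), where \<Lambda>' = "\<Lambda> v"])
        show "L v (\<pi> \<omega>) (f v (\<pi> \<omega>)) = \<Lambda> v \<omega> *\<^sub>R f v \<omega>" if "\<omega> \<in> space M" for \<omega>
          using eig[OF v that] that by (simp add: Lop_eq)
        \<comment> \<open>\<open>Lop\<close> puts the image of the fibre over \<omega> at
          \<open>\<tau> \<omega>\<close>, so the sup norm is evaluated there.\<close>
        show "n (L v \<omega> (f v \<omega>) - L u \<omega> (f v \<omega>)) < \<epsilon> * (\<rho> * m0)" if "\<omega> \<in> space M" for \<omega>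
          using Linf_bound[OF d \<tau>[OF that]] \<epsilon>(3) \<tau>[OF that] \<pi>_\<tau>[OF that] by (simp add: fun_diff_def Lop_eq)
      qed (use f v \<omega> in auto)
      then show "n ((f v - f u) \<omega>) \<le> 16 * K / (1 - \<gamma>) * \<epsilon>" by (simp add: fun_diff_def)
    qed
  qed (use \<gamma> K \<rho> m0 in auto)
qed

end

section \<open>Logarithms of positive families\<close>

text \<open>The inequality \<open>ln x \<le> x - 1\<close> at \<open>a / b\<close> and at
  \<open>b / a\<close> encloses \<open>ln a - ln b\<close> from both sides; the gap between the two
  bounds is \<open>(a - b)^2 / (a * b)\<close>.\<close>

lemma ln_taylor_bound:
  fixes a b m :: real
  assumes m: "0 < m" "m \<le> a" "m \<le> b"
  shows "\<bar>ln a - ln b - (a - b) / b\<bar> \<le> (a - b)^2 / m^2" and "\<bar>ln a - ln b\<bar> \<le> \<bar>a - b\<bar> / m"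
proof -
  have ab: "0 < a" "0 < b" using m by auto
  have 1: "ln a - ln b \<le> a / b - 1" using ln_le_minus_one[of "a / b"] ab by (simp add: ln_div)
  have 2: "ln b - ln a \<le> b / a - 1" using ln_le_minus_one[of "b / a"] ab by (simp add: ln_div)
  have "(a - b) / b + (b / a - 1) = (a - b)^2 / (a * b)" using ab by (simp add: field_simps power2_eq_square)
  moreover have "(a - b)^2 / (a * b) \<le> (a - b)^2 / (m * m)"
    using m by (intro divide_left_mono mult_mono) auto
  moreover have "(a - b) / b = a / b - 1" using ab by (simp add: field_simps)
  ultimately show "\<bar>ln a - ln b - (a - b) / b\<bar> \<le> (a - b)^2 / m^2"
    using 1 2 by (simp add: power2_eq_square abs_le_iff)
  have "(a - b) / b \<le> \<bar>a - b\<bar> / m" using m by (intro frac_le) auto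
  moreover have "(b - a) / a \<le> \<bar>a - b\<bar> / m" using m by (intro frac_le) auto
  moreover have "a / b - 1 = (a - b) / b" "b / a - 1 = (b - a) / a" using ab by (simp_all add: field_simps)
  ultimately show "\<bar>ln a - ln b\<bar> \<le> \<bar>a - b\<bar> / m" using 1 2 by (simp add: abs_le_iff)
qed

lemma real_normed: "normed_subspace (UNIV :: real set) abs"
  by (auto simp: normed_subspace_def abs_mult)

text \<open>Multiplication of bounded functions and the logarithm of functions bounded below lose no
  derivatives, so a scale with a single level, indexed by \<open>unit\<close>, is enough from here
  on.\<close>

locale positive_Linf_family =
  fixes U :: "'b::real_normed_vector set" and M :: "'w measure" and \<Lambda> :: "'b \<Rightarrow> 'w \<Rightarrow> real" and q m :: real
  assumes M: "prob_space M"
    and \<Lambda>_smooth: "\<And>k. smooth_fam U (\<lambda>_::unit. Linf M UNIV abs) (\<lambda>_. supnorm M abs) k 0 (\<lambda>_. q) (\<lambda>hs. \<Lambda>)"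
    and q: "0 < q" and m: "0 < m" and low: "\<And>u \<omega>. u \<in> U \<Longrightarrow> \<omega> \<in> space M \<Longrightarrow> m \<le> \<Lambda> u \<omega>"
begin

abbreviation "Z \<equiv> Linf M (UNIV :: real set) abs"
abbreviation "N \<equiv> supnorm M (abs :: real \<Rightarrow> real)"
abbreviation "smoothZ k i c x \<equiv> smooth_fam U (\<lambda>_::unit. Z) (\<lambda>_. N) k i (\<lambda>_. c) x"

lemma ne: "space M \<noteq> {}"
  using M by (rule prob_space.not_empty)

lemma normedZ: "normed_subspace Z N"
  by (rule Linf_normed[OF real_normed ne])

sublocale Z: seminormed_space Z N
  by (rule normed_subspace_seminormed[OF normedZ])

definition mulZ :: "('w \<Rightarrow> real) \<Rightarrow> ('w \<Rightarrow> real) \<Rightarrow> 'w \<Rightarrow> real" where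
  "mulZ x y = (\<lambda>\<omega>. x \<omega> * y \<omega>)"

lemma mulZ_mem: "x \<in> Z \<Longrightarrow> y \<in> Z \<Longrightarrow> mulZ x y \<in> Z"
  using Linf_smul[OF normed_subspace_seminormed[OF real_normed], of x M y] by (simp add: mulZ_def)

lemma mulZ_bilin: "bilin Z N Z N Z N mulZ"
proof unfold_locales
  show "\<exists>B\<ge>0. \<forall>x\<in>Z. \<forall>y\<in>Z. N (mulZ x y) \<le> B * (N x * N y)"
  proof (intro exI[of _ 1] conjI ballI)
    fix x y assume x: "x \<in> Z" and y: "y \<in> Z"
    have "N (mulZ x y) \<le> N x * N y"
    proof (rule supnorm_le[OF ne])
      fix \<omega> assume \<omega>: "\<omega> \<in> space M"
      show "\<bar>mulZ x y \<omega>\<bar> \<le> N x * N y"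
        using Linf_bound[OF x \<omega>] Linf_bound[OF y \<omega>] Z.nonneg[OF x] by (auto simp: mulZ_def abs_mult intro!: mult_mono)
    qed
    then show "N (mulZ x y) \<le> 1 * (N x * N y)" by simp
  qed simp
qed (auto simp: mulZ_mem, auto simp: mulZ_def plus_fun_def scaleR_fun_def algebra_simps)

lemma \<Lambda>_mem: "u \<in> U \<Longrightarrow> \<Lambda> u \<in> Z"
  using holder_fam_mem[OF smooth_fam_holder[OF \<Lambda>_smooth[of 0]], of "[]" u] q by simp

lemma \<Lambda>_pos: "u \<in> U \<Longrightarrow> \<omega> \<in> space M \<Longrightarrow> 0 < \<Lambda> u \<omega>"
  using low m by (meson less_le_trans)

definition \<kappa> :: "'b \<Rightarrow> 'w \<Rightarrow> real" where
  "\<kappa> u = (\<lambda>\<omega>. if \<omega> \<in> space M then 1 / \<Lambda> u \<omega> else 0)"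

lemma Z_I: "x \<in> borel_measurable M \<Longrightarrow> (\<And>\<omega>. \<omega> \<in> space M \<Longrightarrow> \<bar>x \<omega>\<bar> \<le> B) \<Longrightarrow>
    (\<lambda>\<omega>. if \<omega> \<in> space M then x \<omega> else 0) \<in> Z"
proof -
  assume x: "x \<in> borel_measurable M" "\<And>\<omega>. \<omega> \<in> space M \<Longrightarrow> \<bar>x \<omega>\<bar> \<le> B"
  have "(\<lambda>\<omega>. if \<omega> \<in> space M then x \<omega> else 0) \<in> borel_measurable M"
    using x(1) by (rule measurable_cong[THEN iffD1, rotated]) auto
  then show ?thesis using x(2) unfolding Linf_real by auto
qed

lemma \<Lambda>_borel: "u \<in> U \<Longrightarrow> \<Lambda> u \<in> borel_measurable M"
  using \<Lambda>_mem by (simp add: Linf_real)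

lemma \<kappa>_mem: "u \<in> U \<Longrightarrow> \<kappa> u \<in> Z"
  unfolding \<kappa>_def
proof (rule Z_I)
  assume u: "u \<in> U"
  show "(\<lambda>\<omega>. 1 / \<Lambda> u \<omega>) \<in> borel_measurable M" using \<Lambda>_borel[OF u] by measurable
  show "\<bar>1 / \<Lambda> u \<omega>\<bar> \<le> 1 / m" if "\<omega> \<in> space M" for \<omega>
    using low[OF u that] \<Lambda>_pos[OF u that] m by (simp add: frac_le)
qed

lemma mult_inverse_scale:
  "inverse_scale U (\<lambda>_::unit. Z) (\<lambda>_. N) (\<lambda>_. q) (\<lambda>_::unit. Z) (\<lambda>_. N) (\<lambda>_. q) mulZ \<Lambda> (\<lambda>u. mulZ (\<kappa> u))"
proof unfold_locales
  fix q1 q2 :: real assume "0 \<le> q1" "0 \<le> q2" "q1 + q2 < q"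
  then show "\<exists>l1 l2 :: unit. q1 < q \<and> q2 < q \<and> bilin Z N Z N Z N mulZ" using mulZ_bilin by auto
next
  fix u y assume u: "u \<in> U" and y: "y \<in> Z"
  show "mulZ (\<kappa> u) y \<in> Z" by (rule mulZ_mem[OF \<kappa>_mem[OF u] y])
  show "mulZ (\<Lambda> u) (mulZ (\<kappa> u) y) = y"
  proof
    fix \<omega> show "mulZ (\<Lambda> u) (mulZ (\<kappa> u) y) \<omega> = y \<omega>"
      using \<Lambda>_pos[OF u, of \<omega>] Linf_off[OF y, of \<omega>] by (cases "\<omega> \<in> space M") (auto simp: mulZ_def \<kappa>_def)
  qed
next
  show "\<exists>B\<ge>0. \<forall>u\<in>U. \<forall>x\<in>Z. N x \<le> B * N (mulZ (\<Lambda> u) x)"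
  proof (intro exI[of _ "1 / m"] conjI ballI)
    fix u x assume u: "u \<in> U" and x: "x \<in> Z"
    show "N x \<le> 1 / m * N (mulZ (\<Lambda> u) x)"
    proof (rule supnorm_le[OF ne])
      fix \<omega> assume \<omega>: "\<omega> \<in> space M"
      have "m * \<bar>x \<omega>\<bar> \<le> \<bar>mulZ (\<Lambda> u) x \<omega>\<bar>"
        using low[OF u \<omega>] m by (auto simp: mulZ_def abs_mult intro!: mult_right_mono)
      also have "\<dots> \<le> N (mulZ (\<Lambda> u) x)" by (rule Linf_bound[OF mulZ_mem[OF \<Lambda>_mem[OF u] x] \<omega>])
      finally show "\<bar>x \<omega>\<bar> \<le> 1 / m * N (mulZ (\<Lambda> u) x)" using m by (simp add: field_simps)
    qed
  qed (use m in simp)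
qed (auto simp: mulZ_def fun_diff_def scaleR_fun_def algebra_simps)

text \<open>The reciprocal solves \<open>\<Lambda> \<kappa> = 1\<close>, a linear equation with
  smooth coefficient and bounded inverse, so \<open>smooth_fam_solve\<close> replaces a separate
  chain rule.\<close>

lemma \<kappa>_smooth: "smoothZ k 0 q (\<lambda>hs. \<kappa>)"
proof (rule smooth_fam_solve[OF mult_inverse_scale \<Lambda>_smooth])
  let ?one = "\<lambda>\<omega>. if \<omega> \<in> space M then 1 else (0::real)"
  show "smoothZ k 0 q (\<lambda>hs u. ?one)"
    by (rule smooth_fam_const) (use Linf_const_real[of M 1] Z.seminormed_space_axioms in auto)
  show "\<kappa> u \<in> Z" if "u \<in> U" for u by (rule \<kappa>_mem[OF that])
  show "mulZ (\<Lambda> u) (\<kappa> u) = ?one" if "u \<in> U" for u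
  proof
    fix \<omega> show "mulZ (\<Lambda> u) (\<kappa> u) \<omega> = ?one \<omega>"
      using \<Lambda>_pos[OF that, of \<omega>] by (cases "\<omega> \<in> space M") (auto simp: mulZ_def \<kappa>_def)
  qed
qed

definition G :: "'b \<Rightarrow> 'w \<Rightarrow> real" where
  "G u = (\<lambda>\<omega>. if \<omega> \<in> space M then ln (\<Lambda> u \<omega>) else 0)"

lemma G_mem: "u \<in> U \<Longrightarrow> G u \<in> Z" and G_norm: "u \<in> U \<Longrightarrow> N (G u) \<le> N (\<Lambda> u) + \<bar>ln m\<bar>"
proof -
  assume u: "u \<in> U"
  have b: "\<bar>ln (\<Lambda> u \<omega>)\<bar> \<le> N (\<Lambda> u) + \<bar>ln m\<bar>" if \<omega>: "\<omega> \<in> space M" for \<omega>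
  proof -
    have "ln m \<le> ln (\<Lambda> u \<omega>)" using low[OF u \<omega>] m by simp
    moreover have "ln (\<Lambda> u \<omega>) \<le> \<Lambda> u \<omega>" using ln_le_minus_one[OF \<Lambda>_pos[OF u \<omega>]] by simp
    moreover have "\<Lambda> u \<omega> \<le> N (\<Lambda> u)" using Linf_bound[OF \<Lambda>_mem[OF u] \<omega>] by simp
    ultimately show ?thesis using Z.nonneg[OF \<Lambda>_mem[OF u]] by linarith
  qed
  show "G u \<in> Z" unfolding G_def by (rule Z_I[OF _ b]) (use \<Lambda>_borel[OF u] in measurable)
  show "N (G u) \<le> N (\<Lambda> u) + \<bar>ln m\<bar>" by (rule supnorm_le[OF ne]) (use b in \<open>simp add: G_def\<close>)
qed

lemma G_holder: "holder_fam U (\<lambda>_::unit. Z) (\<lambda>_. N) 0 (\<lambda>_. q) (\<lambda>hs. G)"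
  unfolding holder_fam_def
proof (intro allI impI)
  fix l :: unit and \<alpha> :: real assume \<alpha>: "0 < \<alpha>" "\<alpha> \<le> 1" "\<alpha> < q"
  obtain B where B: "B \<ge> 0"
    "\<And>hs u. length (hs::'b list) = 0 \<Longrightarrow> u \<in> U \<Longrightarrow> N (\<Lambda> u) \<le> B * wt hs"
    "\<And>hs u v. length (hs::'b list) = 0 \<Longrightarrow> u \<in> U \<Longrightarrow> v \<in> U \<Longrightarrow> N (\<Lambda> v - \<Lambda> u) \<le> B * wt hs * norm (v - u) powr \<alpha>"
    using holder_famD[OF smooth_fam_holder[OF \<Lambda>_smooth[of 0]] \<alpha>] by metis
  define H where "H = B + \<bar>ln m\<bar> + B / m"
  show "\<exists>B\<ge>0. \<forall>hs::'b list. length hs = 0 \<longrightarrow> (\<forall>u\<in>U. G u \<in> Z \<and> N (G u) \<le> B * wt hs \<and>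
        (\<forall>v\<in>U. N (G v - G u) \<le> B * wt hs * norm (v - u) powr \<alpha>))"
  proof (intro exI[of _ H] conjI allI impI ballI)
    show "0 \<le> H" using B m by (simp add: H_def)
    fix hs :: "'b list" and u assume hs: "length hs = 0" and u: "u \<in> U"
    then have w: "wt hs = 1" by simp
    show "G u \<in> Z" by (rule G_mem[OF u])
    have "N (G u) \<le> B + \<bar>ln m\<bar>" using G_norm[OF u] B(2)[OF hs u] w by simp
    also have "\<dots> \<le> H" using B m by (simp add: H_def)
    finally show "N (G u) \<le> H * wt hs" using w by simp
    fix v assume v: "v \<in> U"
    have "N (G v - G u) \<le> B / m * norm (v - u) powr \<alpha>"
    proof (rule supnorm_le[OF ne])
      fix \<omega> assume \<omega>: "\<omega> \<in> space M"
      have "\<bar>(G v - G u) \<omega>\<bar> \<le> \<bar>\<Lambda> v \<omega> - \<Lambda> u \<omega>\<bar> / m"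
        using ln_taylor_bound(2)[OF m low[OF v \<omega>] low[OF u \<omega>]] \<omega> by (simp add: G_def fun_diff_def)
      also have "\<bar>\<Lambda> v \<omega> - \<Lambda> u \<omega>\<bar> \<le> N (\<Lambda> v - \<Lambda> u)"
        using Linf_bound[OF Z.diff_mem[OF \<Lambda>_mem[OF v] \<Lambda>_mem[OF u]] \<omega>] by (simp add: fun_diff_def)
      also have "N (\<Lambda> v - \<Lambda> u) \<le> B * norm (v - u) powr \<alpha>" using B(3)[OF hs u v] w by simp
      finally show "\<bar>(G v - G u) \<omega>\<bar> \<le> B / m * norm (v - u) powr \<alpha>" using m by (simp add: divide_right_mono)
    qed
    also have "\<dots> \<le> H * norm (v - u) powr \<alpha>" using B m by (intro mult_right_mono) (auto simp: H_def)
    finally show "N (G v - G u) \<le> H * wt hs * norm (v - u) powr \<alpha>" using w by simp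
  qed
qed

text \<open>The lower bound \<open>m\<close> makes the second-order estimate of the logarithm
  uniform in \<omega>, so differentiation in each fibre is differentiation in the sup norm.\<close>

lemma G_deriv:
  assumes d: "deriv_fam U (\<lambda>_::unit. Z) (\<lambda>_. N) 0 (\<lambda>_. q) (\<lambda>hs. \<Lambda>) \<Lambda>'"
    and h: "holder_fam U (\<lambda>_::unit. Z) (\<lambda>_. N) (Suc 0) (\<lambda>_. q - 1) \<Lambda>'"
  shows "deriv_fam U (\<lambda>_::unit. Z) (\<lambda>_. N) 0 (\<lambda>_. q) (\<lambda>hs. G) (\<lambda>hs u. mulZ (\<kappa> u) (\<Lambda>' hs u))"
  unfolding deriv_fam_def
proof (intro allI impI ballI)
  fix l :: unit and u assume q1: "1 < q" and u: "u \<in> U"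
  have m\<Lambda>': "\<Lambda>' hs u \<in> Z" if "length hs = Suc 0" for hs
    using holder_fam_mem[OF h, of hs u] that q1 u by simp
  have \<kappa>_le: "N (mulZ (\<kappa> u) x) \<le> 1 / m * N x" if x: "x \<in> Z" for x
  proof (rule supnorm_le[OF ne])
    fix \<omega> assume \<omega>: "\<omega> \<in> space M"
    have "\<bar>mulZ (\<kappa> u) x \<omega>\<bar> = \<bar>x \<omega>\<bar> / \<Lambda> u \<omega>" using \<Lambda>_pos[OF u \<omega>] \<omega> by (simp add: mulZ_def \<kappa>_def abs_mult)
    also have "\<dots> \<le> N x / m" using low[OF u \<omega>] m Linf_bound[OF x \<omega>] Z.nonneg[OF x] by (intro frac_le) auto
    finally show "\<bar>mulZ (\<kappa> u) x \<omega>\<bar> \<le> 1 / m * N x" by simp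
  qed
  obtain B where B: "B \<ge> 0"
    "\<And>hs u v. length (hs::'b list) = 0 \<Longrightarrow> u \<in> U \<Longrightarrow> v \<in> U \<Longrightarrow> N (\<Lambda> v - \<Lambda> u) \<le> B * wt hs * norm (v - u) powr 1"
    using holder_famD[OF smooth_fam_holder[OF \<Lambda>_smooth[of 0]] _ _ q1] by (metis order_refl zero_less_one)
  show "(\<forall>hs h g a b. length hs = 0 \<longrightarrow>
        N (mulZ (\<kappa> u) (\<Lambda>' ((a *\<^sub>R h + b *\<^sub>R g) # hs) u) - a *\<^sub>R mulZ (\<kappa> u) (\<Lambda>' (h # hs) u) - b *\<^sub>R mulZ (\<kappa> u) (\<Lambda>' (g # hs) u)) = 0) \<and>
     (\<forall>e>0. \<exists>d>0. \<forall>hs h. length hs = 0 \<longrightarrow> norm h < d \<longrightarrow> u + h \<in> U \<longrightarrow>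
        N (G (u + h) - G u - mulZ (\<kappa> u) (\<Lambda>' (h # hs) u)) \<le> e * norm h * wt hs)"
  proof (intro conjI allI impI)
    fix hs :: "'b list" and h g :: 'b and a b :: real assume hs: "length hs = 0"
    let ?X = "\<Lambda>' ((a *\<^sub>R h + b *\<^sub>R g) # hs) u - a *\<^sub>R \<Lambda>' (h # hs) u - b *\<^sub>R \<Lambda>' (g # hs) u"
    have X: "?X \<in> Z" using m\<Lambda>' hs by (auto intro!: Z.diff_mem Z.scale_mem)
    have X0: "N ?X = 0" using deriv_fam_lin[OF d q1 u hs] .
    have eq: "mulZ (\<kappa> u) (\<Lambda>' ((a *\<^sub>R h + b *\<^sub>R g) # hs) u) - a *\<^sub>R mulZ (\<kappa> u) (\<Lambda>' (h # hs) u) - b *\<^sub>R mulZ (\<kappa> u) (\<Lambda>' (g # hs) u)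
      = mulZ (\<kappa> u) ?X" by (auto simp: mulZ_def fun_diff_def scaleR_fun_def algebra_simps)
    show "N (mulZ (\<kappa> u) (\<Lambda>' ((a *\<^sub>R h + b *\<^sub>R g) # hs) u) - a *\<^sub>R mulZ (\<kappa> u) (\<Lambda>' (h # hs) u) - b *\<^sub>R mulZ (\<kappa> u) (\<Lambda>' (g # hs) u)) = 0"
      unfolding eq using \<kappa>_le[OF X] X0 Z.nonneg[OF mulZ_mem[OF \<kappa>_mem[OF u] X]] by simp
  next
    fix e :: real assume e: "0 < e"
    define e1 where "e1 = e * m / 2"
    have e1: "0 < e1" using e m by (simp add: e1_def)
    obtain d1 where d1: "d1 > 0" "\<And>hs h. length hs = 0 \<Longrightarrow> norm h < d1 \<Longrightarrow> u + h \<in> U \<Longrightarrow>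
       N (\<Lambda> (u + h) - \<Lambda> u - \<Lambda>' (h # hs) u) \<le> e1 * norm h * wt hs"
      using deriv_famD[OF d q1 u e1] by metis
    \<comment> \<open>For \<open>norm h < d2\<close> the quadratic error
      \<open>(B * norm h)^2 / m^2\<close> is at most \<open>e / 2 * norm h\<close>; the other half
      of \<open>e\<close> goes to the remainder of \<Lambda>, which gets divided by at least
      \<open>m\<close>.\<close>
    define d2 where "d2 = e / 2 * m^2 / (B^2 + 1)"
    have B2: "0 < B^2 + 1" by (intro add_nonneg_pos) auto
    have d2: "d2 > 0" unfolding d2_def using e m B2 by (intro divide_pos_pos mult_pos_pos) auto
    show "\<exists>d>0. \<forall>hs h. length hs = 0 \<longrightarrow> norm h < d \<longrightarrow> u + h \<in> U \<longrightarrow>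
        N (G (u + h) - G u - mulZ (\<kappa> u) (\<Lambda>' (h # hs) u)) \<le> e * norm h * wt hs"
    proof (intro exI[of _ "min d1 d2"] conjI allI impI)
      fix hs :: "'b list" and h assume "length hs = 0" and h: "norm h < min d1 d2" "u + h \<in> U"
      then have hs: "hs = []" by simp
      let ?v = "u + h"
      have D: "\<Lambda> ?v - \<Lambda> u \<in> Z" "\<Lambda> ?v - \<Lambda> u - \<Lambda>' [h] u \<in> Z"
        using \<Lambda>_mem h u m\<Lambda>' by (auto intro!: Z.diff_mem)
      have n1: "N (\<Lambda> ?v - \<Lambda> u - \<Lambda>' [h] u) \<le> e1 * norm h" using d1(2)[of "[]" h] h by simp
      have n2: "N (\<Lambda> ?v - \<Lambda> u) \<le> B * norm h" using B(2)[of "[]" u ?v] u h by simp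
      have "N (G ?v - G u - mulZ (\<kappa> u) (\<Lambda>' [h] u)) \<le> e * norm h"
      proof (rule supnorm_le[OF ne])
        fix \<omega> assume \<omega>: "\<omega> \<in> space M"
        let ?a = "\<Lambda> ?v \<omega>" and ?b = "\<Lambda> u \<omega>" and ?p = "\<Lambda>' [h] u \<omega>"
        have b: "?b > 0" by (rule \<Lambda>_pos[OF u \<omega>])
        have ab: "\<bar>?a - ?b\<bar> \<le> B * norm h" using Linf_bound[OF D(1) \<omega>] n2 by (simp add: fun_diff_def)
        have abp: "\<bar>?a - ?b - ?p\<bar> \<le> e1 * norm h" using Linf_bound[OF D(2) \<omega>] n1 by (simp add: fun_diff_def)
        have "(G ?v - G u - mulZ (\<kappa> u) (\<Lambda>' [h] u)) \<omega> = (ln ?a - ln ?b - (?a - ?b) / ?b) + (?a - ?b - ?p) / ?b"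
          using b \<omega> by (simp add: G_def mulZ_def \<kappa>_def fun_diff_def field_simps)
        also have "\<bar>\<dots>\<bar> \<le> \<bar>ln ?a - ln ?b - (?a - ?b) / ?b\<bar> + \<bar>(?a - ?b - ?p) / ?b\<bar>" by (rule abs_triangle_ineq)
        also have "\<dots> \<le> (?a - ?b)^2 / m^2 + (e1 * norm h) / m"
        proof (rule add_mono)
          show "\<bar>ln ?a - ln ?b - (?a - ?b) / ?b\<bar> \<le> (?a - ?b)^2 / m^2"
            by (rule ln_taylor_bound(1)[OF m low[OF h(2) \<omega>] low[OF u \<omega>]])
          have "\<bar>(?a - ?b - ?p) / ?b\<bar> = \<bar>?a - ?b - ?p\<bar> / ?b" using b by simp
          also have "\<dots> \<le> (e1 * norm h) / m" using abp low[OF u \<omega>] m e1 by (intro frac_le) auto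
          finally show "\<bar>(?a - ?b - ?p) / ?b\<bar> \<le> (e1 * norm h) / m" .
        qed
        also have "(?a - ?b)^2 \<le> (B * norm h)^2" using ab by (metis abs_ge_zero power2_abs power_mono)
        also have "(B * norm h)^2 / m^2 \<le> e / 2 * norm h"
        proof -
          have "(B * norm h)^2 = B^2 * norm h * norm h" by (simp add: power2_eq_square)
          also have "\<dots> \<le> (B^2 + 1) * d2 * norm h" using h by (intro mult_right_mono mult_mono) auto
          also have "(B^2 + 1) * d2 = e / 2 * m^2"
            using B2 unfolding d2_def by (metis less_irrefl nonzero_mult_div_cancel_left times_divide_eq_right)
          finally show ?thesis using m by (simp add: field_simps)
        qed
        also have "e / 2 * norm h + (e1 * norm h) / m = e * norm h" using m by (simp add: e1_def field_simps)
        finally show "\<bar>(G ?v - G u - mulZ (\<kappa> u) (\<Lambda>' [h] u)) \<omega>\<bar> \<le> e * norm h" using m by (simp add: divide_right_mono)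
      qed
      then show "N (G ?v - G u - mulZ (\<kappa> u) (\<Lambda>' (h # hs) u)) \<le> e * norm h * wt hs" using hs by simp
    qed (use d1 d2 in auto)
  qed
qed

lemma G_smooth: "smoothZ k 0 q (\<lambda>hs. G)"
proof (cases k)
  case 0
  then show ?thesis using G_holder by simp
next
  case (Suc j)
  obtain \<Lambda>' where \<Lambda>': "deriv_fam U (\<lambda>_::unit. Z) (\<lambda>_. N) 0 (\<lambda>_. q) (\<lambda>hs. \<Lambda>) \<Lambda>'" "smoothZ j (Suc 0) (q - 1) \<Lambda>'"
    using \<Lambda>_smooth[of "Suc j"] by auto
  have "smoothZ j (Suc 0) (q - 1) (\<lambda>hs u. mulZ (\<kappa> u) (\<Lambda>' hs u))"
    by (rule smooth_fam_bilin[where ?s1.0 = "\<lambda>_. []" and ?s2.0 = id, OF _ _ \<kappa>_smooth \<Lambda>'(2), unfolded id_def])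
      (use mulZ_bilin in auto)
  then show ?thesis
    using Suc G_holder G_deriv[OF \<Lambda>'(1) smooth_fam_holder[OF \<Lambda>'(2)]] by auto
qed

text \<open>Under a probability measure integration is a linear functional of norm at most 1 on
  bounded functions, so it preserves the smoothness of the logarithm.\<close>

lemma integral_smooth:
  "smooth_fam U (\<lambda>_::unit. UNIV) (\<lambda>_. abs) k 0 (\<lambda>_. q) (\<lambda>hs u. integral\<^sup>L M (\<lambda>\<omega>. ln (\<Lambda> u \<omega>)))"
proof -
  interpret prob_space M by (rule M)
  have int: "integrable M x" if "x \<in> Z" for x
  proof -
    obtain B where "\<forall>\<omega>\<in>space M. \<bar>x \<omega>\<bar> \<le> B" "x \<in> borel_measurable M" using \<open>x \<in> Z\<close> unfolding Linf_real by auto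
    then show ?thesis by (intro integrable_const_bound[where B = B] AE_I2) auto
  qed
  have "smooth_fam U (\<lambda>_::unit. UNIV) (\<lambda>_. abs) k 0 (\<lambda>_. q) (\<lambda>hs u. integral\<^sup>L M (G u))"
  proof (rule smooth_fam_linear[OF _ G_smooth])
    fix r :: real assume "0 \<le> r" "r < q"
    have "\<bar>integral\<^sup>L M x\<bar> \<le> 1 * N x" if x: "x \<in> Z" for x
    proof -
      have "\<bar>integral\<^sup>L M x\<bar> \<le> (\<integral>\<omega>. \<bar>x \<omega>\<bar> \<partial>M)" by (rule integral_abs_bound)
      also have "\<dots> \<le> (\<integral>\<omega>. N x \<partial>M)"
        using int[OF x] Linf_bound[OF x] by (intro integral_mono) auto
      finally show ?thesis by (simp add: prob_space)
    qed
    then have "\<exists>B\<ge>0. \<forall>x\<in>Z. \<bar>integral\<^sup>L M x\<bar> \<le> B * N x" by (intro exI[of _ 1]) auto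
    then show "\<exists>l1::unit. r < q \<and> seminormed_space Z N \<and> seminormed_space UNIV (abs :: real \<Rightarrow> real) \<and> (\<forall>x\<in>Z. integral\<^sup>L M x \<in> UNIV) \<and>
        (\<forall>x\<in>Z. \<forall>y\<in>Z. integral\<^sup>L M (x + y) = integral\<^sup>L M x + integral\<^sup>L M y) \<and>
        (\<forall>a. \<forall>x\<in>Z. integral\<^sup>L M (a *\<^sub>R x) = a *\<^sub>R integral\<^sup>L M x) \<and>
        (\<exists>B\<ge>0. \<forall>x\<in>Z. \<bar>integral\<^sup>L M x\<bar> \<le> B * N x)"
      using \<open>r < q\<close> int Z.seminormed_space_axioms normed_subspace_seminormed[OF real_normed]
      by (auto simp: plus_fun_def scaleR_fun_def)
  qed
  moreover have "integral\<^sup>L M (G u) = integral\<^sup>L M (\<lambda>\<omega>. ln (\<Lambda> u \<omega>))" for u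
    by (rule Bochner_Integration.integral_cong) (auto simp: G_def)
  ultimately show ?thesis by simp
qed

end

section \<open>Reduction to nested spaces\<close>

text \<open>Provides the mass functional on the whole type, so that \<open>bmul e\<close> is
  bilinear on all functions as \<open>graded_fixpoint\<close> requires. Extension from a basis is
  algebraic and claims no continuity off \<open>E\<close>.\<close>

lemma linear_on_extension:
  fixes E :: "'v::real_vector set" and h :: "'v \<Rightarrow> real"
  assumes E: "subspace E" and add: "\<And>x y. x \<in> E \<Longrightarrow> y \<in> E \<Longrightarrow> h (x + y) = h x + h y"
    and scale: "\<And>c x. x \<in> E \<Longrightarrow> h (c *\<^sub>R x) = c * h x"
  shows "\<exists>e. linear e \<and> (\<forall>x\<in>E. e x = h x)"
proof -
  obtain B where B: "B \<subseteq> E" "independent B" "E \<subseteq> span B" using maximal_independent_subset by blast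
  obtain e where e: "linear e" "\<forall>x\<in>B. e x = h x" using linear_independent_extend[OF B(2)] by blast
  have h0: "h 0 = 0" using scale[of 0 0] subspace_0[OF E] by simp
  have "subspace {x \<in> E. e x = h x}"
    unfolding subspace_def
    using E e(1) by (auto simp: subspace_0 subspace_add subspace_scale linear_0 linear_add linear_scale add scale h0)
  then have "span B \<subseteq> {x \<in> E. e x = h x}" using B e by (intro span_minimal) auto
  then show ?thesis using B(3) e(1) by blast
qed

lemma Lspace_op: "T \<in> Lspace X n Y m \<Longrightarrow> T \<in> op_space X n Y m"
  by (simp add: Lspace_def op_space_def)

lemma Lspace_normed:
  assumes X: "normed_subspace X n" and Y: "normed_subspace Y m"
  shows "normed_subspace (Lspace X n Y m) (opnorm X n m)"
proof -
  interpret X: seminormed_space X n by (rule normed_subspace_seminormed[OF X])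
  interpret Y: seminormed_space Y m by (rule normed_subspace_seminormed[OF Y])
  interpret O: seminormed_space "op_space X n Y m" "opnorm X n m"
    by (rule op_space_seminormed) unfold_locales
  have iff: "T \<in> Lspace X n Y m \<longleftrightarrow> T \<in> op_space X n Y m \<and> (\<forall>x. x \<notin> X \<longrightarrow> T x = 0)" for T
    by (simp add: Lspace_def op_space_def)
  show ?thesis
    unfolding normed_subspace_def
  proof (intro conjI ballI allI)
    fix S T assume S: "S \<in> Lspace X n Y m" and T: "T \<in> Lspace X n Y m"
    show "S + T \<in> Lspace X n Y m" using S T by (auto simp: iff plus_fun_def intro: O.add_mem[unfolded plus_fun_def])
    show "opnorm X n m (S + T) \<le> opnorm X n m S + opnorm X n m T" using S T by (auto simp: iff intro: O.triangle)
  next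
    fix T assume T: "T \<in> Lspace X n Y m"
    show "c *\<^sub>R T \<in> Lspace X n Y m" for c
      using T by (auto simp: iff scaleR_fun_def intro: O.scale_mem[unfolded scaleR_fun_def])
    show "opnorm X n m (c *\<^sub>R T) = \<bar>c\<bar> * opnorm X n m T" for c using T by (auto simp: iff O.scale)
    show "0 \<le> opnorm X n m T" using T by (auto simp: iff O.nonneg)
    show "(opnorm X n m T = 0) = (T = 0)"
    proof
      assume z: "opnorm X n m T = 0"
      show "T = 0"
      proof
        fix x show "T x = 0 x"
        proof (cases "x \<in> X")
          case True
          have "m (T x) \<le> 0"
            using opnorm_bound[OF Lspace_op[OF T] X.seminormed_space_axioms Y.seminormed_space_axioms True] z by simp
          then show ?thesis
            using normed_subspace_eq_0[OF Y op_space_mem[OF Lspace_op[OF T] True]]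
              Y.nonneg[OF op_space_mem[OF Lspace_op[OF T] True]] by simp
        qed (use T in \<open>simp add: iff\<close>)
      qed
    qed (simp add: O.norm_zero)
  qed (use O.zero_mem in \<open>auto simp: iff\<close>)
qed

lemma jet_map:
  assumes Y: "subspace Y" and D: "jet U Y n k \<alpha> D"
    and \<Phi>: "\<And>y. y \<in> Y \<Longrightarrow> \<Phi> y \<in> Z" "\<And>x y. x \<in> Y \<Longrightarrow> y \<in> Y \<Longrightarrow> \<Phi> (x + y) = \<Phi> x + \<Phi> y"
      "\<And>a x. x \<in> Y \<Longrightarrow> \<Phi> (a *\<^sub>R x) = a *\<^sub>R \<Phi> x" "\<And>y. y \<in> Y \<Longrightarrow> m (\<Phi> y) \<le> n y"
  shows "jet U Z m k \<alpha> (\<lambda>hs u. \<Phi> (D hs u))"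
proof -
  have sub: "\<Phi> (x - y) = \<Phi> x - \<Phi> y" if "x \<in> Y" "y \<in> Y" for x y
    using \<Phi>(2)[of x "- y"] \<Phi>(3)[of y "-1"] that subspace_neg[OF Y] by simp
  have d1: "\<exists>B\<ge>0. \<forall>hs. length hs \<le> k \<longrightarrow> (\<forall>u\<in>U. D hs u \<in> Y \<and> n (D hs u) \<le> B * wt hs)"
    and d2: "\<exists>B\<ge>0. \<forall>hs. length hs = k \<longrightarrow> (\<forall>u\<in>U. \<forall>v\<in>U. n (D hs v - D hs u) \<le> B * wt hs * norm (v - u) powr \<alpha>)"
    and d3: "\<forall>u\<in>U. \<forall>i<k. \<forall>e>0. \<exists>d>0. \<forall>hs h. length hs = i \<longrightarrow> norm h < d \<longrightarrow> u + h \<in> U \<longrightarrow>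
        n (D hs (u + h) - D hs u - D (h # hs) u) \<le> e * norm h * wt hs"
    and d4: "\<forall>u\<in>U. \<forall>hs h g a b. length hs < k \<longrightarrow> D ((a *\<^sub>R h + b *\<^sub>R g) # hs) u = a *\<^sub>R D (h # hs) u + b *\<^sub>R D (g # hs) u"
    by (rule D[unfolded jet_def, THEN conjunct1] D[unfolded jet_def, THEN conjunct2, THEN conjunct1]
        D[unfolded jet_def, THEN conjunct2, THEN conjunct2, THEN conjunct1]
        D[unfolded jet_def, THEN conjunct2, THEN conjunct2, THEN conjunct2])+
  have mem: "D hs u \<in> Y" if "length hs \<le> k" "u \<in> U" for hs u using d1 that by auto
  show ?thesis
    unfolding jet_def
  proof (intro conjI)
    obtain B where B: "B \<ge> 0" "\<forall>hs. length hs \<le> k \<longrightarrow> (\<forall>u\<in>U. D hs u \<in> Y \<and> n (D hs u) \<le> B * wt hs)" using d1 by auto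
    show "\<exists>B\<ge>0. \<forall>hs. length hs \<le> k \<longrightarrow> (\<forall>u\<in>U. \<Phi> (D hs u) \<in> Z \<and> m (\<Phi> (D hs u)) \<le> B * wt hs)"
      using B mem by (intro exI[of _ B]) (auto intro: \<Phi>(1) order_trans[OF \<Phi>(4)])
    obtain B where B: "B \<ge> 0" "\<forall>hs. length hs = k \<longrightarrow> (\<forall>u\<in>U. \<forall>v\<in>U. n (D hs v - D hs u) \<le> B * wt hs * norm (v - u) powr \<alpha>)"
      using d2 by auto
    have "m (\<Phi> (D hs v) - \<Phi> (D hs u)) \<le> B * wt hs * norm (v - u) powr \<alpha>" if "length hs = k" "u \<in> U" "v \<in> U" for hs u v
    proof -
      have md: "D hs u \<in> Y" "D hs v \<in> Y" using mem that by auto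
      have "m (\<Phi> (D hs v - D hs u)) \<le> n (D hs v - D hs u)" using md Y by (intro \<Phi>(4) subspace_diff)
      also have "\<dots> \<le> B * wt hs * norm (v - u) powr \<alpha>" by (rule B(2)[rule_format, OF that])
      finally show ?thesis using md by (simp add: sub)
    qed
    then show "\<exists>B\<ge>0. \<forall>hs. length hs = k \<longrightarrow> (\<forall>u\<in>U. \<forall>v\<in>U. m (\<Phi> (D hs v) - \<Phi> (D hs u)) \<le> B * wt hs * norm (v - u) powr \<alpha>)"
      using B(1) by blast
    show "\<forall>u\<in>U. \<forall>i<k. \<forall>e>0. \<exists>d>0. \<forall>hs h. length hs = i \<longrightarrow> norm h < d \<longrightarrow> u + h \<in> U \<longrightarrow>
        m (\<Phi> (D hs (u + h)) - \<Phi> (D hs u) - \<Phi> (D (h # hs) u)) \<le> e * norm h * wt hs"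
    proof (intro ballI allI impI)
      fix u i and e :: real assume u: "u \<in> U" and i: "i < k" and e: "0 < e"
      obtain d where d: "d > 0" "\<forall>hs h. length hs = i \<longrightarrow> norm h < d \<longrightarrow> u + h \<in> U \<longrightarrow>
        n (D hs (u + h) - D hs u - D (h # hs) u) \<le> e * norm h * wt hs" using d3 u i e by blast
      have "m (\<Phi> (D hs (u + h)) - \<Phi> (D hs u) - \<Phi> (D (h # hs) u)) \<le> e * norm h * wt hs"
        if "length hs = i" "norm h < d" "u + h \<in> U" for hs h
      proof -
        have md: "D hs u \<in> Y" "D hs (u + h) \<in> Y" "D (h # hs) u \<in> Y" "D hs (u + h) - D hs u \<in> Y"
            "D hs (u + h) - D hs u - D (h # hs) u \<in> Y"
          using mem that u i Y by (auto intro!: subspace_diff)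
        have "\<Phi> (D hs (u + h)) - \<Phi> (D hs u) - \<Phi> (D (h # hs) u) = \<Phi> (D hs (u + h) - D hs u - D (h # hs) u)"
          using md by (simp add: sub)
        then show ?thesis using \<Phi>(4)[OF md(5)] d(2)[rule_format, OF that] by simp
      qed
      then show "\<exists>d>0. \<forall>hs h. length hs = i \<longrightarrow> norm h < d \<longrightarrow> u + h \<in> U \<longrightarrow>
        m (\<Phi> (D hs (u + h)) - \<Phi> (D hs u) - \<Phi> (D (h # hs) u)) \<le> e * norm h * wt hs" using d(1) by blast
    qed
    show "\<forall>u\<in>U. \<forall>hs h g a b. length hs < k \<longrightarrow>
       \<Phi> (D ((a *\<^sub>R h + b *\<^sub>R g) # hs) u) = a *\<^sub>R \<Phi> (D (h # hs) u) + b *\<^sub>R \<Phi> (D (g # hs) u)"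
    proof (intro ballI allI impI)
      fix u and hs :: "'b list" and h g a b assume a: "u \<in> U" "length hs < k"
      then have md: "D (h # hs) u \<in> Y" "D (g # hs) u \<in> Y" using mem by auto
      have "D ((a *\<^sub>R h + b *\<^sub>R g) # hs) u = a *\<^sub>R D (h # hs) u + b *\<^sub>R D (g # hs) u" using d4 a by blast
      then show "\<Phi> (D ((a *\<^sub>R h + b *\<^sub>R g) # hs) u) = a *\<^sub>R \<Phi> (D (h # hs) u) + b *\<^sub>R \<Phi> (D (g # hs) u)"
        using md \<Phi>(2)[OF subspace_scale[OF Y md(1)] subspace_scale[OF Y md(2)]] \<Phi>(3) by simp
    qed
  qed
qed

text \<open>The image carries the norm transported from \<open>X\<close>, so that \<open>J\<close>
  is an isometry onto it; the norm of the ambient space is in general weaker.\<close>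

locale lin_image =
  fixes X :: "'x::real_vector set" and n :: "'x \<Rightarrow> real" and J :: "'x \<Rightarrow> 'y::real_vector"
  assumes X: "normed_subspace X n"
    and J_add: "x \<in> X \<Longrightarrow> y \<in> X \<Longrightarrow> J (x + y) = J x + J y"
    and J_scale: "x \<in> X \<Longrightarrow> J (a *\<^sub>R x) = a *\<^sub>R J x"
    and J_inj: "inj_on J X"
begin

sublocale seminormed_space X n by (rule normed_subspace_seminormed[OF X])

abbreviation "IX \<equiv> J ` X"
abbreviation "IN \<equiv> \<lambda>y. n (inv_into X J y)"

lemma inv_J: "x \<in> X \<Longrightarrow> inv_into X J (J x) = x"
  using J_inj by simp

lemma J_diff: "x \<in> X \<Longrightarrow> y \<in> X \<Longrightarrow> J (x - y) = J x - J y"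
  using J_add[of x "- y"] J_scale[of y "-1"] scale_mem[of y "-1"] by simp

lemma J_zero: "J 0 = 0"
  using J_scale[OF zero_mem, of 0] by simp

lemma image_normed: "normed_subspace IX IN"
  unfolding normed_subspace_def
proof (intro conjI ballI allI)
  show "0 \<in> IX" using zero_mem J_zero by force
  fix y assume "y \<in> IX"
  then obtain x where x: "x \<in> X" "y = J x" by auto
  have s: "a *\<^sub>R y = J (a *\<^sub>R x)" for a using x by (simp add: J_scale)
  show "a *\<^sub>R y \<in> IX" for a unfolding s using x scale_mem by auto
  show "0 \<le> IN y" using x by (simp add: inv_J nonneg)
  show "IN (a *\<^sub>R y) = \<bar>a\<bar> * IN y" for a unfolding s using x by (simp add: inv_J scale_mem scale)
  show "(IN y = 0) = (y = 0)"
  proof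
    assume "IN y = 0"
    then have "x = 0" using x normed_subspace_eq_0[OF X x(1)] by (simp add: inv_J)
    then show "y = 0" using x J_zero by simp
  next
    assume "y = 0"
    then have "inv_into X J y = 0" using inv_J[OF zero_mem] J_zero by simp
    then show "IN y = 0" by (simp add: norm_zero)
  qed
  fix y' assume "y' \<in> IX"
  then obtain x' where x': "x' \<in> X" "y' = J x'" by auto
  have a: "y + y' = J (x + x')" using x x' by (simp add: J_add)
  show "y + y' \<in> IX" unfolding a using x x' add_mem by auto
  show "IN (y + y') \<le> IN y + IN y'" unfolding a using x x' by (simp add: inv_J add_mem triangle)
qed

lemma image_bilin:
  assumes b: "bilin X n X n X n \<beta>" and \<beta>': "\<And>x y. x \<in> X \<Longrightarrow> y \<in> X \<Longrightarrow> \<beta>' (J x) (J y) = J (\<beta> x y)"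
  shows "bilin IX IN IX IN IX IN \<beta>'"
proof -
  interpret b: bilin X n X n X n \<beta> by (rule b)
  interpret I: seminormed_space IX IN by (rule normed_subspace_seminormed[OF image_normed])
  have sc: "a *\<^sub>R J x = J (a *\<^sub>R x)" if "x \<in> X" for a x using that by (simp add: J_scale)
  have ad: "J x + J y = J (x + y)" if "x \<in> X" "y \<in> X" for x y using that by (simp add: J_add)
  show ?thesis
  proof unfold_locales
    show "\<exists>B\<ge>0. \<forall>x\<in>IX. \<forall>y\<in>IX. IN (\<beta>' x y) \<le> B * (IN x * IN y)"
      using b.bound_ex by (auto simp: \<beta>' inv_J b.mem)
  qed (auto simp: \<beta>' ad sc add_mem scale_mem b.mem b.add_left b.add_right b.scale_left b.scale_right)
qed

end

text \<open>\<open>T'\<close> is tied to \<open>T\<close> only on the image of \<open>J1\<close>;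
  hence one total function can be the transport of operators living on different levels.\<close>

lemma image_op:
  assumes I1: "lin_image X1 n1 J1" and I2: "lin_image X2 n2 J2"
    and T: "T \<in> op_space X1 n1 X2 n2" and T': "\<And>x. x \<in> X1 \<Longrightarrow> T' (J1 x) = J2 (T x)"
  shows "T' \<in> op_space (J1 ` X1) (\<lambda>y. n1 (inv_into X1 J1 y)) (J2 ` X2) (\<lambda>y. n2 (inv_into X2 J2 y))"
    and "opnorm (J1 ` X1) (\<lambda>y. n1 (inv_into X1 J1 y)) (\<lambda>y. n2 (inv_into X2 J2 y)) T' = opnorm X1 n1 n2 T"
proof -
  interpret I1: lin_image X1 n1 J1 by fact
  interpret I2: lin_image X2 n2 J2 by fact
  interpret S: seminormed_space "J1 ` X1" I1.IN by (rule normed_subspace_seminormed[OF I1.image_normed])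
  obtain B where B: "B \<ge> 0" "\<And>x. x \<in> X1 \<Longrightarrow> n2 (T x) \<le> B * n1 x"
    using op_space_bound[OF T I1.seminormed_space_axioms] by metis
  have sc: "a *\<^sub>R J1 x = J1 (a *\<^sub>R x)" if "x \<in> X1" for a x using that by (simp add: I1.J_scale)
  have ad: "J1 x + J1 y = J1 (x + y)" if "x \<in> X1" "y \<in> X1" for x y using that by (simp add: I1.J_add)
  show "T' \<in> op_space (J1 ` X1) I1.IN (J2 ` X2) I2.IN"
    by (rule op_spaceI[where B = B])
      (use op_space_mem[OF T] B in \<open>auto simp: T' ad sc I1.add_mem I1.scale_mem op_space_add[OF T] op_space_scale[OF T]
        I2.J_add I2.J_scale I1.inv_J I2.inv_J S.subspace\<close>)
  have "{I2.IN (T' y) |y. y \<in> J1 ` X1 \<and> I1.IN y \<le> 1} = {n2 (T x) |x. x \<in> X1 \<and> n1 x \<le> 1}"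
  proof (intro set_eqI iffI)
    fix z assume "z \<in> {I2.IN (T' y) |y. y \<in> J1 ` X1 \<and> I1.IN y \<le> 1}"
    then obtain x where "x \<in> X1" "I1.IN (J1 x) \<le> 1" "z = I2.IN (T' (J1 x))" by auto
    then show "z \<in> {n2 (T x) |x. x \<in> X1 \<and> n1 x \<le> 1}"
      using op_space_mem[OF T] by (auto simp: T' I1.inv_J I2.inv_J)
  next
    fix z assume "z \<in> {n2 (T x) |x. x \<in> X1 \<and> n1 x \<le> 1}"
    then obtain x where "x \<in> X1" "n1 x \<le> 1" "z = n2 (T x)" by auto
    then show "z \<in> {I2.IN (T' y) |y. y \<in> J1 ` X1 \<and> I1.IN y \<le> 1}"
      using op_space_mem[OF T] by (auto simp: T' I1.inv_J I2.inv_J intro!: exI[of _ "J1 x"])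
  qed
  then show "opnorm (J1 ` X1) I1.IN I2.IN T' = opnorm X1 n1 n2 T" by (simp add: opnorm_def)
qed

lemma Linf_jlift:
  assumes T: "T \<in> op_space E n E' n'" and E: "seminormed_space E n" and E': "seminormed_space E' n'"
    and \<phi>: "\<phi> \<in> Linf M E n"
  shows "jlift M T \<phi> \<in> Linf M E' n'"
proof -
  interpret E: seminormed_space E n by fact
  interpret E': seminormed_space E' n' by fact
  obtain B where B: "B \<ge> 0" "\<And>x. x \<in> E \<Longrightarrow> n' (T x) \<le> B * n x" using op_space_bound[OF T E] by metis
  have "bochner_measurable M E' n' (\<lambda>\<omega>. T (\<phi> \<omega>))"
  proof (rule bochner_combine[OF Linf_bochner[OF \<phi>] Linf_bochner[OF \<phi>], where F = "\<lambda>x y. T x"])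
    fix r :: real assume r: "0 < r"
    have "n' (T x - T (\<phi> \<omega>)) < r" if \<omega>: "\<omega> \<in> space M" and x: "x \<in> E" "n (x - \<phi> \<omega>) < r / (B + 1)" for \<omega> x
    proof -
      have m: "\<phi> \<omega> \<in> E" "x - \<phi> \<omega> \<in> E" using Linf_mem[OF \<phi> \<omega>] x by (auto intro: E.diff_mem)
      have "n' (T x - T (\<phi> \<omega>)) \<le> B * n (x - \<phi> \<omega>)"
        using B(2)[OF m(2)] op_space_diff[OF T x(1) m(1)] by simp
      also have "\<dots> \<le> (B + 1) * n (x - \<phi> \<omega>)" using E.nonneg[OF m(2)] by (intro mult_right_mono) auto
      also have "\<dots> < r" using x(2) B(1) by (simp add: field_simps)
      finally show ?thesis .
    qed
    moreover have "r / (B + 1) > 0" using r B by simp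
    ultimately show "\<exists>d>0. \<forall>\<omega>\<in>space M. \<forall>x\<in>E. \<forall>y\<in>E. n (x - \<phi> \<omega>) < d \<longrightarrow> n (y - \<phi> \<omega>) < d \<longrightarrow> n' (T x - T (\<phi> \<omega>)) < r"
      by blast
  qed (rule op_space_mem[OF T])
  then have 1: "bochner_measurable M E' n' (jlift M T \<phi>)"
    unfolding bochner_measurable_def jlift_def by (simp cong: conj_cong)
  have 2: "n' (jlift M T \<phi> \<omega>) \<le> B * supnorm M n \<phi>" if \<omega>: "\<omega> \<in> space M" for \<omega>
    using B(2)[OF Linf_mem[OF \<phi> \<omega>]] mult_left_mono[OF Linf_bound[OF \<phi> \<omega>] B(1)] \<omega> by (simp add: jlift_def)
  show ?thesis by (rule LinfI[OF 1 2]) (simp_all add: jlift_def)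
qed

lemma jlift_bound:
  assumes T: "T \<in> op_space E n E' n'" and E: "seminormed_space E n" and ne: "space M \<noteq> {}"
  shows "\<exists>B\<ge>0. \<forall>\<phi>\<in>Linf M E n. supnorm M n' (jlift M T \<phi>) \<le> B * supnorm M n \<phi>"
proof -
  obtain B where B: "B \<ge> 0" "\<And>x. x \<in> E \<Longrightarrow> n' (T x) \<le> B * n x" using op_space_bound[OF T E] by metis
  have "supnorm M n' (jlift M T \<phi>) \<le> B * supnorm M n \<phi>" if \<phi>: "\<phi> \<in> Linf M E n" for \<phi>
  proof (rule supnorm_le[OF ne])
    fix \<omega> assume \<omega>: "\<omega> \<in> space M"
    show "n' (jlift M T \<phi> \<omega>) \<le> B * supnorm M n \<phi>"
      using B(2)[OF Linf_mem[OF \<phi> \<omega>]] mult_left_mono[OF Linf_bound[OF \<phi> \<omega>] B(1)] \<omega> by (simp add: jlift_def)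
  qed
  then show ?thesis using B(1) by blast
qed

section \<open>The graded cocycle and its embedding into one level\<close>

locale graded_cocycle =
  fixes U :: "'b::banach set" and r0 :: real
    and M :: "'w measure" and \<tau> :: "'w \<Rightarrow> 'w"
    and E :: "real \<Rightarrow> 'v::real_vector set" and nE :: "real \<Rightarrow> 'v \<Rightarrow> real"
    and C :: "real \<Rightarrow> 'v set" and ell :: "real \<Rightarrow> 'v \<Rightarrow> real"
    and K \<rho> \<theta> :: "real \<Rightarrow> real"
    and j :: "real \<Rightarrow> real \<Rightarrow> 'v \<Rightarrow> 'v"
    and Lw :: "real \<Rightarrow> 'b \<Rightarrow> 'w \<Rightarrow> 'v \<Rightarrow> 'v"
    and f :: "real \<Rightarrow> 'b \<Rightarrow> 'w \<Rightarrow> 'v"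
  assumes U: "open U"
    and M: "prob_space M" "invertible_mp M \<tau>"
    and E: "\<And>r. 0 < r \<Longrightarrow> r \<le> r0 \<Longrightarrow>
              banach_subspace (E r) (nE r) \<and> closed_convex_cone (E r) (nE r) (C r) \<and>
              bounded_linear_on (E r) (nE r) UNIV abs (ell r) \<and>
              opnorm (E r) (nE r) abs (ell r) = 1 \<and>
              K r \<ge> 1 \<and> 0 < \<rho> r \<and> \<rho> r \<le> 1 \<and> \<theta> r \<ge> 1 \<and>
              (\<forall>\<phi>\<in>C r. ell r \<phi> \<ge> nE r \<phi> / K r)"
    and j: "\<And>s r. 0 < s \<Longrightarrow> s < r \<Longrightarrow> r \<le> r0 \<Longrightarrow>
              bounded_linear_on (E r) (nE r) (E s) (nE s) (j s r) \<and> inj_on (j s r) (E r) \<and>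
              j s r ` C r \<subseteq> C s \<and> (\<forall>\<phi>\<in>E r. ell r \<phi> = ell s (j s r \<phi>))"
    and j_comp: "\<And>t s r. 0 < t \<Longrightarrow> t < s \<Longrightarrow> s < r \<Longrightarrow> r \<le> r0 \<Longrightarrow> \<forall>\<phi>\<in>E r. j t s (j s r \<phi>) = j t r \<phi>"
    and L: "\<And>r u \<omega>. 0 < r \<Longrightarrow> r \<le> r0 \<Longrightarrow> u \<in> U \<Longrightarrow> \<omega> \<in> space M \<Longrightarrow>
              bounded_linear_on (E r) (nE r) (E r) (nE r) (Lw r u \<omega>) \<and>
              Lw r u \<omega> ` (C r - {0}) \<subseteq> cone_rho (E r) (nE r) (C r) (\<rho> r) - {0} \<and>
              1 / \<theta> r \<le> opnorm (E r) (nE r) (nE r) (Lw r u \<omega>) \<and>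
              opnorm (E r) (nE r) (nE r) (Lw r u \<omega>) \<le> \<theta> r"
    and L_meas: "\<And>r u. 0 < r \<Longrightarrow> r \<le> r0 \<Longrightarrow> u \<in> U \<Longrightarrow>
              \<forall>\<phi>\<in>Linf M (E r) (nE r). Lop M \<tau> (Lw r u) \<phi> \<in> Linf M (E r) (nE r)"
    and L_comm: "\<And>s r u \<omega>. 0 < s \<Longrightarrow> s < r \<Longrightarrow> r \<le> r0 \<Longrightarrow> u \<in> U \<Longrightarrow> \<omega> \<in> space M \<Longrightarrow>
              \<forall>\<phi>\<in>E r. j s r (Lw r u \<omega> \<phi>) = Lw s u \<omega> (j s r \<phi>)"
    and f: "\<And>r u. 0 < r \<Longrightarrow> r \<le> r0 \<Longrightarrow> u \<in> U \<Longrightarrow>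
              f r u \<in> Linf M (E r) (nE r) \<and>
              (\<forall>\<omega>\<in>space M. f r u \<omega> \<in> cone_rho (E r) (nE r) (C r) (\<rho> r) \<and>
                 ell r (f r u \<omega>) = 1 \<and>
                 f r u \<omega> = (1 / ell r (Lop M \<tau> (Lw r u) (f r u) \<omega>)) *\<^sub>R Lop M \<tau> (Lw r u) (f r u) \<omega>)"
    and smooth: "\<And>s r t. 0 < s \<Longrightarrow> s < r \<Longrightarrow> r \<le> r0 \<Longrightarrow> 0 \<le> t \<Longrightarrow> t < r - s \<Longrightarrow>
              C_holder U (Lspace (Linf M (E r) (nE r)) (supnorm M (nE r)) (Linf M (E s) (nE s)) (supnorm M (nE s)))
                (opnorm (Linf M (E r) (nE r)) (supnorm M (nE r)) (supnorm M (nE s))) t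
                (\<lambda>u \<phi>. if \<phi> \<in> Linf M (E r) (nE r) then Lop M \<tau> (Lw s u) (jlift M (j s r) \<phi>) else 0)"
begin

abbreviation "X r \<equiv> Linf M (E r) (nE r)"
abbreviation "nX r \<equiv> supnorm M (nE r)"
abbreviation "LX r u \<equiv> Lop M \<tau> (Lw r u)"
abbreviation "\<pi> \<equiv> inv_into (space M) \<tau>"

definition Lam :: "'b \<Rightarrow> 'w \<Rightarrow> real" where
  "Lam u = (\<lambda>\<omega>. if \<omega> \<in> space M then ell r0 (LX r0 u (f r0 u) \<omega>) else 0)"

lemma ne: "space M \<noteq> {}"
  using M(1) by (rule prob_space.not_empty)

lemma level:
  assumes r: "0 < r" "r \<le> r0"
  shows "cocycle_level (E r) (nE r) (C r) (ell r) (K r) (\<rho> r) M \<tau> U (\<theta> r) (Lw r) (f r) (ell r)"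
proof -
  interpret cone_space "E r" "nE r" "C r" "ell r" "K r" "\<rho> r"
    by unfold_locales (use E[OF r] in auto)
  show ?thesis
  proof unfold_locales
    show "bij_betw \<tau> (space M) (space M)" using M(2) by (simp add: invertible_mp_def)
    show "pos_op (Lw r u \<omega>)" if "u \<in> U" "\<omega> \<in> space M" for u \<omega>
      using L[OF r that] by (simp add: pos_op_def op_space_def)
    fix u \<omega> assume u: "u \<in> U" and \<omega>: "\<omega> \<in> space M"
    have fd: "f r u \<omega> \<in> CR \<and> ell r (f r u \<omega>) = 1 \<and>
        f r u \<omega> = (1 / ell r (LX r u (f r u) \<omega>)) *\<^sub>R LX r u (f r u) \<omega>"
      using f[OF r u] \<omega> by blast
    show "f r u \<omega> \<in> CR" by (rule fd[THEN conjunct1])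
    show "ell r (f r u \<omega>) = 1" by (rule fd[THEN conjunct2, THEN conjunct1])
    show "f r u \<omega> = (1 / ell r (LX r u (f r u) \<omega>)) *\<^sub>R LX r u (f r u) \<omega>"
      by (rule fd[THEN conjunct2, THEN conjunct2])
  qed (use ne E[OF r] L[OF r] L_meas[OF r] f[OF r, THEN conjunct1] in auto)
qed

end

text \<open>The level at which smoothness is wanted becomes the weakest level of the scale, and
  \<open>r0\<close> its top.\<close>

locale graded_cocycle_at = graded_cocycle U r0 M \<tau> E nE C ell K \<rho> \<theta> j Lw f
  for U :: "'b::banach set" and r0 :: real
    and M :: "'w measure" and \<tau> :: "'w \<Rightarrow> 'w"
    and E :: "real \<Rightarrow> 'v::real_vector set" and nE :: "real \<Rightarrow> 'v \<Rightarrow> real"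
    and C :: "real \<Rightarrow> 'v set" and ell :: "real \<Rightarrow> 'v \<Rightarrow> real"
    and K \<rho> \<theta> :: "real \<Rightarrow> real"
    and j :: "real \<Rightarrow> real \<Rightarrow> 'v \<Rightarrow> 'v"
    and Lw :: "real \<Rightarrow> 'b \<Rightarrow> 'w \<Rightarrow> 'v \<Rightarrow> 'v"
    and f :: "real \<Rightarrow> 'b \<Rightarrow> 'w \<Rightarrow> 'v" +
  fixes \<sigma> :: real and e :: "'v \<Rightarrow> real"
  assumes \<sigma>: "0 < \<sigma>" "\<sigma> < r0"
    and e_add: "\<And>x y. e (x + y) = e x + e y" and e_scale: "\<And>c x. e (c *\<^sub>R x) = c * e x"
    and e: "\<And>x. x \<in> E \<sigma> \<Longrightarrow> e x = ell \<sigma> x"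
begin

text \<open>All levels \<open>r \<ge> \<sigma>\<close> are embedded into level \<open>\<sigma>\<close>, where the embeddings \<open>j\<close> become inclusions.\<close>

definition jj :: "real \<Rightarrow> 'v \<Rightarrow> 'v" where
  "jj r = (if r = \<sigma> then id else j \<sigma> r)"
definition J :: "real \<Rightarrow> ('w \<Rightarrow> 'v) \<Rightarrow> 'w \<Rightarrow> 'v" where
  "J r = jlift M (jj r)"
definition Y :: "real \<Rightarrow> ('w \<Rightarrow> 'v) set" where
  "Y r = J r ` X r"
definition nY :: "real \<Rightarrow> ('w \<Rightarrow> 'v) \<Rightarrow> real" where
  "nY r y = nX r (inv_into (X r) (J r) y)"

lemma lvl: "\<sigma> \<le> r \<Longrightarrow> r \<le> r0 \<Longrightarrow> cocycle_level (E r) (nE r) (C r) (ell r) (K r) (\<rho> r) M \<tau> U (\<theta> r) (Lw r) (f r) (ell r)"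
  using level \<sigma> by simp

sublocale S: cocycle_level "E \<sigma>" "nE \<sigma>" "C \<sigma>" "ell \<sigma>" "K \<sigma>" "\<rho> \<sigma>" M \<tau> U "\<theta> \<sigma>" "Lw \<sigma>" "f \<sigma>" "ell \<sigma>"
  using lvl \<sigma> by simp

lemma snE: "\<sigma> \<le> r \<Longrightarrow> r \<le> r0 \<Longrightarrow> seminormed_space (E r) (nE r)"
  using E[of r] \<sigma> by (auto simp: banach_subspace_def intro: normed_subspace_seminormed)

lemma jj:
  assumes r: "\<sigma> \<le> r" "r \<le> r0"
  shows "jj r \<in> op_space (E r) (nE r) (E \<sigma>) (nE \<sigma>)" and "inj_on (jj r) (E r)"
    and "x \<in> C r \<Longrightarrow> jj r x \<in> C \<sigma>" and "x \<in> E r \<Longrightarrow> ell \<sigma> (jj r x) = ell r x"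
proof -
  have "jj r \<in> op_space (E r) (nE r) (E \<sigma>) (nE \<sigma>) \<and> inj_on (jj r) (E r) \<and>
     (\<forall>x\<in>C r. jj r x \<in> C \<sigma>) \<and> (\<forall>x\<in>E r. ell \<sigma> (jj r x) = ell r x)"
  proof (cases "r = \<sigma>")
    case True
    have "id \<in> op_space (E \<sigma>) (nE \<sigma>) (E \<sigma>) (nE \<sigma>)"
      by (rule op_spaceI[where B = 1]) (auto simp: S.subspace)
    then show ?thesis using True by (simp add: jj_def)
  next
    case False
    then have "\<sigma> < r" using r by simp
    then show ?thesis using j[of \<sigma> r] \<sigma> r False by (auto simp: jj_def op_space_def)
  qed
  then show "jj r \<in> op_space (E r) (nE r) (E \<sigma>) (nE \<sigma>)" "inj_on (jj r) (E r)"
    "x \<in> C r \<Longrightarrow> jj r x \<in> C \<sigma>" "x \<in> E r \<Longrightarrow> ell \<sigma> (jj r x) = ell r x" by auto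
qed

lemma J_in: "\<omega> \<in> space M \<Longrightarrow> J r \<phi> \<omega> = jj r (\<phi> \<omega>)" and J_out: "\<omega> \<notin> space M \<Longrightarrow> J r \<phi> \<omega> = 0"
  by (simp_all add: J_def jlift_def)

lemma J_mem: "\<sigma> \<le> r \<Longrightarrow> r \<le> r0 \<Longrightarrow> \<phi> \<in> X r \<Longrightarrow> J r \<phi> \<in> X \<sigma>"
  unfolding J_def using Linf_jlift[OF jj(1) snE snE] \<sigma> by simp

lemma J_eqI:
  assumes "\<And>\<omega>. \<omega> \<in> space M \<Longrightarrow> \<psi> \<omega> = jj r (\<phi> \<omega>)" "\<And>\<omega>. \<omega> \<notin> space M \<Longrightarrow> \<psi> \<omega> = 0"
  shows "\<psi> = J r \<phi>"
  using assms by (auto simp: J_def jlift_def fun_eq_iff)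

lemma J_image:
  assumes r: "\<sigma> \<le> r" "r \<le> r0"
  shows "lin_image (X r) (nX r) (J r)"
proof -
  interpret R: cocycle_level "E r" "nE r" "C r" "ell r" "K r" "\<rho> r" M \<tau> U "\<theta> r" "Lw r" "f r" "ell r"
    by (rule lvl[OF r])
  note jo = jj(1)[OF r]
  show ?thesis
  proof unfold_locales
    show "normed_subspace (X r) (nX r)" by (rule R.normedX)
    show "J r (\<phi> + \<psi>) = J r \<phi> + J r \<psi>" if "\<phi> \<in> X r" "\<psi> \<in> X r" for \<phi> \<psi>
      by (rule J_eqI[symmetric])
        (use Linf_mem[OF that(1)] Linf_mem[OF that(2)] in \<open>auto simp: plus_fun_def J_in J_out op_space_add[OF jo]\<close>)
    show "J r (a *\<^sub>R \<phi>) = a *\<^sub>R J r \<phi>" if "\<phi> \<in> X r" for a \<phi>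
      by (rule J_eqI[symmetric])
        (use Linf_mem[OF that(1)] in \<open>auto simp: scaleR_fun_def J_in J_out op_space_scale[OF jo]\<close>)
    show "inj_on (J r) (X r)"
    proof (rule inj_onI)
      fix \<phi> \<psi> assume \<phi>: "\<phi> \<in> X r" and \<psi>: "\<psi> \<in> X r" and eq: "J r \<phi> = J r \<psi>"
      show "\<phi> = \<psi>"
      proof (rule Linf_eqI[OF \<phi> \<psi>])
        fix \<omega> assume \<omega>: "\<omega> \<in> space M"
        have "jj r (\<phi> \<omega>) = jj r (\<psi> \<omega>)" using fun_cong[OF eq, of \<omega>] \<omega> by (simp add: J_in)
        then show "\<phi> \<omega> = \<psi> \<omega>" using jj(2)[OF r] Linf_mem[OF \<phi> \<omega>] Linf_mem[OF \<psi> \<omega>] by (simp add: inj_on_eq_iff)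
      qed
    qed
  qed
qed

lemma nY_J: "\<sigma> \<le> r \<Longrightarrow> r \<le> r0 \<Longrightarrow> \<phi> \<in> X r \<Longrightarrow> nY r (J r \<phi>) = nX r \<phi>"
  unfolding nY_def using lin_image.inv_J[OF J_image] by simp

lemma J_\<sigma>: "\<phi> \<in> X \<sigma> \<Longrightarrow> J \<sigma> \<phi> = \<phi>"
  using J_eqI[of \<phi> \<sigma> \<phi>] Linf_off[of \<phi>] by (auto simp: jj_def)

lemma J_comp:
  assumes sr: "\<sigma> \<le> s" "s < r" "r \<le> r0" and \<phi>: "\<phi> \<in> X r"
  shows "J s (jlift M (j s r) \<phi>) = J r \<phi>"
proof (rule J_eqI)
  fix \<omega> assume \<omega>: "\<omega> \<in> space M"
  show "J s (jlift M (j s r) \<phi>) \<omega> = jj r (\<phi> \<omega>)"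
  proof (cases "s = \<sigma>")
    case True
    then show ?thesis using \<omega> sr by (simp add: J_in jlift_def jj_def)
  next
    case False
    then show ?thesis using \<omega> sr j_comp[of \<sigma> s r] \<sigma> Linf_mem[OF \<phi> \<omega>] by (simp add: J_in jlift_def jj_def)
  qed
qed (simp add: J_out)

lemma L_J:
  assumes r: "\<sigma> \<le> r" "r \<le> r0" and u: "u \<in> U" and \<phi>: "\<phi> \<in> X r"
  shows "LX \<sigma> u (J r \<phi>) = J r (LX r u \<phi>)"
proof (rule J_eqI)
  fix \<omega> assume \<omega>: "\<omega> \<in> space M"
  have \<pi>: "\<pi> \<omega> \<in> space M" by (rule S.\<pi>[OF \<omega>])
  show "LX \<sigma> u (J r \<phi>) \<omega> = jj r (LX r u \<phi> \<omega>)"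
  proof (cases "r = \<sigma>")
    case True
    then show ?thesis using J_\<sigma> \<phi> by (simp add: jj_def)
  next
    case False
    then show ?thesis
      using L_comm[of \<sigma> r u "\<pi> \<omega>"] \<sigma> r u \<pi> Linf_mem[OF \<phi> \<pi>] \<omega> by (simp add: Lop_def J_in jj_def)
  qed
qed (simp add: Lop_def)

text \<open>The image of the fixed section of level \<open>r\<close> is invariant at level \<sigma>
  and has mass 1, but the embedding is known to map cone into cone only, not the interior part
  \<open>cone_rho\<close>. One application of the level-\<sigma> operator supplies the missing
  interior property, since the image is its own renormalised image; then uniqueness applies.\<close>

lemma f_J:
  assumes r: "\<sigma> \<le> r" "r \<le> r0" and u: "u \<in> U"
  shows "f \<sigma> u = J r (f r u)"
proof -
  interpret R: cocycle_level "E r" "nE r" "C r" "ell r" "K r" "\<rho> r" M \<tau> U "\<theta> r" "Lw r" "f r" "ell r"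
    by (rule lvl[OF r])
  define g where "g = J r (f r u)"
  have gX: "g \<in> X \<sigma>" unfolding g_def by (rule J_mem[OF r R.f_X[OF u]])
  have fE: "f r u \<omega> \<in> E r" if "\<omega> \<in> space M" for \<omega> using Linf_mem[OF R.f_X[OF u] that] .
  have ge: "ell \<sigma> (g \<omega>) = 1" if "\<omega> \<in> space M" for \<omega>
    using that R.f(2)[OF u that] jj(4)[OF r fE[OF that]] by (simp add: g_def J_in)
  have gC: "g \<omega> \<in> C \<sigma>" if "\<omega> \<in> space M" for \<omega>
    using that jj(3)[OF r R.CR_C[OF R.f(1)[OF u that]]] by (simp add: g_def J_in)
  have geq: "Lw \<sigma> u (\<pi> \<omega>) (g (\<pi> \<omega>)) = R.\<Lambda> u \<omega> *\<^sub>R g \<omega>" if \<omega>: "\<omega> \<in> space M" for \<omega>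
  proof -
    have "Lw \<sigma> u (\<pi> \<omega>) (g (\<pi> \<omega>)) = LX \<sigma> u (J r (f r u)) \<omega>" using \<omega> by (simp add: Lop_def g_def)
    also have "\<dots> = jj r (LX r u (f r u) \<omega>)" using L_J[OF r u R.f_X[OF u]] \<omega> by (simp add: J_in)
    also have "\<dots> = R.\<Lambda> u \<omega> *\<^sub>R g \<omega>"
      using R.eig[OF u \<omega>] op_space_scale[OF jj(1)[OF r] fE[OF \<omega>]] \<omega> by (simp add: g_def J_in)
    finally show ?thesis .
  qed
  have gCR: "g \<omega> \<in> cone_rho (E \<sigma>) (nE \<sigma>) (C \<sigma>) (\<rho> \<sigma>)" if \<omega>: "\<omega> \<in> space M" for \<omega>
  proof -
    have p: "\<pi> \<omega> \<in> space M" by (rule S.\<pi>[OF \<omega>])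
    have "g (\<pi> \<omega>) \<noteq> 0"
    proof
      assume "g (\<pi> \<omega>) = 0"
      then have "ell \<sigma> (g (\<pi> \<omega>)) = 0" using S.ell_scale[OF S.zero_mem, of 0] by simp
      then show False using ge[OF p] by simp
    qed
    then have "Lw \<sigma> u (\<pi> \<omega>) (g (\<pi> \<omega>)) \<in> S.CR" using S.pos_op_CR[OF S.L(1)[OF u p] gC[OF p]] by simp
    then have "(1 / R.\<Lambda> u \<omega>) *\<^sub>R Lw \<sigma> u (\<pi> \<omega>) (g (\<pi> \<omega>)) \<in> S.CR"
      using R.\<Lambda>_pos[OF u \<omega>] by (intro S.CR_scale) auto
    then show ?thesis using geq[OF \<omega>] R.\<Lambda>_pos[OF u \<omega>] by simp
  qed
  have "f \<sigma> u = g"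
    by (rule Linf_eqI[OF S.f_X[OF u] gX]) (use S.fixed_unique[OF u gCR ge geq] in simp)
  then show ?thesis by (simp add: g_def)
qed

lemma bmul_J:
  assumes r: "\<sigma> \<le> r" "r \<le> r0" and \<phi>: "\<phi> \<in> X r" and \<psi>: "\<psi> \<in> X r"
  shows "bmul e (J r \<phi>) (J r \<psi>) = J r (bmul (ell r) \<phi> \<psi>)"
proof (rule J_eqI)
  fix \<omega> assume \<omega>: "\<omega> \<in> space M"
  have "e (jj r (\<phi> \<omega>)) = ell r (\<phi> \<omega>)"
    using e[OF op_space_mem[OF jj(1)[OF r] Linf_mem[OF \<phi> \<omega>]]] jj(4)[OF r Linf_mem[OF \<phi> \<omega>]] by simp
  then show "bmul e (J r \<phi>) (J r \<psi>) \<omega> = jj r (bmul (ell r) \<phi> \<psi> \<omega>)"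
    using \<omega> op_space_scale[OF jj(1)[OF r] Linf_mem[OF \<psi> \<omega>]] by (simp add: bmul_def J_in)
qed (simp add: bmul_def J_out)

definition AA :: "'b \<Rightarrow> ('w \<Rightarrow> 'v) \<Rightarrow> 'w \<Rightarrow> 'v" where
  "AA u \<psi> = bmul e (LX \<sigma> u (f \<sigma> u)) \<psi> - LX \<sigma> u \<psi> + bmul e (LX \<sigma> u \<psi>) (f \<sigma> u)"

lemma AA_J:
  assumes r: "\<sigma> \<le> r" "r \<le> r0" and u: "u \<in> U" and \<phi>: "\<phi> \<in> X r"
  shows "AA u (J r \<phi>) = J r (cocycle_level.A M \<tau> (Lw r) (f r) (ell r) u \<phi>)"
proof -
  interpret R: cocycle_level "E r" "nE r" "C r" "ell r" "K r" "\<rho> r" M \<tau> U "\<theta> r" "Lw r" "f r" "ell r"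
    by (rule lvl[OF r])
  interpret I: lin_image "X r" "nX r" "J r" by (rule J_image[OF r])
  have m: "f r u \<in> X r" "LX r u (f r u) \<in> X r" "LX r u \<phi> \<in> X r" using R.f_X[OF u] R.L_meas[OF u] \<phi> by auto
  have m2: "bmul (ell r) (LX r u (f r u)) \<phi> \<in> X r" "bmul (ell r) (LX r u \<phi>) (f r u) \<in> X r"
    using m \<phi> by (auto intro: R.bmul_mem)
  show ?thesis
    unfolding AA_def R.A_def f_J[OF r u]
    using m m2 \<phi> by (simp add: L_J[OF r u] bmul_J[OF r] I.J_add I.J_diff R.X.diff_mem)
qed

lemma inverse_Y:
  assumes r: "\<sigma> \<le> r" "r \<le> r0"
  obtains B where "0 \<le> B" "\<And>u y. u \<in> U \<Longrightarrow> y \<in> Y r \<Longrightarrow> nY r y \<le> B * nY r (AA u y)"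
    and "\<And>u y. u \<in> U \<Longrightarrow> y \<in> Y r \<Longrightarrow> \<exists>x\<in>Y r. AA u x = y"
proof -
  interpret R: cocycle_level "E r" "nE r" "C r" "ell r" "K r" "\<rho> r" M \<tau> U "\<theta> r" "Lw r" "f r" "ell r"
    by (rule lvl[OF r])
  obtain B where B: "0 \<le> B" "\<And>u x. u \<in> U \<Longrightarrow> x \<in> X r \<Longrightarrow> nX r x \<le> B * nX r (R.A u x)"
    "\<And>u y. u \<in> U \<Longrightarrow> y \<in> X r \<Longrightarrow> \<exists>x\<in>X r. R.A u x = y" using R.inverse by metis
  show ?thesis
  proof (rule that[OF B(1)])
    fix u y assume u: "u \<in> U" and "y \<in> Y r"
    then obtain x where x: "x \<in> X r" "y = J r x" by (auto simp: Y_def)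
    show "nY r y \<le> B * nY r (AA u y)"
      using B(2)[OF u x(1)] R.A_mem[OF u x(1)] x by (simp add: AA_J[OF r u] nY_J[OF r])
    show "\<exists>x\<in>Y r. AA u x = y"
      using B(3)[OF u x(1)] x AA_J[OF r u] unfolding Y_def by auto
  qed
qed

text \<open>Chosen at the weakest level without mention of \<open>r\<close>, because one solution
  operator has to serve all levels.\<close>

definition AI :: "'b \<Rightarrow> ('w \<Rightarrow> 'v) \<Rightarrow> 'w \<Rightarrow> 'v" where
  "AI u y = (SOME x. x \<in> Y \<sigma> \<and> AA u x = y)"

lemma Y_normed: "\<sigma> \<le> r \<Longrightarrow> r \<le> r0 \<Longrightarrow> normed_subspace (Y r) (nY r)"
  using lin_image.image_normed[OF J_image] unfolding Y_def nY_def[abs_def] by simp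

lemma Y_incl:
  assumes sr: "\<sigma> \<le> s" "s \<le> r" "r \<le> r0"
  shows "Y r \<subseteq> Y s \<and> (\<exists>B\<ge>0. \<forall>x\<in>Y r. nY s x \<le> B * nY r x)"
proof (cases "s = r")
  case True
  then show ?thesis by (auto intro!: exI[of _ 1])
next
  case False
  then have lt: "s < r" using sr by simp
  have jo: "j s r \<in> op_space (E r) (nE r) (E s) (nE s)" using j[of s r] \<sigma> sr lt by (simp add: op_space_def)
  have m: "jlift M (j s r) \<phi> \<in> X s" if "\<phi> \<in> X r" for \<phi>
    using Linf_jlift[OF jo snE snE that] sr lt by simp
  obtain B where B: "B \<ge> 0" "\<forall>\<phi>\<in>X r. nX s (jlift M (j s r) \<phi>) \<le> B * nX r \<phi>"
    using jlift_bound[OF jo snE ne] sr by auto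
  show ?thesis
  proof (intro conjI exI[of _ B] ballI B(1))
    show "Y r \<subseteq> Y s" unfolding Y_def using J_comp[OF sr(1) lt sr(3)] m by force
    fix y assume "y \<in> Y r"
    then obtain \<phi> where \<phi>: "\<phi> \<in> X r" "y = J r \<phi>" by (auto simp: Y_def)
    have "nY s y = nX s (jlift M (j s r) \<phi>)"
      using J_comp[OF sr(1) lt sr(3) \<phi>(1)] nY_J[of s "jlift M (j s r) \<phi>"] m[OF \<phi>(1)] sr \<phi> by simp
    then show "nY s y \<le> B * nY r y" using B \<phi> nY_J[of r \<phi>] sr by simp
  qed
qed

sublocale scale U Y nY \<sigma> r0
  by unfold_locales (use U Y_normed Y_incl in auto)

text \<open>A solution exists in \<open>Y r\<close>, and solutions are unique already in the larger
  space \<open>Y \<sigma>\<close> by the bound on the inverse; so the one chosen there lies in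
  \<open>Y r\<close>.\<close>

lemma AI:
  assumes r: "\<sigma> \<le> r" "r \<le> r0" and u: "u \<in> U" and y: "y \<in> Y r"
  shows "AI u y \<in> Y r \<and> AA u (AI u y) = y"
proof -
  obtain x where x: "x \<in> Y r" "AA u x = y" using inverse_Y[OF r] u y by metis
  have sub: "Y r \<subseteq> Y \<sigma>" using Y_incl[of \<sigma> r] r by simp
  have "AI u y \<in> Y \<sigma> \<and> AA u (AI u y) = y"
    unfolding AI_def by (rule someI[of _ x]) (use x sub in auto)
  moreover obtain B where B: "0 \<le> B" "\<And>u y. u \<in> U \<Longrightarrow> y \<in> Y \<sigma> \<Longrightarrow> nY \<sigma> y \<le> B * nY \<sigma> (AA u y)"
    using inverse_Y[of \<sigma>] \<sigma> by (metis order_refl less_imp_le)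
  interpret YS: seminormed_space "Y \<sigma>" "nY \<sigma>" using seminormed[of \<sigma>] \<sigma> by simp
  have AAd: "AA u (x - z) = AA u x - AA u z" if "x \<in> Y \<sigma>" "z \<in> Y \<sigma>" for x z
  proof -
    have xz: "x \<in> X \<sigma>" "z \<in> X \<sigma>" using that J_mem[of \<sigma>] \<sigma> by (auto simp: Y_def)
    note LL = S.LX_op[OF u]
    have ed: "e (x - y) = e x - e y" for x y using e_add[of "x - y" y] by simp
    have "bmul e (x' - z') w = bmul e x' w - bmul e z' w" and "bmul e w (x' - z') = bmul e w x' - bmul e w z'"
      for x' z' w :: "'w \<Rightarrow> 'v"
      by (simp_all add: bmul_def fun_diff_def fun_eq_iff ed scaleR_left_diff_distrib scaleR_right_diff_distrib)
    then show ?thesis unfolding AA_def op_space_diff[OF LL xz] by simp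
  qed
  have "AI u y = x"
  proof -
    have d: "AI u y - x \<in> Y \<sigma>" using calculation x sub by (intro YS.diff_mem) auto
    have "AA u (AI u y - x) = 0" using AAd calculation x sub by auto
    then have "nY \<sigma> (AI u y - x) \<le> 0" using B(2)[OF u d] YS.norm_zero by simp
    then have "AI u y - x = 0"
      using YS.nonneg[OF d] normed_subspace_eq_0[OF Y_normed d] \<sigma> by simp
    then show ?thesis by simp
  qed
  then show ?thesis using x by simp
qed

text \<open>Conjugation with the embeddings \<open>J\<close> turns the operators from level
  \<open>r\<close> to level \<open>s\<close> into restrictions of the single function
  \<open>LX \<sigma> u\<close>, because \<open>J\<close> intertwines the operators and absorbs
  \<open>jlift\<close>.\<close>

lemma L_jets:
  assumes sr: "\<sigma> \<le> s" "s < r" "r \<le> r0" and \<alpha>: "0 < \<alpha>" "\<alpha> \<le> 1" "real k + \<alpha> < r - s"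
  shows "\<exists>D. jet U (OY (s, r)) (ON (s, r)) k \<alpha> D \<and> (\<forall>u\<in>U. \<forall>\<phi>\<in>Y r. D [] u \<phi> = LX \<sigma> u \<phi>)"
proof -
  have s: "\<sigma> \<le> s" "s \<le> r0" and r: "\<sigma> \<le> r" "r \<le> r0" using sr by auto
  interpret Is: lin_image "X s" "nX s" "J s" by (rule J_image[OF s])
  interpret Ir: lin_image "X r" "nX r" "J r" by (rule J_image[OF r])
  let ?W = "Lspace (X r) (nX r) (X s) (nX s)" and ?n = "opnorm (X r) (nX r) (nX s)"
  have W: "normed_subspace ?W ?n" by (rule Lspace_normed[OF Ir.X Is.X])
  interpret W: seminormed_space ?W ?n by (rule normed_subspace_seminormed[OF W])
  obtain D where D: "jet U ?W ?n k \<alpha> D"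
    "\<And>u. u \<in> U \<Longrightarrow> D [] u = (\<lambda>\<phi>. if \<phi> \<in> X r then LX s u (jlift M (j s r) \<phi>) else 0)"
    using C_holder_imp_jet[OF W U \<alpha>(1,2) smooth[of s r "real k + \<alpha>"]] sr \<sigma> \<alpha> by auto
  define \<Phi> where "\<Phi> = (\<lambda>T \<psi>. J s (T (inv_into (X r) (J r) \<psi>)))"
  \<comment> \<open>Includes \<open>x\<close> outside \<open>X r\<close>, where \<open>T\<close>
    vanishes: \<open>inv_into\<close> may return such an \<open>x\<close>, and linearity of \<Phi>
    is an identity of total functions.\<close>
  have Tm: "T x \<in> X s" if "T \<in> ?W" for T x
    using that op_space_mem[OF Lspace_op[OF that], of x] Is.zero_mem by (cases "x \<in> X r") (auto simp: Lspace_def)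
  have \<Phi>J: "\<Phi> T (J r x) = J s (T x)" if "x \<in> X r" for T x using that by (simp add: \<Phi>_def Ir.inv_J)
  have "jet U (OY (s, r)) (ON (s, r)) k \<alpha> (\<lambda>hs u. \<Phi> (D hs u))"
  proof (rule jet_map[OF W.subspace D(1)])
    fix T assume T: "T \<in> ?W"
    note im = image_op[where T = T and T' = "\<Phi> T", OF Ir.lin_image_axioms Is.lin_image_axioms Lspace_op[OF T] \<Phi>J]
    show "\<Phi> T \<in> OY (s, r)" using im(1) unfolding OY_def fst_conv snd_conv unfolding Y_def nY_def[abs_def] .
    show "ON (s, r) (\<Phi> T) \<le> ?n T" using im(2) unfolding ON_def fst_conv snd_conv unfolding Y_def nY_def[abs_def] by simp
    show "\<Phi> (a *\<^sub>R T) = a *\<^sub>R \<Phi> T" for a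
      using Tm[OF T] by (auto simp: \<Phi>_def scaleR_fun_def Is.J_scale[unfolded scaleR_fun_def])
    fix T' assume T': "T' \<in> ?W"
    show "\<Phi> (T + T') = \<Phi> T + \<Phi> T'"
      using Tm[OF T] Tm[OF T'] by (auto simp: \<Phi>_def plus_fun_def Is.J_add[unfolded plus_fun_def])
  qed
  moreover have "\<Phi> (D [] u) \<phi> = LX \<sigma> u \<phi>" if u: "u \<in> U" and \<phi>: "\<phi> \<in> Y r" for u \<phi>
  proof -
    obtain x where x: "x \<in> X r" "\<phi> = J r x" using \<phi> by (auto simp: Y_def)
    have jo: "j s r \<in> op_space (E r) (nE r) (E s) (nE s)" using j[of s r] \<sigma> sr by (simp add: op_space_def)
    have m: "jlift M (j s r) x \<in> X s"
      using Linf_jlift[OF jo snE snE x(1)] sr by simp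
    have "\<Phi> (D [] u) \<phi> = J s (LX s u (jlift M (j s r) x))" using x D(2)[OF u] by (simp add: \<Phi>J)
    also have "\<dots> = LX \<sigma> u (J s (jlift M (j s r) x))" using L_J[OF s u m] by simp
    also have "J s (jlift M (j s r) x) = \<phi>" using J_comp[OF sr x(1)] x by simp
    finally show ?thesis .
  qed
  ultimately show ?thesis by blast
qed

lemma fixpoint: "graded_fixpoint U Y nY \<sigma> r0 (LX \<sigma>) (bmul e) (f \<sigma>) AI"
proof (rule graded_fixpoint.intro, rule scale_axioms, rule graded_fixpoint_axioms.intro, fold AA_def)
  show "smooth_fam U OY ON k 0 cO (\<lambda>hs. LX \<sigma>)" for k
    by (rule jets_smooth_fam) (use L_jets in auto)
  show "bmul e (x + y) z = bmul e x z + bmul e y z" for x y z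
    by (simp add: bmul_def plus_fun_def e_add scaleR_left_distrib)
  show "bmul e (a *\<^sub>R x) z = a *\<^sub>R bmul e x z" for a x z
    by (simp add: bmul_def scaleR_fun_def e_scale)
  show "bmul e x (y + z) = bmul e x y + bmul e x z" for x y z
    by (simp add: bmul_def plus_fun_def scaleR_right_distrib)
  show "bmul e x (a *\<^sub>R y) = a *\<^sub>R bmul e x y" for a x y
    by (simp add: bmul_def scaleR_fun_def mult.commute)
  show "LX \<sigma> u (f \<sigma> u) = bmul e (LX \<sigma> u (f \<sigma> u)) (f \<sigma> u)" if u: "u \<in> U" for u
  proof -
    have "bmul e (LX \<sigma> u (f \<sigma> u)) (f \<sigma> u) = bmul (ell \<sigma>) (LX \<sigma> u (f \<sigma> u)) (f \<sigma> u)"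
      using bmul_J[of \<sigma> "LX \<sigma> u (f \<sigma> u)" "f \<sigma> u"] S.f_X[OF u] S.L_meas[OF u] S.bmul_mem \<sigma> by (simp add: J_\<sigma>)
    then show ?thesis using S.f_bmul_eq[OF u] by simp
  qed
  fix r assume "\<sigma> \<le> r" "r < r0"
  then have r: "\<sigma> \<le> r" "r \<le> r0" by auto
  interpret R: cocycle_level "E r" "nE r" "C r" "ell r" "K r" "\<rho> r" M \<tau> U "\<theta> r" "Lw r" "f r" "ell r"
    by (rule lvl[OF r])
  interpret I: lin_image "X r" "nX r" "J r" by (rule J_image[OF r])
  show "LX \<sigma> u \<in> op_space (Y r) (nY r) (Y r) (nY r)" if u: "u \<in> U" for u
    using image_op(1)[where T = "LX r u" and T' = "LX \<sigma> u", OF J_image[OF r] J_image[OF r] R.LX_op[OF u] L_J[OF r u]]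
    by (simp add: Y_def nY_def[abs_def])
  show "bilin (Y r) (nY r) (Y r) (nY r) (Y r) (nY r) (bmul e)"
    unfolding Y_def nY_def[abs_def]
    by (rule I.image_bilin[where \<beta> = "bmul (ell r)" and \<beta>' = "bmul e", OF R.bmul_bilin]) (rule bmul_J[OF r])
  show "f \<sigma> u \<in> Y r" if u: "u \<in> U" for u
    unfolding Y_def f_J[OF r u] by (rule imageI[OF R.f_X[OF u]])
  show "\<exists>B. \<forall>u\<in>U. nY r (f \<sigma> u) \<le> B"
  proof (intro exI[of _ "K r"] ballI)
    fix u assume u: "u \<in> U"
    show "nY r (f \<sigma> u) \<le> K r" unfolding f_J[OF r u] nY_J[OF r R.f_X[OF u]] by (rule R.f_norm[OF u])
  qed
  show "\<exists>c\<ge>0. \<forall>u\<in>U. \<forall>v\<in>U. nY r (f \<sigma> v - f \<sigma> u) \<le> c * nY r (LX \<sigma> v (f \<sigma> v) - LX \<sigma> u (f \<sigma> v))"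
  proof -
    obtain c where c: "c \<ge> 0" "\<forall>u\<in>U. \<forall>v\<in>U. nX r (f r v - f r u) \<le> c * nX r (R.LX v (f r v) - R.LX u (f r v))"
      using R.apriori by blast
    have "nY r (f \<sigma> v - f \<sigma> u) \<le> c * nY r (LX \<sigma> v (f \<sigma> v) - LX \<sigma> u (f \<sigma> v))" if u: "u \<in> U" and v: "v \<in> U" for u v
    proof -
      have m: "f r u \<in> X r" "f r v \<in> X r" "LX r v (f r v) \<in> X r" "LX r u (f r v) \<in> X r"
        using R.f_X R.L_meas u v by auto
      have e1: "f \<sigma> v - f \<sigma> u = J r (f r v - f r u)" using m by (simp add: f_J[OF r u] f_J[OF r v] I.J_diff)
      have e2: "LX \<sigma> v (f \<sigma> v) - LX \<sigma> u (f \<sigma> v) = J r (LX r v (f r v) - LX r u (f r v))"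
        using m by (simp add: f_J[OF r v] L_J[OF r u] L_J[OF r v] I.J_diff)
      show ?thesis unfolding e1 e2 using c u v m by (simp add: nY_J[OF r] R.X.diff_mem)
    qed
    then show ?thesis using c(1) by blast
  qed
  show "AI u y \<in> Y r" if "u \<in> U" "y \<in> Y r" for u y using AI[OF r that] by simp
  show "AA u (AI u y) = y" if "u \<in> U" "y \<in> Y r" for u y using AI[OF r that] by simp
  show "\<exists>B\<ge>0. \<forall>u\<in>U. \<forall>x\<in>Y r. nY r x \<le> B * nY r (AA u x)" using inverse_Y[OF r] by metis
qed

sublocale F: graded_fixpoint U Y nY \<sigma> r0 "LX \<sigma>" "bmul e" "f \<sigma>" AI
  "\<lambda>u \<psi>. bmul e (LX \<sigma> u (f \<sigma> u)) \<psi> - LX \<sigma> u \<psi> + bmul e (LX \<sigma> u \<psi>) (f \<sigma> u)"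
  by (rule fixpoint)

lemma at_\<sigma>: "Y \<sigma> = X \<sigma>" "y \<in> X \<sigma> \<Longrightarrow> nY \<sigma> y = nX \<sigma> y"
  using J_\<sigma> nY_J[of \<sigma>] \<sigma> by (force simp: Y_def)+

text \<open>At level \<sigma> the embedding is the identity, so the family can be read there in its
  original norm, with capacity \<open>r0 - \<sigma>\<close>, through any linear contraction.\<close>

lemma to_X:
  fixes \<Phi> :: "('w \<Rightarrow> 'v) \<Rightarrow> 'z::real_vector"
  assumes x: "smooth_fam U Y nY k 0 cV (\<lambda>hs. x)" and Z: "normed_subspace Z m"
    and \<Phi>: "\<And>x. x \<in> X \<sigma> \<Longrightarrow> \<Phi> x \<in> Z" "\<And>x y. x \<in> X \<sigma> \<Longrightarrow> y \<in> X \<sigma> \<Longrightarrow> \<Phi> (x + y) = \<Phi> x + \<Phi> y"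
      "\<And>a x. x \<in> X \<sigma> \<Longrightarrow> \<Phi> (a *\<^sub>R x) = a *\<^sub>R \<Phi> x" "\<And>x. x \<in> X \<sigma> \<Longrightarrow> m (\<Phi> x) \<le> nX \<sigma> x"
  shows "smooth_fam U (\<lambda>_::unit. Z) (\<lambda>_. m) k 0 (\<lambda>_. r0 - \<sigma>) (\<lambda>hs u. \<Phi> (x u))"
proof (rule smooth_fam_linear[OF _ x])
  fix q assume q: "0 \<le> q" "q < r0 - \<sigma>"
  show "\<exists>l1. q < cV l1 \<and> seminormed_space (Y l1) (nY l1) \<and> seminormed_space Z m \<and> (\<forall>x\<in>Y l1. \<Phi> x \<in> Z) \<and>
    (\<forall>x\<in>Y l1. \<forall>y\<in>Y l1. \<Phi> (x + y) = \<Phi> x + \<Phi> y) \<and> (\<forall>a. \<forall>x\<in>Y l1. \<Phi> (a *\<^sub>R x) = a *\<^sub>R \<Phi> x) \<and>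
    (\<exists>B\<ge>0. \<forall>x\<in>Y l1. m (\<Phi> x) \<le> B * nY l1 x)"
    using q \<sigma> \<Phi> seminormed[of \<sigma>] normed_subspace_seminormed[OF Z]
    by (intro exI[of _ \<sigma>]) (auto simp: cV_def at_\<sigma> intro!: exI[of _ 1])
qed

lemma f_smooth_X: "smooth_fam U (\<lambda>_::unit. X \<sigma>) (\<lambda>_. nX \<sigma>) k 0 (\<lambda>_. r0 - \<sigma>) (\<lambda>hs. f \<sigma>)"
  using to_X[OF F.f_smooth S.normedX, where \<Phi> = id] by simp

text \<open>The embeddings preserve the mass, so \<open>Lam\<close>, defined at the top level, can
  be computed at level \<sigma>, where it is a linear image of the smooth family
  \<open>LX \<sigma> u (f \<sigma> u)\<close>.\<close>

lemma Lam_smooth: "smooth_fam U (\<lambda>_::unit. Linf M UNIV abs) (\<lambda>_. supnorm M abs) k 0 (\<lambda>_. r0 - \<sigma>) (\<lambda>hs. Lam)"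
proof -
  define \<Phi> where "\<Phi> = (\<lambda>\<phi> \<omega>. if \<omega> \<in> space M then ell \<sigma> (\<phi> \<omega>) else 0)"
  have "smooth_fam U (\<lambda>_::unit. Linf M UNIV abs) (\<lambda>_. supnorm M abs) k 0 (\<lambda>_. r0 - \<sigma>) (\<lambda>hs u. \<Phi> (LX \<sigma> u (f \<sigma> u)))"
  proof (rule to_X[OF F.w_smooth[OF F.f_smooth] Linf_normed[OF real_normed ne]])
    fix \<phi> assume \<phi>: "\<phi> \<in> X \<sigma>"
    show "\<Phi> \<phi> \<in> Linf M UNIV abs" unfolding \<Phi>_def by (rule S.ell_Linf[OF \<phi>])
    show "\<Phi> (a *\<^sub>R \<phi>) = a *\<^sub>R \<Phi> \<phi>" for a
      using Linf_mem[OF \<phi>] by (auto simp: \<Phi>_def scaleR_fun_def S.ell_scale)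
    show "supnorm M abs (\<Phi> \<phi>) \<le> nX \<sigma> \<phi>"
      using S.ell_le[OF Linf_mem[OF \<phi>]] Linf_bound[OF \<phi>]
      by (intro supnorm_le[OF ne]) (force simp: \<Phi>_def)
    fix \<psi> assume \<psi>: "\<psi> \<in> X \<sigma>"
    show "\<Phi> (\<phi> + \<psi>) = \<Phi> \<phi> + \<Phi> \<psi>"
      using Linf_mem[OF \<phi>] Linf_mem[OF \<psi>] by (auto simp: \<Phi>_def plus_fun_def S.ell_add)
  qed
  moreover have "\<Phi> (LX \<sigma> u (f \<sigma> u)) = Lam u" if u: "u \<in> U" for u
  proof
    fix \<omega>
    interpret R: cocycle_level "E r0" "nE r0" "C r0" "ell r0" "K r0" "\<rho> r0" M \<tau> U "\<theta> r0" "Lw r0" "f r0" "ell r0"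
      using lvl \<sigma> by simp
    have m: "LX r0 u (f r0 u) \<in> X r0" using R.f_X R.L_meas u by auto
    have "LX \<sigma> u (f \<sigma> u) = J r0 (LX r0 u (f r0 u))"
      using f_J[of r0 u] L_J[of r0 u "f r0 u"] R.f_X[OF u] \<sigma> u by simp
    then show "\<Phi> (LX \<sigma> u (f \<sigma> u)) \<omega> = Lam u \<omega>"
      using jj(4)[of r0] Linf_mem[OF m] \<sigma> by (simp add: \<Phi>_def Lam_def J_in)
  qed
  ultimately show ?thesis by (rule smooth_fam_cong)
qed

lemma conclusion:
  assumes t: "0 < t" "t < r0 - \<sigma>"
  shows "C_holder U (X \<sigma>) (nX \<sigma>) t (f \<sigma>)"
    and "C_holder U (Linf M UNIV abs) (supnorm M abs) t Lam"
    and "C_holder U UNIV abs t (\<lambda>u. integral\<^sup>L M (\<lambda>\<omega>. ln (Lam u \<omega>)))"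
proof -
  interpret R: cocycle_level "E r0" "nE r0" "C r0" "ell r0" "K r0" "\<rho> r0" M \<tau> U "\<theta> r0" "Lw r0" "f r0" "ell r0"
    using lvl \<sigma> by simp
  interpret P: positive_Linf_family U M Lam "r0 - \<sigma>" R.m0
  proof (intro positive_Linf_family.intro M(1) Lam_smooth R.m0)
    show "0 < r0 - \<sigma>" using \<sigma> by simp
    show "R.m0 \<le> Lam u \<omega>" if "u \<in> U" "\<omega> \<in> space M" for u \<omega>
      using R.\<Lambda>_lower[OF that] that by (simp add: R.\<Lambda>_def Lam_def)
  qed
  show "C_holder U (X \<sigma>) (nX \<sigma>) t (f \<sigma>)"
    using smooth_fam_C_holder[where l = "()", OF _ U f_smooth_X] S.normedX t by simp
  show "C_holder U (Linf M UNIV abs) (supnorm M abs) t Lam"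
    using smooth_fam_C_holder[where l = "()", OF _ U Lam_smooth] Linf_normed[OF real_normed ne] t by simp
  show "C_holder U UNIV abs t (\<lambda>u. integral\<^sup>L M (\<lambda>\<omega>. ln (Lam u \<omega>)))"
    using smooth_fam_C_holder[where l = "()", OF _ U P.integral_smooth] real_normed t by simp
qed

end

text \<open>Order 0 has a clause of its own in \<open>C_holder\<close>; it is needed when \<epsilon>
  equals \<open>r0\<close> in the last assertion of the theorem.\<close>

lemma C_holder_continuous:
  assumes "C_holder U Y n \<alpha> g" "0 < \<alpha>" "\<alpha> \<le> 1" "normed_subspace Y n" "open U"
  shows "C_holder U Y n 0 g"
proof -
  obtain D where D: "jet U Y n 0 \<alpha> D" "\<And>u. u \<in> U \<Longrightarrow> D [] u = g u"
    using C_holder_imp_jet[OF assms(4,5,2,3), of 0 g] assms(1) by auto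
  obtain B where B: "B \<ge> 0" "\<forall>hs. length hs = 0 \<longrightarrow> (\<forall>u\<in>U. \<forall>v\<in>U. n (D hs v - D hs u) \<le> B * wt hs * norm (v - u) powr \<alpha>)"
    using D(1) unfolding jet_def by (elim conjE exE)
  have B': "n (g v - g u) \<le> B * norm (v - u) powr \<alpha>" if "u \<in> U" "v \<in> U" for u v
    using B(2)[rule_format, of "[]" u v] D(2) that by simp
  have mem: "g u \<in> Y" if "u \<in> U" for u
  proof -
    have "\<exists>B\<ge>0. \<forall>hs. length hs \<le> 0 \<longrightarrow> (\<forall>u\<in>U. D hs u \<in> Y \<and> n (D hs u) \<le> B * wt hs)"
      using D(1) unfolding jet_def by (elim conjE)
    then show ?thesis using D(2)[OF that] that by force
  qed
  have "\<exists>d>0. \<forall>v\<in>U. norm (v - u) < d \<longrightarrow> n (g v - g u) < e" if u: "u \<in> U" and e: "e > 0" for u e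
  proof -
    have "e / 2 > 0" using e by simp
    obtain d where d: "d > 0" "\<And>t. 0 \<le> t \<Longrightarrow> t < d \<Longrightarrow> B * t powr \<alpha> \<le> e / 2"
      using powr_small[OF assms(2) B(1) \<open>e / 2 > 0\<close>] by metis
    have "n (g v - g u) < e" if "v \<in> U" "norm (v - u) < d" for v
      using B'[OF u that(1)] d(2)[OF norm_ge_zero that(2)] e by simp
    then show ?thesis using d(1) by blast
  qed
  then show ?thesis using mem by (simp add: C_holder_def)
qed

section \<open>The theorem\<close>

theorem theorem3p2:
  fixes U :: "'b::banach set" and r0 :: real
    and M :: "'w measure" and \<tau> :: "'w \<Rightarrow> 'w"
    and E :: "real \<Rightarrow> 'v::real_vector set" and nE :: "real \<Rightarrow> 'v \<Rightarrow> real"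
    and C :: "real \<Rightarrow> 'v set" and ell :: "real \<Rightarrow> 'v \<Rightarrow> real"
    and K \<rho> \<theta> :: "real \<Rightarrow> real"
    and j :: "real \<Rightarrow> real \<Rightarrow> 'v \<Rightarrow> 'v"
    and Lw :: "real \<Rightarrow> 'b \<Rightarrow> 'w \<Rightarrow> 'v \<Rightarrow> 'v"
    and f :: "real \<Rightarrow> 'b \<Rightarrow> 'w \<Rightarrow> 'v"
  defines "X \<equiv> \<lambda>r. Linf M (E r) (nE r)"
    and "nX \<equiv> \<lambda>r. supnorm M (nE r)"
    and "Lam \<equiv> \<lambda>u \<omega>. if \<omega> \<in> space M then ell r0 (Lop M \<tau> (Lw r0 u) (f r0 u) \<omega>) else 0"
  assumes U: "open U" "convex U" "U \<noteq> {}"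
    and r0: "r0 > 0"
    and M: "prob_space M" "invertible_mp M \<tau>" "ergodic_map M \<tau>"
    and E: "\<And>r. 0 < r \<Longrightarrow> r \<le> r0 \<Longrightarrow>
              banach_subspace (E r) (nE r) \<and> closed_convex_cone (E r) (nE r) (C r) \<and>
              bounded_linear_on (E r) (nE r) UNIV abs (ell r) \<and>
              opnorm (E r) (nE r) abs (ell r) = 1 \<and>
              K r \<ge> 1 \<and> 0 < \<rho> r \<and> \<rho> r \<le> 1 \<and> \<theta> r \<ge> 1 \<and>
              (\<forall>\<phi>\<in>C r. ell r \<phi> \<ge> nE r \<phi> / K r) \<and>
              cone_rho (E r) (nE r) (C r) (\<rho> r) \<noteq> {0}"
    and unif: "\<And>a. 0 < a \<Longrightarrow> a \<le> r0 \<Longrightarrow>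
              \<exists>B. \<forall>r\<in>{a..r0}. K r \<le> B \<and> \<theta> r \<le> B \<and> 1 / \<rho> r \<le> B"
    and j: "\<And>s r. 0 < s \<Longrightarrow> s < r \<Longrightarrow> r \<le> r0 \<Longrightarrow>
              bounded_linear_on (E r) (nE r) (E s) (nE s) (j s r) \<and> inj_on (j s r) (E r) \<and>
              j s r ` C r \<subseteq> C s \<and> (\<forall>\<phi>\<in>E r. ell r \<phi> = ell s (j s r \<phi>))"
    and j_bdd: "\<exists>B. \<forall>s r. 0 < s \<and> s < r \<and> r \<le> r0 \<longrightarrow> opnorm (E r) (nE r) (nE s) (j s r) \<le> B"
    and j_comp: "\<And>t s r. 0 < t \<Longrightarrow> t < s \<Longrightarrow> s < r \<Longrightarrow> r \<le> r0 \<Longrightarrow>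
              \<forall>\<phi>\<in>E r. j t s (j s r \<phi>) = j t r \<phi>"
    and L: "\<And>r u \<omega>. 0 < r \<Longrightarrow> r \<le> r0 \<Longrightarrow> u \<in> U \<Longrightarrow> \<omega> \<in> space M \<Longrightarrow>
              bounded_linear_on (E r) (nE r) (E r) (nE r) (Lw r u \<omega>) \<and>
              Lw r u \<omega> ` (C r - {0}) \<subseteq> cone_rho (E r) (nE r) (C r) (\<rho> r) - {0} \<and>
              1 / \<theta> r \<le> opnorm (E r) (nE r) (nE r) (Lw r u \<omega>) \<and>
              opnorm (E r) (nE r) (nE r) (Lw r u \<omega>) \<le> \<theta> r"
    and L_meas: "\<And>r u. 0 < r \<Longrightarrow> r \<le> r0 \<Longrightarrow> u \<in> U \<Longrightarrow>
              \<forall>\<phi>\<in>X r. Lop M \<tau> (Lw r u) \<phi> \<in> X r"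
    and L_comm: "\<And>s r u \<omega>. 0 < s \<Longrightarrow> s < r \<Longrightarrow> r \<le> r0 \<Longrightarrow> u \<in> U \<Longrightarrow> \<omega> \<in> space M \<Longrightarrow>
              \<forall>\<phi>\<in>E r. j s r (Lw r u \<omega> \<phi>) = Lw s u \<omega> (j s r \<phi>)"
    and f: "\<And>r u. 0 < r \<Longrightarrow> r \<le> r0 \<Longrightarrow> u \<in> U \<Longrightarrow>
              f r u \<in> X r \<and>
              (\<forall>\<omega>\<in>space M. f r u \<omega> \<in> cone_rho (E r) (nE r) (C r) (\<rho> r) \<and>
                 ell r (f r u \<omega>) = 1 \<and>
                 f r u \<omega> = (1 / ell r (Lop M \<tau> (Lw r u) (f r u) \<omega>)) *\<^sub>R Lop M \<tau> (Lw r u) (f r u) \<omega>)"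
    and smooth: "\<And>s r t. 0 < s \<Longrightarrow> s < r \<Longrightarrow> r \<le> r0 \<Longrightarrow> 0 \<le> t \<Longrightarrow> t < r - s \<Longrightarrow>
              C_holder U (Lspace (X r) (nX r) (X s) (nX s)) (opnorm (X r) (nX r) (nX s)) t
                (\<lambda>u \<phi>. if \<phi> \<in> X r then Lop M \<tau> (Lw s u) (jlift M (j s r) \<phi>) else 0)"
  shows "(\<forall>s t. 0 < s \<and> s < r0 \<and> 0 < t \<and> t < r0 - s \<longrightarrow>
            C_holder U (X s) (nX s) t (f s) \<and>
            C_holder U (Linf M UNIV abs) (supnorm M abs) t Lam \<and>
            C_holder U UNIV abs t (\<lambda>u. integral\<^sup>L M (\<lambda>\<omega>. ln (Lam u \<omega>)))) \<and>
         (\<forall>\<epsilon>>0. \<epsilon> \<le> r0 \<longrightarrow> C_holder U UNIV abs (r0 - \<epsilon>) (\<lambda>u. integral\<^sup>L M (\<lambda>\<omega>. ln (Lam u \<omega>))))"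
proof -
  note Lam_eq = Lam_def
  interpret graded_cocycle U r0 M \<tau> E nE C ell K \<rho> \<theta> j Lw f
  proof (rule graded_cocycle.intro)
    fix r assume "0 < r" "r \<le> r0"
    from E[OF this] show "banach_subspace (E r) (nE r) \<and> closed_convex_cone (E r) (nE r) (C r) \<and>
        bounded_linear_on (E r) (nE r) UNIV abs (ell r) \<and>
        opnorm (E r) (nE r) abs (ell r) = 1 \<and>
        K r \<ge> 1 \<and> 0 < \<rho> r \<and> \<rho> r \<le> 1 \<and> \<theta> r \<ge> 1 \<and>
        (\<forall>\<phi>\<in>C r. ell r \<phi> \<ge> nE r \<phi> / K r)" by blast
  qed (fact U M j j_comp L L_comm L_meas[unfolded X_def] f[unfolded X_def] smooth[unfolded X_def nX_def])+
  have Lam: "Lam = graded_cocycle.Lam r0 M \<tau> ell Lw f"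
    by (simp add: Lam_eq Lam_def fun_eq_iff)
  have main: "C_holder U (X s) (nX s) t (f s) \<and> C_holder U (Linf M UNIV abs) (supnorm M abs) t Lam \<and>
      C_holder U UNIV abs t (\<lambda>u. integral\<^sup>L M (\<lambda>\<omega>. ln (Lam u \<omega>)))"
    if s: "0 < s" "s < r0" and t: "0 < t" "t < r0 - s" for s t
  proof -
    interpret S: cocycle_level "E s" "nE s" "C s" "ell s" "K s" "\<rho> s" M \<tau> U "\<theta> s" "Lw s" "f s" "ell s"
      by (rule level) (use s in auto)
    have sc: "ell s (c *\<^sub>R x) = c * ell s x" if "x \<in> E s" for c x
      using S.ell_scale[OF that] by simp
    obtain e where e: "linear e" "\<forall>x\<in>E s. e x = ell s x"
      using linear_on_extension[OF S.subspace S.ell_add sc] by auto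
    interpret graded_cocycle_at U r0 M \<tau> E nE C ell K \<rho> \<theta> j Lw f s e
      by (intro graded_cocycle_at.intro graded_cocycle_axioms graded_cocycle_at_axioms.intro s)
        (use e in \<open>auto simp: linear_add linear_scale\<close>)
    show ?thesis using conclusion[OF t] unfolding Lam X_def nX_def by blast
  qed
  have "C_holder U UNIV abs (r0 - \<epsilon>) (\<lambda>u. integral\<^sup>L M (\<lambda>\<omega>. ln (Lam u \<omega>)))" if \<epsilon>: "0 < \<epsilon>" "\<epsilon> \<le> r0" for \<epsilon>
  \<comment> \<open>For \<open>\<epsilon> = r0\<close> the order is 0, which \<open>main\<close>
    does not cover; continuity follows from Holder continuity obtained at level
    \<open>r0 / 2\<close>.\<close>
  proof (cases "\<epsilon> = r0")
    case True
    define \<alpha> where "\<alpha> = min 1 (r0 / 4)"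
    have \<alpha>: "0 < \<alpha>" "\<alpha> \<le> 1" "\<alpha> < r0 - r0 / 2" using r0 by (auto simp: \<alpha>_def)
    have "C_holder U UNIV abs \<alpha> (\<lambda>u. integral\<^sup>L M (\<lambda>\<omega>. ln (Lam u \<omega>)))"
      using main[of "r0 / 2" \<alpha>] \<alpha> r0 by simp
    then show ?thesis using C_holder_continuous[OF _ \<alpha>(1,2) real_normed U(1)] True by simp
  next
    case False
    \<comment> \<open>The level \<open>\<epsilon> / 2\<close> is low enough, since
      \<open>r0 - \<epsilon> < r0 - \<epsilon> / 2\<close>.\<close>
    then show ?thesis using main[of "\<epsilon> / 2" "r0 - \<epsilon>"] \<epsilon> by simp
  qed
  with main show ?thesis by blast
qed

end
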